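(* There exist constants $C>0$ and $\beta>0$, depending only on the a priori data $N_0,d_0,r_0,K_0,L,\beta_0,c_0,m$, such that, for all $\mathcal{P}^0,\mathcal{P}^1\in\mathcal{A}$ with $d_H(\partial\mathcal{P}^0,\partial\mathcal{P}^1)\le\delta_0/5$ and $\mathcal{U}$ an associated vector field as described in the context, for all $t\in[0,1]$ and all $f,g\in H^{1/2}(\partial\Omega)$, $$\left|F'(t,f,g)-F'(0,f,g)\right|\le C\,\|f\|_{H^{1/2}(\partial\Omega)}\|g\|_{H^{1/2}(\partial\Omega)}\;t^{\beta}\,d_H(\partial\mathcal{P}^0,\partial\mathcal{P}^1)^{1+\beta}.$$
   Context: Setting. Fix $L>0$ and $\Omega=(-L,L)\times(-L,L)\subset\mathbb{R}^2$, real numbers $-L=\omega_0<\omega_1<\dots<\omega_m=L$, layers $\Omega_i=\{(x,y)\in\Omega:\omega_{i-1}<y<\omega_i\}$ ($i=1,\dots,m$), and $\Sigma_i=(-L,L)\times\{\omega_i\}$, with $\mathrm{dist}(\Sigma_i,\Sigma_{i+1})\ge d_0$ for $i=0,\dots,m-1$; $\Sigma=\Sigma_1\cup\dots\cup\Sigma_{m-1}$. Let $k,\gamma_1,\dots,\gamma_m$ be positive constants with $|k-\gamma_i|\ge c_0$ for all $i$, $\gamma_b=\sum_{i=1}^m\gamma_i\chi_{\Omega_i}$, and $\gamma_{\mathcal{P}}=\gamma_b+(k-\gamma_b)\chi_{\mathcal{P}}$ for a closed polygon $\mathcal{P}\subset\Omega$. Dirichlet to Neumann map: $\Lambda_{\mathcal{P}}:H^{1/2}(\partial\Omega)\to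 H^{-1/2}(\partial\Omega)$, $\Lambda_{\mathcal{P}}f=\gamma_{\mathcal{P}}\frac{\partial u}{\partial n}|_{\partial\Omega}$, where $u\in H^1(\Omega)$ is the unique solution of $\mathrm{div}(\gamma_{\mathcal{P}}\nabla u)=0$ in $\Omega$, $u=f$ on $\partial\Omega$, and $n$ is the unit outer normal. $\mathcal{A}$ is the set of closed, simply connected, simple polygons $\mathcal{P}\subset\Omega$ such that: (i) $\mathcal{P}$ has at most $N_0$ sides, each of length greater than $d_0$; (ii) $\partial\mathcal{P}$ is of Lipschitz class with constants $r_0,K_0$ (standard sense); (iii) the angle $\vartheta$ at each vertex satisfies $\beta_0\le\vartheta\le2\pi-\beta_0$ and $|\vartheta-\pi|\ge\beta_0$, where $\beta_0\in(0,\pi/2]$; (iv) $\mathrm{dist}(\mathcal{P},\partial\Omega)\ge d_0$; (v) every vertex $P$ of $\mathcal{P}$ satisfies $\mathrm{dist}(P,\Sigma_i)\ge d_0/2$ for $i=1,\dots,m-1$. Here $N_0,d_0,r_0,K_0,\beta_0,c_0$ are given positive constants. $d_H(A,B)=\max\{\sup_{x\in A}\inf_{y\in B}\mathrm{dist}(x,y),\ \sup_{y\in B}\inf_{x\in A}\mathrm{dist}(y,x)\}$ is the Hausdorff distance. Movement from $\mathcal{P}^0$ to $\mathcal{P}^1$. Let $\delta_0=\min\{K_0r_0,\,d_0\sin\beta_0/16\}$, $C_0=\sqrt{1+16/\sin^2\beta_0}$, and let $\mathcal{P}^0,\mathcal{P}^1\in\mathcal{A}$ satisfy $d_H(\partial\mathcal{P}^0,\partial\mathcal{P}^1)\le\delta_0/5$.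 Then $\mathcal{P}^0,\mathcal{P}^1$ have the same number of vertices, which can be matched so that matched vertices are at distance at most $C_0d_H(\partial\mathcal{P}^0,\partial\mathcal{P}^1)$, and a side of $\mathcal{P}^0$ meets an interface $\Sigma_i$ if and only if the corresponding side of $\mathcal{P}^1$ does. Let $P^0_1,\dots,P^0_M$ be the vertices of $\mathcal{P}^0$ together with the points of $\partial\mathcal{P}^0\cap\Sigma$, listed in cyclic order along $\partial\mathcal{P}^0$ (so $P^0_jP^0_{j+1}$ is a segment of $\partial\mathcal{P}^0$, with $P^0_{M+1}=P^0_1$), and let $P^1_1,\dots,P^1_M$ be the corresponding points for $\mathcal{P}^1$, with $\mathrm{dist}(P^0_j,P^1_j)\le C_0d_H(\partial\mathcal{P}^0,\partial\mathcal{P}^1)$. Let $W$ be the tubular neighborhood of $\partial\mathcal{P}^0$ of width $d_0/4$ (so $\mathrm{dist}(W,\partial\Omega)\ge d_0/2$). $\mathcal{U}\in W^{1,\infty}(\mathbb{R}^2;\mathbb{R}^2)$ denotes a continuous vector field such that: $\mathrm{supp}\,\mathcal{U}\subset\overline{W}$; $\mathcal{U}$ is affine on each segment $P^0_jP^0_{j+1}$ and on each connected component of $(W\cap\Sigma)\setminus\mathcal{P}^0$; $\mathcal{U}(P^0_j)=P^1_j-P^0_j$ for $j=1,\dots,M$; and $|\mathcal{U}|+\frac{d_0}{8}|D\mathcal{U}|\le C_0d_H(\partial\mathcal{P}^0,\partial\mathcal{P}^1)$ a.e. Set $\Phi_t=I+t\mathcal{U}$ and $\mathcal{P}^t=\Phi_t(\mathcal{P}^0)$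 for $t\in[0,1]$ (at $t=1$ this is $\mathcal{P}^1$). For $f,g\in H^{1/2}(\partial\Omega)$, $F(t,f,g)=\langle\Lambda_{\mathcal{P}^t}f,g\rangle$ (duality between $H^{-1/2}(\partial\Omega)$ and $H^{1/2}(\partial\Omega)$). $F(\cdot,f,g)$ is differentiable on $[0,1]$ (one-sided at the endpoints) and $F'$ denotes the derivative with respect to $t$.
   Formalization: The constants C and β may also depend on the fixed conductivities k, γ_1, …, γ_m: with only the listed a priori data the claim fails, since replacing (k, γ_i) by (sk, sγ_i), s ≥ 1, keeps all hypotheses and multiplies F' by s. *)

theory Defs
  imports "HOL-Analysis.Analysis"
begin

type_synonym plane = "real \<times> real"

section \<open>Sobolev spaces\<close>

primrec Ck :: "nat \<Rightarrow> (plane \<Rightarrow> real) \<Rightarrow> bool" where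
  "Ck 0 f \<longleftrightarrow> continuous_on UNIV f"
| "Ck (Suc n) f \<longleftrightarrow> (\<forall>x. f differentiable (at x)) \<and>
     (\<forall>v. Ck n (\<lambda>x. frechet_derivative f (at x) v))"

definition smooth :: "(plane \<Rightarrow> real) \<Rightarrow> bool" where
  "smooth f \<longleftrightarrow> (\<forall>n. Ck n f)"

definition grad :: "(plane \<Rightarrow> real) \<Rightarrow> plane \<Rightarrow> plane" where
  "grad f x = (frechet_derivative f (at x) (1, 0), frechet_derivative f (at x) (0, 1))"

definition supp :: "(plane \<Rightarrow> 'b::zero) \<Rightarrow> plane set" where
  "supp f = closure {x. f x \<noteq> 0}"

definition test_function :: "plane set \<Rightarrow> (plane \<Rightarrow> real) \<Rightarrow> bool" where
  "test_function S \<phi> \<longleftrightarrow> smooth \<phi> \<and> compact (supp \<phi>) \<and> supp \<phi> \<subseteq> S"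

definition locally_integrable :: "plane set \<Rightarrow> (plane \<Rightarrow> 'b::euclidean_space) \<Rightarrow> bool" where
  "locally_integrable S u \<longleftrightarrow> (\<forall>K. compact K \<and> K \<subseteq> S \<longrightarrow> set_integrable lebesgue K u)"

definition weak_gradient :: "plane set \<Rightarrow> (plane \<Rightarrow> real) \<Rightarrow> (plane \<Rightarrow> plane) \<Rightarrow> bool" where
  "weak_gradient S u G \<longleftrightarrow> locally_integrable S u \<and> locally_integrable S G \<and>
     (\<forall>\<phi>. test_function S \<phi> \<longrightarrow>
        (\<integral>x. u x *\<^sub>R grad \<phi> x \<partial>lebesgue_on S) = - (\<integral>x. \<phi> x *\<^sub>R G x \<partial>lebesgue_on S))"

definition L2 :: "'a measure \<Rightarrow> ('a \<Rightarrow> 'b::euclidean_space) \<Rightarrow> bool" where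
  "L2 M u \<longleftrightarrow> u \<in> borel_measurable M \<and> integrable M (\<lambda>x. (norm (u x))\<^sup>2)"

definition H1 :: "plane set \<Rightarrow> (plane \<Rightarrow> real) set" where
  "H1 S = {u. L2 (lebesgue_on S) u \<and> (\<exists>G. weak_gradient S u G \<and> L2 (lebesgue_on S) G)}"

text \<open>The weak gradient is unique up to null sets; we pick a representative.\<close>

definition wgrad :: "plane set \<Rightarrow> (plane \<Rightarrow> real) \<Rightarrow> plane \<Rightarrow> plane" where
  "wgrad S u = (SOME G. weak_gradient S u G)"

text \<open>Vector fields in \<open>W\<^sup>1\<^sup>,\<^sup>\<infinity>(\<real>\<^sup>2; \<real>\<^sup>2)\<close>; \<open>jac_norm\<close> is the operator norm of
  the weak Jacobian, whose rows are the weak gradients of the two components.\<close>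

definition jac_norm :: "(plane \<Rightarrow> plane) \<Rightarrow> plane \<Rightarrow> real" where
  "jac_norm U x = onorm (\<lambda>v. (wgrad UNIV (fst \<circ> U) x \<bullet> v, wgrad UNIV (snd \<circ> U) x \<bullet> v))"

definition W1inf :: "(plane \<Rightarrow> plane) set" where
  "W1inf = {U. U \<in> borel_measurable lebesgue \<and>
     (\<exists>G. weak_gradient UNIV (fst \<circ> U) G) \<and> (\<exists>G. weak_gradient UNIV (snd \<circ> U) G) \<and>
     (\<exists>B. AE x in lebesgue. norm (U x) \<le> B \<and> jac_norm U x \<le> B)}"

section \<open>The square, its boundary, and the Dirichlet to Neumann map\<close>

definition square :: "real \<Rightarrow> plane set" where
  "square L = {-L<..<L} \<times> {-L<..<L}"

definition square_param :: "real \<Rightarrow> real \<Rightarrow> plane" where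
  "square_param L s =
     (if s < 2*L then (s - L, -L)
      else if s < 4*L then (L, s - 3*L)
      else if s < 6*L then (5*L - s, L)
      else (-L, 7*L - s))"

text \<open>Arc length on the boundary of the square, as the image of Lebesgue measure under the
  unit-speed parametrisation. Elements of \<open>L\<^sup>2\<close> and \<open>H\<^sup>1\<^sup>/\<^sup>2\<close> of the boundary
  are functions on the plane of which only the values on the boundary matter.\<close>

definition bdry :: "real \<Rightarrow> plane measure" where
  "bdry L = distr (lebesgue_on {0..<8*L}) (restrict_space borel (frontier (square L))) (square_param L)"

definition gagliardo :: "(plane \<Rightarrow> real) \<Rightarrow> plane \<times> plane \<Rightarrow> real" where
  "gagliardo f = (\<lambda>(x, y). (f x - f y)\<^sup>2 / (dist x y)\<^sup>2)"

definition Hhalf :: "real \<Rightarrow> (plane \<Rightarrow> real) set" where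
  "Hhalf L = {f. L2 (bdry L) f \<and> integrable (bdry L \<Otimes>\<^sub>M bdry L) (gagliardo f)}"

definition Hhalf_norm :: "real \<Rightarrow> (plane \<Rightarrow> real) \<Rightarrow> real" where
  "Hhalf_norm L f =
     sqrt ((\<integral>x. (f x)\<^sup>2 \<partial>bdry L) + (\<integral>z. gagliardo f z \<partial>(bdry L \<Otimes>\<^sub>M bdry L)))"

definition has_trace :: "real \<Rightarrow> (plane \<Rightarrow> real) \<Rightarrow> (plane \<Rightarrow> real) \<Rightarrow> bool" where
  "has_trace L u f \<longleftrightarrow> u \<in> H1 (square L) \<and> L2 (bdry L) f \<and>
     (\<exists>\<phi> :: nat \<Rightarrow> plane \<Rightarrow> real. (\<forall>n. smooth (\<phi> n)) \<and>
        (\<lambda>n. \<integral>x. (\<phi> n x - u x)\<^sup>2 \<partial>lebesgue_on (square L)) \<longlonglongrightarrow> 0 \<and>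
        (\<lambda>n. \<integral>x. (norm (grad (\<phi> n) x - wgrad (square L) u x))\<^sup>2 \<partial>lebesgue_on (square L)) \<longlonglongrightarrow> 0 \<and>
        (\<lambda>n. \<integral>x. (\<phi> n x - f x)\<^sup>2 \<partial>bdry L) \<longlonglongrightarrow> 0)"

definition weak_solution :: "plane set \<Rightarrow> (plane \<Rightarrow> real) \<Rightarrow> (plane \<Rightarrow> real) \<Rightarrow> bool" where
  "weak_solution S a u \<longleftrightarrow> u \<in> H1 S \<and>
     (\<forall>\<phi>. test_function S \<phi> \<longrightarrow> (\<integral>x. a x * (wgrad S u x \<bullet> grad \<phi> x) \<partial>lebesgue_on S) = 0)"

definition dirichlet_solution :: "real \<Rightarrow> (plane \<Rightarrow> real) \<Rightarrow> (plane \<Rightarrow> real) \<Rightarrow> plane \<Rightarrow> real" where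
  "dirichlet_solution L a f = (SOME u. weak_solution (square L) a u \<and> has_trace L u f)"

text \<open>The conormal derivative \<open>a \<partial>u/\<partial>n\<close> of a weak solution \<open>u\<close>, an element of
  \<open>H\<^sup>-\<^sup>1\<^sup>/\<^sup>2\<close> represented as a functional on \<open>H\<^sup>1\<^sup>/\<^sup>2\<close>. It is given by
  Green's formula; the integral does not depend on the extension \<open>v\<close> of \<open>g\<close>.\<close>

definition conormal :: "real \<Rightarrow> (plane \<Rightarrow> real) \<Rightarrow> (plane \<Rightarrow> real) \<Rightarrow> (plane \<Rightarrow> real) \<Rightarrow> real" where
  "conormal L a u g = (THE c. \<forall>v. has_trace L v g \<longrightarrow>
     c = (\<integral>x. a x * (wgrad (square L) u x \<bullet> wgrad (square L) v x) \<partial>lebesgue_on (square L)))"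

definition DN :: "real \<Rightarrow> (plane \<Rightarrow> real) \<Rightarrow> (plane \<Rightarrow> real) \<Rightarrow> (plane \<Rightarrow> real) \<Rightarrow> real" where
  "DN L a f = conormal L a (dirichlet_solution L a f)"

section \<open>The layered medium\<close>

definition layer :: "real \<Rightarrow> (nat \<Rightarrow> real) \<Rightarrow> nat \<Rightarrow> plane set" where
  "layer L \<omega> i = {(x, y). (x, y) \<in> square L \<and> \<omega> (i - 1) < y \<and> y < \<omega> i}"

definition interface :: "real \<Rightarrow> (nat \<Rightarrow> real) \<Rightarrow> nat \<Rightarrow> plane set" where
  "interface L \<omega> i = {-L<..<L} \<times> {\<omega> i}"

definition interfaces :: "real \<Rightarrow> nat \<Rightarrow> (nat \<Rightarrow> real) \<Rightarrow> plane set" where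
  "interfaces L m \<omega> = (\<Union>i\<in>{1..<m}. interface L \<omega> i)"

definition layering :: "real \<Rightarrow> real \<Rightarrow> nat \<Rightarrow> (nat \<Rightarrow> real) \<Rightarrow> bool" where
  "layering L d0 m \<omega> \<longleftrightarrow> \<omega> 0 = -L \<and> \<omega> m = L \<and> (\<forall>i<m. \<omega> i < \<omega> (Suc i)) \<and>
     (\<forall>i<m. setdist (interface L \<omega> i) (interface L \<omega> (Suc i)) \<ge> d0)"

definition background :: "real \<Rightarrow> nat \<Rightarrow> (nat \<Rightarrow> real) \<Rightarrow> (nat \<Rightarrow> real) \<Rightarrow> plane \<Rightarrow> real" where
  "background L m \<omega> \<gamma> x = (\<Sum>i=1..m. \<gamma> i * indicator (layer L \<omega> i) x)"

definition conductivity ::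
    "real \<Rightarrow> nat \<Rightarrow> (nat \<Rightarrow> real) \<Rightarrow> real \<Rightarrow> (nat \<Rightarrow> real) \<Rightarrow> plane set \<Rightarrow> plane \<Rightarrow> real" where
  "conductivity L m \<omega> k \<gamma> P x =
     background L m \<omega> \<gamma> x + (k - background L m \<omega> \<gamma> x) * indicator P x"

section \<open>Polygons\<close>

definition cnext :: "'a list \<Rightarrow> nat \<Rightarrow> 'a" where
  "cnext xs j = xs ! (Suc j mod length xs)"

text \<open>\<open>is_polygon vs P\<close>: \<open>P\<close> is the closed region bounded by the simple closed polygonal
  line with vertices \<open>vs\<close> in cyclic order. Flat vertices are excluded, so that the set of
  vertices is determined by \<open>P\<close>. By the Jordan curve theorem such a \<open>P\<close> is closed and simply
  connected, with frontier the union of the sides.\<close>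

definition is_polygon :: "plane list \<Rightarrow> plane set \<Rightarrow> bool" where
  "is_polygon vs P \<longleftrightarrow> (let n = length vs; side = (\<lambda>i. closed_segment (vs ! i) (cnext vs i));
        B = (\<Union>i<n. side i) in
     n \<ge> 3 \<and> distinct vs \<and>
     (\<forall>i<n. \<not> collinear {vs ! i, cnext vs i, cnext vs (Suc i)}) \<and>
     (\<forall>i<n. \<forall>j<n. i \<noteq> j \<longrightarrow> side i \<inter> side j = {vs ! i, cnext vs i} \<inter> {vs ! j, cnext vs j}) \<and>
     P = B \<union> inside B)"

definition vertices :: "plane set \<Rightarrow> plane set" where
  "vertices P = {v. \<exists>vs. is_polygon vs P \<and> v \<in> set vs}"

text \<open>The opening angle of \<open>P\<close> at \<open>v\<close>, in \<open>(0, 2\<pi>)\<close>: the measure of the set of directions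
  pointing into \<open>P\<close>, which for a polygon does not depend on \<open>r\<close> once \<open>r\<close> is small.\<close>

definition interior_angle :: "plane set \<Rightarrow> plane \<Rightarrow> real" where
  "interior_angle P v =
     Lim (at_right 0) (\<lambda>r. measure lebesgue {\<theta> \<in> {0..2*pi}. v + r *\<^sub>R (cos \<theta>, sin \<theta>) \<in> P})"

definition lipschitz_class :: "real \<Rightarrow> real \<Rightarrow> plane set \<Rightarrow> bool" where
  "lipschitz_class r0 K0 D \<longleftrightarrow> (\<forall>p \<in> frontier D. \<exists>e1 e2 \<psi>.
     norm e1 = 1 \<and> norm e2 = 1 \<and> e1 \<bullet> e2 = 0 \<and> \<psi> 0 = 0 \<and> K0-lipschitz_on {-r0..r0} \<psi> \<and>
     (\<forall>x\<in>{-r0..r0}. \<forall>y\<in>{-(K0*r0)..K0*r0}. p + x *\<^sub>R e1 + y *\<^sub>R e2 \<in> D \<longleftrightarrow> \<psi> x < y))"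

definition admissible :: "nat \<Rightarrow> real \<Rightarrow> real \<Rightarrow> real \<Rightarrow> real \<Rightarrow> real \<Rightarrow> nat \<Rightarrow> (nat \<Rightarrow> real) \<Rightarrow> plane set set" where
  "admissible N0 d0 r0 K0 \<beta>0 L m \<omega> = {P. P \<subseteq> square L \<and>
     (\<exists>vs. is_polygon vs P \<and> length vs \<le> N0 \<and>
        (\<forall>i<length vs. dist (vs ! i) (cnext vs i) > d0)) \<and>
     lipschitz_class r0 K0 (interior P) \<and>
     (\<forall>v\<in>vertices P. \<beta>0 \<le> interior_angle P v \<and> interior_angle P v \<le> 2*pi - \<beta>0 \<and>
        \<bar>interior_angle P v - pi\<bar> \<ge> \<beta>0) \<and>
     setdist P (frontier (square L)) \<ge> d0 \<and>
     (\<forall>v\<in>vertices P. \<forall>i\<in>{1..<m}. infdist v (interface L \<omega> i) \<ge> d0 / 2)}"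

definition hausdorff_dist :: "plane set \<Rightarrow> plane set \<Rightarrow> real" where
  "hausdorff_dist A B = max (SUP x\<in>A. infdist x B) (SUP y\<in>B. infdist y A)"

section \<open>Moving one polygon to another\<close>

definition delta0 :: "real \<Rightarrow> real \<Rightarrow> real \<Rightarrow> real \<Rightarrow> real" where
  "delta0 d0 r0 K0 \<beta>0 = min (K0 * r0) (d0 * sin \<beta>0 / 16)"

definition C0 :: "real \<Rightarrow> real" where
  "C0 \<beta>0 = sqrt (1 + 16 / (sin \<beta>0)\<^sup>2)"

definition marked_points :: "plane set \<Rightarrow> plane set \<Rightarrow> plane list \<Rightarrow> bool" where
  "marked_points S P ps \<longleftrightarrow> distinct ps \<and> set ps = vertices P \<union> (frontier P \<inter> S) \<and>
     (\<forall>j<length ps. closed_segment (ps ! j) (cnext ps j) \<subseteq> frontier P \<and>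
        open_segment (ps ! j) (cnext ps j) \<inter> set ps = {})"

definition matched_points ::
    "real \<Rightarrow> real \<Rightarrow> nat \<Rightarrow> (nat \<Rightarrow> real) \<Rightarrow> plane set \<Rightarrow> plane set \<Rightarrow> plane list \<Rightarrow> plane list \<Rightarrow> bool" where
  "matched_points \<beta>0 L m \<omega> P0 P1 p0 p1 \<longleftrightarrow>
     marked_points (interfaces L m \<omega>) P0 p0 \<and> marked_points (interfaces L m \<omega>) P1 p1 \<and>
     length p0 = length p1 \<and>
     (\<forall>j<length p0.
        (p0 ! j \<in> vertices P0 \<longleftrightarrow> p1 ! j \<in> vertices P1) \<and>
        (\<forall>i\<in>{1..<m}. p0 ! j \<in> interface L \<omega> i \<longleftrightarrow> p1 ! j \<in> interface L \<omega> i) \<and>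
        dist (p0 ! j) (p1 ! j) \<le> C0 \<beta>0 * hausdorff_dist (frontier P0) (frontier P1))"

definition affine_map_on :: "plane set \<Rightarrow> (plane \<Rightarrow> plane) \<Rightarrow> bool" where
  "affine_map_on S U \<longleftrightarrow> (\<exists>A b. linear A \<and> (\<forall>x\<in>S. U x = A x + b))"

definition tube :: "real \<Rightarrow> plane set \<Rightarrow> plane set" where
  "tube d0 P = {x. infdist x (frontier P) < d0 / 4}"

definition movement_field ::
    "real \<Rightarrow> real \<Rightarrow> real \<Rightarrow> nat \<Rightarrow> (nat \<Rightarrow> real) \<Rightarrow> plane set \<Rightarrow> plane set \<Rightarrow> (plane \<Rightarrow> plane) \<Rightarrow> bool" where
  "movement_field d0 \<beta>0 L m \<omega> P0 P1 U \<longleftrightarrow>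
     U \<in> W1inf \<and> continuous_on UNIV U \<and> supp U \<subseteq> closure (tube d0 P0) \<and>
     (\<exists>p0 p1. matched_points \<beta>0 L m \<omega> P0 P1 p0 p1 \<and>
        (\<forall>j<length p0. affine_map_on (closed_segment (p0 ! j) (cnext p0 j)) U \<and>
           U (p0 ! j) = p1 ! j - p0 ! j)) \<and>
     (\<forall>T \<in> components ((tube d0 P0 \<inter> interfaces L m \<omega>) - P0). affine_map_on T U) \<and>
     (AE x in lebesgue. norm (U x) + d0 / 8 * jac_norm U x
        \<le> C0 \<beta>0 * hausdorff_dist (frontier P0) (frontier P1))"

definition moved :: "(plane \<Rightarrow> plane) \<Rightarrow> plane set \<Rightarrow> real \<Rightarrow> plane set" where
  "moved U P0 t = (\<lambda>x. x + t *\<^sub>R U x) ` P0"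

definition F ::
    "real \<Rightarrow> nat \<Rightarrow> (nat \<Rightarrow> real) \<Rightarrow> real \<Rightarrow> (nat \<Rightarrow> real) \<Rightarrow> plane set \<Rightarrow> (plane \<Rightarrow> plane) \<Rightarrow>
     real \<Rightarrow> (plane \<Rightarrow> real) \<Rightarrow> (plane \<Rightarrow> real) \<Rightarrow> real" where
  "F L m \<omega> k \<gamma> P0 U t f g = DN L (conductivity L m \<omega> k \<gamma> (moved U P0 t)) f g"

definition F' ::
    "real \<Rightarrow> nat \<Rightarrow> (nat \<Rightarrow> real) \<Rightarrow> real \<Rightarrow> (nat \<Rightarrow> real) \<Rightarrow> plane set \<Rightarrow> (plane \<Rightarrow> plane) \<Rightarrow>
     real \<Rightarrow> (plane \<Rightarrow> real) \<Rightarrow> (plane \<Rightarrow> real) \<Rightarrow> real" where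
  "F' L m \<omega> k \<gamma> P0 U t f g =
     vector_derivative (\<lambda>s. F L m \<omega> k \<gamma> P0 U s f g) (at t within {0..1})"

end

theory Submission
  imports Defs
begin

text \<open>
  The function \<open>F\<close> of time has a Lipschitz continuous derivative, so the estimate holds with exponent \<open>1\<close>.
  The reason is visible after pulling everything back to the fixed polygon \<open>P0\<close>. Suppose that the map
  \<open>I + t V\<close> carries the conductivity of \<open>P0\<close> to that of the moved polygon. Then the Dirichlet to Neumann
  form of the moved conductivity is that of an anisotropic conductivity \<open>\<gamma> Kt\<close>, in which \<open>\<gamma>\<close> does
  not depend on time and \<open>Kt\<close> is a quotient of two quadratic polynomials in \<open>t\<close>, whose coefficients
  are controlled by the Lipschitz constant \<open>\<delta>\<close> of \<open>V\<close> (\<open>quotient_expansion\<close>, \<open>Kt_estimates\<close>).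
  Alessandrini's identity writes \<open>F t - F s\<close> as the difference of the two energies, evaluated at
  a solution for time \<open>t\<close> and one for time \<open>s\<close>. As solutions depend on time in a Lipschitz way, this gives
  \<open>\<bar>F t - F s - (t - s) D s\<bar> \<le> C \<delta>\<^sup>2 (t - s)\<^sup>2\<close> (\<open>DN_second_order\<close>). Exchanging \<open>s\<close> and \<open>t\<close> yields a
  derivative with Lipschitz constant of order \<open>\<delta>\<^sup>2\<close>, hence of order the square of the Hausdorff distance.

  Two points need care. Changes of variables are made with smooth maps, whereas the field is only
  Lipschitz, by the bound on its weak derivative (\<open>weak_lipschitz\<close>). The constants above involve
  \<open>V\<close> through \<open>\<delta>\<close> alone, so \<open>V\<close> can be mollified, and the forms pass to the limit because they are continuous
  under bounded convergence of the coefficients almost everywhere (\<open>DN_tendsto\<close>).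

  Moreover \<open>I + t U\<close> need not respect the layers. But the moved polygon depends only on the values of
  \<open>U\<close> on the boundary of \<open>P0\<close> (\<open>flow_polygon_cong\<close>), and there the vertical component of \<open>U\<close> is bounded by a small
  multiple of the distance to every interface (\<open>U_vertical\<close>): vertices are far from the interfaces, points
  on an interface move along it, and \<open>U\<close> is affine in between. Clipping the vertical component at this multiple
  of the distance gives a field \<open>V\<close> that agrees with \<open>U\<close> on the boundary of \<open>P0\<close> and whose flow keeps each layer.
  The smallness of the Hausdorff distance makes its Lipschitz constant at most \<open>3/7\<close>, and then the Jacobian
  determinant of \<open>I + t V\<close> stays away from zero.

  Solutions enter through their gradients. The gradients of the functions with a given trace are the limits of
  gradients of smooth functions whose boundary values converge (\<open>trace_grad\<close>). The Dirichlet problem is solved by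
  minimising the energy over them, and a function in \<open>H\<^sup>1\<^sup>/\<^sup>2\<close> is extended to the square by averaging it over the
  boundary with an explicit kernel (\<open>extension_exists\<close>).
\<close>

(* Points of the plane are kept as single variables under quantifiers. *)
declare split_paired_All [simp del] split_paired_Ex [simp del]

section \<open>Calculus of smooth functions on the plane\<close>

lemma Ck_SucI:
 assumes "\<And>x. (f has_derivative f' x) (at x)" "\<And>v. Ck n (\<lambda>x. f' x v)"
 shows "Ck (Suc n) f"
proof -
 have "frechet_derivative f (at x) = f' x" for x
  using frechet_derivative_at[OF assms(1)] by simp
 moreover have "f differentiable (at x)" for x using assms(1) by (rule differentiableI)
 ultimately show ?thesis using assms(2) by simp
qed

lemma Ck_SucD:
 assumes "Ck (Suc n) f"
 shows "(f has_derivative frechet_derivative f (at x)) (at x)"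
  "Ck n (\<lambda>x. frechet_derivative f (at x) v)"
 using assms by (simp_all add: frechet_derivative_works[symmetric])

lemma Ck_lower: "Ck (Suc n) f ==> Ck n f"
proof (induction n arbitrary: f)
 case 0
 then show ?case
  by (auto intro!: differentiable_imp_continuous_on simp: differentiable_on_def)
next
 case (Suc n)
 show ?case
  by (rule Ck_SucI[OF Ck_SucD(1)[OF Suc.prems]]) (rule Suc.IH[OF Ck_SucD(2)[OF Suc.prems]])
qed

lemma Ck_const: "Ck n (\<lambda>_. c)"
proof (induction n arbitrary: c)
 case (Suc n)
 show ?case by (rule Ck_SucI[where f'="\<lambda>_ _. 0"]) (auto intro: Suc)
qed simp

lemma Ck_linear: assumes "bounded_linear l" shows "Ck n l"
proof (cases n)
 case 0 then show ?thesis by (simp add: assms linear_continuous_on)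
next
 case (Suc k)
 show ?thesis unfolding Suc
  by (rule Ck_SucI[where f'="\<lambda>_. l"])
   (auto intro: Ck_const bounded_linear_imp_has_derivative assms)
qed

lemma Ck_add: "Ck n f ==> Ck n g ==> Ck n (\<lambda>x. f x + g x)"
proof (induction n arbitrary: f g)
 case (Suc n)
 show ?case
  by (rule Ck_SucI[OF has_derivative_add[OF Ck_SucD(1)[OF Suc.prems(1)] Ck_SucD(1)[OF Suc.prems(2)]]])
   (intro Suc.IH Ck_SucD[OF Suc.prems(1)] Ck_SucD[OF Suc.prems(2)])
qed (auto intro: continuous_intros)

lemma Ck_mult: "Ck n f ==> Ck n g ==> Ck n (\<lambda>x. f x * g x)"
proof (induction n arbitrary: f g)
 case (Suc n)
 show ?case
  by (rule Ck_SucI[OF has_derivative_mult[OF Ck_SucD(1)[OF Suc.prems(1)] Ck_SucD(1)[OF Suc.prems(2)]]])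
   (intro Ck_add Suc.IH Ck_SucD[OF Suc.prems(1)] Ck_SucD[OF Suc.prems(2)] Ck_lower[OF Suc.prems(1)]
    Ck_lower[OF Suc.prems(2)])
qed (auto intro: continuous_intros)

lemma Ck_inverse:
 assumes "\<And>x. f x ~= 0"
 shows "Ck n f ==> Ck n (\<lambda>x. inverse (f x))"
proof (induction n)
 case 0 then show ?case using assms by (auto intro!: continuous_intros)
next
 case (Suc n)
 have i: "Ck n (\<lambda>x. inverse (f x))" using Suc Ck_lower by blast
 have "((\<lambda>x. inverse (f x)) has_derivative
   (\<lambda>v. (-1) * (inverse (f x) * frechet_derivative f (at x) v * inverse (f x)))) (at x)" for x
  using Deriv.has_derivative_inverse[OF assms Ck_SucD(1)[OF Suc.prems], of x] by simp
 then show ?case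
  by (rule Ck_SucI) (intro Ck_mult Ck_const i Ck_SucD[OF Suc.prems])
qed

lemma smooth_const [intro, simp]: "smooth (\<lambda>_. c)"
 and smooth_add [intro]: "smooth f ==> smooth g ==> smooth (\<lambda>x. f x + g x)"
 and smooth_mult [intro]: "smooth f ==> smooth g ==> smooth (\<lambda>x. f x * g x)"
 and smooth_linear: "bounded_linear f ==> smooth f"
 and smooth_inverse: "(\<And>x. h x ~= 0) ==> smooth h ==> smooth (\<lambda>x. inverse (h x))"
 by (auto simp: smooth_def Ck_const Ck_add Ck_mult Ck_linear intro: Ck_inverse)

lemma smooth_divide: "(\<And>x. h x ~= 0) ==> smooth f ==> smooth h ==> smooth (\<lambda>x. f x / h x)"
 by (simp add: divide_inverse smooth_mult smooth_inverse)

lemma smooth_uminus [intro]: "smooth f ==> smooth (\<lambda>x. - f x)"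
 using smooth_mult[OF smooth_const[of "-1"], of f] by simp

lemma smooth_diff [intro]: "smooth f ==> smooth g ==> smooth (\<lambda>x. f x - g x)"
 using smooth_add[of f "\<lambda>x. - g x"] smooth_uminus[of g] by simp

lemma smooth_fst [intro, simp]: "smooth fst" and smooth_snd [intro, simp]: "smooth snd"
 by (intro smooth_linear bounded_linear_fst bounded_linear_snd)+

lemma smooth_power [intro]: "smooth f ==> smooth (\<lambda>x. f x ^ n)"
 by (induction n) auto

lemma smooth_continuous: "smooth f ==> continuous_on A f"
 using continuous_on_subset[of UNIV f A] unfolding smooth_def by (metis Ck.simps(1) subset_UNIV)

lemma smooth_frechet: "smooth f ==> smooth (\<lambda>x. frechet_derivative f (at x) v)"
 unfolding smooth_def using Ck_SucD(2) by blast

lemma inner_plane: "(x::plane) \<bullet> y = fst x * fst y + snd x * snd y"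
 by (simp add: inner_prod_def)

lemma frechet_grad:
 assumes "f differentiable (at x)"
 shows "frechet_derivative f (at x) v = grad f x \<bullet> v"
proof -
 interpret bounded_linear "frechet_derivative f (at x)"
  using assms by (simp add: bounded_linear_def frechet_derivative_works has_derivative_def
   linear_frechet_derivative)
 have "v = fst v *\<^sub>R (1,0) + snd v *\<^sub>R (0,1)" by (simp add: prod_eq_iff)
 then have "frechet_derivative f (at x) v
   = fst v *\<^sub>R frechet_derivative f (at x) (1,0) + snd v *\<^sub>R frechet_derivative f (at x) (0,1)"
  by (metis add scaleR)
 then show ?thesis by (simp add: grad_def inner_plane)
qed

lemma smooth_has_derivative:
 assumes "smooth f" shows "(f has_derivative (\<lambda>v. grad f x \<bullet> v)) (at x)"
proof -
 have "Ck (Suc 0) f" using assms by (simp add: smooth_def del: Ck.simps)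
 then have d: "(f has_derivative frechet_derivative f (at x)) (at x)" by (rule Ck_SucD)
 then have "frechet_derivative f (at x) = (\<lambda>v. grad f x \<bullet> v)"
  by (intro ext frechet_grad) (auto simp: differentiable_def)
 then show ?thesis using d by simp
qed

lemma grad_eqI:
 assumes "(f has_derivative (\<lambda>v. g \<bullet> v)) (at x)" shows "grad f x = g"
 unfolding grad_def frechet_derivative_at[OF assms, symmetric] by (simp add: inner_plane prod_eq_iff)

lemma smooth_grad: assumes "smooth f"
 shows "smooth (\<lambda>x. fst (grad f x))" "smooth (\<lambda>x. snd (grad f x))" "smooth (\<lambda>x. grad f x \<bullet> v)"
proof -
 show a: "smooth (\<lambda>x. fst (grad f x))" "smooth (\<lambda>x. snd (grad f x))"
  using smooth_frechet[OF assms] by (auto simp: grad_def)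
 show "smooth (\<lambda>x. grad f x \<bullet> v)" unfolding inner_plane by (intro smooth_add smooth_mult smooth_const a)
qed

lemma continuous_grad: assumes "smooth f" shows "continuous_on A (grad f)"
proof -
 have "continuous_on A (\<lambda>x. (fst (grad f x), snd (grad f x)))"
  by (intro continuous_on_Pair smooth_continuous smooth_grad assms)
 then show ?thesis by simp
qed

lemma grad_add: "smooth f ==> smooth g ==> grad (\<lambda>x. f x + g x) x = grad f x + grad g x"
 by (rule grad_eqI, rule has_derivative_eq_rhs[OF has_derivative_add[OF smooth_has_derivative smooth_has_derivative]])
  (auto simp: inner_add_left)

lemma grad_mult: "smooth f ==> smooth g ==> grad (\<lambda>x. f x * g x) x = f x *\<^sub>R grad g x + g x *\<^sub>R grad f x"
 by (rule grad_eqI, rule has_derivative_eq_rhs[OF has_derivative_mult[OF smooth_has_derivative smooth_has_derivative]])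
  (auto simp: inner_add_left)

lemma grad_const [simp]: "grad (\<lambda>_. c) x = 0"
 by (rule grad_eqI) simp

lemma grad_cmult: "smooth f ==> grad (\<lambda>x. c * f x) x = c *\<^sub>R grad f x"
 using grad_mult[of "\<lambda>_. c" f x] by simp

lemma grad_diff: "smooth f ==> smooth g ==> grad (\<lambda>x. f x - g x) x = grad f x - grad g x"
 by (rule grad_eqI, rule has_derivative_eq_rhs[OF has_derivative_diff[OF smooth_has_derivative smooth_has_derivative]])
  (auto simp: inner_diff_left)

text \<open>The partial derivatives of \<open>h \<circ> T\<close> are sums of products of functions \<open>h' \<circ> T\<close> with \<open>h'\<close>
 again smooth, so an induction that quantifies over all smooth \<open>h\<close> closes.\<close>

lemma smooth_compose:
 assumes "smooth (\<lambda>x. fst (T x))" "smooth (\<lambda>x. snd (T x))" "smooth h"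
 shows "smooth (\<lambda>x. h (T x))"
proof -
 have dP: "(T has_derivative (\<lambda>v. (grad (\<lambda>x. fst (T x)) x \<bullet> v, grad (\<lambda>x. snd (T x)) x \<bullet> v))) (at x)" for x
  using has_derivative_Pair[OF smooth_has_derivative[OF assms(1)] smooth_has_derivative[OF assms(2)]] by simp
 have "Ck n (\<lambda>x. h (T x))" if "smooth h" for n h
  using that
 proof (induction n arbitrary: h)
  case 0
  have "continuous_on UNIV T"
   by (rule has_derivative_continuous_on) (rule dP[THEN has_derivative_at_withinI])
  then show ?case using smooth_continuous[OF 0]
   by (auto intro: continuous_on_compose2)
 next
  case (Suc n)
  have d: "((\<lambda>x. h (T x)) has_derivative (\<lambda>v. fst (grad h (T x)) * (grad (\<lambda>x. fst (T x)) x \<bullet> v)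
    + snd (grad h (T x)) * (grad (\<lambda>x. snd (T x)) x \<bullet> v))) (at x)" for x
   using has_derivative_compose[OF dP smooth_has_derivative[OF Suc.prems]] by (simp add: inner_plane)
  have c: "Ck n f" if "smooth f" for f using that by (simp add: smooth_def)
  show ?case
   by (rule Ck_SucI[OF d]) (intro Ck_add Ck_mult Suc.IH c smooth_grad Suc.prems assms)
 qed
 then show ?thesis using assms(3) by (simp add: smooth_def)
qed

lemma grad_compose:
 assumes "smooth (\<lambda>x. fst (T x))" "smooth (\<lambda>x. snd (T x))" "smooth h"
 shows "grad (\<lambda>x. h (T x)) x = fst (grad h (T x)) *\<^sub>R grad (\<lambda>x. fst (T x)) x
  + snd (grad h (T x)) *\<^sub>R grad (\<lambda>x. snd (T x)) x"
proof (rule grad_eqI)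
 have dP: "(T has_derivative (\<lambda>v. (grad (\<lambda>x. fst (T x)) x \<bullet> v, grad (\<lambda>x. snd (T x)) x \<bullet> v))) (at x)" for x
  using has_derivative_Pair[OF smooth_has_derivative[OF assms(1)] smooth_has_derivative[OF assms(2)]] by simp
 have "(\<lambda>v. grad h (T x) \<bullet> (grad (\<lambda>x. fst (T x)) x \<bullet> v, grad (\<lambda>x. snd (T x)) x \<bullet> v)) =
  (\<lambda>v. (fst (grad h (T x)) *\<^sub>R grad (\<lambda>x. fst (T x)) x + snd (grad h (T x)) *\<^sub>R grad (\<lambda>x. snd (T x)) x) \<bullet> v)"
  by (rule ext) (simp only: inner_plane[of "grad h _"] inner_add_left inner_scaleR_left fst_conv snd_conv)
 then show "((\<lambda>x. h (T x)) has_derivative (\<lambda>v. (fst (grad h (T x)) *\<^sub>R grad (\<lambda>x. fst (T x)) x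
  + snd (grad h (T x)) *\<^sub>R grad (\<lambda>x. snd (T x)) x) \<bullet> v)) (at x)"
  by (rule has_derivative_eq_rhs[OF has_derivative_compose[OF dP smooth_has_derivative[OF assms(3)]]])
qed

subsection \<open>Cut-off functions\<close>

text \<open>The function \<open>exp (- 1 / x)\<close>, extended by zero, is flat at the origin; dividing by powers
 of \<open>x\<close> makes the family closed under differentiation.\<close>

definition flat :: "nat => real => real" where
 "flat j x = (if 0 < x then exp (- (1/x)) / x ^ j else 0)"

lemma exp_ge_power_div_fact: "0 <= x ==> x ^ n / fact n <= exp (x::real)"
proof -
 assume "0 <= x"
 then have "(\<Sum>i\<in>{n}. inverse (fact i) *\<^sub>R x ^ i) <= (\<Sum>i. inverse (fact i) *\<^sub>R x ^ i)"
  by (intro sum_le_suminf summable_exp_generic) auto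
 moreover have "(\<Sum>i\<in>{n}. inverse (fact i) *\<^sub>R x ^ i) = x ^ n / fact n" by (simp add: divide_inverse)
 moreover have "(\<Sum>i. inverse (fact i) *\<^sub>R x ^ i) = exp x" by (simp only: exp_def divide_inverse)
 ultimately show ?thesis by (simp only:)
qed

lemma flat_bound: "\<bar>flat j x\<bar> <= fact (j + 2) * x^2"
proof (cases "0 < x")
 case True
 define c :: real where "c = fact (j+2)"
 have c: "0 < c" by (simp add: c_def)
 have "(1/x) ^ (j+2) / c <= exp (1/x)" unfolding c_def using True by (intro exp_ge_power_div_fact) simp
 then have "1 / exp (1/x) <= c * x ^ (j + 2)"
  using True c by (simp add: divide_simps power_one_over mult_ac)
 then have "1 / exp (1/x) / x ^ j <= c * x^2"
  using True by (simp add: divide_simps power_add power2_eq_square mult_ac)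
 then have "\<bar>flat j x\<bar> <= c * x^2" using True
  by (simp add: flat_def exp_minus inverse_eq_divide)
 then show ?thesis unfolding c_def .
qed (simp add: flat_def)

lemma flat_deriv: "(flat j has_real_derivative (flat (j+2) x - j * flat (j+1) x)) (at x)"
proof -
 consider "0 < x" | "x < 0" | "x = 0" by linarith
 then show ?thesis
 proof cases
  case 1
  have "((\<lambda>x. exp (- (1/x)) / x ^ j) has_real_derivative
    (exp (- (1/x)) * (1 / x^2) * x ^ j - exp (- (1/x)) * (real j * x ^ (j - 1))) / (x ^ j * x ^ j)) (at x)"
   using 1 by (auto intro!: derivative_eq_intros simp: power2_eq_square)
  also have "(exp (- (1/x)) * (1 / x^2) * x ^ j - exp (- (1/x)) * (real j * x ^ (j - 1))) / (x ^ j * x ^ j)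
    = flat (j+2) x - j * flat (j+1) x"
   using 1 by (cases j) (simp_all add: flat_def divide_simps power_add power2_eq_square, simp_all add: algebra_simps)
  finally have "((\<lambda>x. exp (- (1/x)) / x ^ j) has_real_derivative (flat (j+2) x - j * flat (j+1) x)) (at x)" .
  then show ?thesis
   by (rule has_field_derivative_transform_within_open[where S="{0<..}"]) (use 1 in \<open>auto simp: flat_def\<close>)
 next
  case 2
  show ?thesis
   by (rule has_field_derivative_transform_within_open[where S="{..<0}" and f="\<lambda>_. 0"])
    (use 2 in \<open>auto simp: flat_def\<close>)
 next
  case 3
  have "((\<lambda>h. flat j h / h) \<longlongrightarrow> 0) (at 0)"
  proof (rule Lim_null_comparison)
   show "\<forall>\<^sub>F h in at 0. norm (flat j h / h) <= fact (j+2) * \<bar>h\<bar>"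
    using flat_bound[of j] by (auto simp: eventually_at_filter divide_simps power2_eq_square abs_mult_self_eq mult.assoc
     simp del: fact_Suc intro!: always_eventually)
   show "((\<lambda>h. fact (j+2) * \<bar>h\<bar>) \<longlongrightarrow> (0::real)) (at 0)"
    by (auto intro!: tendsto_eq_intros)
  qed
  then show ?thesis using 3 by (simp add: DERIV_def flat_def)
 qed
qed

lemma smooth_flat: assumes "smooth l" shows "smooth (\<lambda>p. flat j (l p))"
proof -
 have "Ck n (\<lambda>p. flat j (l p))" for n
 proof (induction n arbitrary: j)
  case 0
  have "continuous_on UNIV (flat j)"
   by (rule DERIV_continuous_on) (rule flat_deriv)
  then show ?case using smooth_continuous[OF assms]
   by (auto intro: continuous_on_compose2)
 next
  case (Suc n)
  have d: "((\<lambda>p. flat j (l p)) has_derivative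
    (\<lambda>v. (flat (j+2) (l x) + (- real j) * flat (j+1) (l x)) * (grad l x \<bullet> v))) (at x)" for x
   using has_derivative_compose[OF smooth_has_derivative[OF assms], of "flat j"]
    flat_deriv[of j "l x", unfolded has_field_derivative_def] by simp
  have c: "Ck n (\<lambda>x. grad l x \<bullet> v)" for v using smooth_grad(3)[OF assms] by (simp add: smooth_def)
  show ?case by (rule Ck_SucI[OF d]) (intro Ck_add Ck_mult Ck_const Suc.IH c)
 qed
 then show ?thesis by (simp add: smooth_def)
qed

text \<open>A smooth step: \<open>0\<close> on the negative half-line, \<open>1\<close> from \<open>1\<close> on.\<close>

definition step :: "real => real" where
 "step x = flat 0 x / (flat 0 x + flat 0 (1 - x))"

lemma flat_nonneg: "0 <= flat j x" and flat_pos: "0 < x ==> 0 < flat j x" and flat_zero: "x <= 0 ==> flat j x = 0"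
 by (auto simp: flat_def)

lemma step_denom: "0 < flat 0 x + flat 0 (1 - x)"
 using flat_nonneg[of 0 x] flat_nonneg[of 0 "1-x"] flat_pos[of x 0] flat_pos[of "1-x" 0] by linarith

lemma smooth_step: "smooth l ==> smooth (\<lambda>p. step (l p))"
 unfolding step_def using step_denom
 by (intro smooth_divide smooth_add smooth_flat smooth_diff smooth_const) (auto simp: less_imp_neq[symmetric])

lemma step_0: "x <= 0 ==> step x = 0" and step_1: "1 <= x ==> step x = 1"
 using flat_pos[of x 0] by (auto simp: step_def flat_zero)

lemma step_range: "0 <= step x" "step x <= 1"
 using step_denom[of x] flat_nonneg[of 0 x] flat_nonneg[of 0 "1-x"] by (auto simp: step_def divide_simps)

lemma step_deriv_bounded: "\<exists>C d. \<forall>x. (step has_real_derivative d x) (at x) \<and> \<bar>d x\<bar> <= C"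
proof -
 define f where "f = (\<lambda>p::plane. step (fst p))"
 have f: "smooth f" unfolding f_def by (rule smooth_step) simp
 have d: "(step has_real_derivative fst (grad f (x,0))) (at x)" for x
 proof -
  have "((\<lambda>s. (s, 0)) has_derivative (\<lambda>v::real. (v, 0::real))) (at x)"
   by (auto intro!: derivative_eq_intros)
  from has_derivative_compose[OF this smooth_has_derivative[OF f]]
  moreover have "(\<lambda>v. grad f (x,0) \<bullet> (v,0)) = (*) (fst (grad f (x,0)))"
   by (simp add: inner_plane fun_eq_iff)
  moreover have "(\<lambda>x. f (x, 0)) = step" by (simp add: f_def)
  ultimately show ?thesis by (simp add: has_field_derivative_def)
 qed
 have "continuous_on {0..1} (\<lambda>x. fst (grad f (x,0)))"
  by (intro continuous_intros continuous_on_compose2[OF continuous_grad[OF f, of UNIV]]) auto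
 then obtain C where C: "\<And>x. x \<in> {0..1} ==> \<bar>fst (grad f (x,0))\<bar> <= C"
  using compact_imp_bounded[OF compact_continuous_image[OF _ compact_Icc], of 0 1 "\<lambda>x. fst (grad f (x,0))"]
  unfolding bounded_iff by (metis image_eqI real_norm_def)
 have "\<bar>fst (grad f (x,0))\<bar> <= max C 0" for x
 proof (cases "x \<in> {0..1}")
  case True then show ?thesis using C by fastforce
 next
  case False
  then consider "x < 0" | "1 < x" by fastforce
  then have "(step has_real_derivative 0) (at x)"
  proof cases
   case 1 show ?thesis
    by (rule has_field_derivative_transform_within_open[where S="{..<0}" and f="\<lambda>_. 0"])
     (use 1 in \<open>auto simp: step_0\<close>)
  next
   case 2 show ?thesis
    by (rule has_field_derivative_transform_within_open[where S="{1<..}" and f="\<lambda>_. 1"])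
     (use 2 in \<open>auto simp: step_1\<close>)
  qed
  then have "fst (grad f (x,0)) = 0" using d DERIV_unique by blast
  then show ?thesis by simp
 qed
 then show ?thesis using d by (intro exI[of _ "max C 0"] exI[of _ "\<lambda>x. fst (grad f (x,0))"]) auto
qed

subsection \<open>Convolution\<close>

lemma smooth_bounded_on_ball:
 assumes "smooth g" shows "\<exists>B\<ge>0. \<forall>x. norm x <= r --> \<bar>g x\<bar> <= B \<and> norm (grad g x) <= B"
proof -
 obtain B1 where 1: "\<forall>x\<in>cball 0 r. \<bar>g x\<bar> <= B1"
  using compact_imp_bounded[OF compact_continuous_image[OF smooth_continuous[OF assms] compact_cball[of 0 r]]]
  unfolding bounded_iff by auto
 obtain B2 where 2: "\<forall>x\<in>cball 0 r. norm (grad g x) <= B2"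
  using compact_imp_bounded[OF compact_continuous_image[OF continuous_grad[OF assms] compact_cball[of 0 r]]]
  unfolding bounded_iff by auto
 show ?thesis
  by (rule exI[of _ "max 0 (max B1 B2)"]) (use 1 2 in \<open>auto simp: le_max_iff_disj\<close>)
qed

lemma smooth_lipschitz_on_ball:
 assumes "smooth g" shows "\<exists>B\<ge>0. \<forall>x y. norm x <= r --> norm y <= r --> \<bar>g x - g y\<bar> <= B * norm (x - y)"
proof -
 obtain B where B: "B \<ge> 0" "\<And>x. norm x <= r ==> norm (grad g x) <= B"
  using smooth_bounded_on_ball[OF assms, of r] by blast
 have "norm (g x - g y) <= B * norm (x - y)" if "norm x <= r" "norm y <= r" for x y
 proof (rule differentiable_bound[where S="cball 0 r" and f'="\<lambda>x v. grad g x \<bullet> v"])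
  show "onorm (\<lambda>v. grad g x \<bullet> v) <= B" if "x \<in> cball 0 r" for x
  proof (rule onorm_le)
   fix v show "norm (grad g x \<bullet> v) <= B * norm v"
    using Cauchy_Schwarz_ineq2[of "grad g x" v] B(2)[of x] that
    by (smt (verit) mult_right_mono norm_ge_zero mem_cball_0 real_norm_def)
  qed
 qed (use that in \<open>auto intro: has_derivative_at_withinI smooth_has_derivative assms\<close>)
 then show ?thesis using B(1) by auto
qed

lemma smooth_taylor:
 assumes "smooth K"
 shows "\<exists>C\<ge>0. \<forall>z h. norm z <= R --> norm h <= 1 --> \<bar>K (z + h) - K z - grad K z \<bullet> h\<bar> <= C * (norm h)^2"
proof -
 obtain B1 where B1: "B1 \<ge> 0" "\<And>x y. norm x <= R+1 ==> norm y <= R+1 ==>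
   \<bar>fst (grad K x) - fst (grad K y)\<bar> <= B1 * norm (x - y)"
  using smooth_lipschitz_on_ball[OF smooth_grad(1)[OF assms], of "R+1"] by blast
 obtain B2 where B2: "B2 \<ge> 0" "\<And>x y. norm x <= R+1 ==> norm y <= R+1 ==>
   \<bar>snd (grad K x) - snd (grad K y)\<bar> <= B2 * norm (x - y)"
  using smooth_lipschitz_on_ball[OF smooth_grad(2)[OF assms], of "R+1"] by blast
 have "\<bar>K (z + h) - K z - grad K z \<bullet> h\<bar> <= (B1 + B2) * (norm h)^2" if "norm z <= R" "norm h <= 1" for z h
 proof -
  define k where "k = (\<lambda>w. K w - grad K z \<bullet> w)"
  have "norm (k (z + h) - k z) <= (B1 + B2) * norm h * norm (z + h - z)"
  proof (rule differentiable_bound[where S="cball z (norm h)" and f'="\<lambda>w v. (grad K w - grad K z) \<bullet> v"])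
   fix w assume w: "w \<in> cball z (norm h)"
   have "(k has_derivative (\<lambda>v. grad K w \<bullet> v - grad K z \<bullet> v)) (at w)"
    unfolding k_def by (intro has_derivative_diff smooth_has_derivative assms
      bounded_linear_imp_has_derivative bounded_linear_inner_right)
   then show "(k has_derivative (\<lambda>v. (grad K w - grad K z) \<bullet> v)) (at w within cball z (norm h))"
    by (simp add: inner_diff_left has_derivative_at_withinI)
   have w': "norm (w - z) <= norm h" using w by (simp add: dist_norm norm_minus_commute)
   then have "norm w <= R + 1" using norm_triangle_sub[of w z] that by linarith
   then have "norm (grad K w - grad K z) <= B1 * norm (w - z) + B2 * norm (w - z)"
    using B1(2)[of w z] B2(2)[of w z] that norm_le_l1[of "grad K w - grad K z"]
     sqrt_sum_squares_le_sum_abs[of "fst (grad K w - grad K z)" "snd (grad K w - grad K z)"]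
    by (simp add: norm_prod_def)
   also have "\<dots> <= (B1 + B2) * norm h"
    using w' B1(1) B2(1) by (simp add: distrib_right add_mono mult_left_mono)
   finally have g: "norm (grad K w - grad K z) <= (B1 + B2) * norm h" .
   show "onorm (\<lambda>v. (grad K w - grad K z) \<bullet> v) <= (B1 + B2) * norm h"
   proof (rule onorm_le)
    fix v show "norm ((grad K w - grad K z) \<bullet> v) <= (B1 + B2) * norm h * norm v"
     using Cauchy_Schwarz_ineq2[of "grad K w - grad K z" v] g
     by (smt (verit) mult_right_mono norm_ge_zero real_norm_def)
   qed
  qed (auto simp: dist_norm)
  then show ?thesis by (simp add: k_def inner_add_right power2_eq_square algebra_simps)
 qed
 then show ?thesis using B1(1) B2(1) by (intro exI[of _ "B1 + B2"]) auto
qed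

text \<open>Differentiation under the integral sign. The points \<open>s a\<close> stay in a bounded set, so the remainder in
 the Taylor formula is bounded uniformly in \<open>a\<close>.\<close>

context
 fixes \<mu> :: "'a measure" and s :: "'a => plane" and w :: "'a => real" and R :: real
 assumes s: "s \<in> borel_measurable \<mu>" and w: "integrable \<mu> w"
  and R: "\<And>a. a \<in> space \<mu> ==> norm (s a) <= R"
begin

lemma convolution_integrable:
 assumes "smooth K" shows "integrable \<mu> (\<lambda>a. K (x - s a) * w a)"
proof -
 obtain B where B: "B \<ge> 0" "\<And>z. norm z <= norm x + R ==> \<bar>K z\<bar> <= B"
  using smooth_bounded_on_ball[OF assms, of "norm x + R"] by blast
 have m: "(\<lambda>a. K (x - s a)) \<in> borel_measurable \<mu>"
  using s borel_measurable_continuous_onI[OF smooth_continuous[OF assms]]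
  by (rule_tac measurable_compose[of "\<lambda>a. x - s a" _ borel]) auto
 show ?thesis
 proof (rule Bochner_Integration.integrable_bound[of _ "\<lambda>a. B * w a"])
  have "norm (K (x - s a) * w a) <= norm (B * w a)" if "a \<in> space \<mu>" for a
  proof -
   have "norm (x - s a) <= norm x + R" using norm_triangle_ineq4[of x "s a"] R[OF that] by linarith
   from B(2)[OF this] show ?thesis using B(1) by (simp add: abs_mult mult_right_mono)
  qed
  then show "AE a in \<mu>. norm (K (x - s a) * w a) <= norm (B * w a)" by (intro AE_I2)
 qed (use w m in auto)
qed

lemma convolution_has_derivative:
 assumes K: "smooth K"
 shows "((\<lambda>x. \<integral>a. K (x - s a) * w a \<partial>\<mu>) has_derivative (\<lambda>v. \<integral>a. (grad K (x - s a) \<bullet> v) * w a \<partial>\<mu>)) (at x)"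
proof -
 define F where "F = (\<lambda>x. \<integral>a. K (x - s a) * w a \<partial>\<mu>)"
 define D where "D = (\<lambda>v. \<integral>a. (grad K (x - s a) \<bullet> v) * w a \<partial>\<mu>)"
 have iD: "integrable \<mu> (\<lambda>a. (grad K (x - s a) \<bullet> v) * w a)" for v
  by (rule convolution_integrable) (rule smooth_grad[OF K])
 obtain C where C: "C \<ge> 0" "\<And>z h. norm z <= norm x + R ==> norm h <= 1 ==>
   \<bar>K (z + h) - K z - grad K z \<bullet> h\<bar> <= C * (norm h)^2"
  using smooth_taylor[OF K, of "norm x + R"] by blast
 have lin: "D v = (LINT a|\<mu>. fst (grad K (x - s a)) * w a) * fst v + (LINT a|\<mu>. snd (grad K (x - s a)) * w a) * snd v" for v
 proof -
  have "D v = (LINT a|\<mu>. fst v * (fst (grad K (x - s a)) * w a) + snd v * (snd (grad K (x - s a)) * w a))"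
   unfolding D_def by (simp add: inner_plane algebra_simps)
  also have "\<dots> = fst v * (LINT a|\<mu>. fst (grad K (x - s a)) * w a) + snd v * (LINT a|\<mu>. snd (grad K (x - s a)) * w a)"
   by (subst Bochner_Integration.integral_add)
    (auto intro!: integrable_mult_right convolution_integrable smooth_grad K)
  finally show ?thesis by (simp add: mult.commute)
 qed
 have "(F has_derivative D) (at x)"
 proof (rule has_derivativeI_sandwich[where e=1])
  have "D = (\<lambda>v. ((LINT a|\<mu>. fst (grad K (x - s a)) * w a), (LINT a|\<mu>. snd (grad K (x - s a)) * w a)) \<bullet> v)"
   by (rule ext) (simp add: lin inner_plane)
  then show "bounded_linear D" by (simp add: bounded_linear_inner_right)
  define W where "W = (LINT a|\<mu>. \<bar>w a\<bar>)"
  show "norm (F y - F x - D (y - x)) / norm (y - x) <= C * W * norm (y - x)" if "y ~= x" "dist y x < 1" for y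
  proof -
   define h where "h = y - x"
   have h: "norm h <= 1" "y = x + h" "h ~= 0" using that by (auto simp: h_def dist_norm)
   have "F y - F x - D (y - x) = (LINT a|\<mu>. (K (x - s a + h) - K (x - s a) - grad K (x - s a) \<bullet> h) * w a)"
    using convolution_integrable[OF K, of y] convolution_integrable[OF K, of x] iD[of h]
    by (simp add: F_def D_def h left_diff_distrib Bochner_Integration.integral_diff algebra_simps
      flip: Bochner_Integration.integral_diff)
   also have "norm \<dots> <= (LINT a|\<mu>. C * (norm h)^2 * \<bar>w a\<bar>)"
   proof (rule order_trans[OF integral_norm_bound], rule Bochner_Integration.integral_mono[OF integrable_norm])
    have "integrable \<mu> (\<lambda>a. K (y - s a) * w a - K (x - s a) * w a - (grad K (x - s a) \<bullet> h) * w a)"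
     by (intro Bochner_Integration.integrable_diff convolution_integrable K iD)
    then show "integrable \<mu> (\<lambda>a. (K (x - s a + h) - K (x - s a) - grad K (x - s a) \<bullet> h) * w a)"
     by (simp add: h algebra_simps)
    show "integrable \<mu> (\<lambda>a. C * (norm h)^2 * \<bar>w a\<bar>)" using w by auto
    show "norm ((K (x - s a + h) - K (x - s a) - grad K (x - s a) \<bullet> h) * w a) <= C * (norm h)^2 * \<bar>w a\<bar>"
     if "a \<in> space \<mu>" for a
    proof -
     have "norm (x - s a) <= norm x + R" using norm_triangle_ineq4[of x "s a"] R[OF that] by linarith
     from C(2)[OF this h(1)] show ?thesis by (auto simp: abs_mult intro!: mult_right_mono)
    qed
   qed
   also have "\<dots> = C * W * norm h * norm h" by (simp add: W_def power2_eq_square)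
   finally show ?thesis using h(3) unfolding h_def by (simp add: divide_simps)
  qed
  show "((\<lambda>y. C * W * norm (y - x)) \<longlongrightarrow> 0) (at x)"
   by (auto intro!: tendsto_eq_intros)
 qed simp
 then show ?thesis by (simp add: F_def D_def)
qed

lemma smooth_convolution:
 assumes "smooth K" shows "smooth (\<lambda>x. \<integral>a. K (x - s a) * w a \<partial>\<mu>)"
proof -
 have "Ck n (\<lambda>x. \<integral>a. K (x - s a) * w a \<partial>\<mu>)" if "smooth K" for n K
  using that
 proof (induction n arbitrary: K)
  case 0
  have "continuous_on UNIV (\<lambda>x. \<integral>a. K (x - s a) * w a \<partial>\<mu>)"
   by (rule has_derivative_continuous_on) (rule convolution_has_derivative[OF 0, THEN has_derivative_at_withinI])
  then show ?case by simp
 next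
  case (Suc n)
  show ?case
   by (rule Ck_SucI[OF convolution_has_derivative[OF Suc.prems]]) (intro Suc.IH smooth_grad Suc.prems)
 qed
 then show ?thesis using assms by (simp add: smooth_def)
qed

lemma grad_convolution:
 assumes "smooth K"
 shows "grad (\<lambda>x. \<integral>a. K (x - s a) * w a \<partial>\<mu>) x \<bullet> v = (LINT a|\<mu>. (grad K (x - s a) \<bullet> v) * w a)"
 using fun_cong[OF has_derivative_unique[OF convolution_has_derivative[OF assms]
  smooth_has_derivative[OF smooth_convolution[OF assms]], of x], of v] by (simp only:)

end

section \<open>Square integrable functions\<close>

definition sqn :: "'a measure => ('a => 'b::euclidean_space) => real" where
 "sqn M u = (LINT x|M. (norm (u x))^2)"

definition nrm :: "'a measure => ('a => 'b::euclidean_space) => real" where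
 "nrm M u = sqrt (sqn M u)"

lemma sqn_nonneg [simp]: "0 <= sqn M u" by (simp add: sqn_def)
lemma nrm_nonneg [simp]: "0 <= nrm M u" by (simp add: nrm_def)
lemma nrm_sq: "(nrm M u)^2 = sqn M u" by (simp add: nrm_def)

lemma sqn_inner: "sqn M u = (LINT x|M. u x \<bullet> u x)"
 by (simp add: sqn_def power2_norm_eq_inner)

lemma L2_measurable: "L2 M u ==> u \<in> borel_measurable M"
 and L2_integrable: "L2 M u ==> integrable M (\<lambda>x. (norm (u x))^2)"
 by (auto simp: L2_def)

lemma L2_dominated:
 assumes "u \<in> borel_measurable M" "integrable M h" "AE x in M. (norm (u x))^2 <= h x"
 shows "L2 M u"
 unfolding L2_def
proof
 show "integrable M (\<lambda>x. (norm (u x))^2)"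
  by (rule Bochner_Integration.integrable_bound[OF assms(2)]) (use assms in auto)
qed fact

lemma L2_zero [simp]: "L2 M (\<lambda>_. 0)" by (simp add: L2_def)

lemma L2_scaleR: "L2 M u ==> L2 M (\<lambda>x. c *\<^sub>R u x)"
 by (auto simp: L2_def power_mult_distrib)

lemma norm_add_sq_le: "(norm (a + b))^2 <= 2 * (norm a)^2 + 2 * (norm b)^2"
proof -
 have "(norm (a + b))^2 <= (norm a + norm b)^2" by (simp add: norm_triangle_ineq power_mono)
 also have "\<dots> <= 2 * (norm a)^2 + 2 * (norm b)^2"
  using zero_le_power2[of "norm a - norm b"] by (simp add: power2_sum power2_diff)
 finally show ?thesis .
qed

lemma L2_add: assumes "L2 M u" "L2 M v" shows "L2 M (\<lambda>x. u x + v x)"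
 by (rule L2_dominated[where h="\<lambda>x. 2 * (norm (u x))^2 + 2 * (norm (v x))^2"])
  (use assms in \<open>auto simp: L2_def norm_add_sq_le\<close>)

lemma L2_diff: assumes "L2 M u" "L2 M v" shows "L2 M (\<lambda>x. u x - v x)"
 using L2_add[OF assms(1) L2_scaleR[OF assms(2), of "-1"]] by simp

lemma L2_norm: "L2 M u ==> L2 M (\<lambda>x. norm (u x))"
 by (auto simp: L2_def)

lemma L2_bounded_mult:
 fixes u :: "'a => 'b::euclidean_space"
 assumes "L2 M u" "a \<in> borel_measurable M" "AE x in M. \<bar>a x\<bar> <= B"
 shows "L2 M (\<lambda>x. a x *\<^sub>R u x)"
proof (rule L2_dominated[where h="\<lambda>x. B^2 * (norm (u x))^2"])
 show "(\<lambda>x. a x *\<^sub>R u x) \<in> borel_measurable M" using assms by (auto simp: L2_def)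
 show "integrable M (\<lambda>x. B^2 * (norm (u x))^2)" using assms by (auto simp: L2_def)
 show "AE x in M. (norm (a x *\<^sub>R u x))^2 <= B^2 * (norm (u x))^2"
  using assms(3) by eventually_elim
   (auto simp: power_mult_distrib intro!: mult_right_mono simp flip: abs_le_square_iff)
qed

lemma L2_inner_integrable:
 assumes "L2 M u" "L2 M v" shows "integrable M (\<lambda>x. u x \<bullet> v x)"
proof (rule Bochner_Integration.integrable_bound[of _ "\<lambda>x. (norm (u x))^2 + (norm (v x))^2"])
 show "AE x in M. norm (u x \<bullet> v x) <= norm ((norm (u x))^2 + (norm (v x))^2)"
 proof (rule AE_I2)
  fix x
  have "\<bar>u x \<bullet> v x\<bar> <= norm (u x) * norm (v x)" by (rule Cauchy_Schwarz_ineq2)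
  also have "\<dots> <= (norm (u x))^2 + (norm (v x))^2"
   using zero_le_power2[of "norm (u x) - norm (v x)"] zero_le_power2[of "norm (u x)"] zero_le_power2[of "norm (v x)"]
   unfolding power2_diff by linarith
  finally show "norm (u x \<bullet> v x) <= norm ((norm (u x))^2 + (norm (v x))^2)" by simp
 qed
qed (use assms in \<open>auto simp: L2_def\<close>)

lemma L2_cauchy_schwarz:
 assumes "L2 M u" "L2 M v" shows "\<bar>\<integral>x. u x \<bullet> v x \<partial>M\<bar> <= nrm M u * nrm M v"
proof -
 define A B C where "A = sqn M u" and "B = (LINT x|M. u x \<bullet> v x)" and "C = sqn M v"
 have q: "0 <= A + 2 * t * B + t^2 * C" for t
 proof -
  have "0 <= (LINT x|M. (norm (u x + t *\<^sub>R v x))^2)" by simp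
  also have "\<dots> = (LINT x|M. u x \<bullet> u x + (2 * t) * (u x \<bullet> v x) + t^2 * (v x \<bullet> v x))"
   unfolding power2_norm_eq_inner
   by (simp add: inner_add_left inner_add_right inner_commute power2_eq_square algebra_simps)
  also have "\<dots> = A + 2 * t * B + t^2 * C"
   using L2_inner_integrable[OF assms(1,1)] L2_inner_integrable[OF assms(1,2)] L2_inner_integrable[OF assms(2,2)]
   by (simp add: A_def B_def C_def sqn_inner)
  finally show ?thesis .
 qed
 have "B^2 <= A * C"
 proof (cases "C = 0")
  case True
  have "B = 0"
  proof (rule ccontr)
   assume "B ~= 0"
   then show False using q[of "- (A + 1) / (2 * B)"] True by (simp add: field_simps)
  qed
  then show ?thesis using True by simp
 next
  case False
  then have "0 < C" by (simp add: C_def less_le)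
  then show ?thesis using q[of "- B / C"] by (simp add: field_simps power2_eq_square)
 qed
 then show ?thesis
  unfolding nrm_def A_def[symmetric] B_def[symmetric] C_def[symmetric] real_sqrt_mult[symmetric]
  by (rule real_le_rsqrt[of "\<bar>B\<bar>", simplified])
qed

lemma nrm_triangle: assumes "L2 M u" "L2 M v" shows "nrm M (\<lambda>x. u x + v x) <= nrm M u + nrm M v"
proof (rule power2_le_imp_le)
 have "(nrm M (\<lambda>x. u x + v x))^2 = sqn M u + 2 * (LINT x|M. u x \<bullet> v x) + sqn M v"
  using L2_inner_integrable[OF assms(1,1)] L2_inner_integrable[OF assms(1,2)] L2_inner_integrable[OF assms(2,2)]
  by (simp add: nrm_sq sqn_inner inner_add_left inner_add_right inner_commute[of "v _" "u _"])
 also have "\<dots> <= (nrm M u + nrm M v)^2"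
  using L2_cauchy_schwarz[OF assms] by (simp add: power2_sum nrm_sq)
 finally show "(nrm M (\<lambda>x. u x + v x))^2 <= (nrm M u + nrm M v)^2" .
qed simp

lemma nrm_scaleR: "nrm M (\<lambda>x. c *\<^sub>R u x) = \<bar>c\<bar> * nrm M u"
 by (simp add: nrm_def sqn_def power_mult_distrib real_sqrt_mult)

lemma nrm_diff_commute: "nrm M (\<lambda>x. u x - v x) = nrm M (\<lambda>x. v x - u x)"
 by (simp add: nrm_def sqn_def norm_minus_commute)

lemma nrm_triangle_diff: assumes "L2 M u" "L2 M v" "L2 M w"
 shows "nrm M (\<lambda>x. u x - w x) <= nrm M (\<lambda>x. u x - v x) + nrm M (\<lambda>x. v x - w x)"
 using nrm_triangle[OF L2_diff[OF assms(1,2)] L2_diff[OF assms(2,3)]] by simp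

lemma nrm_triangle_sub: assumes "L2 M u" "L2 M v"
 shows "nrm M u <= nrm M v + nrm M (\<lambda>x. u x - v x)"
 using nrm_triangle[OF assms(2) L2_diff[OF assms]] by simp

lemma nrm_mono_AE:
 fixes u :: "'a => 'b::euclidean_space" and v :: "'a => 'c::euclidean_space"
 assumes "L2 M v" "u \<in> borel_measurable M" "AE x in M. norm (u x) <= B * norm (v x)" "0 <= B"
 shows "L2 M u" "nrm M u <= B * nrm M v"
proof -
 have le: "AE x in M. (norm (u x))^2 <= B^2 * (norm (v x))^2"
  using assms(3) by eventually_elim (metis power_mult_distrib power_mono norm_ge_zero)
 show u: "L2 M u"
  by (rule L2_dominated[OF assms(2) _ le]) (use assms(1) in \<open>auto simp: L2_def\<close>)
 have "sqn M u <= B^2 * sqn M v"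
  unfolding sqn_def Bochner_Integration.integral_mult_right_zero[symmetric]
  by (rule integral_mono_AE) (use le u assms(1) in \<open>auto simp: L2_def\<close>)
 then have "nrm M u <= sqrt (B^2 * sqn M v)" by (simp add: nrm_def)
 then show "nrm M u <= B * nrm M v" using assms(4) by (simp add: nrm_def real_sqrt_mult)
qed

lemma integral_bilinear_bound:
 fixes u :: "'a => 'b::euclidean_space" and v :: "'a => 'c::euclidean_space"
 assumes "L2 M u" "L2 M v" "h \<in> borel_measurable M" "AE x in M. \<bar>h x\<bar> <= B * (norm (u x) * norm (v x))" "0 <= B"
 shows "integrable M h" "\<bar>\<integral>x. h x \<partial>M\<bar> <= B * (nrm M u * nrm M v)"
proof -
 have i: "integrable M (\<lambda>x. B * (norm (u x) * norm (v x)))"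
  using L2_inner_integrable[OF L2_norm[OF assms(1)] L2_norm[OF assms(2)]] by simp
 show h: "integrable M h"
  by (rule Bochner_Integration.integrable_bound[OF i]) (use assms in auto)
 have "\<bar>\<integral>x. h x \<partial>M\<bar> <= (LINT x|M. \<bar>h x\<bar>)" by (rule integral_abs_bound)
 also have "\<dots> <= (LINT x|M. B * (norm (u x) * norm (v x)))"
  by (rule integral_mono_AE) (use h i assms(4) in auto)
 also have "\<dots> = B * (LINT x|M. norm (u x) \<bullet> norm (v x))" by simp
 also have "\<dots> <= B * (nrm M (\<lambda>x. norm (u x)) * nrm M (\<lambda>x. norm (v x)))"
  using L2_cauchy_schwarz[OF L2_norm[OF assms(1)] L2_norm[OF assms(2)]] assms(5)
  by (intro mult_left_mono) auto
 also have "\<dots> = B * (nrm M u * nrm M v)" by (simp add: nrm_def sqn_def)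
 finally show "\<bar>\<integral>x. h x \<partial>M\<bar> <= B * (nrm M u * nrm M v)" .
qed

lemma L2_cong_AE: assumes "AE x in M. u x = v x" "u \<in> borel_measurable M" "v \<in> borel_measurable M"
 shows "L2 M u \<longleftrightarrow> L2 M v"
proof -
 have "integrable M (\<lambda>x. (norm (u x))^2) \<longleftrightarrow> integrable M (\<lambda>x. (norm (v x))^2)"
  by (rule integrable_cong_AE) (use assms in auto)
 then show ?thesis using assms by (simp add: L2_def)
qed

lemma nn_integral_L2: "L2 M u ==> (\<integral>\<^sup>+x. ennreal ((norm (u x))^2) \<partial>M) = ennreal (sqn M u)"
 unfolding sqn_def by (rule nn_integral_eq_integral) (auto simp: L2_def)

lemma convergent_of_weighted_steps:
 fixes w :: "nat => 'b::euclidean_space"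
 assumes "summable (\<lambda>k. 2 ^ k * (norm (w (Suc k) - w k))^2)" shows "convergent w"
proof -
 define S where "S = (\<Sum>k. 2 ^ k * (norm (w (Suc k) - w k))^2)"
 have S: "0 <= S" unfolding S_def by (rule suminf_nonneg[OF assms]) simp
 have "norm (w (Suc k) - w k) <= sqrt S * sqrt (1/2) ^ k" for k
 proof (rule power2_le_imp_le)
  have "2 ^ k * (norm (w (Suc k) - w k))^2 <= S"
   using sum_le_suminf[OF assms, of "{k}"] by (simp add: S_def)
  then have "(norm (w (Suc k) - w k))^2 <= S / 2 ^ k" by (simp add: pos_le_divide_eq mult.commute)
  also have "\<dots> = S * (1/2) ^ k" by (simp add: power_one_over)
  also have "\<dots> = (sqrt S * sqrt (1/2) ^ k)^2"
  proof -
   have "(sqrt (1/2) ^ k)^2 = ((sqrt (1/2))^2) ^ k" unfolding power_mult[symmetric] mult.commute[of k] ..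
   then show ?thesis using S by (simp add: power_mult_distrib)
  qed
  finally show "(norm (w (Suc k) - w k))^2 <= (sqrt S * sqrt (1/2) ^ k)^2" .
 qed (use S in simp)
 moreover have "summable (\<lambda>k. sqrt S * sqrt (1/2) ^ k)"
  by (intro summable_mult summable_geometric) (simp add: real_sqrt_lt_1_iff)
 ultimately have "summable (\<lambda>k. w (Suc k) - w k)"
  by (meson summable_comparison_test')
 then have "convergent (\<lambda>n. \<Sum>k<n. w (Suc k) - w k)" by (simp add: summable_iff_convergent)
 then have "convergent (\<lambda>n. w n - w 0)" by (simp add: sum_lessThan_telescope)
 then have "convergent (\<lambda>n. (w n - w 0) + w 0)" by (intro convergent_add convergent_const)
 then show ?thesis by simp
qed

text \<open>Completeness. The subsequence is chosen so that the increments stay summable even after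
 multiplication of their squares by \<open>2 ^ k\<close>; this forces geometric decay almost everywhere.\<close>

lemma L2_complete:
 fixes u :: "nat => 'a => 'b::euclidean_space"
 assumes L: "\<And>n. L2 M (u n)"
  and C: "\<And>e. 0 < e ==> \<exists>N. \<forall>m\<ge>N. \<forall>n\<ge>N. sqn M (\<lambda>x. u m x - u n x) < e"
 shows "\<exists>v. L2 M v \<and> (\<lambda>n. sqn M (\<lambda>x. u n x - v x)) \<longlonglongrightarrow> 0"
proof -
 have "\<exists>N. \<forall>m\<ge>N. \<forall>n\<ge>N. sqn M (\<lambda>x. u m x - u n x) < (1/4) ^ k" for k :: nat by (rule C) simp
 then obtain N where N: "\<And>k m n. N k <= m ==> N k <= n ==> sqn M (\<lambda>x. u m x - u n x) < (1/4) ^ (k::nat)" by metis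
 define r where "r k = (\<Sum>i\<le>k. N i)" for k :: nat
 have r: "N k <= r k" "r k <= r (Suc k)" for k
  by (auto simp: r_def intro: member_le_sum)
 have r': "N k <= r l" if "k <= l" for k l
  using that by (auto simp: r_def intro: member_le_sum)
 have mu [measurable]: "u n \<in> borel_measurable M" for n by (rule L2_measurable[OF L])
 define v where "v x = lim (\<lambda>k. u (r k) x)" for x
 have mv [measurable]: "v \<in> borel_measurable M" unfolding v_def by (rule borel_measurable_lim_metric) simp
 have "AE x in M. (\<lambda>k. u (r k) x) \<longlonglongrightarrow> v x"
 proof -
  have "(\<integral>\<^sup>+x. (\<Sum>k. ennreal (2 ^ k * (norm (u (r (Suc k)) x - u (r k) x))^2)) \<partial>M)
    = (\<Sum>k. \<integral>\<^sup>+x. ennreal (2 ^ k * (norm (u (r (Suc k)) x - u (r k) x))^2) \<partial>M)"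
   by (rule nn_integral_suminf) simp
  also have "\<dots> <= (\<Sum>k. ennreal ((1/2) ^ k))"
  proof (intro suminf_le summableI)
   fix k
   have "(\<integral>\<^sup>+x. ennreal (2 ^ k * (norm (u (r (Suc k)) x - u (r k) x))^2) \<partial>M)
     = ennreal (2 ^ k) * ennreal (sqn M (\<lambda>x. u (r (Suc k)) x - u (r k) x))"
    using nn_integral_L2[OF L2_diff[OF L L]] by (simp add: ennreal_mult nn_integral_cmult)
   also have "\<dots> = ennreal (2 ^ k * sqn M (\<lambda>x. u (r (Suc k)) x - u (r k) x))"
    by (simp add: ennreal_mult)
   also have "\<dots> <= ennreal (2 ^ k * (1/4) ^ k)"
    using N[of k "r (Suc k)" "r k"] r[of k] r'[of k "Suc k"] by (intro ennreal_leI mult_left_mono) auto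
   also have "2 ^ k * (1/4) ^ k = (1/2::real) ^ k" by (simp flip: power_mult_distrib)
   finally show "(\<integral>\<^sup>+x. ennreal (2 ^ k * (norm (u (r (Suc k)) x - u (r k) x))^2) \<partial>M) <= ennreal ((1/2) ^ k)" .
  qed
  also have "\<dots> = ennreal (\<Sum>k. (1/2) ^ k)" by (rule suminf_ennreal2) (auto intro: summable_geometric)
  also have "\<dots> < \<infinity>" by simp
  finally have "AE x in M. (\<Sum>k. ennreal (2 ^ k * (norm (u (r (Suc k)) x - u (r k) x))^2)) ~= \<infinity>"
   by (intro nn_integral_PInf_AE) auto
  then show ?thesis
  proof eventually_elim
   case (elim x)
   then have "summable (\<lambda>k. 2 ^ k * (norm (u (r (Suc k)) x - u (r k) x))^2)"
    by (intro summable_suminf_not_top) auto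
   then have "convergent (\<lambda>k. u (r k) x)" by (rule convergent_of_weighted_steps)
   then show ?case by (simp add: v_def convergent_LIMSEQ_iff)
  qed
 qed
 note lim = this
 have fatou: "(\<integral>\<^sup>+x. ennreal ((norm (u n x - v x))^2) \<partial>M) <= ennreal ((1/4) ^ k)" if "N k <= n" for n k
 proof -
  have "(\<integral>\<^sup>+x. ennreal ((norm (u n x - v x))^2) \<partial>M)
    = (\<integral>\<^sup>+x. liminf (\<lambda>l. ennreal ((norm (u n x - u (r l) x))^2)) \<partial>M)"
   using lim by (intro nn_integral_cong_AE, elim eventually_mono)
    (auto intro!: lim_imp_Liminf[symmetric] tendsto_intros)
  also have "\<dots> <= liminf (\<lambda>l. \<integral>\<^sup>+x. ennreal ((norm (u n x - u (r l) x))^2) \<partial>M)"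
   by (rule nn_integral_liminf) simp
  also have "\<dots> <= ennreal ((1/4) ^ k)"
  proof -
   have "\<forall>\<^sub>F l in sequentially. (\<integral>\<^sup>+x. ennreal ((norm (u n x - u (r l) x))^2) \<partial>M) <= ennreal ((1/4) ^ k)"
    unfolding eventually_sequentially
    by (intro exI[of _ k] allI impI)
     (use N[OF that r'] in \<open>auto simp: nn_integral_L2[OF L2_diff[OF L L]] intro!: ennreal_leI less_imp_le\<close>)
   then show ?thesis by (intro Liminf_le) auto
  qed
  finally show ?thesis .
 qed
 have Ld: "L2 M (\<lambda>x. u n x - v x)" if "N k <= n" for n k
 proof -
  have "integrable M (\<lambda>x. (norm (u n x - v x))^2)"
   by (rule integrableI_bounded) (use le_less_trans[OF fatou[OF that] ennreal_less_top] in auto)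
  then show ?thesis by (simp add: L2_def)
 qed
 have v: "L2 M v"
  using L2_diff[OF L[of "N 0"] Ld[of 0 "N 0"]] by simp
 have "(\<lambda>n. sqn M (\<lambda>x. u n x - v x)) \<longlonglongrightarrow> 0"
 proof (rule LIMSEQ_I)
  fix e :: real assume e: "0 < e"
  obtain k where k: "(1/4::real) ^ k < e" using real_arch_pow_inv[of e "1/4"] e by auto
  have "norm (sqn M (\<lambda>x. u n x - v x) - 0) < e" if "N k <= n" for n
  proof -
   have "sqn M (\<lambda>x. u n x - v x) <= (1/4) ^ k"
    using fatou[OF that] by (simp add: nn_integral_L2[OF Ld[OF that]])
   then show ?thesis using k by simp
  qed
  then show "\<exists>no. \<forall>n\<ge>no. norm (sqn M (\<lambda>x. u n x - v x) - 0) < e" by blast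
 qed
 with v show ?thesis by blast
qed

section \<open>Weak gradients on the square\<close>

lemma mem_box_plane: "x \<in> box a b \<longleftrightarrow> fst a < fst x \<and> fst x < fst b \<and> snd a < snd x \<and> snd x < snd (b::plane)"
 and mem_cbox_plane: "x \<in> cbox a b \<longleftrightarrow> fst a <= fst x \<and> fst x <= fst b \<and> snd a <= snd x \<and> snd x <= snd b"
 by (auto simp: mem_box Basis_prod_def inner_plane)

lemma square_box: "square L = box (-L, -L) (L, L)"
 by (auto simp: square_def mem_box_plane)

lemma square_open [simp]: "open (square L)" by (simp add: square_box open_box)
lemma square_sets [simp, measurable]: "square L \<in> sets borel" by (simp add: square_box)
lemma square_lebesgue [simp]: "square L \<in> sets lebesgue" "square L \<inter> space lebesgue \<in> sets lebesgue"
 by (auto simp: square_box)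

lemma mem_square: "x \<in> square L \<longleftrightarrow> \<bar>fst x\<bar> < L \<and> \<bar>snd x\<bar> < L"
 by (cases x) (auto simp: square_def)

abbreviation SM :: "real => plane measure" where "SM L \<equiv> lebesgue_on (square L)"

lemma finite_measure_SM: "finite_measure (SM L)"
 by (rule finite_measureI) (simp add: emeasure_restrict_space square_box emeasure_lborel_box_eq space_restrict_space)

lemma borel_measurable_SM: "f \<in> borel_measurable borel ==> f \<in> borel_measurable (SM L)"
 by (intro measurable_restrict_space1 measurable_completion) simp

lemma continuous_measurable_SM: "continuous_on UNIV f ==> f \<in> borel_measurable (SM L)"
 by (intro borel_measurable_SM borel_measurable_continuous_onI)

lemma integrable_SM_bounded:
 fixes f :: "plane => 'b::{banach, second_countable_topology}"
 assumes "f \<in> borel_measurable (SM L)" "\<And>x. x \<in> square L ==> norm (f x) <= B"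
 shows "integrable (SM L) f"
proof -
 interpret finite_measure "SM L" by (rule finite_measure_SM)
 show ?thesis by (rule integrable_const_bound[of _ B]) (use assms in auto)
qed

lemma continuous_bounded_square:
 assumes "continuous_on UNIV f" obtains B where "\<And>x. x \<in> square L ==> norm (f x) <= B"
proof -
 have "compact (f ` cbox (-L,-L) (L,L))"
  using assms by (intro compact_continuous_image compact_cbox) (auto intro: continuous_on_subset)
 then obtain B where B: "\<And>x. x \<in> cbox (-L,-L) (L,L) ==> norm (f x) <= B"
  using compact_imp_bounded[of "f ` cbox (-L,-L) (L,L)"] unfolding bounded_iff by blast
 then show ?thesis using that[of B] box_subset_cbox[of "(-L,-L)" "(L,L)"] by (auto simp: square_box)
qed

lemma L2_continuous_SM: assumes "continuous_on UNIV f" shows "L2 (SM L) f"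
proof -
 have "continuous_on UNIV (\<lambda>x. (norm (f x))^2)" using assms by (intro continuous_intros)
 from continuous_bounded_square[OF this, of L] obtain B where "\<And>x. x \<in> square L ==> norm ((norm (f x))^2) <= B" by blast
 then show ?thesis unfolding L2_def using assms
  by (intro conjI continuous_measurable_SM integrable_SM_bounded[where B=B] continuous_intros) auto
qed

lemma L2_integrable_SM: fixes u :: "plane => 'b::euclidean_space"
 assumes "L2 (SM L) u" shows "integrable (SM L) u"
proof -
 interpret finite_measure "SM L" by (rule finite_measure_SM)
 show ?thesis
 proof (rule Bochner_Integration.integrable_bound[of _ "\<lambda>x. 1 + (norm (u x))^2"])
  have "norm (u x) <= 1 + (norm (u x))^2" for x
   using self_le_power[of "norm (u x)" 2] zero_le_power2[of "norm (u x)"] by linarith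
  then show "AE x in SM L. norm (u x) <= norm (1 + (norm (u x))^2)" by (simp add: order_trans[OF _ abs_ge_self])
 qed (use assms in \<open>auto simp: L2_def\<close>)
qed

lemma integrable_mult_bounded:
 fixes G :: "'a => 'b::{banach, second_countable_topology}"
 assumes "integrable M G" "a \<in> borel_measurable M" "\<And>x. x \<in> space M ==> norm (a x) <= B"
 shows "integrable M (\<lambda>x. a x *\<^sub>R G x)"
proof (rule Bochner_Integration.integrable_bound[OF integrable_scaleR_right[OF assms(1), of B]])
 have "norm (a x *\<^sub>R G x) <= norm (B *\<^sub>R G x)" if "x \<in> space M" for x
  using mult_right_mono[OF order_trans[OF assms(3)[OF that] abs_ge_self], of "norm (G x)"] by simp
 then show "AE x in M. norm (a x *\<^sub>R G x) <= norm (B *\<^sub>R G x)" by (rule AE_I2)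
qed (use assms in simp)

lemma integrable_bounded_mult:
 fixes G :: "'a => 'b::{banach, second_countable_topology}"
 assumes "integrable M u" "G \<in> borel_measurable M" "\<And>x. x \<in> space M ==> norm (G x) <= B"
 shows "integrable M (\<lambda>x. u x *\<^sub>R G x)"
proof (rule Bochner_Integration.integrable_bound[OF integrable_mult_right[OF assms(1), of B]])
 have "norm (u x *\<^sub>R G x) <= norm (B * u x)" if "x \<in> space M" for x
  using mult_left_mono[OF order_trans[OF assms(3)[OF that] abs_ge_self], of "\<bar>u x\<bar>"] by (simp add: abs_mult mult.commute)
 then show "AE x in M. norm (u x *\<^sub>R G x) <= norm (B * u x)" by (rule AE_I2)
qed (use assms in simp)

lemma locally_integrable_of_L2: assumes "L2 (SM L) u" shows "locally_integrable (square L) u"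
 unfolding locally_integrable_def
proof (intro allI impI, elim conjE)
 fix K assume K: "compact K" "K \<subseteq> square L"
 then have "K \<in> sets lebesgue" by (simp add: lmeasurable_compact fmeasurableD)
 moreover have "set_integrable lebesgue (square L) u"
  using L2_integrable_SM[OF assms] by (simp add: set_integrable_def integrable_restrict_space)
 ultimately show "set_integrable lebesgue K u" using K(2) by (rule_tac set_integrable_subset)
qed

subsection \<open>Integration by parts\<close>

lemma lborel_integral_reflect:
 fixes h :: "plane => 'b::euclidean_space"
 assumes [measurable]: "h \<in> borel_measurable borel"
 shows "(LINT a|lborel. h a) = (LINT b|lborel. h (x - b))" "integrable lborel h ==> integrable lborel (\<lambda>b. h (x - b))"
proof -
 have e: "(lborel :: plane measure) = distr lborel borel (\<lambda>b. x - b)"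
  using lborel_affine[of "-1" x] by (simp add: density_1)
 then have "(LINT a|lborel. h a) = (LINT a|distr lborel borel (\<lambda>b. x - b). h a)" by simp
 also have "\<dots> = (LINT b|lborel. h (x - b))" by (rule integral_distr) auto
 finally show "(LINT a|lborel. h a) = (LINT b|lborel. h (x - b))" .
 show "integrable lborel (\<lambda>b. h (x - b))" if "integrable lborel h"
  using that integrable_distr_eq[of "\<lambda>b. x - b" lborel borel h] e by simp
qed

text \<open>The convolution of \<open>h\<close> with a constant does not depend on the point, so its derivative vanishes.\<close>

lemma integral_partial_zero:
 fixes h :: "plane => real"
 assumes h: "smooth h" and R: "\<And>x y. h (x, y) ~= 0 ==> \<bar>x\<bar> < R \<and> \<bar>y\<bar> < R"
 shows "integrable lborel (grad h)" "integral\<^sup>L lborel (grad h) = 0"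
proof -
 let ?C = "cbox (-R,-R) (R,R) :: plane set" and ?D = "cbox (-(\<bar>R\<bar>+1),-(\<bar>R\<bar>+1)) (\<bar>R\<bar>+1,\<bar>R\<bar>+1) :: plane set"
 have z: "grad h p = 0" if "p \<notin> ?C" for p
 proof -
  have "((\<lambda>_. 0) has_derivative (\<lambda>v. 0 \<bullet> v)) (at p)" by simp
  then have "(h has_derivative (\<lambda>v. 0 \<bullet> v)) (at p)"
  proof (rule has_derivative_transform_within_open)
   show "open (- ?C)" by (simp add: closed_cbox open_Compl)
   show "0 = h q" if "q \<in> - ?C" for q
    using that R[of "fst q" "snd q"] by (cases "h q = 0") (auto simp: mem_box_plane mem_cbox_plane)
  qed (use that in simp)
  then show ?thesis by (rule grad_eqI)
 qed
 have eq: "grad h = (\<lambda>x. indicator ?C x *\<^sub>R grad h x)" using z by (auto simp: indicator_def fun_eq_iff)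
 show i: "integrable lborel (grad h)"
  by (subst eq, rule borel_integrable_compact) (auto intro: continuous_grad h)
 define s where "s a = (if a \<in> ?D then a else 0)" for a
 obtain B where B: "\<And>a. a \<in> ?D ==> norm a <= B" using bounded_cbox unfolding bounded_iff by blast
 have ms: "s \<in> borel_measurable lborel" unfolding s_def[abs_def] by measurable
 have iw: "integrable lborel (indicator ?D :: plane => real)"
  by (rule integrable_real_indicator) (simp_all add: emeasure_lborel_cbox_finite[simplified])
 have sb: "norm (s a) <= \<bar>B\<bar>" for a using B[of a] by (auto simp: s_def)
 have inD: "a \<in> ?D" if x: "norm x < 1" "x - a \<in> ?C" for x a :: plane
 proof -
  have "\<bar>fst x\<bar> < 1" "\<bar>snd x\<bar> < 1" using x(1) norm_fst_le[of "fst x" "snd x"] norm_snd_le[of "snd x" "fst x"] by auto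
  then show ?thesis using x(2) by (auto simp: mem_cbox_plane)
 qed
 have hC: "x \<in> ?C" if "h x ~= 0" for x using R[of "fst x" "snd x"] that by (auto simp: mem_cbox_plane)
 have const: "(LINT a|lborel. h (x - s a) * indicator ?D a) = (LINT a|lborel. h a)" if x: "norm x < 1" for x
 proof -
  have "h (x - s a) * indicator ?D a = h (x - a)" for a using inD[OF x, of a] hC[of "x - a"] by (auto simp: s_def indicator_def)
  then show ?thesis
   using lborel_integral_reflect(1)[OF borel_measurable_continuous_onI[OF smooth_continuous[OF h]], of x] by simp
 qed
 have "integral\<^sup>L lborel (grad h) \<bullet> v = 0" for v
 proof -
  have d: "((\<lambda>x. \<integral>a. h (x - s a) * indicator ?D a \<partial>lborel) has_derivative (\<lambda>v. \<integral>a. (grad h (0 - s a) \<bullet> v) * indicator ?D a \<partial>lborel)) (at 0)"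
   by (rule convolution_has_derivative[OF ms iw sb h])
  have "((\<lambda>x. \<integral>a. h (x - s a) * indicator ?D a \<partial>lborel) has_derivative (\<lambda>v. 0)) (at 0)"
  proof (rule has_derivative_transform_within_open)
   show "((\<lambda>_. \<integral>a. h a \<partial>lborel) has_derivative (\<lambda>v. 0)) (at 0)" by (rule has_derivative_const)
   show "open (ball (0::plane) 1)" "(0::plane) \<in> ball 0 1" by simp_all
   show "(LINT a|lborel. h a) = (LINT a|lborel. h (x - s a) * indicator ?D a)" if "x \<in> ball 0 1" for x
    using const[of x] that by simp
  qed
  from fun_cong[OF has_derivative_unique[OF d this], of v]
  have "(LINT a|lborel. (grad h (0 - s a) \<bullet> v) * indicator ?D a) = 0" .
  moreover have "(grad h (0 - s a) \<bullet> v) * indicator ?D a = grad h (0 - a) \<bullet> v" for a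
  proof (cases "a \<in> ?D")
   case False
   then have "grad h (0 - a) = 0" using inD[of 0 a] by (intro z) auto
   then show ?thesis using False by simp
  qed (simp add: s_def)
  ultimately have "(LINT a|lborel. grad h (0 - a) \<bullet> v) = 0" by simp
  then have "(LINT a|lborel. grad h a \<bullet> v) = 0"
   using lborel_integral_reflect(1)[OF borel_measurable_continuous_onI[OF smooth_continuous[OF smooth_grad(3)[OF h]]], of v 0] by simp
  then show ?thesis using i by simp
 qed
 then show "integral\<^sup>L lborel (grad h) = 0" by (metis inner_eq_zero_iff)
qed

lemma test_function_smooth: "test_function S q ==> smooth q"
 by (simp add: test_function_def)

lemma test_function_zero: "test_function S q ==> x \<notin> S ==> q x = 0"
 unfolding test_function_def supp_def using closure_subset[of "{x. q x ~= 0}"] by blast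

lemma grad_zero_off_supp: "x \<notin> supp q ==> grad q x = 0"
proof -
 assume x: "x \<notin> supp q"
 have "((\<lambda>_. 0) has_derivative (\<lambda>v. 0 \<bullet> v)) (at x)" by simp
 then have "(q has_derivative (\<lambda>v. 0 \<bullet> v)) (at x)"
 proof (rule has_derivative_transform_within_open)
  show "open (- supp q)" by (simp add: supp_def open_Compl)
  show "0 = q y" if "y \<in> - supp q" for y
   using that closure_subset[of "{x. q x ~= 0}"] by (auto simp: supp_def)
 qed (use x in simp)
 then show ?thesis by (rule grad_eqI)
qed

lemma test_function_grad_zero: "test_function S q ==> x \<notin> S ==> grad q x = 0"
 using grad_zero_off_supp[of x q] by (auto simp: test_function_def)

lemma integration_by_parts:
 assumes p: "smooth p" and q: "test_function (square L) q"
 shows "(LINT x|SM L. p x *\<^sub>R grad q x) = - (LINT x|SM L. q x *\<^sub>R grad p x)"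
proof -
 have q': "smooth q" using q by (rule test_function_smooth)
 let ?h = "\<lambda>x. p x * q x"
 have h: "smooth ?h" using p q' by auto
 have g: "grad ?h x = p x *\<^sub>R grad q x + q x *\<^sub>R grad p x" for x by (rule grad_mult[OF p q'])
 have b: "?h (x, y) ~= 0 ==> \<bar>x\<bar> < L \<and> \<bar>y\<bar> < L" for x y
  using test_function_zero[OF q, of "(x,y)"] mem_square[of "(x,y)" L] by auto
 have "(LINT x|SM L. grad ?h x) = (LINT x|lebesgue. indicator (square L) x *\<^sub>R grad ?h x)"
  by (rule integral_restrict_space) simp
 also have "(\<lambda>x. indicator (square L) x *\<^sub>R grad ?h x) = grad ?h"
  using test_function_zero[OF q] test_function_grad_zero[OF q] by (auto simp: fun_eq_iff indicator_def g)
 also have "integral\<^sup>L lebesgue (grad ?h) = integral\<^sup>L lborel (grad ?h)"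
  by (rule integral_completion) (simp add: borel_measurable_continuous_onI continuous_grad h)
 also have "\<dots> = 0" by (rule integral_partial_zero(2)[OF h b])
 finally have "(LINT x|SM L. p x *\<^sub>R grad q x + q x *\<^sub>R grad p x) = 0" by (simp add: g)
 moreover have "integrable (SM L) (\<lambda>x. p x *\<^sub>R grad q x)" "integrable (SM L) (\<lambda>x. q x *\<^sub>R grad p x)"
  by (auto intro!: L2_integrable_SM L2_continuous_SM continuous_intros smooth_continuous continuous_grad p q')
 ultimately show ?thesis by (simp add: eq_neg_iff_add_eq_0)
qed

text \<open>Both sides of the identity that defines the weak gradient are continuous in the mean square norm.\<close>

lemma weak_gradient_limit:
 assumes u: "L2 (SM L) u" and G: "L2 (SM L) G" and p: "\<And>n. smooth (p n)"
  and l1: "(\<lambda>n. sqn (SM L) (\<lambda>x. p n x - u x)) \<longlonglongrightarrow> 0"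
  and l2: "(\<lambda>n. sqn (SM L) (\<lambda>x. grad (p n) x - G x)) \<longlonglongrightarrow> 0"
 shows "weak_gradient (square L) u G"
 unfolding weak_gradient_def
proof (intro conjI allI impI)
 show "locally_integrable (square L) u" "locally_integrable (square L) G"
  using u G by (auto intro: locally_integrable_of_L2)
 fix q assume q: "test_function (square L) q"
 have q': "smooth q" using q by (rule test_function_smooth)
 have Lp: "L2 (SM L) (p n)" "L2 (SM L) (grad (p n))" "L2 (SM L) q" "L2 (SM L) (grad q)" for n
  by (auto intro!: L2_continuous_SM smooth_continuous continuous_grad p q')
 have conv: "(\<lambda>n. \<integral>x. f n x \<bullet> g x \<partial>SM L) \<longlonglongrightarrow> (LINT x|SM L. f' x \<bullet> g x)"
  if f: "\<And>n. L2 (SM L) (f n)" and f': "L2 (SM L) f'" and g: "L2 (SM L) g"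
   and l: "(\<lambda>n. sqn (SM L) (\<lambda>x. f n x - f' x)) \<longlonglongrightarrow> 0"
  for f :: "nat => plane => 'b::euclidean_space" and f' g
 proof -
  have "(\<lambda>n. (LINT x|SM L. f n x \<bullet> g x) - (LINT x|SM L. f' x \<bullet> g x)) \<longlonglongrightarrow> 0"
  proof (rule Lim_null_comparison)
   have "(LINT x|SM L. f n x \<bullet> g x) - (LINT x|SM L. f' x \<bullet> g x) = (LINT x|SM L. (f n x - f' x) \<bullet> g x)" for n
    using L2_inner_integrable[OF f g] L2_inner_integrable[OF f' g] by (simp add: inner_diff_left)
   then show "\<forall>\<^sub>F n in sequentially. norm ((LINT x|SM L. f n x \<bullet> g x) - (LINT x|SM L. f' x \<bullet> g x))
     <= nrm (SM L) (\<lambda>x. f n x - f' x) * nrm (SM L) g"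
    using L2_cauchy_schwarz[OF L2_diff[OF f f'] g] by (auto intro!: always_eventually)
   have "(\<lambda>n. nrm (SM L) (\<lambda>x. f n x - f' x)) \<longlonglongrightarrow> sqrt 0"
    unfolding nrm_def by (intro tendsto_intros l)
   then show "(\<lambda>n. nrm (SM L) (\<lambda>x. f n x - f' x) * nrm (SM L) g) \<longlonglongrightarrow> 0"
    by (auto intro!: tendsto_eq_intros)
  qed
  then show ?thesis by (simp add: LIM_zero_iff)
 qed
 have "(LINT x|SM L. u x * (grad q x \<bullet> v)) = - (LINT x|SM L. (G x \<bullet> v) * q x)" for v
 proof (rule LIMSEQ_unique)
  have Lv: "L2 (SM L) (\<lambda>x. grad q x \<bullet> v)" "L2 (SM L) (\<lambda>x. q x *\<^sub>R v)"
   by (intro L2_continuous_SM continuous_intros continuous_grad smooth_continuous q')+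
  show "(\<lambda>n. \<integral>x. p n x * (grad q x \<bullet> v) \<partial>SM L) \<longlonglongrightarrow> (LINT x|SM L. u x * (grad q x \<bullet> v))"
   using conv[OF Lp(1) u Lv(1) l1] by simp
  have "(\<lambda>n. - (LINT x|SM L. grad (p n) x \<bullet> (q x *\<^sub>R v))) \<longlonglongrightarrow> - (LINT x|SM L. G x \<bullet> (q x *\<^sub>R v))"
   by (intro tendsto_minus conv Lp G Lv l2)
  moreover have "- (LINT x|SM L. grad (p n) x \<bullet> (q x *\<^sub>R v)) = (LINT x|SM L. p n x * (grad q x \<bullet> v))" for n
  proof -
   have i: "integrable (SM L) (\<lambda>x. p n x *\<^sub>R grad q x)" "integrable (SM L) (\<lambda>x. q x *\<^sub>R grad (p n) x)"
    by (auto intro!: L2_integrable_SM L2_continuous_SM continuous_intros smooth_continuous continuous_grad p q')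
   show ?thesis
    using arg_cong[OF integration_by_parts[OF p[of n] q], of "\<lambda>w. w \<bullet> v"] integral_inner_left[OF i(1), of v] integral_inner_left[OF i(2), of v]
    by (simp add: mult.commute)
  qed
  ultimately show "(\<lambda>n. \<integral>x. p n x * (grad q x \<bullet> v) \<partial>SM L) \<longlonglongrightarrow> - (LINT x|SM L. (G x \<bullet> v) * q x)"
   by (simp add: mult.commute)
 qed
 moreover have "integrable (SM L) (\<lambda>x. u x *\<^sub>R grad q x)"
 proof -
  obtain B where "\<And>x. x \<in> square L ==> norm (grad q x) <= B"
   using continuous_bounded_square[OF continuous_grad[OF q']] by blast
  then show ?thesis
   by (intro integrable_bounded_mult[where B=B] L2_integrable_SM u continuous_measurable_SM continuous_grad q') auto
 qed
 moreover have "integrable (SM L) (\<lambda>x. q x *\<^sub>R G x)"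
 proof -
  obtain B where "\<And>x. x \<in> square L ==> norm (q x) <= B"
   using continuous_bounded_square[OF smooth_continuous[OF q']] by blast
  then show ?thesis
   by (intro integrable_mult_bounded[where B=B] L2_integrable_SM G continuous_measurable_SM smooth_continuous q') auto
 qed
 ultimately have "(LINT x|SM L. u x *\<^sub>R grad q x) \<bullet> v = (- (LINT x|SM L. q x *\<^sub>R G x)) \<bullet> v" for v
  using integral_inner_left[of v "SM L" "\<lambda>x. u x *\<^sub>R grad q x"] integral_inner_left[of v "SM L" "\<lambda>x. q x *\<^sub>R G x"]
  by (simp add: mult.commute)
 then show "(LINT x|SM L. u x *\<^sub>R grad q x) = - (LINT x|SM L. q x *\<^sub>R G x)"
  using euclidean_eqI by blast
qed

subsection \<open>Uniqueness of weak gradients\<close>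

lemma AE_zero_of_box_integrals:
 fixes f :: "'a::euclidean_space => real"
 assumes f: "integrable lborel f" and z: "\<And>a b. (\<integral>x\<in>box a b. f x \<partial>lborel) = 0"
 shows "AE x in lborel. f x = 0"
proof -
 have si: "set_integrable lborel A f" if "A \<in> sets borel" for A
  using integrable_mult_indicator[OF _ f, of A] that by (simp add: set_integrable_def)
 have univ: "(LINT x|lborel. f x) = 0"
 proof (rule LIMSEQ_unique)
  have "(\<lambda>n. \<integral>x. indicator (box (- real n *\<^sub>R One) (real n *\<^sub>R One)) x *\<^sub>R f x \<partial>lborel) \<longlonglongrightarrow> (LINT x|lborel. f x)"
  proof (rule integral_dominated_convergence)
   show "AE x in lborel. (\<lambda>n. indicator (box (- real n *\<^sub>R One) (real n *\<^sub>R One)) x *\<^sub>R f x) \<longlonglongrightarrow> f x"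
   proof (rule AE_I2)
    fix x :: 'a
    obtain N where N: "x \<in> box (- real N *\<^sub>R One) (real N *\<^sub>R One)"
     using UN_box_eq_UNIV[where 'a='a] by (auto simp: set_eq_iff)
    have "x \<in> box (- real n *\<^sub>R One) (real n *\<^sub>R One)" if "N <= n" for n
     using N that by (fastforce simp: mem_box)
    then show "(\<lambda>n. indicator (box (- real n *\<^sub>R One) (real n *\<^sub>R One)) x *\<^sub>R f x) \<longlonglongrightarrow> f x"
     by (intro tendsto_eventually eventually_sequentiallyI[of N]) simp
   qed
  next
   show "AE x in lborel. norm (indicator (box (- real n *\<^sub>R One) (real n *\<^sub>R One)) x *\<^sub>R f x) <= norm (f x)" for n
    by (rule AE_I2) (simp add: indicator_def)
  qed (use f in auto)
  then show "(\<lambda>n::nat. 0) \<longlonglongrightarrow> (LINT x|lborel. f x)" using z by (simp add: set_lebesgue_integral_def)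
 qed simp
 have "(\<integral>x\<in>A. f x \<partial>lborel) = 0" if "A \<in> sets borel" for A
 proof -
  have "A \<in> sigma_sets UNIV (range (\<lambda>(a, b). box a b :: 'a set))"
   using that by (subst (asm) borel_eq_box) simp
  moreover have "Int_stable (range (\<lambda>(a, b). box a b :: 'a set))"
   by (fastforce simp: Int_stable_def box_Int_box)
  moreover have "range (\<lambda>(a, b). box a b :: 'a set) \<subseteq> Pow UNIV" by simp
  ultimately have "Int_stable (range (\<lambda>(a, b). box a b :: 'a set))" "range (\<lambda>(a, b). box a b :: 'a set) \<subseteq> Pow UNIV"
   "A \<in> sigma_sets UNIV (range (\<lambda>(a, b). box a b :: 'a set))" by blast+
  then show ?thesis
  proof (induction rule: sigma_sets_induct_disjoint)
   case (basic A) then show ?case using z by auto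
  next
   case (compl A)
   then have A: "A \<in> sets borel" by (subst borel_eq_box) simp
   have "(LINT x|lborel. f x) = (\<integral>x\<in>A \<union> - A. f x \<partial>lborel)" by (simp add: set_lebesgue_integral_def)
   also have "\<dots> = (\<integral>x\<in>A. f x \<partial>lborel) + (\<integral>x\<in>- A. f x \<partial>lborel)"
    by (rule set_integral_Un) (use A in \<open>auto intro!: si\<close>)
   finally show ?case using univ compl by (simp add: Compl_eq_Diff_UNIV)
  next
   case (union A)
   then have A: "A i \<in> sets borel" for i by (subst borel_eq_box) auto
   then have "(\<integral>x\<in>(\<Union>i. A i). f x \<partial>lborel) = (\<Sum>i. \<integral>x\<in>A i. f x \<partial>lborel)"
    using union(1) by (intro lebesgue_integral_countable_add si) (auto simp: disjoint_family_on_def)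
   then show ?case using union by simp
  qed (simp add: set_lebesgue_integral_def)
 qed
 then show ?thesis
  using sigma_finite_measure.density_zero[OF sigma_finite_lborel, of f] f by (simp add: set_lebesgue_integral_def)
qed

text \<open>Products of smooth steps of growing slope converge to the indicator of the box.\<close>

lemma test_box_integral:
 assumes H: "locally_integrable (square L) G" and z: "\<And>q. test_function (square L) q ==> (LINT x|SM L. q x * G x) = 0"
  and sub: "box a b \<subseteq> Q" "closure Q \<subseteq> square L"
 shows "(LINT x|lebesgue. indicator (box a b) x * G x) = 0"
proof (rule LIMSEQ_unique)
 have cQ: "compact (closure Q)"
  using sub(2) bounded_subset[OF bounded_box[of "(-L,-L)" "(L,L)"]] closure_subset[of Q]
  by (auto simp: compact_closure square_box[symmetric])
 define q where "q n x = step (real n * (fst x - fst a)) * step (real n * (fst b - fst x)) *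
   (step (real n * (snd x - snd a)) * step (real n * (snd b - snd x)))" for n :: nat and x :: plane
 have q0: "q n x = 0" if "x \<notin> box a b" for n x
  using that by (cases a; cases b; cases x)
   (auto simp: q_def mem_box_plane not_less step_0 mult_nonneg_nonpos)
 have supp: "supp (q n) \<subseteq> closure Q" for n
  unfolding supp_def using q0 sub(1) by (intro closure_mono) auto
 have sm: "smooth (q n)" for n
  unfolding q_def by (intro smooth_mult smooth_step smooth_diff smooth_const smooth_fst smooth_snd)
 have qr: "0 <= q n x" "q n x <= 1" for n x
  unfolding q_def by (intro mult_nonneg_nonneg mult_le_one step_range)+
 have t: "test_function (square L) (q n)" for n
  unfolding test_function_def using sm supp[of n] sub(2) compact_Int_closed[OF cQ, of "supp (q n)"]
  by (auto simp: supp_def Int_absorb1)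
 have lim: "(\<lambda>n. q n x) \<longlonglongrightarrow> indicator (box a b) x" for x
 proof (cases "x \<in> box a b")
  case True
  have st: "(\<lambda>n. step (real n * c)) \<longlonglongrightarrow> 1" if "0 < c" for c :: real
  proof -
   obtain N :: nat where N: "1 / c < real N" using reals_Archimedean2 by blast
   have "step (real n * c) = 1" if "N <= n" for n
   proof -
    have "1 / c < real n" using N that by linarith
    then show ?thesis using \<open>0 < c\<close> by (intro step_1) (simp add: field_simps)
   qed
   then show ?thesis by (intro tendsto_eventually eventually_sequentiallyI[of N]) simp
  qed
  have "(\<lambda>n. q n x) \<longlonglongrightarrow> 1 * 1 * (1 * 1)"
   unfolding q_def using True by (intro tendsto_mult st) (auto simp: mem_box_plane mem_cbox_plane)
  then show ?thesis using True by simp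
 qed (simp add: q0)
 have si: "set_integrable lebesgue (closure Q) G"
  using H cQ sub(2) by (auto simp: locally_integrable_def)
 have clQ: "closure Q \<in> sets lebesgue" by simp
 have bQ: "box a b \<subseteq> closure Q" using sub(1) closure_subset by blast
 have "(\<lambda>n. \<integral>x. q n x * (indicator (closure Q) x * G x) \<partial>lebesgue) \<longlonglongrightarrow> (LINT x|lebesgue. indicator (box a b) x * (indicator (closure Q) x * G x))"
 proof (rule integral_dominated_convergence)
  have i: "integrable lebesgue (\<lambda>x. indicator (closure Q) x * G x)"
   using si by (simp add: set_integrable_def)
  then show "integrable lebesgue (\<lambda>x. norm (indicator (closure Q) x * G x))" by (rule integrable_norm)
  from i have m: "(\<lambda>x. indicator (closure Q) x * G x) \<in> borel_measurable lebesgue" by (rule borel_measurable_integrable)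
  show "(\<lambda>x. indicator (box a b) x * (indicator (closure Q) x * G x)) \<in> borel_measurable lebesgue"
   by (intro borel_measurable_times borel_measurable_indicator m) auto
  show "(\<lambda>x. q n x * (indicator (closure Q) x * G x)) \<in> borel_measurable lebesgue" for n
   using borel_measurable_continuous_onI[OF smooth_continuous[OF sm[of n]]]
   by (intro borel_measurable_times m measurable_completion) auto
  show "AE x in lebesgue. (\<lambda>n. q n x * (indicator (closure Q) x * G x)) \<longlonglongrightarrow> indicator (box a b) x * (indicator (closure Q) x * G x)"
   by (intro AE_I2 tendsto_intros lim)
  show "AE x in lebesgue. norm (q n x * (indicator (closure Q) x * G x)) <= norm (indicator (closure Q) x * G x)" for n
   using qr[of n] by (intro AE_I2) (simp add: abs_mult mult_left_le_one_le)
 qed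
 moreover have "(LINT x|lebesgue. q n x * (indicator (closure Q) x * G x)) = 0" for n
 proof -
  have "(LINT x|lebesgue. q n x * (indicator (closure Q) x * G x)) = (LINT x|lebesgue. indicator (square L) x *\<^sub>R (q n x * G x))"
  proof (intro Bochner_Integration.integral_cong refl)
   fix x
   show "q n x * (indicator (closure Q) x * G x) = indicator (square L) x *\<^sub>R (q n x * G x)"
    using sub(2) bQ q0[of x n] by (cases "x \<in> box a b") (auto simp: indicator_def)
  qed
  also have "\<dots> = (LINT x|SM L. q n x * G x)" by (subst integral_restrict_space) auto
  finally show ?thesis using z[OF t] by simp
 qed
 moreover have "(\<lambda>x. indicator (box a b) x * (indicator (closure Q) x * G x)) = (\<lambda>x. indicator (box a b) x * G x)"
  using bQ by (auto simp: fun_eq_iff indicator_def)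
 ultimately show "(\<lambda>n::nat. 0::real) \<longlonglongrightarrow> (LINT x|lebesgue. indicator (box a b) x * G x)"
  by (simp only:)
qed simp

text \<open>Fundamental lemma of the calculus of variations on the square.\<close>

lemma zero_of_test_integrals:
 assumes H: "locally_integrable (square L) G"
  and z: "\<And>q. test_function (square L) q ==> (LINT x|SM L. q x * G x) = 0"
 shows "AE x in SM L. G x = 0"
proof -
 define Q where "Q n = square (L - 1 / real (Suc n))" for n
 have clQ: "closure (Q n) \<subseteq> square L" for n
 proof -
  have "closure (Q n) \<subseteq> cbox (- (L - 1 / real (Suc n)), - (L - 1 / real (Suc n))) (L - 1 / real (Suc n), L - 1 / real (Suc n))"
   unfolding Q_def square_box by (rule closure_minimal[OF box_subset_cbox closed_cbox])
  also have "\<dots> \<subseteq> square L"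
  proof
   fix x :: plane
   assume "x \<in> cbox (- (L - 1 / real (Suc n)), - (L - 1 / real (Suc n))) (L - 1 / real (Suc n), L - 1 / real (Suc n))"
   moreover have "0 < 1 / real (Suc n)" by simp
   ultimately show "x \<in> square L" unfolding mem_square mem_cbox_plane fst_conv snd_conv by linarith
  qed
  finally show ?thesis .
 qed
 have "AE x in lebesgue. x \<in> Q n --> G x = 0" for n
 proof -
  have "compact (closure (Q n))" by (simp add: Q_def square_box compact_closure bounded_box)
  then have si: "set_integrable lebesgue (closure (Q n)) G"
   using H clQ by (auto simp: locally_integrable_def)
  have "set_integrable lebesgue (Q n) G"
   by (rule set_integrable_subset[OF si]) (auto simp: Q_def closure_subset)
  then have i: "integrable lebesgue (\<lambda>x. indicator (Q n) x * G x)" by (simp add: set_integrable_def)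
  then obtain f where f: "f \<in> borel_measurable lborel" "AE x in lborel. indicator (Q n) x * G x = f x"
   using completion_ex_borel_measurable_real[of "\<lambda>x. indicator (Q n) x * G x" lborel] by (auto dest: borel_measurable_integrable)
  have ae: "AE x in lebesgue. indicator (Q n) x * G x = f x" using f(2) by (rule AE_completion)
  have fl: "f \<in> borel_measurable lebesgue" using f(1) by (rule measurable_completion)
  have fi: "integrable lborel f"
   using i integrable_cong_AE[OF borel_measurable_integrable[OF i] fl ae] integrable_completion[OF f(1)] by simp
  have "(\<integral>x\<in>box a b. f x \<partial>lborel) = 0" for a b
  proof -
   define a' b' where "a' = (max (fst a) (-(L - 1 / real (Suc n))), max (snd a) (-(L - 1 / real (Suc n))))"
    and "b' = (min (fst b) (L - 1 / real (Suc n)), min (snd b) (L - 1 / real (Suc n)))"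
   have eq: "box a b \<inter> Q n = box a' b'"
    by (cases a; cases b) (auto simp: Q_def square_box a'_def b'_def mem_box_plane mem_cbox_plane)
   have "(\<integral>x\<in>box a b. f x \<partial>lborel) = (LINT x|lebesgue. indicator (box a b) x * f x)"
    using f(1) by (subst integral_completion) (auto simp: set_lebesgue_integral_def)
   also have "\<dots> = (LINT x|lebesgue. indicator (box a' b') x * G x)"
   proof (rule integral_cong_AE)
    show "(\<lambda>x. indicator (box a b) x * f x) \<in> borel_measurable lebesgue"
     by (intro borel_measurable_times borel_measurable_indicator fl) auto
    show "AE x in lebesgue. indicator (box a b) x * f x = indicator (box a' b') x * G x"
     using ae by eventually_elim (auto simp: eq[symmetric] indicator_inter_arith)
    have "(\<lambda>x. indicator (box a b) x * (indicator (Q n) x * G x)) \<in> borel_measurable lebesgue"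
     by (intro borel_measurable_times[OF _ borel_measurable_integrable[OF i]] borel_measurable_indicator) auto
    then show "(\<lambda>x. indicator (box a' b') x * G x) \<in> borel_measurable lebesgue"
     by (simp add: eq[symmetric] indicator_inter_arith mult.assoc)
   qed
   also have "\<dots> = 0"
    by (rule test_box_integral[OF H z _ clQ[of n]]) (use eq in auto)
   finally show ?thesis .
  qed
  from AE_zero_of_box_integrals[OF fi this] have "AE x in lebesgue. f x = 0" by (rule AE_completion)
  with ae show ?thesis by eventually_elim auto
 qed
 then have "AE x in lebesgue. \<forall>n. x \<in> Q n --> G x = 0" unfolding AE_all_countable by blast
 moreover have "\<exists>n. x \<in> Q n" if "x \<in> square L" for x
 proof -
  define e where "e = L - max \<bar>fst x\<bar> \<bar>snd x\<bar>"
  have "0 < e" using that by (auto simp: e_def mem_square)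
  then obtain n where "inverse (real (Suc n)) < e" using reals_Archimedean by blast
  then show ?thesis by (intro exI[of _ n]) (auto simp: Q_def mem_square e_def inverse_eq_divide simp del: of_nat_Suc)
 qed
 ultimately have "AE x in lebesgue. x \<in> square L --> G x = 0" by (auto elim: eventually_mono)
 then show ?thesis by (simp add: AE_restrict_space_iff)
qed

lemma weak_gradient_unique:
 assumes "weak_gradient (square L) u G" "weak_gradient (square L) u G'"
 shows "AE x in SM L. G x = G' x"
proof -
 have li: "locally_integrable (square L) G" "locally_integrable (square L) G'"
  using assms by (auto simp: weak_gradient_def)
 have lid: "locally_integrable (square L) (\<lambda>x. (G x - G' x) \<bullet> v)" for v
  unfolding locally_integrable_def
 proof (intro allI impI)
  fix K assume K: "compact K \<and> K \<subseteq> square L"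
  then have "set_integrable lebesgue K G" "set_integrable lebesgue K G'" using li by (auto simp: locally_integrable_def)
  then have "integrable lebesgue (\<lambda>x. (indicator K x *\<^sub>R G x - indicator K x *\<^sub>R G' x) \<bullet> v)"
   unfolding set_integrable_def by (intro integrable_inner_left Bochner_Integration.integrable_diff) auto
  then show "set_integrable lebesgue K (\<lambda>x. (G x - G' x) \<bullet> v)"
   by (simp add: set_integrable_def inner_diff_left algebra_simps)
 qed
 have int: "integrable (SM L) (\<lambda>x. q x *\<^sub>R H x)" if q: "test_function (square L) q" and H: "locally_integrable (square L) H" for q and H :: "plane => plane"
 proof -
  have "integrable lebesgue (\<lambda>x. indicator (supp q) x *\<^sub>R H x)"
   using q H by (auto simp: test_function_def locally_integrable_def set_integrable_def)
  then have i: "integrable (SM L) (\<lambda>x. indicator (supp q) x *\<^sub>R H x)"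
   using integrable_mult_indicator[OF square_lebesgue(1)] by (simp only: integrable_restrict_space[OF square_lebesgue(2)])
  obtain B where B: "\<And>x. x \<in> square L ==> norm (q x) <= B"
   using continuous_bounded_square[OF smooth_continuous[OF test_function_smooth[OF q]]] by blast
  have "integrable (SM L) (\<lambda>x. q x *\<^sub>R (indicator (supp q) x *\<^sub>R H x))"
   by (rule integrable_mult_bounded[OF i continuous_measurable_SM, of _ B]) (use B smooth_continuous[OF test_function_smooth[OF q]] in auto)
  moreover have "(\<lambda>x. q x *\<^sub>R (indicator (supp q) x *\<^sub>R H x)) = (\<lambda>x. q x *\<^sub>R H x)"
   using closure_subset[of "{x. q x ~= 0}"] by (auto simp: indicator_def supp_def fun_eq_iff)
  ultimately show ?thesis by (simp only:)
 qed
 have "AE x in SM L. (G x - G' x) \<bullet> v = 0" for v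
 proof (rule zero_of_test_integrals[OF lid])
  fix q assume q: "test_function (square L) q"
  have "(LINT x|SM L. q x *\<^sub>R G x) = (LINT x|SM L. q x *\<^sub>R G' x)"
  proof -
   have "(LINT x|SM L. u x *\<^sub>R grad q x) = - (LINT x|SM L. q x *\<^sub>R G x)"
    "(LINT x|SM L. u x *\<^sub>R grad q x) = - (LINT x|SM L. q x *\<^sub>R G' x)"
    using assms q by (auto simp: weak_gradient_def)
   then show ?thesis by simp
  qed
  then have "(LINT x|SM L. q x *\<^sub>R G x) \<bullet> v - (LINT x|SM L. q x *\<^sub>R G' x) \<bullet> v = 0" by simp
  then show "(LINT x|SM L. q x * ((G x - G' x) \<bullet> v)) = 0"
   using integral_inner_left[OF int[OF q li(1)], of v] integral_inner_left[OF int[OF q li(2)], of v]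
    integrable_inner_left[OF int[OF q li(1)], of v] integrable_inner_left[OF int[OF q li(2)], of v]
   by (simp add: inner_diff_left right_diff_distrib)
 qed
 from this[of "(1,0)"] this[of "(0,1)"] show ?thesis
  by eventually_elim (simp add: inner_plane prod_eq_iff)
qed

section \<open>The boundary of the square\<close>

lemma frontier_square: "0 < L ==> frontier (square L) = cbox (-L,-L) (L,L) - square L"
 unfolding square_box frontier_box by (auto simp: box_eq_empty Basis_prod_def)

lemma mem_frontier_square:
 "0 < L ==> p \<in> frontier (square L) \<longleftrightarrow> \<bar>fst p\<bar> <= L \<and> \<bar>snd p\<bar> <= L \<and> (\<bar>fst p\<bar> = L \<or> \<bar>snd p\<bar> = L)"
 unfolding frontier_square by (auto simp: mem_cbox_plane mem_square)

lemma square_param_frontier: "0 < L ==> s \<in> {0..<8*L} ==> square_param L s \<in> frontier (square L)"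
 by (auto simp: mem_frontier_square square_param_def)

lemma square_param_borel [measurable]: "square_param L \<in> borel_measurable borel"
 unfolding square_param_def by measurable

lemma square_param_measurable:
 "0 < L ==> square_param L \<in> lebesgue_on {0..<8*L} \<rightarrow>\<^sub>M restrict_space borel (frontier (square L))"
 by (rule measurable_restrict_space2)
  (auto simp: space_restrict_space square_param_frontier intro!: measurable_restrict_space1 measurable_completion)

lemma space_bdry: "space (bdry L) = frontier (square L)"
 by (simp add: bdry_def space_restrict_space)

lemma finite_measure_bdry: assumes "0 < L" shows "finite_measure (bdry L)"
proof -
 interpret finite_measure "lebesgue_on {0..<8*L}"
  using assms by (intro finite_measureI) (simp add: emeasure_restrict_space space_restrict_space)
 show ?thesis unfolding bdry_def by (rule finite_measure_distr) (rule square_param_measurable[OF assms])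
qed

lemma borel_measurable_bdry: "f \<in> borel_measurable borel ==> f \<in> borel_measurable (bdry L)"
 unfolding bdry_def by (simp add: measurable_restrict_space1)

lemma L2_continuous_bdry: fixes f :: "plane => 'b::euclidean_space"
 assumes "0 < L" "continuous_on UNIV f" shows "L2 (bdry L) f"
proof -
 interpret finite_measure "bdry L" by (rule finite_measure_bdry[OF assms(1)])
 have "compact (f ` cbox (-L,-L) (L,L))"
  using assms by (intro compact_continuous_image compact_cbox) (auto intro: continuous_on_subset)
 then obtain B where B: "\<And>x. x \<in> cbox (-L,-L) (L,L) ==> norm (f x) <= B"
  using compact_imp_bounded[of "f ` cbox (-L,-L) (L,L)"] unfolding bounded_iff by blast
 have m: "f \<in> borel_measurable (bdry L)" by (intro borel_measurable_bdry borel_measurable_continuous_onI assms)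
 have "integrable (bdry L) (\<lambda>x. (norm (f x))^2)"
 proof (rule integrable_const_bound[of _ "B^2"])
  show "AE x in bdry L. norm ((norm (f x))^2) <= B^2"
   using B by (intro AE_I2) (auto simp: space_bdry frontier_square[OF assms(1)] intro!: power_mono)
 qed (use m in auto)
 then show ?thesis using m by (simp add: L2_def)
qed

lemma nn_integral_bdry:
 assumes "0 < L" "h \<in> borel_measurable (bdry L)"
 shows "(\<integral>\<^sup>+x. h x \<partial>bdry L) = (\<integral>\<^sup>+s. h (square_param L s) * indicator {0..<8*L} s \<partial>lborel)"
 unfolding bdry_def using assms(2)[unfolded bdry_def]
 by (subst nn_integral_distr[OF square_param_measurable[OF assms(1)]])
  (auto simp: nn_integral_restrict_space nn_integral_completion)

lemma nn_integral_sides: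
 fixes h :: "plane => ennreal"
 assumes L: "0 < L" and h [measurable]: "h \<in> borel_measurable borel"
 shows "(\<integral>\<^sup>+x. h (x, -L) * indicator {-L<..<L} x \<partial>lborel) <= (\<integral>\<^sup>+p. h p \<partial>bdry L)"
  "(\<integral>\<^sup>+x. h (x, L) * indicator {-L<..<L} x \<partial>lborel) <= (\<integral>\<^sup>+p. h p \<partial>bdry L)"
  "(\<integral>\<^sup>+y. h (-L, y) * indicator {-L<..<L} y \<partial>lborel) <= (\<integral>\<^sup>+p. h p \<partial>bdry L)"
  "(\<integral>\<^sup>+y. h (L, y) * indicator {-L<..<L} y \<partial>lborel) <= (\<integral>\<^sup>+p. h p \<partial>bdry L)"
proof -
 have b: "(\<integral>\<^sup>+p. h p \<partial>bdry L) = (\<integral>\<^sup>+s. h (square_param L s) * indicator {0..<8*L} s \<partial>lborel)"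
  by (rule nn_integral_bdry[OF L borel_measurable_bdry[OF h]])
 have "(\<integral>\<^sup>+x. h (x, -L) * indicator {-L<..<L} x \<partial>lborel)
   = (\<integral>\<^sup>+s. h (-L + 1 * s, -L) * indicator {-L<..<L} (-L + 1 * s) \<partial>lborel)"
  by (subst nn_integral_real_affine[where c=1 and t="-L"]) auto
 also have "\<dots> <= (\<integral>\<^sup>+p. h p \<partial>bdry L)" unfolding b
  by (intro nn_integral_mono) (auto simp: indicator_def square_param_def)
 finally show "(\<integral>\<^sup>+x. h (x, -L) * indicator {-L<..<L} x \<partial>lborel) <= (\<integral>\<^sup>+p. h p \<partial>bdry L)" .
 have "(\<integral>\<^sup>+x. h (x, L) * indicator {-L<..<L} x \<partial>lborel)
   = (\<integral>\<^sup>+s. h (5*L + (-1) * s, L) * indicator {-L<..<L} (5*L + (-1) * s) \<partial>lborel)"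
  by (subst nn_integral_real_affine[where c="-1" and t="5*L"]) auto
 also have "\<dots> <= (\<integral>\<^sup>+p. h p \<partial>bdry L)" unfolding b
  by (intro nn_integral_mono) (auto simp: indicator_def square_param_def)
 finally show "(\<integral>\<^sup>+x. h (x, L) * indicator {-L<..<L} x \<partial>lborel) <= (\<integral>\<^sup>+p. h p \<partial>bdry L)" .
 have "(\<integral>\<^sup>+y. h (-L, y) * indicator {-L<..<L} y \<partial>lborel)
   = (\<integral>\<^sup>+s. h (-L, 7*L + (-1) * s) * indicator {-L<..<L} (7*L + (-1) * s) \<partial>lborel)"
  by (subst nn_integral_real_affine[where c="-1" and t="7*L"]) auto
 also have "\<dots> <= (\<integral>\<^sup>+p. h p \<partial>bdry L)" unfolding b
  by (intro nn_integral_mono) (auto simp: indicator_def square_param_def)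
 finally show "(\<integral>\<^sup>+y. h (-L, y) * indicator {-L<..<L} y \<partial>lborel) <= (\<integral>\<^sup>+p. h p \<partial>bdry L)" .
 have "(\<integral>\<^sup>+y. h (L, y) * indicator {-L<..<L} y \<partial>lborel)
   = (\<integral>\<^sup>+s. h (L, -3*L + 1 * s) * indicator {-L<..<L} (-3*L + 1 * s) \<partial>lborel)"
  by (subst nn_integral_real_affine[where c=1 and t="-3*L"]) auto
 also have "\<dots> <= (\<integral>\<^sup>+p. h p \<partial>bdry L)" unfolding b
  by (intro nn_integral_mono) (auto simp: indicator_def square_param_def)
 finally show "(\<integral>\<^sup>+y. h (L, y) * indicator {-L<..<L} y \<partial>lborel) <= (\<integral>\<^sup>+p. h p \<partial>bdry L)" .
qed

subsection \<open>Estimates in boundary layers\<close>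

text \<open>The fundamental theorem of calculus and the Cauchy-Schwarz inequality.\<close>

lemma square_increment_le:
 fixes g g' :: "real => real"
 assumes d: "\<And>s. (g has_real_derivative g' s) (at s)" and c: "continuous_on UNIV g'" and s: "s <= t"
 shows "(g t - g s)^2 <= (t - s) * (LINT x|lborel. indicator {s..t} x * (g' x)^2)"
proof -
 have L: "L2 lborel (\<lambda>x. indicator {s..t} x * g' x)" "L2 lborel (indicator {s..t} :: real => real)"
 proof -
  have i: "integrable lborel (\<lambda>x. indicator {s..t} x *\<^sub>R (g' x)^2)"
   by (rule borel_integrable_compact) (auto intro!: continuous_intros continuous_on_subset[OF c])
  have m: "g' \<in> borel_measurable borel" by (rule borel_measurable_continuous_onI[OF c])
  have "(\<lambda>x. (norm (indicator {s..t} x * g' x))^2) = (\<lambda>x. indicator {s..t} x *\<^sub>R (g' x)^2)"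
   "(\<lambda>x. (norm (indicator {s..t} x :: real))^2) = indicator {s..t}"
   by (auto simp: indicator_def fun_eq_iff)
  then show "L2 lborel (\<lambda>x. indicator {s..t} x * g' x)" "L2 lborel (indicator {s..t} :: real => real)"
   unfolding L2_def using i m by (auto simp: integrable_indicator_iff emeasure_lborel_Icc_eq)
 qed
 have "(LINT x|lborel. indicator {s..t} x *\<^sub>R g' x) = g t - g s"
  by (rule integral_FTC_atLeastAtMost[OF s])
   (auto intro: continuous_on_subset[OF c] has_field_derivative_at_within[OF d] simp flip: has_real_derivative_iff_has_vector_derivative)
 moreover have "(\<lambda>x. (indicator {s..t} x * g' x) \<bullet> (indicator {s..t} x :: real)) = (\<lambda>x. indicator {s..t} x *\<^sub>R g' x)"
  by (auto simp: indicator_def fun_eq_iff)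
 ultimately have "\<bar>g t - g s\<bar> <= nrm lborel (\<lambda>x. indicator {s..t} x * g' x) * nrm lborel (indicator {s..t} :: real => real)"
  using L2_cauchy_schwarz[OF L] by simp
 then have "(g t - g s)^2 <= (nrm lborel (\<lambda>x. indicator {s..t} x * g' x) * nrm lborel (indicator {s..t} :: real => real))^2"
  by (simp add: abs_le_square_iff[symmetric])
 also have "\<dots> = sqn lborel (\<lambda>x. indicator {s..t} x * g' x) * sqn lborel (indicator {s..t} :: real => real)"
  by (simp add: power_mult_distrib nrm_sq)
 also have "sqn lborel (\<lambda>x. indicator {s..t} x * g' x) = (LINT x|lborel. indicator {s..t} x * (g' x)^2)"
  unfolding sqn_def by (rule Bochner_Integration.integral_cong) (auto simp: indicator_def)
 also have "sqn lborel (indicator {s..t} :: real => real) = (LINT x|lborel. indicator {s..t} x)"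
  unfolding sqn_def by (rule Bochner_Integration.integral_cong) (auto simp: indicator_def)
 also have "\<dots> = t - s" using s by simp
 finally show ?thesis by (simp add: mult.commute)
qed

lemma strip_1d:
 fixes g g' :: "real => real"
 assumes d: "\<And>s. (g has_real_derivative g' s) (at s)" and c: "continuous_on UNIV g'" and e: "a <= e" "e <= b"
 shows "(\<integral>\<^sup>+s. ennreal ((g s)^2) * indicator {a<..<b} s \<partial>lborel)
  <= ennreal (2 * (b - a)) * ennreal ((g e)^2) + ennreal (2 * (b - a)^2) * (\<integral>\<^sup>+s. ennreal ((g' s)^2) * indicator {a<..<b} s \<partial>lborel)"
proof -
 define E where "E = (LINT x|lborel. indicator {a..b} x * (g' x)^2)"
 have ab: "a <= b" using e by simp
 have i: "integrable lborel (\<lambda>x. indicator {s..t} x * (g' x)^2)" for s t :: real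
  using borel_integrable_compact[of "{s..t}" "\<lambda>x. (g' x)^2"] continuous_on_subset[OF c, of "{s..t}"]
  by (auto intro!: continuous_intros)
 have E0: "0 <= E" unfolding E_def by (rule Bochner_Integration.integral_nonneg) auto
 have sub: "(t - s) * (LINT x|lborel. indicator {s..t} x * (g' x)^2) <= (b - a) * E" if "a <= s" "s <= t" "t <= b" for s t
 proof (rule mult_mono)
  show "(LINT x|lborel. indicator {s..t} x * (g' x)^2) <= E"
   unfolding E_def by (rule Bochner_Integration.integral_mono[OF i i]) (use that in \<open>auto simp: indicator_def\<close>)
 qed (use that in \<open>auto intro: Bochner_Integration.integral_nonneg\<close>)
 have pt: "(g s)^2 <= 2 * (g e)^2 + 2 * (b - a) * E" if "a <= s" "s <= b" for s
 proof -
  have "(g s - g e)^2 <= (b - a) * E"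
  proof (cases "e <= s")
   case True then show ?thesis using square_increment_le[OF d c True] sub[of e s] that e by linarith
  next
   case False then show ?thesis using square_increment_le[OF d c, of s e] sub[of s e] that e
    by (simp add: power2_commute[of "g s"])
  qed
  moreover have "(g s)^2 <= 2 * (g e)^2 + 2 * (g s - g e)^2"
   using norm_add_sq_le[of "g e" "g s - g e"] by simp
  ultimately show ?thesis using mult.assoc[of 2 "b - a" E] by linarith
 qed
 have "(\<integral>\<^sup>+s. ennreal ((g s)^2) * indicator {a<..<b} s \<partial>lborel)
   <= (\<integral>\<^sup>+s. ennreal (2 * (g e)^2 + 2 * (b - a) * E) * indicator {a<..<b} s \<partial>lborel)"
 proof (rule nn_integral_mono)
  fix s
  show "ennreal ((g s)^2) * indicator {a<..<b} s <= ennreal (2 * (g e)^2 + 2 * (b - a) * E) * indicator {a<..<b} s"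
   using ennreal_leI[OF pt[of s]] by (cases "s \<in> {a<..<b}") simp_all
 qed
 also have "\<dots> = ennreal (2 * (g e)^2 + 2 * (b - a) * E) * ennreal (b - a)"
  using ab by (subst nn_integral_cmult_indicator) auto
 also have "\<dots> = ennreal (2 * (b - a) * (g e)^2 + 2 * (b - a)^2 * E)"
 proof -
  have "0 <= 2 * (g e)^2 + 2 * (b - a) * E" using ab E0 by (intro add_nonneg_nonneg mult_nonneg_nonneg) auto
  then show ?thesis using ab by (subst ennreal_mult[symmetric]) (auto simp: power2_eq_square algebra_simps)
 qed
 also have "\<dots> = ennreal (2 * (b - a)) * ennreal ((g e)^2) + ennreal (2 * (b - a)^2) * ennreal E"
  using ab E0 by (simp add: ennreal_mult ennreal_plus)
 also have "ennreal E = (\<integral>\<^sup>+s. ennreal ((g' s)^2) * indicator {a<..<b} s \<partial>lborel)"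
 proof -
  have "ennreal E = (\<integral>\<^sup>+s. ennreal (indicator {a..b} s * (g' s)^2) \<partial>lborel)"
   unfolding E_def by (rule nn_integral_eq_integral[symmetric]) (auto intro!: i)
  also have "\<dots> = (\<integral>\<^sup>+s. ennreal ((g' s)^2) * indicator {a<..<b} s \<partial>lborel)"
  proof (rule nn_integral_cong_AE)
   have "AE s in lborel. s ~= a" "AE s in lborel. s ~= b" by (rule AE_lborel_singleton)+
   then show "AE s in lborel. ennreal (indicator {a..b} s * (g' s)^2) = ennreal ((g' s)^2) * indicator {a<..<b} s"
    by eventually_elim (auto simp: indicator_def)
  qed
  finally show ?thesis .
 qed
 finally show ?thesis .
qed

lemma ennreal_partial_le:
 assumes "smooth u"
 shows "ennreal ((fst (grad u p))^2) <= ennreal ((norm (grad u p))^2)" "ennreal ((snd (grad u p))^2) <= ennreal ((norm (grad u p))^2)"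
 by (auto intro!: ennreal_leI simp: norm_prod_def)

lemma partial_deriv:
 assumes "smooth u"
 shows "((\<lambda>y. u (x, y)) has_real_derivative snd (grad u (x, y))) (at y)"
  "((\<lambda>x. u (x, y)) has_real_derivative fst (grad u (x, y))) (at x)"
proof -
 have "((\<lambda>y. (x, y)) has_derivative (\<lambda>v. (0, v))) (at y)" by (auto intro!: derivative_eq_intros)
 from has_derivative_compose[OF this smooth_has_derivative[OF assms]]
 have "((\<lambda>y. u (x, y)) has_derivative (\<lambda>v. grad u (x, y) \<bullet> (0, v))) (at y)" .
 moreover have "(\<lambda>v. grad u (x, y) \<bullet> (0, v)) = (*) (snd (grad u (x, y)))" by (simp add: inner_plane fun_eq_iff)
 ultimately show "((\<lambda>y. u (x, y)) has_real_derivative snd (grad u (x, y))) (at y)" by (simp add: has_field_derivative_def)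
 have "((\<lambda>x. (x, y)) has_derivative (\<lambda>v. (v, 0))) (at x)" by (auto intro!: derivative_eq_intros)
 from has_derivative_compose[OF this smooth_has_derivative[OF assms]]
 have "((\<lambda>x. u (x, y)) has_derivative (\<lambda>v. grad u (x, y) \<bullet> (v, 0))) (at x)" .
 moreover have "(\<lambda>v. grad u (x, y) \<bullet> (v, 0)) = (*) (fst (grad u (x, y)))" by (simp add: inner_plane fun_eq_iff)
 ultimately show "((\<lambda>x. u (x, y)) has_real_derivative fst (grad u (x, y))) (at x)" by (simp add: has_field_derivative_def)
qed

lemma grad_sq_measurable: "smooth u ==> (\<lambda>p. ennreal ((norm (grad u p))^2)) \<in> borel_measurable borel"
 "smooth u ==> (\<lambda>p. ennreal ((u p)^2)) \<in> borel_measurable borel"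
 using borel_measurable_continuous_onI[OF continuous_grad[of u UNIV]] borel_measurable_continuous_onI[OF smooth_continuous[of u UNIV]]
 by auto

lemma tonelli_plane:
 fixes h :: "plane => ennreal"
 assumes "h \<in> borel_measurable borel"
 shows "(\<integral>\<^sup>+p. h p \<partial>lborel) = (\<integral>\<^sup>+x. \<integral>\<^sup>+y. h (x, y) \<partial>lborel \<partial>lborel)"
  "(\<integral>\<^sup>+p. h p \<partial>lborel) = (\<integral>\<^sup>+y. \<integral>\<^sup>+x. h (x, y) \<partial>lborel \<partial>lborel)"
proof -
 have h: "h \<in> borel_measurable (lborel \<Otimes>\<^sub>M lborel)" using assms by (simp add: lborel_prod)
 show "(\<integral>\<^sup>+p. h p \<partial>lborel) = (\<integral>\<^sup>+x. \<integral>\<^sup>+y. h (x, y) \<partial>lborel \<partial>lborel)"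
  using lborel.nn_integral_fst[OF h] by (simp add: lborel_prod)
 show "(\<integral>\<^sup>+p. h p \<partial>lborel) = (\<integral>\<^sup>+y. \<integral>\<^sup>+x. h (x, y) \<partial>lborel \<partial>lborel)"
  using lborel_pair.nn_integral_snd[OF h] by (simp add: lborel_prod)
qed

lemma strip_2d:
 assumes u: "smooth u" and e: "a <= e" "e <= b"
 shows "(\<integral>\<^sup>+p. ennreal ((u p)^2) * indicator ({-L<..<L} \<times> {a<..<b}) p \<partial>lborel)
   <= ennreal (2 * (b - a)) * (\<integral>\<^sup>+x. ennreal ((u (x, e))^2) * indicator {-L<..<L} x \<partial>lborel)
    + ennreal (2 * (b - a)^2) * (\<integral>\<^sup>+p. ennreal ((norm (grad u p))^2) * indicator ({-L<..<L} \<times> {a<..<b}) p \<partial>lborel)" (is ?V)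
  and "(\<integral>\<^sup>+p. ennreal ((u p)^2) * indicator ({a<..<b} \<times> {-L<..<L}) p \<partial>lborel)
   <= ennreal (2 * (b - a)) * (\<integral>\<^sup>+y. ennreal ((u (e, y))^2) * indicator {-L<..<L} y \<partial>lborel)
    + ennreal (2 * (b - a)^2) * (\<integral>\<^sup>+p. ennreal ((norm (grad u p))^2) * indicator ({a<..<b} \<times> {-L<..<L}) p \<partial>lborel)" (is ?H)
proof -
 note [measurable] = grad_sq_measurable[OF u] borel_measurable_continuous_onI[OF smooth_continuous[OF u]]
  borel_measurable_continuous_onI[OF continuous_grad[OF u]]
 have [measurable]: "{-L<..<L} \<times> {a<..<b} \<in> sets (borel :: plane measure)" "{a<..<b} \<times> {-L<..<L} \<in> sets (borel :: plane measure)"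
  by (intro borel_open open_Times; simp)+
 have cont: "continuous_on UNIV (\<lambda>y. snd (grad u (x, y)))" "continuous_on UNIV (\<lambda>x. fst (grad u (x, y)))" for x y
  by (intro continuous_intros continuous_on_compose2[OF continuous_grad[OF u, of UNIV]]; simp)+
 have "(\<integral>\<^sup>+p. ennreal ((u p)^2) * indicator ({-L<..<L} \<times> {a<..<b}) p \<partial>lborel)
   = (\<integral>\<^sup>+x. \<integral>\<^sup>+y. ennreal ((u (x,y))^2) * indicator ({-L<..<L} \<times> {a<..<b}) (x,y) \<partial>lborel \<partial>lborel)"
  by (rule tonelli_plane(1)) measurable
 also have "\<dots> = (\<integral>\<^sup>+x. indicator {-L<..<L} x * (\<integral>\<^sup>+y. ennreal ((u (x,y))^2) * indicator {a<..<b} y \<partial>lborel) \<partial>lborel)"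
  by (intro nn_integral_cong, subst nn_integral_cmult[symmetric]) (auto simp: indicator_times ac_simps)
 also have "\<dots> <= (\<integral>\<^sup>+x. indicator {-L<..<L} x * (ennreal (2 * (b - a)) * ennreal ((u (x, e))^2)
   + ennreal (2 * (b - a)^2) * (\<integral>\<^sup>+y. ennreal ((norm (grad u (x,y)))^2) * indicator {a<..<b} y \<partial>lborel)) \<partial>lborel)"
  using strip_1d[OF partial_deriv(1)[OF u] cont(1) e]
  by (intro nn_integral_mono mult_left_mono order_trans[OF strip_1d[OF partial_deriv(1)[OF u] cont(1) e]]
    add_mono order_refl mult_right_mono ennreal_partial_le[OF u]) auto
 also have "\<dots> = (\<integral>\<^sup>+x. ennreal (2 * (b - a)) * (ennreal ((u (x, e))^2) * indicator {-L<..<L} x)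
   + ennreal (2 * (b - a)^2) * (\<integral>\<^sup>+y. ennreal ((norm (grad u (x,y)))^2) * indicator ({-L<..<L} \<times> {a<..<b}) (x,y) \<partial>lborel) \<partial>lborel)"
  by (intro nn_integral_cong) (auto simp: indicator_def)
 also have "\<dots> = ennreal (2 * (b - a)) * (\<integral>\<^sup>+x. ennreal ((u (x, e))^2) * indicator {-L<..<L} x \<partial>lborel)
   + ennreal (2 * (b - a)^2) * (\<integral>\<^sup>+x. \<integral>\<^sup>+y. ennreal ((norm (grad u (x,y)))^2) * indicator ({-L<..<L} \<times> {a<..<b}) (x,y) \<partial>lborel \<partial>lborel)"
  by (subst nn_integral_add, measurable, subst nn_integral_cmult, measurable, subst nn_integral_cmult, measurable)
 also have "(\<integral>\<^sup>+x. \<integral>\<^sup>+y. ennreal ((norm (grad u (x,y)))^2) * indicator ({-L<..<L} \<times> {a<..<b}) (x,y) \<partial>lborel \<partial>lborel)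
   = (\<integral>\<^sup>+p. ennreal ((norm (grad u p))^2) * indicator ({-L<..<L} \<times> {a<..<b}) p \<partial>lborel)"
  by (rule tonelli_plane(1)[symmetric]) measurable
 finally show ?V .
 have "(\<integral>\<^sup>+p. ennreal ((u p)^2) * indicator ({a<..<b} \<times> {-L<..<L}) p \<partial>lborel)
   = (\<integral>\<^sup>+y. \<integral>\<^sup>+x. ennreal ((u (x,y))^2) * indicator ({a<..<b} \<times> {-L<..<L}) (x,y) \<partial>lborel \<partial>lborel)"
  by (rule tonelli_plane(2)) measurable
 also have "\<dots> = (\<integral>\<^sup>+y. indicator {-L<..<L} y * (\<integral>\<^sup>+x. ennreal ((u (x,y))^2) * indicator {a<..<b} x \<partial>lborel) \<partial>lborel)"
  by (intro nn_integral_cong, subst nn_integral_cmult[symmetric]) (auto simp: indicator_times ac_simps)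
 also have "\<dots> <= (\<integral>\<^sup>+y. indicator {-L<..<L} y * (ennreal (2 * (b - a)) * ennreal ((u (e, y))^2)
   + ennreal (2 * (b - a)^2) * (\<integral>\<^sup>+x. ennreal ((norm (grad u (x,y)))^2) * indicator {a<..<b} x \<partial>lborel)) \<partial>lborel)"
  by (intro nn_integral_mono mult_left_mono order_trans[OF strip_1d[OF partial_deriv(2)[OF u] cont(2) e]]
    add_mono order_refl mult_right_mono ennreal_partial_le[OF u]) auto
 also have "\<dots> = (\<integral>\<^sup>+y. ennreal (2 * (b - a)) * (ennreal ((u (e, y))^2) * indicator {-L<..<L} y)
   + ennreal (2 * (b - a)^2) * (\<integral>\<^sup>+x. ennreal ((norm (grad u (x,y)))^2) * indicator ({a<..<b} \<times> {-L<..<L}) (x,y) \<partial>lborel) \<partial>lborel)"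
  by (intro nn_integral_cong) (auto simp: indicator_def)
 also have "\<dots> = ennreal (2 * (b - a)) * (\<integral>\<^sup>+y. ennreal ((u (e, y))^2) * indicator {-L<..<L} y \<partial>lborel)
   + ennreal (2 * (b - a)^2) * (\<integral>\<^sup>+y. \<integral>\<^sup>+x. ennreal ((norm (grad u (x,y)))^2) * indicator ({a<..<b} \<times> {-L<..<L}) (x,y) \<partial>lborel \<partial>lborel)"
  by (subst nn_integral_add, measurable, subst nn_integral_cmult, measurable, subst nn_integral_cmult, measurable)
 also have "(\<integral>\<^sup>+y. \<integral>\<^sup>+x. ennreal ((norm (grad u (x,y)))^2) * indicator ({a<..<b} \<times> {-L<..<L}) (x,y) \<partial>lborel \<partial>lborel)
   = (\<integral>\<^sup>+p. ennreal ((norm (grad u p))^2) * indicator ({a<..<b} \<times> {-L<..<L}) p \<partial>lborel)"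
  by (rule tonelli_plane(2)[symmetric]) measurable
 finally show ?H .
qed

lemma ennreal_sqn_SM:
 fixes f :: "plane => 'b::euclidean_space"
 assumes f: "L2 (SM L) f" and A: "A \<in> sets borel" "A \<subseteq> square L"
 shows "L2 (SM L) (\<lambda>x. indicator A x *\<^sub>R f x)"
  "ennreal (sqn (SM L) (\<lambda>x. indicator A x *\<^sub>R f x)) = (\<integral>\<^sup>+p. ennreal ((norm (f p))^2) * indicator A p \<partial>lborel)"
proof -
 show L: "L2 (SM L) (\<lambda>x. indicator A x *\<^sub>R f x)"
  by (rule L2_bounded_mult[OF f, where B=1]) (use A in \<open>auto intro!: borel_measurable_SM simp: indicator_def\<close>)
 have "ennreal (sqn (SM L) (\<lambda>x. indicator A x *\<^sub>R f x)) = (\<integral>\<^sup>+x. ennreal ((norm (indicator A x *\<^sub>R f x))^2) \<partial>SM L)"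
  by (rule nn_integral_L2[OF L, symmetric])
 also have "\<dots> = (\<integral>\<^sup>+x. ennreal ((norm (indicator A x *\<^sub>R f x))^2) * indicator (square L) x \<partial>lborel)"
  by (subst nn_integral_restrict_space) (auto simp: nn_integral_completion)
 also have "\<dots> = (\<integral>\<^sup>+p. ennreal ((norm (f p))^2) * indicator A p \<partial>lborel)"
  using A(2) by (intro nn_integral_cong) (auto simp: indicator_def)
 finally show "ennreal (sqn (SM L) (\<lambda>x. indicator A x *\<^sub>R f x)) = (\<integral>\<^sup>+p. ennreal ((norm (f p))^2) * indicator A p \<partial>lborel)" .
qed

definition lay :: "real => real => plane set" where
 "lay L h = {p \<in> square L. L - h < \<bar>fst p\<bar> \<or> L - h < \<bar>snd p\<bar>}"

lemma lay_subset: "lay L h \<subseteq> square L" by (auto simp: lay_def)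

lemma lay_sets [simp]: "lay L h \<in> sets borel"
proof -
 have "lay L h = square L \<inter> ({p. L - h < \<bar>fst p\<bar>} \<union> {p. L - h < \<bar>snd p\<bar>})" by (auto simp: lay_def)
 moreover have "open {p::plane. L - h < \<bar>fst p\<bar>}" "open {p::plane. L - h < \<bar>snd p\<bar>}"
  by (intro open_Collect_less continuous_intros)+
 ultimately have "open (lay L h)" by (simp add: open_Int open_Un)
 then show ?thesis by simp
qed

lemma lay_strips: assumes "0 < h" "h <= L"
 shows "lay L h = ({-L<..<L} \<times> {-L<..<-L+h}) \<union> ({-L<..<L} \<times> {L-h<..<L})
  \<union> ({-L<..<-L+h} \<times> {-L<..<L}) \<union> ({L-h<..<L} \<times> {-L<..<L})" (is "_ = ?R")
proof (rule set_eqI)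
 fix p :: plane
 show "p \<in> lay L h \<longleftrightarrow> p \<in> ?R"
  using assms by (cases p) (auto simp: lay_def mem_square abs_if split: if_splits)
qed

text \<open>Each of the four strips that cover the layer is integrated in the normal direction, starting from a side of
 the square.\<close>

lemma layer_estimate:
 assumes u: "smooth u" and h: "0 < h" "h <= L"
 shows "sqn (SM L) (\<lambda>x. indicator (lay L h) x *\<^sub>R u x)
  <= 8 * h * sqn (bdry L) u + 8 * h^2 * sqn (SM L) (\<lambda>x. indicator (lay L h) x *\<^sub>R grad u x)"
proof -
 have L: "0 < L" using h by simp
 note lay = ennreal_sqn_SM[OF _ lay_sets lay_subset, of L _ h]
 have L2: "L2 (SM L) u" "L2 (SM L) (grad u)" "L2 (bdry L) u"
  using u L by (auto intro!: L2_continuous_SM L2_continuous_bdry smooth_continuous continuous_grad)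
 let ?p = "\<lambda>p. ennreal ((u p)^2)" and ?g = "\<lambda>p. ennreal ((norm (grad u p))^2)"
 define B where "B = (\<integral>\<^sup>+p. ?p p \<partial>bdry L)"
 define G where "G = (\<integral>\<^sup>+p. ?g p * indicator (lay L h) p \<partial>lborel)"
 have B: "B = ennreal (sqn (bdry L) u)" unfolding B_def using nn_integral_L2[OF L2(3)] by simp
 have G: "G = ennreal (sqn (SM L) (\<lambda>x. indicator (lay L h) x *\<^sub>R grad u x))" unfolding G_def using lay(2)[OF L2(2)] by simp
 note [measurable] = grad_sq_measurable[OF u] borel_measurable_continuous_onI[OF smooth_continuous[OF u]]
  borel_measurable_continuous_onI[OF continuous_grad[OF u]]
 have [measurable]: "{a<..<b} \<times> {c<..<d} \<in> sets (borel :: plane measure)" for a b c d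
  by (intro borel_open open_Times; simp)
 note side = nn_integral_sides[OF L grad_sq_measurable(2)[OF u], folded B_def]
 have Gm: "(\<integral>\<^sup>+p. ?g p * indicator A p \<partial>lborel) <= G" if "A \<subseteq> lay L h" for A
  unfolding G_def using that by (intro nn_integral_mono mult_left_mono) (auto simp: indicator_def)
 let ?X = "ennreal (2 * h) * B + ennreal (2 * h^2) * G"
 note sub = lay_strips[OF h]
 have s1: "(\<integral>\<^sup>+p. ?p p * indicator ({-L<..<L} \<times> {-L<..<-L+h}) p \<partial>lborel) <= ?X"
  by (rule order_trans[OF strip_2d(1)[OF u, of "-L" "-L"]])
   (use h in \<open>auto intro!: add_mono mult_left_mono side Gm simp: sub\<close>)
 have s2: "(\<integral>\<^sup>+p. ?p p * indicator ({-L<..<L} \<times> {L-h<..<L}) p \<partial>lborel) <= ?X"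
  by (rule order_trans[OF strip_2d(1)[OF u, of "L-h" L]])
   (use h in \<open>auto intro!: add_mono mult_left_mono side Gm simp: sub\<close>)
 have s3: "(\<integral>\<^sup>+p. ?p p * indicator ({-L<..<-L+h} \<times> {-L<..<L}) p \<partial>lborel) <= ?X"
  by (rule order_trans[OF strip_2d(2)[OF u, of "-L" "-L"]])
   (use h in \<open>auto intro!: add_mono mult_left_mono side Gm simp: sub\<close>)
 have s4: "(\<integral>\<^sup>+p. ?p p * indicator ({L-h<..<L} \<times> {-L<..<L}) p \<partial>lborel) <= ?X"
  by (rule order_trans[OF strip_2d(2)[OF u, of "L-h" L]])
   (use h in \<open>auto intro!: add_mono mult_left_mono side Gm simp: sub\<close>)
 have "ennreal (sqn (SM L) (\<lambda>x. indicator (lay L h) x *\<^sub>R u x)) = (\<integral>\<^sup>+p. ?p p * indicator (lay L h) p \<partial>lborel)"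
  using lay(2)[OF L2(1)] by simp
 also have "\<dots> <= (\<integral>\<^sup>+p. ?p p * indicator ({-L<..<L} \<times> {-L<..<-L+h}) p
   + (?p p * indicator ({-L<..<L} \<times> {L-h<..<L}) p
   + (?p p * indicator ({-L<..<-L+h} \<times> {-L<..<L}) p
   + ?p p * indicator ({L-h<..<L} \<times> {-L<..<L}) p)) \<partial>lborel)"
  unfolding sub by (intro nn_integral_mono) (auto simp: indicator_def intro: add_increasing add_increasing2)
 also have "\<dots> = (\<integral>\<^sup>+p. ?p p * indicator ({-L<..<L} \<times> {-L<..<-L+h}) p \<partial>lborel)
   + ((\<integral>\<^sup>+p. ?p p * indicator ({-L<..<L} \<times> {L-h<..<L}) p \<partial>lborel)
   + ((\<integral>\<^sup>+p. ?p p * indicator ({-L<..<-L+h} \<times> {-L<..<L}) p \<partial>lborel)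
   + (\<integral>\<^sup>+p. ?p p * indicator ({L-h<..<L} \<times> {-L<..<L}) p \<partial>lborel)))"
  by (simp add: nn_integral_add)
 also have "\<dots> <= ?X + (?X + (?X + ?X))" by (intro add_mono s1 s2 s3 s4)
 also have "\<dots> = ennreal (8 * h * sqn (bdry L) u + 8 * h^2 * sqn (SM L) (\<lambda>x. indicator (lay L h) x *\<^sub>R grad u x))"
  unfolding B G using h by (simp add: ennreal_mult[symmetric] ennreal_plus[symmetric] del: ennreal_plus)
 finally show ?thesis using h by (subst (asm) ennreal_le_iff) auto
qed

text \<open>The square is itself a strip that starts from one of its sides.\<close>

lemma poincare:
 assumes u: "smooth u" and L: "0 < L"
 shows "sqn (SM L) u <= 4 * L * sqn (bdry L) u + 8 * L^2 * sqn (SM L) (grad u)"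
proof -
 have L2: "L2 (SM L) u" "L2 (SM L) (grad u)" "L2 (bdry L) u"
  using u L by (auto intro!: L2_continuous_SM L2_continuous_bdry smooth_continuous continuous_grad)
 have eq: "ennreal (sqn (SM L) f) = (\<integral>\<^sup>+p. ennreal ((norm (f p))^2) * indicator (square L) p \<partial>lborel)"
  if "L2 (SM L) f" for f :: "plane => 'b::euclidean_space"
  unfolding nn_integral_L2[OF that, symmetric] by (subst nn_integral_restrict_space) (auto simp: nn_integral_completion)
 have "ennreal (sqn (SM L) u) <= ennreal (4 * L) * (\<integral>\<^sup>+x. ennreal ((u (x, -L))^2) * indicator {-L<..<L} x \<partial>lborel)
  + ennreal (8 * L^2) * ennreal (sqn (SM L) (grad u))"
  using strip_2d(1)[OF u, of "-L" "-L" L L] L unfolding eq[OF L2(1)] eq[OF L2(2)]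
  by (simp add: square_def power2_eq_square)
 also have "\<dots> <= ennreal (4 * L) * ennreal (sqn (bdry L) u) + ennreal (8 * L^2) * ennreal (sqn (SM L) (grad u))"
  using nn_integral_sides(1)[OF L grad_sq_measurable(2)[OF u]] nn_integral_L2[OF L2(3)]
  by (intro add_mono mult_left_mono) auto
 also have "\<dots> = ennreal (4 * L * sqn (bdry L) u + 8 * L^2 * sqn (SM L) (grad u))"
  using L by (simp add: ennreal_mult[symmetric] ennreal_plus[symmetric] del: ennreal_plus)
 finally show ?thesis using L by (subst (asm) ennreal_le_iff) auto
qed

subsection \<open>Functions with zero trace\<close>

text \<open>Zero within \<open>h / 3\<close> of the boundary, one at distance more than \<open>2 h / 3\<close> from it.\<close>

definition cutoff :: "real => real => plane => real" where
 "cutoff L h p = (step (3 * (L - fst p) / h - 1) * step (3 * (L + fst p) / h - 1)) *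
  (step (3 * (L - snd p) / h - 1) * step (3 * (L + snd p) / h - 1))"

lemma smooth_cutoff: "smooth (cutoff L h)"
 unfolding cutoff_def[abs_def] divide_inverse
 by (intro smooth_mult smooth_step smooth_diff smooth_add smooth_const smooth_fst smooth_snd)

lemma cutoff_range: "0 <= cutoff L h p" "cutoff L h p <= 1"
 unfolding cutoff_def by (intro mult_nonneg_nonneg mult_le_one step_range)+

lemma cutoff_zero: assumes "0 < h" "cutoff L h p ~= 0"
 shows "\<bar>fst p\<bar> < L - h / 3" "\<bar>snd p\<bar> < L - h / 3"
proof -
 have "step (3 * c / h - 1) = 0" if "c <= h / 3" for c
  using that assms(1) by (intro step_0) (simp add: field_simps)
 then have "h / 3 < L - fst p" "h / 3 < L + fst p" "h / 3 < L - snd p" "h / 3 < L + snd p"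
  using assms(2) unfolding cutoff_def mult_eq_0_iff de_Morgan_disj by (meson not_le)+
 then show "\<bar>fst p\<bar> < L - h / 3" "\<bar>snd p\<bar> < L - h / 3" by auto
qed

lemma cutoff_one: assumes "0 < h" "\<bar>fst p\<bar> < L - 2 * h / 3" "\<bar>snd p\<bar> < L - 2 * h / 3"
 shows "cutoff L h p = 1"
proof -
 have "step (3 * c / h - 1) = 1" if "2 * h / 3 <= c" for c
  using that assms(1) by (intro step_1) (simp add: field_simps)
 note st = this
 have "step (3 * (L - fst p) / h - 1) = 1" "step (3 * (L + fst p) / h - 1) = 1"
  "step (3 * (L - snd p) / h - 1) = 1" "step (3 * (L + snd p) / h - 1) = 1"
  by (rule st, use assms in linarith)+
 then show ?thesis by (simp add: cutoff_def)
qed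

lemma grad_cutoff_bound: "\<exists>C\<ge>0. \<forall>L h p. 0 < h --> norm (grad (cutoff L h) p) <= C / h"
proof -
 obtain C d where C: "\<And>x. (step has_real_derivative d x) (at x)" "\<And>x. \<bar>d x\<bar> <= C"
  using step_deriv_bounded by blast
 have C0: "0 <= C" using C(2)[of 0] by simp
 have chain: "((\<lambda>x. step (3 * (L + s * x) / h - 1)) has_real_derivative d (3 * (L + s * x) / h - 1) * (3 * s / h)) (at x)" if "0 < h" for L s x h
  by (rule DERIV_chain2[OF C(1)]) (use that in \<open>auto intro!: derivative_eq_intros\<close>)
 have pair: "\<exists>D. ((\<lambda>x. step (3 * (L - x) / h - 1) * step (3 * (L + x) / h - 1)) has_real_derivative D) (at x) \<and> \<bar>D\<bar> <= 6 * C / h"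
  if "0 < h" for L x h
 proof -
  define D where "D = step (3 * (L - x) / h - 1) * (d (3 * (L + x) / h - 1) * (3 / h))
    + d (3 * (L - x) / h - 1) * (- 3 / h) * step (3 * (L + x) / h - 1)"
  have "((\<lambda>x. step (3 * (L - x) / h - 1) * step (3 * (L + x) / h - 1)) has_real_derivative D) (at x)"
   using DERIV_mult'[OF chain[OF that, of L "-1" x] chain[OF that, of L 1 x]] by (simp add: D_def)
  moreover have "\<bar>D\<bar> <= 1 * (C * (3 / h)) + (C * (3 / h)) * 1"
   unfolding D_def
   by (rule order_trans[OF abs_triangle_ineq], unfold abs_mult, intro add_mono mult_mono)
    (use that C(2) step_range C0 in auto)
  ultimately show ?thesis by auto
 qed
 have "norm (grad (cutoff L h) p) <= 12 * C / h" if h: "0 < h" for L h p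
 proof -
  obtain x y where p: "p = (x, y)" by (cases p)
  let ?f = "\<lambda>x. step (3 * (L - x) / h - 1) * step (3 * (L + x) / h - 1)"
  have r: "0 <= ?f x" "?f x <= 1" for x by (intro mult_nonneg_nonneg mult_le_one step_range)+
  obtain D where D: "(?f has_real_derivative D) (at x)" "\<bar>D\<bar> <= 6 * C / h" using pair[OF h] by blast
  obtain E where E: "(?f has_real_derivative E) (at y)" "\<bar>E\<bar> <= 6 * C / h" using pair[OF h] by blast
  have "((\<lambda>x. cutoff L h (x, y)) has_real_derivative D * ?f y) (at x)"
   unfolding cutoff_def fst_conv snd_conv using DERIV_cmult_right[OF D(1), of "?f y"] by simp
  then have 1: "fst (grad (cutoff L h) (x, y)) = D * ?f y"
   using partial_deriv(2)[OF smooth_cutoff] DERIV_unique by blast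
  have "((\<lambda>y. cutoff L h (x, y)) has_real_derivative ?f x * E) (at y)"
   unfolding cutoff_def fst_conv snd_conv using DERIV_cmult[OF E(1), of "?f x"] by simp
  then have 2: "snd (grad (cutoff L h) (x, y)) = ?f x * E"
   using partial_deriv(1)[OF smooth_cutoff] DERIV_unique by blast
  have "norm (grad (cutoff L h) p) <= \<bar>D * ?f y\<bar> + \<bar>?f x * E\<bar>"
   unfolding p norm_prod_def 1 2 by (simp add: sqrt_sum_squares_le_sum_abs)
  also have "\<dots> <= \<bar>D\<bar> * 1 + 1 * \<bar>E\<bar>"
   unfolding abs_mult by (intro add_mono mult_mono) (use r[of x] r[of y] in \<open>auto simp: abs_mult[symmetric]\<close>)
  also have "\<dots> <= 12 * C / h" using D(2) E(2) by simp
  finally show ?thesis .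
 qed
 then show ?thesis using C0 by (intro exI[of _ "12 * C"]) auto
qed

section \<open>Gradients with prescribed trace\<close>

text \<open>The weak gradients of the functions in \<open>H\<^sup>1\<close> with trace \<open>f\<close>. By the Poincare inequality
 the functions themselves need not be mentioned.\<close>

definition trace_grad :: "real => (plane => real) => (plane => plane) => bool" where
 "trace_grad L f G \<longleftrightarrow> L2 (SM L) G \<and> (\<forall>e>0. \<exists>z. smooth z \<and>
  nrm (SM L) (\<lambda>x. grad z x - G x) < e \<and> nrm (bdry L) (\<lambda>x. z x - f x) < e)"

lemma trace_grad_L2: "trace_grad L f G ==> L2 (SM L) G" by (simp add: trace_grad_def)

lemma L2_smooth: "smooth z ==> L2 (SM L) z" "smooth z ==> L2 (SM L) (grad z)" "smooth z ==> 0 < L ==> L2 (bdry L) z"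
 by (auto intro!: L2_continuous_SM L2_continuous_bdry smooth_continuous continuous_grad)

lemma trace_grad_combination:
 assumes L: "0 < L" and f: "L2 (bdry L) f" "L2 (bdry L) g" and t: "trace_grad L f G" "trace_grad L g H"
 shows "trace_grad L (\<lambda>x. f x + c * g x) (\<lambda>x. G x + c *\<^sub>R H x)"
 unfolding trace_grad_def
proof (intro conjI allI impI)
 note GH = t[THEN trace_grad_L2]
 show "L2 (SM L) (\<lambda>x. G x + c *\<^sub>R H x)" by (intro L2_add L2_scaleR GH)
 fix e :: real assume e: "0 < e"
 define k where "k = 1 + \<bar>c\<bar>"
 have k: "0 < k" by (simp add: k_def add_pos_nonneg)
 define d where "d = (e / 2) / k"
 have d: "0 < d" using e k by (simp add: d_def)
 have d': "(1 + \<bar>c\<bar>) * d < e" unfolding k_def[symmetric] using e k by (simp add: d_def)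
 obtain z where z: "smooth z" "nrm (SM L) (\<lambda>x. grad z x - G x) < d" "nrm (bdry L) (\<lambda>x. z x - f x) < d"
  using t(1) d unfolding trace_grad_def by blast
 obtain q where q: "smooth q" "nrm (SM L) (\<lambda>x. grad q x - H x) < d" "nrm (bdry L) (\<lambda>x. q x - g x) < d"
  using t(2) d unfolding trace_grad_def by blast
 have comb: "a + \<bar>c\<bar> * b < e" if "a < d" "b < d" for a b
 proof -
  have "a + \<bar>c\<bar> * b <= a + \<bar>c\<bar> * d" using that by (simp add: mult_left_mono)
  also have "\<dots> < (1 + \<bar>c\<bar>) * d" using that by (simp add: distrib_right)
  finally show ?thesis using d' by simp
 qed
 have sm: "smooth (\<lambda>x. z x + c * q x)" by (intro smooth_add smooth_mult smooth_const z(1) q(1))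
 have sc: "smooth (\<lambda>x. c * q x)" by (intro smooth_mult smooth_const q(1))
 have g: "grad (\<lambda>x. z x + c * q x) x = grad z x + c *\<^sub>R grad q x" for x
  by (simp add: grad_add[OF z(1) sc] grad_cmult[OF q(1)])
 have "nrm (SM L) (\<lambda>x. (grad z x - G x) + c *\<^sub>R (grad q x - H x)) < e"
  using nrm_triangle[OF L2_diff[OF L2_smooth(2)[OF z(1)] GH(1)] L2_scaleR[OF L2_diff[OF L2_smooth(2)[OF q(1)] GH(2)], of c]]
   comb[OF z(2) q(2)] by (simp add: nrm_scaleR)
 moreover have "(\<lambda>x. (grad z x - G x) + c *\<^sub>R (grad q x - H x)) = (\<lambda>x. grad (\<lambda>x. z x + c * q x) x - (G x + c *\<^sub>R H x))"
  by (simp add: g algebra_simps)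
 moreover have "nrm (bdry L) (\<lambda>x. (z x - f x) + c *\<^sub>R (q x - g x)) < e"
  using nrm_triangle[OF L2_diff[OF L2_smooth(3)[OF z(1) L] f(1)] L2_scaleR[OF L2_diff[OF L2_smooth(3)[OF q(1) L] f(2)], of c]]
   comb[OF z(3) q(3)] nrm_scaleR[of "bdry L" c "\<lambda>x. q x - g x"] by simp
 moreover have "(\<lambda>x. (z x - f x) + c *\<^sub>R (q x - g x)) = (\<lambda>x. z x + c * q x - (f x + c * g x))"
  by (simp add: algebra_simps)
 ultimately show "\<exists>z. smooth z \<and> nrm (SM L) (\<lambda>x. grad z x - (G x + c *\<^sub>R H x)) < e \<and> nrm (bdry L) (\<lambda>x. z x - (f x + c * g x)) < e"
  by (intro exI[of _ "\<lambda>x. z x + c * q x"] conjI sm) simp_all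
qed

lemma trace_grad_diff:
 assumes "0 < L" "L2 (bdry L) f" "trace_grad L f G" "trace_grad L f H"
 shows "trace_grad L (\<lambda>_. 0) (\<lambda>x. G x - H x)"
 using trace_grad_combination[OF assms(1,2,2,3,4), of "-1"] by simp

lemma trace_grad_add_zero:
 assumes "0 < L" "L2 (bdry L) f" "trace_grad L f G" "trace_grad L (\<lambda>_. 0) H"
 shows "trace_grad L f (\<lambda>x. G x + c *\<^sub>R H x)"
 using trace_grad_combination[OF assms(1,2) _ assms(3,4), of c] by simp

lemma trace_grad_closed:
 assumes G: "L2 (SM L) G" and Gn: "\<And>n. trace_grad L f (Gn n)" and l: "(\<lambda>n. sqn (SM L) (\<lambda>x. Gn n x - G x)) \<longlonglongrightarrow> 0"
 shows "trace_grad L f G"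
 unfolding trace_grad_def
proof (intro conjI G allI impI)
 fix e :: real assume e: "0 < e"
 have "(\<lambda>n. nrm (SM L) (\<lambda>x. Gn n x - G x)) \<longlonglongrightarrow> sqrt 0" unfolding nrm_def by (intro tendsto_intros l)
 then have "\<forall>\<^sub>F n in sequentially. nrm (SM L) (\<lambda>x. Gn n x - G x) < e / 2"
  using e by (intro order_tendstoD) auto
 then obtain n where n: "nrm (SM L) (\<lambda>x. Gn n x - G x) < e / 2"
  by (auto simp: eventually_sequentially)
 obtain z where z: "smooth z" "nrm (SM L) (\<lambda>x. grad z x - Gn n x) < e / 2" "nrm (bdry L) (\<lambda>x. z x - f x) < e / 2"
  using Gn[of n] e unfolding trace_grad_def by (meson half_gt_zero)
 have "nrm (SM L) (\<lambda>x. grad z x - G x) < e"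
  using nrm_triangle_diff[OF L2_smooth(2)[OF z(1)] trace_grad_L2[OF Gn[of n]] G] z(2) n by linarith
 then show "\<exists>z. smooth z \<and> nrm (SM L) (\<lambda>x. grad z x - G x) < e \<and> nrm (bdry L) (\<lambda>x. z x - f x) < e"
  using z e by (intro exI[of _ z]) auto
qed

lemma trace_grad_test:
 assumes L: "0 < L" and q: "test_function (square L) q" shows "trace_grad L (\<lambda>_. 0) (grad q)"
proof -
 have "nrm (bdry L) q = 0"
 proof -
  have "(LINT x|bdry L. (norm (q x))^2) = (LINT x|bdry L. 0)"
   by (rule Bochner_Integration.integral_cong[OF refl])
    (use test_function_zero[OF q] in \<open>auto simp: space_bdry frontier_square[OF L]\<close>)
  then show ?thesis by (simp add: nrm_def sqn_def)
 qed
 then show ?thesis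
  using test_function_smooth[OF q] L2_smooth(2)[OF test_function_smooth[OF q]]
  unfolding trace_grad_def by (intro conjI allI impI exI[of _ q]) (auto simp: nrm_def sqn_def)
qed

lemma nrm_lay_tendsto_0:
 assumes G: "L2 (SM L) G" and L: "0 < L" and e: "0 < e"
 shows "\<exists>h. 0 < h \<and> h <= L \<and> nrm (SM L) (\<lambda>x. indicator (lay L h) x *\<^sub>R G x) < e"
proof -
 have "(\<lambda>n. \<integral>x. (norm (indicator (lay L (L / real (Suc n))) x *\<^sub>R G x))^2 \<partial>SM L) \<longlonglongrightarrow> (LINT x|SM L. 0)"
 proof (rule integral_dominated_convergence)
  show "integrable (SM L) (\<lambda>x. (norm (G x))^2)" by (rule L2_integrable[OF G])
  show "(\<lambda>x. (norm (indicator (lay L (L / real (Suc n))) x *\<^sub>R G x))^2) \<in> borel_measurable (SM L)" for n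
   using L2_measurable[OF ennreal_sqn_SM(1)[OF G lay_sets lay_subset]] by measurable
  show "AE x in SM L. (\<lambda>n. (norm (indicator (lay L (L / real (Suc n))) x *\<^sub>R G x))^2) \<longlonglongrightarrow> 0"
  proof (rule AE_I2)
   fix x assume "x \<in> space (SM L)"
   then have x: "\<bar>fst x\<bar> < L" "\<bar>snd x\<bar> < L" by (auto simp: space_restrict_space mem_square)
   define m where "m = min (L - \<bar>fst x\<bar>) (L - \<bar>snd x\<bar>)"
   have "(\<lambda>n. L / real (Suc n)) \<longlonglongrightarrow> 0"
    using LIMSEQ_inverse_real_of_nat[THEN tendsto_mult_left, of L] by (simp add: divide_inverse)
   then have "\<forall>\<^sub>F n in sequentially. L / real (Suc n) < m"
    using x by (intro order_tendstoD) (auto simp: m_def)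
   then have "\<forall>\<^sub>F n in sequentially. (norm (indicator (lay L (L / real (Suc n))) x *\<^sub>R G x))^2 = 0"
    by eventually_elim (auto simp: lay_def m_def)
   then show "(\<lambda>n. (norm (indicator (lay L (L / real (Suc n))) x *\<^sub>R G x))^2) \<longlonglongrightarrow> 0" by (rule tendsto_eventually)
  qed
  show "AE x in SM L. norm ((norm (indicator (lay L (L / real (Suc n))) x *\<^sub>R G x))^2) <= (norm (G x))^2" for n
   by (intro AE_I2) (auto simp: indicator_def)
 qed simp
 then have "(\<lambda>n. nrm (SM L) (\<lambda>x. indicator (lay L (L / real (Suc n))) x *\<^sub>R G x)) \<longlonglongrightarrow> sqrt 0"
  unfolding nrm_def sqn_def by (intro tendsto_intros) simp
 then have "\<forall>\<^sub>F n in sequentially. nrm (SM L) (\<lambda>x. indicator (lay L (L / real (Suc n))) x *\<^sub>R G x) < e"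
  using e by (intro order_tendstoD) auto
 then obtain n where "nrm (SM L) (\<lambda>x. indicator (lay L (L / real (Suc n))) x *\<^sub>R G x) < e"
  by (auto simp: eventually_sequentially)
 then show ?thesis using L by (intro exI[of _ "L / real (Suc n)"]) (auto simp: divide_simps)
qed

text \<open>Cutting off near the boundary: the product of the function with the gradient of the cut-off
 function, of size \<open>1/h\<close> in a layer of width \<open>h\<close>, is small by the layer estimate, because the
 boundary values are small and so is the gradient in the layer.\<close>

lemma zero_trace_approx:
 assumes L: "0 < L" and G: "trace_grad L (\<lambda>_. 0) G" and e: "0 < e"
 shows "\<exists>q. test_function (square L) q \<and> nrm (SM L) (\<lambda>x. grad q x - G x) < e"
proof -
 note LG = trace_grad_L2[OF G]
 obtain C where C: "0 <= C" "\<And>h p. 0 < h ==> norm (grad (cutoff L h) p) <= C / h"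
  using grad_cutoff_bound by blast
 (* the gradient in the layer enters once directly and 3 C times through the gradient of the cut-off *)
 define c where "c = 1 + 3 * C"
 have c: "0 < c" using C by (simp add: c_def)
 obtain h where h: "0 < h" "h <= L" and w: "nrm (SM L) (\<lambda>x. indicator (lay L h) x *\<^sub>R G x) < e / (4 * c)"
  using nrm_lay_tendsto_0[OF LG L, of "e / (4 * c)"] e c by auto
 define \<eta> where "\<eta> = min (e / (4 * c)) (e * h / (4 * (1 + C) * sqrt (8 * h)))"
 have \<eta>: "0 < \<eta>" using e c h C(1) by (auto simp: \<eta>_def intro!: divide_pos_pos)
 obtain z where z: "smooth z" "nrm (SM L) (\<lambda>x. grad z x - G x) < \<eta>" "nrm (bdry L) z < \<eta>"
  using G \<eta> unfolding trace_grad_def by auto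
 let ?\<chi> = "cutoff L h"
 define q where "q = (\<lambda>x. ?\<chi> x * z x)"
 have sm: "smooth q" unfolding q_def by (intro smooth_mult smooth_cutoff z)
 have gr: "grad q x = ?\<chi> x *\<^sub>R grad z x + z x *\<^sub>R grad ?\<chi> x" for x
  unfolding q_def by (rule grad_mult[OF smooth_cutoff z(1)])
 let ?K = "cbox (- (L - h/3), - (L - h/3)) (L - h/3, L - h/3) :: plane set"
 have "supp q \<subseteq> ?K"
  unfolding supp_def
 proof (rule closure_minimal)
  show "{x. q x ~= 0} \<subseteq> ?K"
   using cutoff_zero[OF h(1), of L] by (force simp: q_def mem_cbox_plane)
 qed (rule closed_cbox)
 moreover have "?K \<subseteq> square L" using h by (auto simp: mem_cbox_plane mem_square)
 moreover have "compact (supp q)"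
  using compact_Int_closed[OF compact_cbox, of "supp q"] calculation(1) by (metis closed_closure inf.absorb_iff2 supp_def)
 ultimately have test: "test_function (square L) q" using sm by (auto simp: test_function_def)
 let ?i = "\<lambda>x. indicator (lay L h) x :: real"
 note lay = ennreal_sqn_SM(1)[OF _ lay_sets lay_subset, of L _ h]
 have off: "?\<chi> x = 1 \<and> grad ?\<chi> x = 0" if "x \<in> square L" "x \<notin> lay L h" for x
 proof
  let ?A = "{p. \<bar>fst p\<bar> < L - 2 * h / 3} \<inter> {p. \<bar>snd p\<bar> < L - 2 * h / 3} :: plane set"
  have x: "x \<in> ?A" using that h(1) by (auto simp: lay_def)
  have one: "?\<chi> y = 1" if "y \<in> ?A" for y using that by (intro cutoff_one[OF h(1)]) auto
  show "?\<chi> x = 1" by (rule one[OF x])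
  have "((\<lambda>_. 1) has_derivative (\<lambda>v. 0 \<bullet> v)) (at x)" by simp
  then have "(?\<chi> has_derivative (\<lambda>v. 0 \<bullet> v)) (at x)"
  proof (rule has_derivative_transform_within_open)
   show "open ?A" by (intro open_Int open_Collect_less continuous_intros)
  qed (use x one in auto)
  then show "grad ?\<chi> x = 0" by (rule grad_eqI)
 qed
 let ?u1 = "\<lambda>x. ?\<chi> x *\<^sub>R (grad z x - G x)" and ?u2 = "\<lambda>x. (?\<chi> x - 1) *\<^sub>R (?i x *\<^sub>R G x)"
  and ?u3 = "\<lambda>x. (?i x *\<^sub>R z x) *\<^sub>R grad ?\<chi> x"
 have m\<chi>: "?\<chi> \<in> borel_measurable (SM L)" "grad ?\<chi> \<in> borel_measurable (SM L)"
  by (intro continuous_measurable_SM smooth_continuous continuous_grad smooth_cutoff)+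
 note Ld = L2_diff[OF L2_smooth(2)[OF z(1)] LG]
 have unit: "norm (t *\<^sub>R v) <= 1 * norm v" if "\<bar>t\<bar> <= 1" for t and v :: plane
  using that by (simp add: mult_left_le_one_le)
 have n1: "L2 (SM L) ?u1" "nrm (SM L) ?u1 <= 1 * nrm (SM L) (\<lambda>x. grad z x - G x)"
 proof -
  have "AE x in SM L. norm (?u1 x) <= 1 * norm (grad z x - G x)"
   using cutoff_range[of L h] by (intro AE_I2 unit) (simp add: abs_le_iff)
  moreover have "?u1 \<in> borel_measurable (SM L)"
   using L2_measurable[OF Ld] m\<chi> by (intro borel_measurable_scaleR) auto
  ultimately show "L2 (SM L) ?u1" "nrm (SM L) ?u1 <= 1 * nrm (SM L) (\<lambda>x. grad z x - G x)"
   using nrm_mono_AE[OF Ld, of ?u1 1] by simp_all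
 qed
 have n2: "L2 (SM L) ?u2" "nrm (SM L) ?u2 <= 1 * nrm (SM L) (\<lambda>x. ?i x *\<^sub>R G x)"
 proof -
  have "AE x in SM L. norm (?u2 x) <= 1 * norm (?i x *\<^sub>R G x)"
   using cutoff_range[of L h] by (intro AE_I2 unit) (simp add: abs_le_iff)
  moreover have "?u2 \<in> borel_measurable (SM L)"
   using m\<chi> by (intro borel_measurable_scaleR[OF _ L2_measurable[OF lay[OF LG]]]) auto
  ultimately show "L2 (SM L) ?u2" "nrm (SM L) ?u2 <= 1 * nrm (SM L) (\<lambda>x. ?i x *\<^sub>R G x)"
   using nrm_mono_AE[OF lay[OF LG], of ?u2 1] by simp_all
 qed
 have m3: "?u3 \<in> borel_measurable (SM L)"
  by (intro borel_measurable_scaleR[OF L2_measurable[OF lay[OF L2_smooth(1)[OF z(1)]]]] m\<chi>)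
 have n3: "L2 (SM L) ?u3" "nrm (SM L) ?u3 <= (C / h) * nrm (SM L) (\<lambda>x. ?i x *\<^sub>R z x)"
 proof -
  have "norm (?u3 x) <= (C / h) * norm (?i x *\<^sub>R z x)" for x
   using mult_left_mono[OF C(2)[OF h(1), of x], of "norm (?i x *\<^sub>R z x)"] by (simp add: mult.commute)
  then show "L2 (SM L) ?u3" "nrm (SM L) ?u3 <= (C / h) * nrm (SM L) (\<lambda>x. ?i x *\<^sub>R z x)"
   using nrm_mono_AE[OF lay[OF L2_smooth(1)[OF z(1)]] m3, of "C / h"] C(1) h(1) by auto
 qed
 have lphi: "nrm (SM L) (\<lambda>x. ?i x *\<^sub>R z x) <= sqrt (8 * h) * nrm (bdry L) z + 3 * h * nrm (SM L) (\<lambda>x. ?i x *\<^sub>R grad z x)"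
 proof -
  have "nrm (SM L) (\<lambda>x. ?i x *\<^sub>R z x) <= sqrt (8 * h * sqn (bdry L) z + 8 * h^2 * sqn (SM L) (\<lambda>x. ?i x *\<^sub>R grad z x))"
   unfolding nrm_def by (intro real_sqrt_le_mono layer_estimate z h)
  also have "\<dots> <= sqrt (8 * h * sqn (bdry L) z) + sqrt (8 * h^2 * sqn (SM L) (\<lambda>x. ?i x *\<^sub>R grad z x))"
   using h by (intro sqrt_add_le_add_sqrt) auto
  also have "sqrt (8 * h * sqn (bdry L) z) = sqrt (8 * h) * nrm (bdry L) z" by (simp add: real_sqrt_mult nrm_def)
  also have "sqrt (8 * h^2 * sqn (SM L) (\<lambda>x. ?i x *\<^sub>R grad z x)) = sqrt 8 * h * nrm (SM L) (\<lambda>x. ?i x *\<^sub>R grad z x)"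
   using h by (simp add: real_sqrt_mult nrm_def)
  also have "\<dots> <= 3 * h * nrm (SM L) (\<lambda>x. ?i x *\<^sub>R grad z x)"
   using h real_sqrt_le_mono[of 8 9] by (intro mult_right_mono) auto
  finally show ?thesis by simp
 qed
 have lgrad: "nrm (SM L) (\<lambda>x. ?i x *\<^sub>R grad z x) <= e / (4 * c) + e / (4 * c)"
 proof -
  have "nrm (SM L) (\<lambda>x. ?i x *\<^sub>R grad z x) <= nrm (SM L) (\<lambda>x. ?i x *\<^sub>R G x) + nrm (SM L) (\<lambda>x. ?i x *\<^sub>R grad z x - ?i x *\<^sub>R G x)"
   by (rule nrm_triangle_sub[OF lay[OF L2_smooth(2)[OF z(1)]] lay[OF LG]])
  also have "nrm (SM L) (\<lambda>x. ?i x *\<^sub>R grad z x - ?i x *\<^sub>R G x) <= 1 * nrm (SM L) (\<lambda>x. grad z x - G x)"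
   by (rule nrm_mono_AE(2)[OF Ld])
    (use L2_measurable[OF lay[OF Ld]] in \<open>auto simp: scaleR_diff_right indicator_def intro!: AE_I2\<close>)
  finally show ?thesis using w z(2) by (simp add: \<eta>_def)
 qed
 have eq: "AE x in SM L. grad q x - G x = (?u1 x + ?u2 x) + ?u3 x"
 proof (rule AE_I2)
  fix x assume "x \<in> space (SM L)"
  then have x: "x \<in> square L" by (simp add: space_restrict_space)
  show "grad q x - G x = (?u1 x + ?u2 x) + ?u3 x"
   using off[OF x] by (cases "x \<in> lay L h") (simp_all add: gr algebra_simps)
 qed
 have "nrm (SM L) (\<lambda>x. grad q x - G x) <= 1 * nrm (SM L) (\<lambda>x. (?u1 x + ?u2 x) + ?u3 x)"
  by (rule nrm_mono_AE(2)[OF L2_add[OF L2_add[OF n1(1) n2(1)] n3(1)]])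
   (use eq L2_measurable[OF L2_diff[OF L2_smooth(2)[OF sm] LG]] in \<open>auto elim: eventually_mono\<close>)
 also have "\<dots> <= nrm (SM L) ?u1 + nrm (SM L) ?u2 + nrm (SM L) ?u3"
  using nrm_triangle[OF L2_add[OF n1(1) n2(1)] n3(1)] nrm_triangle[OF n1(1) n2(1)] by linarith
 also have "\<dots> < e / (4 * c) + e / (4 * c) + (C / h) * (sqrt (8 * h) * \<eta> + 3 * h * (e / (4 * c) + e / (4 * c)))"
 proof -
  have "nrm (SM L) ?u1 < e / (4 * c)" using n1(2) z(2) by (simp add: \<eta>_def)
  moreover have "nrm (SM L) ?u2 < e / (4 * c)" using n2(2) w by simp
  moreover have "sqrt (8 * h) * nrm (bdry L) z + 3 * h * nrm (SM L) (\<lambda>x. ?i x *\<^sub>R grad z x)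
    <= sqrt (8 * h) * \<eta> + 3 * h * (e / (4 * c) + e / (4 * c))"
   using lgrad z(3) h by (intro add_mono mult_left_mono) auto
  then have "nrm (SM L) ?u3 <= (C / h) * (sqrt (8 * h) * \<eta> + 3 * h * (e / (4 * c) + e / (4 * c)))"
   using n3(2) lphi C(1) h(1) by (meson divide_nonneg_pos mult_left_mono order_trans)
  ultimately show ?thesis by linarith
 qed
 also have "\<dots> <= e"
 proof -
  have "(C / h) * (sqrt (8 * h) * \<eta>) <= (C / h) * (sqrt (8 * h) * (e * h / (4 * (1 + C) * sqrt (8 * h))))"
   using C(1) h(1) by (intro mult_left_mono) (auto simp: \<eta>_def)
  also have "\<dots> = (C / (1 + C)) * (e / 4)"
  proof -
   have "(C / h) * (s * (e * h / (4 * k * s))) = (C / k) * (e / 4)" if "0 < s" "0 < k" for s k :: real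
    using that h(1) by (simp add: field_simps)
   from this[of "sqrt (8 * h)" "1 + C"] show ?thesis using h(1) C(1) by simp
  qed
  also have "\<dots> <= 1 * (e / 4)" using C(1) e by (intro mult_right_mono) auto
  finally have 1: "(C / h) * (sqrt (8 * h) * \<eta>) <= e / 4" by simp
  have "e / (4 * c) + e / (4 * c) + (C / h) * (3 * h * (e / (4 * c) + e / (4 * c))) = c * (e / (4 * c) + e / (4 * c))"
  proof -
   have "X + (C / h) * (3 * h * X) = c * X" for X using h(1) by (simp add: c_def field_simps)
   then show ?thesis .
  qed
  also have "\<dots> = e / 2" using c by (simp add: field_simps)
  finally have 2: "e / (4 * c) + e / (4 * c) + (C / h) * (3 * h * (e / (4 * c) + e / (4 * c))) = e / 2" .
  show ?thesis unfolding distrib_left[of "C / h"] using 1 2 e by linarith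
 qed
 finally show ?thesis using test by blast
qed

subsection \<open>Functions with a given trace\<close>

lemma locally_integrable_measurable:
 fixes G :: "plane => 'b::euclidean_space"
 assumes "locally_integrable (square L) G" shows "G \<in> borel_measurable (SM L)"
proof (rule borel_measurable_LIMSEQ_metric)
 let ?r = "\<lambda>n. L - 1 / real (Suc n)"
 let ?K = "\<lambda>n. cbox (- ?r n, - ?r n) (?r n, ?r n) :: plane set"
 have sub: "?K n \<subseteq> square L" for n
 proof
  fix x assume "x \<in> ?K n"
  moreover have "0 < 1 / real (Suc n)" by simp
  ultimately show "x \<in> square L" unfolding mem_square mem_cbox_plane fst_conv snd_conv by linarith
 qed
 show "(\<lambda>x. indicator (?K n) x *\<^sub>R G x) \<in> borel_measurable (SM L)" for n
 proof -
  have "integrable lebesgue (\<lambda>x. indicator (?K n) x *\<^sub>R G x)"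
   using assms sub[of n] compact_cbox[of "(- ?r n, - ?r n)" "(?r n, ?r n)"]
   unfolding locally_integrable_def set_integrable_def by (elim allE[of _ "?K n"]) simp
  then show ?thesis by (intro measurable_restrict_space1 borel_measurable_integrable)
 qed
 fix x assume "x \<in> space (SM L)"
 then have x: "\<bar>fst x\<bar> < L" "\<bar>snd x\<bar> < L" by (auto simp: space_restrict_space mem_square)
 define m where "m = min (L - \<bar>fst x\<bar>) (L - \<bar>snd x\<bar>)"
 have "(\<lambda>n. 1 / real (Suc n)) \<longlonglongrightarrow> 0"
  using LIMSEQ_inverse_real_of_nat by (simp add: inverse_eq_divide)
 then have "\<forall>\<^sub>F n in sequentially. 1 / real (Suc n) < m"
  using x by (intro order_tendstoD) (auto simp: m_def)
 then have "\<forall>\<^sub>F n in sequentially. indicator (?K n) x *\<^sub>R G x = G x"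
 proof eventually_elim
  case (elim n)
  then have "1 / real (Suc n) < L - \<bar>fst x\<bar>" "1 / real (Suc n) < L - \<bar>snd x\<bar>" by (simp_all add: m_def)
  then have "x \<in> ?K n" unfolding mem_cbox_plane fst_conv snd_conv by linarith
  then show ?case by simp
 qed
 then show "(\<lambda>n. indicator (?K n) x *\<^sub>R G x) \<longlonglongrightarrow> G x" by (rule tendsto_eventually)
qed

lemma wgrad_eq:
 assumes "weak_gradient (square L) u G"
 shows "AE x in SM L. wgrad (square L) u x = G x" "wgrad (square L) u \<in> borel_measurable (SM L)"
proof -
 have w: "weak_gradient (square L) u (wgrad (square L) u)"
  unfolding wgrad_def by (rule someI[of "weak_gradient (square L) u", OF assms])
 show "AE x in SM L. wgrad (square L) u x = G x" by (rule weak_gradient_unique[OF w assms])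
 show "wgrad (square L) u \<in> borel_measurable (SM L)"
  using w by (intro locally_integrable_measurable) (simp add: weak_gradient_def)
qed

lemma wgrad_L2: assumes "u \<in> H1 (square L)" shows "L2 (SM L) (wgrad (square L) u)"
proof -
 obtain G where G: "weak_gradient (square L) u G" "L2 (SM L) G" using assms by (auto simp: H1_def)
 show ?thesis using L2_cong_AE[OF wgrad_eq(1)[OF G(1)] wgrad_eq(2)[OF G(1)] L2_measurable[OF G(2)]] G(2) by simp
qed

lemma nrm_cong_AE:
 assumes "AE x in M. u x = v x" "u \<in> borel_measurable M" "v \<in> borel_measurable M" shows "nrm M u = nrm M v"
 unfolding nrm_def sqn_def
 by (intro arg_cong[where f=sqrt] integral_cong_AE) (use assms in \<open>auto elim: eventually_mono\<close>)

lemma has_trace_trace_grad: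
 assumes "has_trace L u f" shows "trace_grad L f (wgrad (square L) u)"
 unfolding trace_grad_def
proof (intro conjI allI impI)
 show "L2 (SM L) (wgrad (square L) u)" using assms wgrad_L2 by (auto simp: has_trace_def)
 fix e :: real assume e: "0 < e"
 obtain z :: "nat => plane => real" where z: "\<And>n. smooth (z n)"
  "(\<lambda>n. sqn (SM L) (\<lambda>x. grad (z n) x - wgrad (square L) u x)) \<longlonglongrightarrow> 0" "(\<lambda>n. sqn (bdry L) (\<lambda>x. z n x - f x)) \<longlonglongrightarrow> 0"
  using assms unfolding has_trace_def sqn_def real_norm_def power2_abs by blast
 have "(\<lambda>n. nrm (SM L) (\<lambda>x. grad (z n) x - wgrad (square L) u x)) \<longlonglongrightarrow> sqrt 0"
  "(\<lambda>n. nrm (bdry L) (\<lambda>x. z n x - f x)) \<longlonglongrightarrow> sqrt 0"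
  unfolding nrm_def by (intro tendsto_intros z)+
 then have "\<forall>\<^sub>F n in sequentially. nrm (SM L) (\<lambda>x. grad (z n) x - wgrad (square L) u x) < e"
  "\<forall>\<^sub>F n in sequentially. nrm (bdry L) (\<lambda>x. z n x - f x) < e"
  using e by (auto intro!: order_tendstoD(2))
 then have "\<forall>\<^sub>F n in sequentially. nrm (SM L) (\<lambda>x. grad (z n) x - wgrad (square L) u x) < e \<and> nrm (bdry L) (\<lambda>x. z n x - f x) < e"
  by eventually_elim simp
 then show "\<exists>z. smooth z \<and> nrm (SM L) (\<lambda>x. grad z x - wgrad (square L) u x) < e \<and> nrm (bdry L) (\<lambda>x. z x - f x) < e"
  using z(1) by (auto simp: eventually_sequentially)
qed

text \<open>The Poincare inequality makes the functions converge along with their gradients.\<close>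

lemma trace_grad_has_trace:
 assumes L: "0 < L" and f: "L2 (bdry L) f" and t: "trace_grad L f G"
 shows "\<exists>u. has_trace L u f \<and> (AE x in SM L. wgrad (square L) u x = G x)"
proof -
 note G = trace_grad_L2[OF t]
 have "\<exists>z. smooth z \<and> nrm (SM L) (\<lambda>x. grad z x - G x) < inverse (real (Suc n)) \<and> nrm (bdry L) (\<lambda>x. z x - f x) < inverse (real (Suc n))" for n
  using t unfolding trace_grad_def by (elim conjE allE[of _ "inverse (real (Suc n))"]) simp
 then obtain z where z: "\<And>n. smooth (z n)" "\<And>n. nrm (SM L) (\<lambda>x. grad (z n) x - G x) < inverse (real (Suc n))"
  "\<And>n. nrm (bdry L) (\<lambda>x. z n x - f x) < inverse (real (Suc n))" by metis
 have Lg: "L2 (SM L) (grad (z n))" "L2 (SM L) (z n)" "L2 (bdry L) (z n)" for n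
  by (rule L2_smooth(2)[OF z(1)], rule L2_smooth(1)[OF z(1)], rule L2_smooth(3)[OF z(1) L])
 have sq: "(\<lambda>n. sqn M (\<lambda>x. h n x)) \<longlonglongrightarrow> 0" if "\<And>n. nrm M (h n) < inverse (real (Suc n))" for M :: "plane measure" and h :: "nat => plane => 'b::euclidean_space"
 proof -
  have "(\<lambda>n. nrm M (h n)) \<longlonglongrightarrow> 0"
   by (rule tendsto_sandwich[OF _ _ tendsto_const LIMSEQ_inverse_real_of_nat]) (use that in \<open>auto intro!: always_eventually less_imp_le\<close>)
  then have "(\<lambda>n. (nrm M (h n))^2) \<longlonglongrightarrow> 0^2" by (intro tendsto_intros)
  then show ?thesis by (simp add: nrm_sq)
 qed
 define c where "c = 8 * L * 2 + 16 * L^2 * 2"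
 have c: "0 < c" using L by (simp add: c_def add_pos_pos)
 have small: "\<exists>N. \<forall>m\<ge>N. \<forall>n\<ge>N. sqn (SM L) (\<lambda>x. z m x - z n x) < e" if e: "0 < e" for e
 proof -
  have "(\<lambda>n. (inverse (real (Suc n)))^2) \<longlonglongrightarrow> 0^2" by (intro tendsto_intros LIMSEQ_inverse_real_of_nat)
  then have "\<forall>\<^sub>F n in sequentially. (inverse (real (Suc n)))^2 < e / c"
   by (rule order_tendstoD(2)) (use e c in simp)
  then obtain N where N: "\<And>n. N <= n ==> (inverse (real (Suc n)))^2 < e / c" by (auto simp: eventually_sequentially)
  have "sqn (SM L) (\<lambda>x. z m x - z n x) < e" if "N <= m" "N <= n" for m n
  proof -
   define r where "r = inverse (real (Suc N))"
   have r: "nrm M (h k) < r" if "N <= k" "\<And>n. nrm M (h n) < inverse (real (Suc n))" for M :: "plane measure" and h :: "nat => plane => 'b::euclidean_space" and k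
   proof -
    have "inverse (real (Suc k)) <= r" unfolding r_def by (rule le_imp_inverse_le) (use that(1) in auto)
    then show ?thesis using that(2)[of k] by linarith
   qed
   have "nrm (bdry L) (\<lambda>x. z m x - z n x) <= r + r"
    using nrm_triangle_diff[OF Lg(3)[of m] f Lg(3)[of n]] r[OF that(1) z(3)] r[OF that(2) z(3)] nrm_diff_commute[of "bdry L" f "z n"] by linarith
   then have b: "sqn (bdry L) (\<lambda>x. z m x - z n x) <= (r + r)^2"
    unfolding nrm_sq[symmetric] by (intro power_mono) auto
   have "nrm (SM L) (\<lambda>x. grad (z m) x - grad (z n) x) <= r + r"
    using nrm_triangle_diff[OF Lg(1)[of m] G Lg(1)[of n]] r[OF that(1) z(2)] r[OF that(2) z(2)] nrm_diff_commute[of "SM L" G "grad (z n)"] by linarith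
   then have g: "sqn (SM L) (\<lambda>x. grad (z m) x - grad (z n) x) <= (r + r)^2"
    unfolding nrm_sq[symmetric] by (intro power_mono) auto
   have "sqn (SM L) (\<lambda>x. z m x - z n x) <= 4 * L * sqn (bdry L) (\<lambda>x. z m x - z n x)
     + 8 * L^2 * sqn (SM L) (\<lambda>x. grad (z m) x - grad (z n) x)"
   proof -
    have "grad (\<lambda>x. z m x - z n x) = (\<lambda>x. grad (z m) x - grad (z n) x)"
     by (rule ext) (rule grad_diff[OF z(1) z(1)])
    then show ?thesis using poincare[OF smooth_diff[OF z(1)[of m] z(1)[of n]] L] by (simp only:)
   qed
   also have "\<dots> <= 4 * L * (r + r)^2 + 8 * L^2 * (r + r)^2"
    using b g L by (intro add_mono mult_left_mono) auto
   also have "\<dots> = c * r^2" by (simp add: c_def power2_eq_square algebra_simps)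
   also have "\<dots> < e" using N[of N] c by (simp add: r_def pos_less_divide_eq mult.commute)
   finally show ?thesis .
  qed
  then show ?thesis by blast
 qed
 obtain u where u: "L2 (SM L) u" "(\<lambda>n. sqn (SM L) (\<lambda>x. z n x - u x)) \<longlonglongrightarrow> 0"
  using L2_complete[OF Lg(2) small] by blast
 have wg: "weak_gradient (square L) u G"
  by (rule weak_gradient_limit[OF u(1) G z(1) u(2) sq[OF z(2)]])
 have "(\<lambda>n. sqn (SM L) (\<lambda>x. grad (z n) x - wgrad (square L) u x)) \<longlonglongrightarrow> 0"
 proof -
  have "sqn (SM L) (\<lambda>x. grad (z n) x - wgrad (square L) u x) = sqn (SM L) (\<lambda>x. grad (z n) x - G x)" for n
   unfolding nrm_sq[symmetric]
   by (rule arg_cong[where f="\<lambda>t. t^2"], rule nrm_cong_AE)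
    (use wgrad_eq[OF wg] L2_measurable[OF Lg(1)] L2_measurable[OF G] in \<open>auto elim: eventually_mono\<close>)
  then show ?thesis using sq[OF z(2)] by simp
 qed
 moreover have "u \<in> H1 (square L)" using u(1) wg G by (auto simp: H1_def)
 ultimately have "has_trace L u f"
  unfolding has_trace_def using f z(1) u(2) sq[OF z(3)] unfolding sqn_def by (auto intro!: exI[of _ z])
 then show ?thesis using wgrad_eq(1)[OF wg] by blast
qed

section \<open>The Dirichlet problem and the Dirichlet to Neumann form\<close>

locale coefficient =
 fixes L :: real and a :: "plane => real" and \<kappa> \<Lambda> :: real
 assumes L: "0 < L" and a: "a \<in> borel_measurable (SM L)" and \<kappa>: "0 < \<kappa>"
  and bounds: "AE x in SM L. \<kappa> <= a x \<and> a x <= \<Lambda>"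
begin

definition form :: "(plane => plane) => (plane => plane) => real" where
 "form G H = (LINT x|SM L. a x * (G x \<bullet> H x))"

definition solves :: "(plane => real) => (plane => plane) => bool" where
 "solves f G \<longleftrightarrow> trace_grad L f G \<and> (\<forall>H. trace_grad L (\<lambda>_. 0) H --> form G H = 0)"

lemma form_bound:
 assumes "L2 (SM L) G" "L2 (SM L) H"
 shows "integrable (SM L) (\<lambda>x. a x * (G x \<bullet> H x))" "\<bar>form G H\<bar> <= \<bar>\<Lambda>\<bar> * (nrm (SM L) G * nrm (SM L) H)"
proof -
 have m: "(\<lambda>x. a x * (G x \<bullet> H x)) \<in> borel_measurable (SM L)"
  using a L2_measurable[OF assms(1)] L2_measurable[OF assms(2)] by measurable
 have "AE x in SM L. \<bar>a x * (G x \<bullet> H x)\<bar> <= \<bar>\<Lambda>\<bar> * (norm (G x) * norm (H x))"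
  using bounds by eventually_elim (use \<kappa> in \<open>auto simp: abs_mult intro!: mult_mono Cauchy_Schwarz_ineq2\<close>)
 from integral_bilinear_bound[OF assms m this]
 show "integrable (SM L) (\<lambda>x. a x * (G x \<bullet> H x))" "\<bar>form G H\<bar> <= \<bar>\<Lambda>\<bar> * (nrm (SM L) G * nrm (SM L) H)"
  by (auto simp: form_def)
qed

lemma form_commute: "form G H = form H G" by (simp add: form_def inner_commute)

lemma form_add: assumes "L2 (SM L) G" "L2 (SM L) H" "L2 (SM L) K"
 shows "form (\<lambda>x. G x + c *\<^sub>R H x) K = form G K + c * form H K"
 using form_bound(1)[OF assms(1,3)] form_bound(1)[OF assms(2,3)]
 by (simp add: form_def inner_add_left distrib_left mult.left_commute)

lemma form_diff: assumes "L2 (SM L) G" "L2 (SM L) H" "L2 (SM L) K"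
 shows "form (\<lambda>x. G x - H x) K = form G K - form H K"
 using form_add[OF assms, of "-1"] by simp

lemma form_add_right: assumes "L2 (SM L) G" "L2 (SM L) H" "L2 (SM L) K"
 shows "form K (\<lambda>x. G x + c *\<^sub>R H x) = form K G + c * form K H"
 using form_add[OF assms, of c] by (simp add: form_commute[of K])

lemma form_diff_right: assumes "L2 (SM L) G" "L2 (SM L) H" "L2 (SM L) K"
 shows "form K (\<lambda>x. G x - H x) = form K G - form K H"
 using form_diff[OF assms] by (simp add: form_commute[of K])

lemma form_coercive: assumes "L2 (SM L) G" shows "\<kappa> * sqn (SM L) G <= form G G"
 unfolding form_def sqn_inner Bochner_Integration.integral_mult_right_zero[symmetric]
 by (rule integral_mono_AE)
  (use bounds form_bound(1)[OF assms assms] L2_inner_integrable[OF assms assms] in \<open>auto elim!: eventually_mono intro!: mult_right_mono simp: inner_ge_zero\<close>)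

lemma form_tendsto:
 assumes "\<And>n. L2 (SM L) (Gn n)" "L2 (SM L) G" "L2 (SM L) H" "(\<lambda>n. sqn (SM L) (\<lambda>x. Gn n x - G x)) \<longlonglongrightarrow> 0"
 shows "(\<lambda>n. form (Gn n) H) \<longlonglongrightarrow> form G H"
proof -
 have "(\<lambda>n. form (Gn n) H - form G H) \<longlonglongrightarrow> 0"
 proof (rule Lim_null_comparison)
  show "\<forall>\<^sub>F n in sequentially. norm (form (Gn n) H - form G H) <= \<bar>\<Lambda>\<bar> * (nrm (SM L) (\<lambda>x. Gn n x - G x) * nrm (SM L) H)"
   using form_bound(2)[OF L2_diff[OF assms(1,2)] assms(3)] form_diff[OF assms(1-3)] by (auto intro!: always_eventually)
  have "(\<lambda>n. nrm (SM L) (\<lambda>x. Gn n x - G x)) \<longlonglongrightarrow> sqrt 0" unfolding nrm_def by (intro tendsto_intros assms)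
  then show "(\<lambda>n. \<bar>\<Lambda>\<bar> * (nrm (SM L) (\<lambda>x. Gn n x - G x) * nrm (SM L) H)) \<longlonglongrightarrow> 0"
   by (auto intro!: tendsto_eq_intros)
 qed
 then show ?thesis by (simp add: LIM_zero_iff)
qed

text \<open>Elements of almost minimal energy of a decreasing sequence of midpoint convex sets form a Cauchy
 sequence, by the parallelogram law.\<close>

lemma minimizing_limit:
 fixes S :: "nat => (plane => plane) set"
 assumes dec: "\<And>n j. n <= j ==> S j \<subseteq> S n" and LS: "\<And>n G. G \<in> S n ==> L2 (SM L) G"
  and mid: "\<And>n G H. G \<in> S n ==> H \<in> S n ==> (\<lambda>x. (1/2) *\<^sub>R (G x + H x)) \<in> S n"
  and K: "\<And>n. \<exists>G\<in>S n. form G G <= K"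
 shows "\<exists>m u G. (\<forall>n. u n \<in> S n \<and> form (u n) (u n) < m n + inverse (real (Suc n)) \<and> m n <= K \<and> (\<forall>H\<in>S n. m n <= form H H))
  \<and> L2 (SM L) G \<and> (\<lambda>n. sqn (SM L) (\<lambda>x. u n x - G x)) \<longlonglongrightarrow> 0"
proof -
 let ?i = "\<lambda>n. inverse (real (Suc n))"
 define m where "m n = (INF G\<in>S n. form G G)" for n
 have iS: "?i j <= ?i n" if "n <= j" for n j :: nat by (rule le_imp_inverse_le) (use that in auto)
 have nn: "0 <= form G G" if "L2 (SM L) G" for G
  using form_coercive[OF that] \<kappa> by (meson less_eq_real_def mult_nonneg_nonneg order_trans sqn_nonneg)
 have bdd: "bdd_below ((\<lambda>G. form G G) ` S n)" for n using nn LS by (intro bdd_belowI[of _ 0]) auto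
 have ne: "S n ~= {}" for n using K by blast
 have low: "m n <= form G G" if "G \<in> S n" for n G unfolding m_def by (rule cINF_lower[OF bdd that])
 have mK: "m n <= K" for n using K[of n] low by (meson order_trans)
 have inc: "m n <= m j" if "n <= j" for n j unfolding m_def by (rule cINF_superset_mono[OF ne bdd dec[OF that]]) simp
 obtain M where M: "m \<longlonglongrightarrow> M" "\<And>n. m n <= M"
  using incseq_convergent[of m K] inc mK by (auto simp: incseq_def)
 have "\<exists>G\<in>S n. form G G < m n + ?i n" for n
  using cInf_lessD[of "(\<lambda>G. form G G) ` S n" "m n + ?i n"] ne[of n] unfolding m_def by auto
 then obtain u where u: "\<And>n. u n \<in> S n" "\<And>n. form (u n) (u n) < m n + ?i n" by metis
 note LG = LS[OF u(1)]
 have gap: "\<kappa> * sqn (SM L) (\<lambda>x. u n x - u j x) <= 2 * (M - m n) + 4 * ?i n" if nj: "n <= j" for n j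
 proof -
  let ?P = "\<lambda>x. u n x + 1 *\<^sub>R u j x" and ?D = "\<lambda>x. u n x - u j x"
  have LP: "L2 (SM L) ?P" by (rule L2_add[OF LG L2_scaleR[OF LG]])
  note LD = L2_diff[OF LG[of n] LG[of j]]
  have "u j \<in> S n" using u(1)[of j] dec[OF nj] by blast
  from low[OF mid[OF u(1) this]] have "4 * m n <= form ?P ?P" by (simp add: form_def)
  moreover have "form ?P ?P = form (u n) (u n) + 2 * form (u n) (u j) + form (u j) (u j)"
   unfolding form_add[OF LG LG LP] form_add_right[OF LG LG LG] using form_commute[of "u j" "u n"] by simp
  moreover have "form ?D ?D = form (u n) (u n) - 2 * form (u n) (u j) + form (u j) (u j)"
   unfolding form_diff[OF LG LG LD] form_diff_right[OF LG LG LG] using form_commute[of "u j" "u n"] by simp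
  ultimately show ?thesis
   unfolding right_diff_distrib using form_coercive[OF LD] u(2)[of n] u(2)[of j] M(2)[of j] iS[OF nj] by linarith
 qed
 have "\<exists>N. \<forall>j\<ge>N. \<forall>n\<ge>N. sqn (SM L) (\<lambda>x. u j x - u n x) < e" if e: "0 < e" for e
 proof -
  have "(\<lambda>n. 2 * (M - m n) + 4 * ?i n) \<longlonglongrightarrow> 2 * (M - M) + 4 * 0" by (intro tendsto_intros M LIMSEQ_inverse_real_of_nat)
  then have "\<forall>\<^sub>F n in sequentially. 2 * (M - m n) + 4 * ?i n < \<kappa> * e" using e \<kappa> by (intro order_tendstoD(2)) auto
  then obtain N where N: "\<And>n. N <= n ==> 2 * (M - m n) + 4 * ?i n < \<kappa> * e" by (auto simp: eventually_sequentially)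
  have lt: "sqn (SM L) (\<lambda>x. u n x - u j x) < e" if "N <= n" "n <= j" for j n
   using le_less_trans[OF gap[OF that(2)] N[OF that(1)]] \<kappa> by simp
  have "sqn (SM L) (\<lambda>x. u j x - u n x) < e" if "N <= j" "N <= n" for j n
  proof (cases "n <= j")
   case True
   then show ?thesis using lt[OF that(2) True] unfolding nrm_sq[symmetric] nrm_diff_commute[of _ "u j"] by simp
  qed (use lt[of j n] that in simp)
  then show ?thesis by blast
 qed
 from L2_complete[OF LG this] obtain G where "L2 (SM L) G" "(\<lambda>n. sqn (SM L) (\<lambda>x. u n x - G x)) \<longlonglongrightarrow> 0" by blast
 then show ?thesis using u mK low by blast
qed

lemma solution_exists:
 assumes f: "L2 (bdry L) f" and t: "trace_grad L f G0"
 shows "\<exists>G. solves f G"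
proof -
 let ?S = "{G. trace_grad L f G}"
 have mid: "(\<lambda>x. (1/2) *\<^sub>R (G x + H x)) \<in> ?S" if "G \<in> ?S" "H \<in> ?S" for G H
 proof -
  have "trace_grad L f (\<lambda>x. G x + (1/2) *\<^sub>R (H x - G x))"
   by (rule trace_grad_add_zero[OF L f _ trace_grad_diff[OF L f]]) (use that in auto)
  moreover have "(\<lambda>x. G x + (1/2) *\<^sub>R (H x - G x)) = (\<lambda>x. (1/2) *\<^sub>R (G x + H x))"
   by (simp add: fun_eq_iff prod_eq_iff field_simps)
  ultimately show ?thesis by simp
 qed
 have "\<exists>m u G. (\<forall>n. u n \<in> ?S \<and> form (u n) (u n) < m n + inverse (real (Suc n)) \<and> m n <= form G0 G0 \<and> (\<forall>H\<in>?S. m n <= form H H))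
  \<and> L2 (SM L) G \<and> (\<lambda>n. sqn (SM L) (\<lambda>x. u n x - G x)) \<longlonglongrightarrow> 0"
  by (rule minimizing_limit) (use t trace_grad_L2 mid in auto)
 then obtain m Gn G where Gn: "\<And>n. trace_grad L f (Gn n)" "\<And>n. form (Gn n) (Gn n) < m n + inverse (real (Suc n))"
  and lower: "\<And>n H. trace_grad L f H ==> m n <= form H H"
  and G: "L2 (SM L) G" "(\<lambda>n. sqn (SM L) (\<lambda>x. Gn n x - G x)) \<longlonglongrightarrow> 0"
  by (simp del: of_nat_Suc) blast
 note LG = trace_grad_L2[OF Gn(1)]
 have tG: "trace_grad L f G" by (rule trace_grad_closed[OF G(1) Gn(1) G(2)])
 have "form G H = 0" if H: "trace_grad L (\<lambda>_. 0) H" for H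
 proof -
  note LH = trace_grad_L2[OF H]
  have q: "0 <= 2 * t * form G H + t^2 * form H H" for t
  proof (rule LIMSEQ_le)
   show "(\<lambda>n. - inverse (real (Suc n))) \<longlonglongrightarrow> 0" using tendsto_minus[OF LIMSEQ_inverse_real_of_nat] by simp
   show "(\<lambda>n. 2 * t * form (Gn n) H + t^2 * form H H) \<longlonglongrightarrow> 2 * t * form G H + t^2 * form H H"
    by (intro tendsto_intros form_tendsto LG G LH)
   have "- inverse (real (Suc n)) <= 2 * t * form (Gn n) H + t^2 * form H H" for n
   proof -
    have "m n <= form (\<lambda>x. Gn n x + t *\<^sub>R H x) (\<lambda>x. Gn n x + t *\<^sub>R H x)"
     by (intro lower trace_grad_add_zero L f Gn H)
    also have "\<dots> = form (Gn n) (Gn n) + 2 * t * form (Gn n) H + t^2 * form H H"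
     by (simp add: form_add form_add_right LG LH L2_scaleR L2_add form_commute[of H "Gn n"] power2_eq_square algebra_simps)
    finally show ?thesis using Gn(2)[of n] by linarith
   qed
   then show "\<exists>N. \<forall>n\<ge>N. - inverse (real (Suc n)) <= 2 * t * form (Gn n) H + t^2 * form H H" by blast
  qed
  have h: "0 <= form H H" using form_coercive[OF LH] \<kappa> by (meson less_eq_real_def mult_nonneg_nonneg order_trans sqn_nonneg)
  show ?thesis
  proof (cases "form H H = 0")
   case True then show ?thesis using q[of 1] q[of "-1"] by simp
  next
   case False
   then have "0 < form H H" using h by simp
   then have "(form G H)^2 <= 0" using q[of "- form G H / form H H"] by (simp add: power2_eq_square field_simps)
   then show ?thesis by simp
  qed
 qed
 then show ?thesis using tG unfolding solves_def by blast
qed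

lemma solution_unique:
 assumes f: "L2 (bdry L) f" and s: "solves f G" "solves f G'" shows "nrm (SM L) (\<lambda>x. G x - G' x) = 0"
proof -
 have t: "trace_grad L f G" "trace_grad L f G'" using s by (auto simp: solves_def)
 have z: "trace_grad L (\<lambda>_. 0) (\<lambda>x. G x - G' x)" by (rule trace_grad_diff[OF L f t])
 have "form (\<lambda>x. G x - G' x) (\<lambda>x. G x - G' x) = form G (\<lambda>x. G x - G' x) - form G' (\<lambda>x. G x - G' x)"
  by (rule form_diff) (use t z trace_grad_L2 in blast)+
 also have "\<dots> = 0" using s z by (auto simp: solves_def)
 finally have "\<kappa> * sqn (SM L) (\<lambda>x. G x - G' x) <= 0" using form_coercive[OF trace_grad_L2[OF z]] by simp
 then have "sqn (SM L) (\<lambda>x. G x - G' x) <= 0" using \<kappa> by (simp add: mult_le_0_iff)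
 then show ?thesis using sqn_nonneg[of "SM L" "\<lambda>x. G x - G' x"] by (simp add: nrm_def)
qed

lemma form_solution_trace:
 assumes g: "L2 (bdry L) g" and s: "solves f G" and t: "trace_grad L g H" "trace_grad L g H'"
 shows "form G H = form G H'"
proof -
 have z: "trace_grad L (\<lambda>_. 0) (\<lambda>x. H x - H' x)" by (rule trace_grad_diff[OF L g t])
 have "form G (\<lambda>x. H x - H' x) = form G H - form G H'"
  by (rule form_diff_right) (use t s trace_grad_L2 in \<open>auto simp: solves_def\<close>)
 then show ?thesis using s z by (simp add: solves_def)
qed

text \<open>Test functions are dense among the gradients with zero trace, so a weak solution has the gradient of the
 minimiser, and the form does not distinguish two extensions of \<open>g\<close>.\<close>

lemma DN_eq_form:
 assumes f: "L2 (bdry L) f" and g: "L2 (bdry L) g" and s: "solves f G" and H: "trace_grad L g H"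
 shows "DN L a f g = form G H"
proof -
 have tG: "trace_grad L f G" using s by (simp add: solves_def)
 obtain u0 where u0: "has_trace L u0 f" "AE x in SM L. wgrad (square L) u0 x = G x"
  using trace_grad_has_trace[OF L f tG] by blast
 have test0: "form G (grad z) = 0" if "test_function (square L) z" for z
  using s trace_grad_test[OF L that] by (simp add: solves_def)
 have "weak_solution (square L) a u0"
  unfolding weak_solution_def
 proof (intro conjI allI impI)
  show H1: "u0 \<in> H1 (square L)" using u0(1) by (simp add: has_trace_def)
  fix z assume z: "test_function (square L) z"
  have Lp: "L2 (SM L) (grad z)" by (rule L2_smooth(2)[OF test_function_smooth[OF z]])
  have "(LINT x|SM L. a x * (wgrad (square L) u0 x \<bullet> grad z x)) = form G (grad z)"
   unfolding form_def
   by (rule integral_cong_AE)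
    (use u0(2) borel_measurable_integrable[OF form_bound(1)[OF wgrad_L2[OF H1] Lp]]
     borel_measurable_integrable[OF form_bound(1)[OF trace_grad_L2[OF tG] Lp]] in \<open>auto elim: eventually_mono\<close>)
  then show "(LINT x|SM L. a x * (wgrad (square L) u0 x \<bullet> grad z x)) = 0" using test0[OF z] by simp
 qed
 with u0(1) have ex: "\<exists>u. weak_solution (square L) a u \<and> has_trace L u f" by blast
 define u where "u = dirichlet_solution L a f"
 have u: "weak_solution (square L) a u" "has_trace L u f"
  using someI_ex[OF ex] unfolding u_def dirichlet_solution_def by auto
 define U where "U = wgrad (square L) u"
 have tU: "trace_grad L f U" unfolding U_def by (rule has_trace_trace_grad[OF u(2)])
 note LU = trace_grad_L2[OF tU]
 have sU: "solves f U"
  unfolding solves_def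
 proof (intro conjI tU allI impI)
  fix K assume K: "trace_grad L (\<lambda>_. 0) K"
  note LK = trace_grad_L2[OF K]
  have "\<exists>q. test_function (square L) q \<and> nrm (SM L) (\<lambda>x. grad q x - K x) < inverse (real (Suc n))" for n
   by (rule zero_trace_approx[OF L K]) simp
  then obtain q where q: "\<And>n. test_function (square L) (q n)" "\<And>n. nrm (SM L) (\<lambda>x. grad (q n) x - K x) < inverse (real (Suc n))"
   by metis
  have "(\<lambda>n. nrm (SM L) (\<lambda>x. grad (q n) x - K x)) \<longlonglongrightarrow> 0"
   by (rule tendsto_sandwich[OF _ _ tendsto_const LIMSEQ_inverse_real_of_nat]) (use q(2) in \<open>auto intro!: always_eventually less_imp_le\<close>)
  then have "(\<lambda>n. (nrm (SM L) (\<lambda>x. grad (q n) x - K x))^2) \<longlonglongrightarrow> 0^2" by (intro tendsto_intros)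
  then have "(\<lambda>n. sqn (SM L) (\<lambda>x. grad (q n) x - K x)) \<longlonglongrightarrow> 0" by (simp add: nrm_sq)
  then have "(\<lambda>n. form (grad (q n)) U) \<longlonglongrightarrow> form K U"
   by (intro form_tendsto LU LK L2_smooth(2) test_function_smooth[OF q(1)])
  moreover have "form (grad (q n)) U = 0" for n
   unfolding form_commute[of "grad (q n)"]
   using u(1) q(1) by (simp add: weak_solution_def form_def U_def)
  ultimately have "(\<lambda>n::nat. 0::real) \<longlonglongrightarrow> form K U" by simp
  then show "form U K = 0" by (simp add: LIMSEQ_const_iff form_commute[of U])
 qed
 have c: "form U H = (LINT x|SM L. a x * (wgrad (square L) u x \<bullet> wgrad (square L) v x))" if "has_trace L v g" for v
  using form_solution_trace[OF g sU H has_trace_trace_grad[OF that]] by (simp add: form_def U_def)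
 obtain v where v: "has_trace L v g" using trace_grad_has_trace[OF L g H] by blast
 have "DN L a f g = form U H"
  unfolding DN_def conormal_def u_def[symmetric]
 proof (rule the_equality)
  show "\<forall>v. has_trace L v g --> form U H = (LINT x|SM L. a x * (wgrad (square L) u x \<bullet> wgrad (square L) v x))"
   using c by blast
  show "c' = form U H" if "\<forall>v. has_trace L v g --> c' = (LINT x|SM L. a x * (wgrad (square L) u x \<bullet> wgrad (square L) v x))" for c'
   using that v c[OF v] by simp
 qed
 also have "\<dots> = form G H"
 proof -
  have "form (\<lambda>x. U x - G x) H = form U H - form G H"
   by (rule form_diff) (use LU tG H trace_grad_L2 in blast)+
  moreover have "\<bar>form (\<lambda>x. U x - G x) H\<bar> <= \<bar>\<Lambda>\<bar> * (nrm (SM L) (\<lambda>x. U x - G x) * nrm (SM L) H)"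
   by (rule form_bound(2)[OF L2_diff[OF LU trace_grad_L2[OF tG]] trace_grad_L2[OF H]])
  ultimately show ?thesis using solution_unique[OF f sU s] by simp
 qed
 finally show ?thesis .
qed

text \<open>A solution is orthogonal to the difference of two gradients with the same trace.\<close>

lemma solution_bound:
 assumes f: "L2 (bdry L) f" and s: "solves f G" and H: "trace_grad L f H"
 shows "\<kappa> * nrm (SM L) G <= \<bar>\<Lambda>\<bar> * nrm (SM L) H"
proof (cases "nrm (SM L) G = 0")
 case False
 have tG: "trace_grad L f G" using s by (simp add: solves_def)
 have "\<kappa> * (nrm (SM L) G)^2 <= form G G" using form_coercive[OF trace_grad_L2[OF tG]] by (simp add: nrm_sq)
 also have "\<dots> = form G H" by (rule form_solution_trace[OF f s tG H])
 also have "\<dots> <= \<bar>\<Lambda>\<bar> * (nrm (SM L) G * nrm (SM L) H)"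
  using form_bound(2)[OF trace_grad_L2[OF tG] trace_grad_L2[OF H]] by simp
 finally show ?thesis using False nrm_nonneg[of "SM L" G] by (simp add: power2_eq_square mult.left_commute mult_le_cancel_left)
qed simp

end

text \<open>A bounded sequence of gradients need not converge, but convex combinations do.\<close>

lemma trace_grad_of_bounded:
 assumes L: "0 < L" and f: "L2 (bdry L) f" and z: "\<And>n::nat. smooth (z n)" and C: "\<And>n. nrm (SM L) (grad (z n)) <= C"
  and l: "(\<lambda>n. nrm (bdry L) (\<lambda>x. z n x - f x)) \<longlonglongrightarrow> 0"
 shows "\<exists>G. trace_grad L f G \<and> nrm (SM L) G <= C"
proof -
 let ?S = "SM L" and ?B = "bdry L" and ?i = "\<lambda>n. inverse (real (Suc n))"
 interpret coefficient L "\<lambda>_. 1" 1 1 by unfold_locales (use L in auto)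
 have form: "form G G = sqn ?S G" for G by (simp add: form_def sqn_inner)
 define A where "A n = {p. smooth p \<and> nrm ?B (\<lambda>x. p x - f x) < ?i n}" for n
 have A: "A j \<subseteq> A n" if "n <= j" for n j
 proof -
  have "?i j <= ?i n" by (rule le_imp_inverse_le) (use that in auto)
  from less_le_trans[OF _ this] show ?thesis by (auto simp: A_def simp del: of_nat_Suc)
 qed
 have C0: "0 <= C" using order_trans[OF nrm_nonneg C] .
 have K: "\<exists>G\<in>grad ` A n. form G G <= C^2" for n
 proof -
  have "\<forall>\<^sub>F k in sequentially. nrm ?B (\<lambda>x. z k x - f x) < ?i n" by (rule order_tendstoD(2)[OF l]) simp
  then obtain k where "z k \<in> A n" using z by (auto simp: A_def eventually_sequentially)
  then show ?thesis using power_mono[OF C[of k], of 2] by (auto simp: form nrm_sq)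
 qed
 have mid: "(\<lambda>x. (1/2) *\<^sub>R (G x + H x)) \<in> grad ` A n" if GH: "G \<in> grad ` A n" "H \<in> grad ` A n" for n G H
 proof -
  obtain p r where p: "p \<in> A n" "G = grad p" and r: "r \<in> A n" "H = grad r" using GH by blast
  have sp: "smooth p" "smooth r" using p r by (auto simp: A_def)
  define q where "q x = (1/2) * p x + (1/2) * r x" for x
  have sq: "smooth q" unfolding q_def by (intro smooth_add smooth_mult smooth_const sp)
  note d = L2_diff[OF L2_smooth(3)[OF sp(1) L] f] L2_diff[OF L2_smooth(3)[OF sp(2) L] f]
  have "(\<lambda>x. q x - f x) = (\<lambda>x. (1/2) *\<^sub>R (p x - f x) + (1/2) *\<^sub>R (r x - f x))" by (auto simp: q_def field_simps)
  then have "nrm ?B (\<lambda>x. q x - f x) <= (1/2) * nrm ?B (\<lambda>x. p x - f x) + (1/2) * nrm ?B (\<lambda>x. r x - f x)"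
   using nrm_triangle[OF L2_scaleR[OF d(1), of "1/2"] L2_scaleR[OF d(2), of "1/2"]] unfolding nrm_scaleR by simp
  also have "\<dots> < ?i n" using p(1) r(1) by (auto simp: A_def)
  finally have "q \<in> A n" using sq by (simp add: A_def)
  moreover have "(\<lambda>x. (1/2) *\<^sub>R (G x + H x)) = grad q"
   unfolding q_def p r fun_eq_iff grad_add[OF smooth_mult[OF smooth_const sp(1)] smooth_mult[OF smooth_const sp(2)]]
    grad_cmult[OF sp(1)] grad_cmult[OF sp(2)] scaleR_add_right by simp
  ultimately show ?thesis by (metis imageI)
 qed
 have LA: "L2 ?S G" if "G \<in> grad ` A n" for n G using that L2_smooth(2) by (auto simp: A_def)
 have "\<exists>m u G. (\<forall>n. u n \<in> grad ` A n \<and> form (u n) (u n) < m n + ?i n \<and> m n <= C^2 \<and> (\<forall>H\<in>grad ` A n. m n <= form H H))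
  \<and> L2 ?S G \<and> (\<lambda>n. sqn ?S (\<lambda>x. u n x - G x)) \<longlonglongrightarrow> 0"
  by (rule minimizing_limit[OF image_mono[OF A] LA mid K])
 then obtain m u G where u: "\<And>n. u n \<in> grad ` A n" "\<And>n. sqn ?S (u n) < m n + ?i n" "\<And>n. m n <= C^2"
  and G: "L2 ?S G" "(\<lambda>n. sqn ?S (\<lambda>x. u n x - G x)) \<longlonglongrightarrow> 0"
  unfolding form by blast
 have "(\<lambda>n. nrm ?S (\<lambda>x. u n x - G x)) \<longlonglongrightarrow> sqrt 0" unfolding nrm_def by (intro tendsto_intros G)
 then have G0: "(\<lambda>n. nrm ?S (\<lambda>x. u n x - G x)) \<longlonglongrightarrow> 0" by simp
 have "trace_grad L f G" unfolding trace_grad_def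
 proof (intro conjI G(1) allI impI)
  fix e :: real assume e: "0 < e"
  have "\<forall>\<^sub>F n in sequentially. ?i n < e" by (rule order_tendstoD(2)[OF LIMSEQ_inverse_real_of_nat e])
  then have "\<forall>\<^sub>F n in sequentially. nrm ?S (\<lambda>x. u n x - G x) < e \<and> ?i n < e"
   using order_tendstoD(2)[OF G0 e] by eventually_elim simp
  then obtain n where n: "nrm ?S (\<lambda>x. u n x - G x) < e" "?i n < e" by (auto simp: eventually_sequentially)
  obtain p where "p \<in> A n" "u n = grad p" using u(1) by blast
  then show "\<exists>z. smooth z \<and> nrm ?S (\<lambda>x. grad z x - G x) < e \<and> nrm ?B (\<lambda>x. z x - f x) < e"
   using n by (intro exI[of _ p]) (auto simp: A_def)
 qed
 moreover have "nrm ?S G <= C"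
 proof (rule LIMSEQ_le_const)
  show "(\<lambda>n. sqrt (C^2 + ?i n) + nrm ?S (\<lambda>x. u n x - G x)) \<longlonglongrightarrow> C"
   using tendsto_add[OF tendsto_real_sqrt[OF tendsto_add[OF tendsto_const[of "C^2"] LIMSEQ_inverse_real_of_nat]] G0] C0 by simp
  have "nrm ?S G <= sqrt (C^2 + ?i n) + nrm ?S (\<lambda>x. u n x - G x)" for n
  proof -
   have "nrm ?S (u n) <= sqrt (C^2 + ?i n)" unfolding nrm_def using u(2,3)[of n] by (intro real_sqrt_le_mono) linarith
   then show ?thesis using nrm_triangle_sub[OF G(1) LA[OF u(1)[of n]]] nrm_diff_commute[of ?S G "u n"] by linarith
  qed
  then show "\<exists>N. \<forall>n\<ge>N. nrm ?S G <= sqrt (C^2 + ?i n) + nrm ?S (\<lambda>x. u n x - G x)" by blast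
 qed
 ultimately show ?thesis by blast
qed

section \<open>Extension of boundary values\<close>

abbreviation bdry2 :: "real => (plane \<times> plane) measure" where "bdry2 L \<equiv> bdry L \<Otimes>\<^sub>M bdry L"

definition kern :: "real => plane => real" where
 "kern E z = inverse ((z \<bullet> z + E^2)^2)"

lemma kern_denom: "E ~= 0 ==> 0 < z \<bullet> z + E^2" for z :: plane
 by (simp add: add_nonneg_pos)

lemma smooth_kern: "E ~= 0 ==> smooth (kern E)"
 unfolding kern_def[abs_def] inner_plane
 using kern_denom[of E] unfolding inner_plane
 by (intro smooth_inverse smooth_power smooth_add smooth_mult smooth_const smooth_fst smooth_snd) (auto simp: less_imp_neq[symmetric])

lemma kern_pos: "E ~= 0 ==> 0 < kern E z"
 using kern_denom[of E z] by (simp add: kern_def)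

lemma grad_kern: assumes "E ~= 0"
 shows "grad (kern E) z = (-4 / (z \<bullet> z + E^2) ^ 3) *\<^sub>R z"
proof (rule grad_eqI)
 have p: "0 < z \<bullet> z + E^2" by (rule kern_denom[OF assms])
 have 1: "((\<lambda>z. z \<bullet> z + E^2) has_derivative (\<lambda>v. 2 * (z \<bullet> v))) (at z)"
  by (auto intro!: derivative_eq_intros simp: inner_commute)
 have 2: "((\<lambda>t. inverse (t^2)) has_derivative (*) (-2 / (z \<bullet> z + E^2) ^ 3)) (at (z \<bullet> z + E^2))"
  unfolding has_field_derivative_def[symmetric]
  by (rule derivative_eq_intros refl)+ (use p in \<open>auto simp: divide_simps power2_eq_square power3_eq_cube\<close>)
 have "(kern E has_derivative (\<lambda>v. (-2 / (z \<bullet> z + E^2) ^ 3) * (2 * (z \<bullet> v)))) (at z)"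
  using has_derivative_compose[OF 1 2] by (simp add: kern_def[abs_def])
 moreover have "(\<lambda>v. (-2 / (z \<bullet> z + E^2) ^ 3) * (2 * (z \<bullet> v))) = (\<lambda>v. ((-4 / (z \<bullet> z + E^2) ^ 3) *\<^sub>R z) \<bullet> v)"
  by (rule ext) simp
 ultimately show "(kern E has_derivative (\<lambda>v. ((-4 / (z \<bullet> z + E^2) ^ 3) *\<^sub>R z) \<bullet> v)) (at z)" by simp
qed

subsection \<open>Integrals of the kernel over the plane\<close>

lemma nn_integral_cauchy_half:
 assumes a: "0 < (a::real)"
 shows "(\<integral>\<^sup>+t. ennreal (1 / (t^2 + a^2)) * indicator {0..} t \<partial>lborel) = ennreal (pi / (2 * a))"
proof -
 have "(\<integral>\<^sup>+t. ennreal (1 / (t^2 + a^2)) * indicator {0..} t \<partial>lborel) = ennreal (pi / 2 / a - arctan (0 / a) / a)"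
 proof (rule nn_integral_FTC_atLeast)
  show "((\<lambda>t. arctan (t / a) / a) has_real_derivative 1 / (t^2 + a^2)) (at t)" for t
  proof -
   have "((\<lambda>t. arctan (t / a)) has_real_derivative inverse (1 + (t / a)^2) * (1 / a)) (at t)"
    by (rule DERIV_chain2[OF DERIV_arctan]) (use a in \<open>auto intro!: derivative_eq_intros\<close>)
   then have "((\<lambda>t. arctan (t / a) / a) has_real_derivative inverse (1 + (t / a)^2) * (1 / a) / a) (at t)"
    by (rule DERIV_cdivide)
   moreover have "inverse (1 + (t / a)^2) * (1 / a) / a = 1 / (t^2 + a^2)"
   proof -
    have "1 + (t / a)^2 = (t^2 + a^2) / a^2" using a by (simp add: field_simps)
    then show ?thesis using a by (simp add: power2_eq_square)
   qed
   ultimately show ?thesis by simp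
  qed
  have "filterlim (\<lambda>t::real. t / a) at_top at_top"
   using filterlim_tendsto_pos_mult_at_top[OF tendsto_const[of "1 / a"] _ filterlim_ident] a by simp
  then have "((\<lambda>t. arctan (t / a)) \<longlongrightarrow> pi / 2) at_top"
   by (rule filterlim_compose[OF tendsto_arctan_at_top])
  then show "((\<lambda>t. arctan (t / a) / a) \<longlongrightarrow> pi / 2 / a) at_top" using a by (intro tendsto_divide tendsto_const) auto
 qed (auto)
 then show ?thesis by simp
qed

lemma nn_integral_cauchy:
 assumes a: "0 < (a::real)"
 shows "(\<integral>\<^sup>+t. ennreal (1 / ((t - s)^2 + a^2)) \<partial>lborel) <= ennreal (pi / a)"
proof -
 have "(\<integral>\<^sup>+t. ennreal (1 / ((t - s)^2 + a^2)) \<partial>lborel) = (\<integral>\<^sup>+t. ennreal (1 / (t^2 + a^2)) \<partial>lborel)"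
  by (subst nn_integral_real_affine[where c=1 and t=s]) auto
 also have "\<dots> <= (\<integral>\<^sup>+t. ennreal (1 / (t^2 + a^2)) * indicator {0..} t + ennreal (1 / (t^2 + a^2)) * indicator {..0} t \<partial>lborel)"
  by (intro nn_integral_mono) (auto simp: indicator_def)
 also have "\<dots> = (\<integral>\<^sup>+t. ennreal (1 / (t^2 + a^2)) * indicator {0..} t \<partial>lborel) + (\<integral>\<^sup>+t. ennreal (1 / (t^2 + a^2)) * indicator {..0} t \<partial>lborel)"
  by (rule nn_integral_add) auto
 also have "(\<integral>\<^sup>+t. ennreal (1 / (t^2 + a^2)) * indicator {..0} t \<partial>lborel) = (\<integral>\<^sup>+t. ennreal (1 / (t^2 + a^2)) * indicator {0..} t \<partial>lborel)"
  by (subst nn_integral_real_affine[where c="-1" and t=0]) (auto simp: indicator_def)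
 finally show ?thesis
  using a by (simp add: nn_integral_cauchy_half ennreal_plus[symmetric] add_divide_distrib[symmetric] del: ennreal_plus)
qed

lemma fst_snd_borel [measurable]: "(fst :: plane => real) \<in> borel_measurable borel" "(snd :: plane => real) \<in> borel_measurable borel"
 by (intro borel_measurable_continuous_onI continuous_intros)+

lemma nn_integral_quartic:
 fixes Q :: plane
 assumes a: "0 < (a::real)"
 shows "(\<integral>\<^sup>+x. ennreal (1 / ((x - Q) \<bullet> (x - Q) + a^2)^2) \<partial>lborel) <= ennreal ((pi / a)^2)"
proof -
 have "(\<integral>\<^sup>+x. ennreal (1 / ((x - Q) \<bullet> (x - Q) + a^2)^2) \<partial>lborel)
   <= (\<integral>\<^sup>+x. ennreal (1 / ((fst x - fst Q)^2 + a^2)) * ennreal (1 / ((snd x - snd Q)^2 + a^2)) \<partial>lborel)"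
 proof (rule nn_integral_mono)
  fix x :: plane
  define X Y where "X = (fst x - fst Q)^2" and "Y = (snd x - snd Q)^2"
  have XY: "0 <= X" "0 <= Y" "0 < a^2" using a by (auto simp: X_def Y_def)
  have "(X + a^2) * (Y + a^2) <= (X + Y + a^2) * (X + Y + a^2)" using XY by (intro mult_mono) auto
  then have "1 / (X + Y + a^2)^2 <= 1 / (X + a^2) * (1 / (Y + a^2))"
   using XY by (simp add: power2_eq_square frac_le add_nonneg_pos)
  moreover have "(x - Q) \<bullet> (x - Q) = X + Y" by (simp add: inner_plane X_def Y_def power2_eq_square)
  ultimately show "ennreal (1 / ((x - Q) \<bullet> (x - Q) + a^2)^2) <= ennreal (1 / ((fst x - fst Q)^2 + a^2)) * ennreal (1 / ((snd x - snd Q)^2 + a^2))"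
   using XY unfolding X_def[symmetric] Y_def[symmetric] by (simp add: ennreal_mult[symmetric] ennreal_leI)
 qed
 also have "\<dots> = (\<integral>\<^sup>+x. \<integral>\<^sup>+y. ennreal (1 / ((x - fst Q)^2 + a^2)) * ennreal (1 / ((y - snd Q)^2 + a^2)) \<partial>lborel \<partial>lborel)"
 proof (subst tonelli_plane(1))
  have "((t - s)^2 + a^2) ~= 0" for s t using a by (simp add: sum_power2_eq_zero_iff)
  then show "(\<lambda>x. ennreal (1 / ((fst x - fst Q)^2 + a^2)) * ennreal (1 / ((snd x - snd Q)^2 + a^2))) \<in> borel_measurable borel"
   by (intro borel_measurable_times_ennreal measurable_compose[OF _ measurable_ennreal] borel_measurable_continuous_onI continuous_intros) auto
 qed simp
 also have "\<dots> = (\<integral>\<^sup>+x. ennreal (1 / ((x - fst Q)^2 + a^2)) \<partial>lborel) * (\<integral>\<^sup>+y. ennreal (1 / ((y - snd Q)^2 + a^2)) \<partial>lborel)"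
  by (simp add: nn_integral_cmult nn_integral_multc)
 also have "\<dots> <= ennreal (pi / a) * ennreal (pi / a)"
  by (intro mult_mono nn_integral_cauchy a) auto
 also have "\<dots> = ennreal ((pi / a)^2)" using a by (simp add: ennreal_mult[symmetric] power2_eq_square)
 finally show ?thesis .
qed

subsection \<open>Boundary measure of balls\<close>

lemma square_param_lipschitz:
 assumes "0 < L" "s \<in> {0..<8*L}" "t \<in> {0..<8*L}" shows "norm (square_param L s - square_param L t) <= 2 * \<bar>s - t\<bar>"
proof -
 have "\<bar>fst (square_param L s) - fst (square_param L t)\<bar> <= \<bar>s - t\<bar>"
  using assms unfolding square_param_def by (auto simp: abs_if)
 moreover have "\<bar>snd (square_param L s) - snd (square_param L t)\<bar> <= \<bar>s - t\<bar>"
  using assms unfolding square_param_def by (auto simp: abs_if)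
 ultimately show ?thesis
  using sqrt_sum_squares_le_sum_abs[of "fst (square_param L s - square_param L t)" "snd (square_param L s - square_param L t)"]
  by (simp add: norm_prod_def)
qed

lemma square_param_surj:
 assumes "0 < L" "p \<in> frontier (square L)" shows "\<exists>s\<in>{0..<8*L}. square_param L s = p"
proof -
 obtain x y where p: "p = (x, y)" by (cases p)
 have c: "\<bar>x\<bar> <= L" "\<bar>y\<bar> <= L" "\<bar>x\<bar> = L \<or> \<bar>y\<bar> = L" using assms by (auto simp: mem_frontier_square p)
 consider "y = -L" "x < L" | "x = L" "y < L" | "y = L" "-L < x" | "x = -L" "-L < y"
  using c assms(1) by (smt (verit))
 then show ?thesis
 proof cases
  case 1 then show ?thesis using c assms by (intro bexI[of _ "x + L"]) (auto simp: square_param_def p)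
 next
  case 2 then show ?thesis using c assms by (intro bexI[of _ "y + 3*L"]) (auto simp: square_param_def p)
 next
  case 3 then show ?thesis using c assms by (intro bexI[of _ "5*L - x"]) (auto simp: square_param_def p)
 next
  case 4 then show ?thesis using c assms by (intro bexI[of _ "7*L - y"]) (auto simp: square_param_def p)
 qed
qed

lemma measure_bdry_ball:
 assumes L: "0 < L" and z: "z \<in> frontier (square L)" and r: "0 < r" "r <= 4 * L"
 shows "r / 8 <= measure (bdry L) (cball z (r / 4) \<inter> frontier (square L))"
proof -
 interpret finite_measure "bdry L" by (rule finite_measure_bdry[OF L])
 obtain s0 where s0: "s0 \<in> {0..<8*L}" "square_param L s0 = z" using square_param_surj[OF L z] by blast
 define a where "a = (if s0 < 4 * L then s0 else s0 - r / 8)"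
 have sub: "{a..a + r/8} \<subseteq> {0..<8*L}" using s0(1) r L by (auto simp: a_def)
 let ?T = "cball z (r / 4) \<inter> frontier (square L)"
 have T: "?T \<in> sets (bdry L)" unfolding bdry_def sets_distr sets_restrict_space
  by (rule image_eqI[of _ _ "cball z (r / 4)"]) auto
 have near: "square_param L s \<in> ?T" if "s \<in> {a..a + r/8}" for s
 proof -
  have s: "s \<in> {0..<8*L}" using sub that by blast
  have "\<bar>s - s0\<bar> <= r / 8" using that by (auto simp: a_def split: if_splits)
  then have "norm (square_param L s - z) <= r / 4" using square_param_lipschitz[OF L s s0(1)] s0(2) by simp
  then show ?thesis using square_param_frontier[OF L s] by (simp add: dist_norm norm_minus_commute)
 qed
 have "ennreal (r / 8) = emeasure lborel {a..a + r/8}" using r by simp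
 also have "\<dots> = (\<integral>\<^sup>+s. indicator {a..a + r/8} s \<partial>lborel)" by simp
 also have "\<dots> <= (\<integral>\<^sup>+s. indicator ?T (square_param L s) * indicator {0..<8*L} s \<partial>lborel)"
  by (rule nn_integral_mono) (use near sub in \<open>auto simp: indicator_def\<close>)
 also have "\<dots> = (\<integral>\<^sup>+p. indicator ?T p \<partial>bdry L)" by (rule nn_integral_bdry[OF L, symmetric]) (use T in simp)
 also have "\<dots> = emeasure (bdry L) ?T" using T by simp
 finally show ?thesis by (simp add: emeasure_eq_measure)
qed

subsection \<open>The regularised extensions\<close>

lemma gagliardo_nonneg: "0 <= gagliardo f p"
 by (simp add: gagliardo_def case_prod_unfold)

text \<open>The extension of \<open>f\<close> is approximated by the averages of \<open>f\<close> over the boundary with weight \<open>kern E (x - Q)\<close>.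
 This weight is the inverse fourth power of the distance, regularised at scale \<open>E\<close>. On a curve it decays fast enough
 for the gradient to be controlled, uniformly in \<open>E\<close>, by the double integral that defines the seminorm.\<close>

context
 fixes L :: real and f :: "plane => real"
 assumes L: "0 < L" and f: "f \<in> Hhalf L"
begin

interpretation bd: finite_measure "bdry L" by (rule finite_measure_bdry[OF L])

lemma Hhalf_L2: "L2 (bdry L) f" using f by (simp add: Hhalf_def)

lemma Hhalf_integrable: "integrable (bdry L) f" "integrable (bdry L) (\<lambda>x. (f x - c)^2)"
proof -
 have "L2 (bdry L) (\<lambda>_. c)" by (simp add: L2_def)
 from L2_integrable[OF L2_diff[OF Hhalf_L2 this]] show "integrable (bdry L) (\<lambda>x. (f x - c)^2)" by simp
 have "L2 (bdry L) (\<lambda>_. 1::real)" by (simp add: L2_def)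
 from L2_inner_integrable[OF Hhalf_L2 this] show "integrable (bdry L) f" by simp
qed

lemma id_bdry: "(\<lambda>x. x) \<in> borel_measurable (bdry L)"
 by (rule borel_measurable_bdry) simp

lemma norm_bdry: "x \<in> space (bdry L) ==> norm x <= 2 * L"
 using mem_frontier_square[OF L, of x] norm_fst_le[of x] sqrt_sum_squares_le_sum_abs[of "fst x" "snd x"]
 by (simp add: space_bdry norm_prod_def)

definition wt :: "real => plane => real" where "wt E x = (LINT Q|bdry L. kern E (x - Q) * 1)"
definition num :: "real => plane => real" where "num E x = (LINT Q|bdry L. kern E (x - Q) * f Q)"
definition ext :: "real => plane => real" where "ext E x = num E x / wt E x"

lemma conv:
 assumes "integrable (bdry L) w" "smooth K"
 shows "integrable (bdry L) (\<lambda>Q. K (x - Q) * w Q)" "smooth (\<lambda>x. \<integral>Q. K (x - Q) * w Q \<partial>bdry L)"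
  "grad (\<lambda>x. \<integral>Q. K (x - Q) * w Q \<partial>bdry L) x \<bullet> v = (LINT Q|bdry L. (grad K (x - Q) \<bullet> v) * w Q)"
 by (rule convolution_integrable[OF id_bdry assms(1) norm_bdry assms(2)], assumption)
  (rule smooth_convolution[OF id_bdry assms(1) norm_bdry assms(2)], assumption,
  rule grad_convolution[OF id_bdry assms(1) norm_bdry assms(2)], assumption)

lemma kern_integrable: assumes "E ~= 0"
 shows "integrable (bdry L) (\<lambda>Q. kern E (x - Q))" "integrable (bdry L) (\<lambda>Q. kern E (x - Q) * f Q)"
 using conv(1)[of "\<lambda>_. 1" "kern E" x] conv(1)[OF Hhalf_integrable(1) smooth_kern[OF assms], of x] smooth_kern[OF assms] by auto

text \<open>The lower bound for the total weight: the boundary contains an arc of length comparable to \<open>r\<close>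
 at distance at most \<open>2 r\<close> from \<open>x\<close>, where \<open>r^2\<close> is the squared distance plus \<open>E^2\<close>.\<close>

lemma wt_lower:
 assumes e: "0 < E" "E <= L" and x: "x \<in> cbox (-L,-L) (L,L)"
 shows "\<exists>r. E <= r \<and> (\<forall>Q\<in>frontier (square L). r^2 <= (x - Q) \<bullet> (x - Q) + E^2) \<and> 1 <= 200 * r ^ 3 * wt E x
  \<and> (x \<in> frontier (square L) --> r = E)"
proof -
 let ?F = "frontier (square L)"
 have ne: "(-L, -L) \<in> ?F" using L by (simp add: mem_frontier_square)
 have "compact ?F" using compact_frontier_bounded[of "square L"] by (simp add: square_box bounded_box)
 then obtain z where z: "z \<in> ?F" "\<And>Q. Q \<in> ?F ==> norm (x - z) <= norm (x - Q)"
  using continuous_attains_inf[of ?F "\<lambda>Q. norm (x - Q)"] ne by (force intro!: continuous_intros)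
 define d where "d = norm (x - z)"
 (* r is the regularised distance from x to the boundary *)
 define r where "r = sqrt (d^2 + E^2)"
 have r2: "r^2 = d^2 + E^2" by (simp add: r_def)
 have er: "E <= r" unfolding r_def by (rule real_le_rsqrt) simp
 have r0: "0 < r" using er e by linarith
 have dr: "d <= r" unfolding r_def by (rule real_le_rsqrt) simp
 have fr: "x \<in> ?F ==> r = E"
 proof -
  assume "x \<in> ?F"
  then have "d = 0" using z(2)[of x] by (simp add: d_def)
  then show "r = E" using e by (simp add: r_def)
 qed
 have dL: "d <= 3 * L"
 proof -
  obtain a b where ab: "x = (a, b)" by (cases x)
  define y where "y = (L, b)"
  have "y \<in> ?F" using x by (auto simp: mem_frontier_square[OF L] y_def mem_cbox_plane ab)
  from z(2)[OF this] have "d <= norm (x - y)" by (simp add: d_def)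
  also have "\<dots> = \<bar>a - L\<bar>" by (simp add: ab y_def norm_prod_def)
  also have "\<dots> <= 3 * L" using x by (auto simp: mem_cbox_plane ab)
  finally show ?thesis .
 qed
 have r4: "r <= 4 * L"
 proof -
  have "r^2 <= (3 * L)^2 + L^2" unfolding r2 using dL e by (intro add_mono power_mono) (auto simp: d_def)
  also have "\<dots> <= (4 * L)^2" by (simp add: power2_eq_square)
  finally show ?thesis by (rule power2_le_imp_le) (use L in simp)
 qed
 have D: "r^2 <= (x - Q) \<bullet> (x - Q) + E^2" if "Q \<in> ?F" for Q
  unfolding r2 using z(2)[OF that] by (simp add: d_def power2_norm_eq_inner[symmetric] power_mono)
 let ?T = "cball z (r / 4) \<inter> ?F"
 have T: "?T \<in> sets (bdry L)" unfolding bdry_def sets_distr sets_restrict_space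
  by (rule image_eqI[of _ _ "cball z (r / 4)"]) auto
 have near: "1 / (25 * r ^ 4) * indicator ?T Q <= kern E (x - Q)" for Q
 proof (cases "Q \<in> ?T")
  case True
  have "norm (x - Q) <= 2 * r"
   using norm_triangle_ineq[of "x - z" "z - Q"] True dr r0 by (simp add: dist_norm d_def)
  then have "(norm (x - Q))^2 <= (2 * r)^2" by (intro power_mono) auto
  then have A: "(x - Q) \<bullet> (x - Q) + E^2 <= 5 * r^2"
   using power_mono[OF er, of 2] e by (simp add: power2_norm_eq_inner power_mult_distrib)
  have "((x - Q) \<bullet> (x - Q) + E^2)^2 <= (5 * r^2)^2" using A kern_denom[of E "x - Q"] e by (intro power_mono) auto
  also have "\<dots> = 25 * r ^ 4" by (simp add: power_mult_distrib flip: power_mult)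
  finally have "1 / (25 * r ^ 4) <= 1 / ((x - Q) \<bullet> (x - Q) + E^2)^2"
   using kern_denom[of E "x - Q"] e by (intro divide_left_mono) (auto intro!: mult_pos_pos zero_less_power r0)
  then show ?thesis using True by (simp add: kern_def inverse_eq_divide)
 next
  case False then show ?thesis using kern_pos[of E "x - Q"] e by simp
 qed
 have "1 / (25 * r ^ 4) * (r / 8) <= 1 / (25 * r ^ 4) * measure (bdry L) ?T"
  using measure_bdry_ball[OF L z(1) r0 r4] r0 by (intro mult_left_mono) auto
 also have "\<dots> = (LINT Q|bdry L. 1 / (25 * r ^ 4) * indicator ?T Q)"
  using T by (simp add: Int_absorb2 sets.sets_into_space)
 also have "\<dots> <= (LINT Q|bdry L. kern E (x - Q))"
  by (rule Bochner_Integration.integral_mono) (use T near kern_integrable(1)[of E x] e in \<open>auto simp: bd.emeasure_eq_measure\<close>)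
 finally have "1 / (25 * r ^ 4) * (r / 8) <= wt E x" by (simp add: wt_def)
 then have "200 * r ^ 3 * (1 / (25 * r ^ 4) * (r / 8)) <= 200 * r ^ 3 * wt E x"
  using r0 by (intro mult_left_mono) auto
 moreover have "200 * r ^ 3 * (1 / (25 * r ^ 4) * (r / 8)) = 1" using r0 by (simp add: field_simps power_numeral_reduce)
 ultimately show ?thesis using er D fr by (intro exI[of _ r]) auto
qed

lemma bdry_nontrivial: "0 < measure (bdry L) (frontier (square L))"
proof -
 have "(-L, -L) \<in> frontier (square L)" using L by (simp add: mem_frontier_square)
 from measure_bdry_ball[OF L this L] L
 have "0 < measure (bdry L) (cball (-L,-L) (L / 4) \<inter> frontier (square L))" by simp
 also have "\<dots> <= measure (bdry L) (frontier (square L))"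
  using sets.top[of "bdry L"] by (intro bd.finite_measure_mono) (auto simp: space_bdry)
 finally show ?thesis .
qed

lemma wt_pos: assumes "E ~= 0" shows "0 < wt E x"
proof -
 have "0 <= wt E x" unfolding wt_def by (rule Bochner_Integration.integral_nonneg) (simp add: kern_pos[OF assms] less_imp_le)
 moreover have "wt E x ~= 0"
 proof
  assume "wt E x = 0"
  then have "AE Q in bdry L. kern E (x - Q) = 0"
   using integral_nonneg_eq_0_iff_AE[OF kern_integrable(1)[OF assms, of x]] kern_pos[OF assms] by (simp add: wt_def less_imp_le)
  then have "AE Q in bdry L. False" using kern_pos[OF assms] by (auto elim!: eventually_mono simp: less_imp_neq[symmetric])
  then have "emeasure (bdry L) (space (bdry L)) = 0" by (simp add: AE_iff_null null_sets_def)
  then show False using bdry_nontrivial by (simp add: measure_def space_bdry)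
 qed
 ultimately show ?thesis by simp
qed

lemma smooth_wt: "E ~= 0 ==> smooth (wt E)" and smooth_num: "E ~= 0 ==> smooth (num E)"
 unfolding wt_def[abs_def] num_def[abs_def] by (rule conv(2); simp add: smooth_kern Hhalf_integrable)+

lemma smooth_ext: "E ~= 0 ==> smooth (ext E)"
 unfolding ext_def[abs_def] using wt_pos[of E] by (intro smooth_divide smooth_wt smooth_num) (auto simp: less_imp_neq[symmetric])

lemma ext_average: assumes "E ~= 0" shows "wt E x * (ext E x - c) = (LINT Q|bdry L. kern E (x - Q) * (f Q - c))"
proof -
 have "(LINT Q|bdry L. kern E (x - Q) * (f Q - c)) = num E x - c * wt E x"
  using kern_integrable[OF assms, of x] by (simp add: right_diff_distrib num_def wt_def)
 moreover have "wt E x * ext E x = num E x" using wt_pos[OF assms, of x] by (simp add: ext_def)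
 ultimately show ?thesis by (simp only: right_diff_distrib mult.commute[of c])
qed

lemma ext_grad: assumes "E ~= 0"
 shows "wt E x * (grad (ext E) x \<bullet> v) = (LINT Q|bdry L. (grad (kern E) (x - Q) \<bullet> v) * (f Q - ext E x))"
  "integrable (bdry L) (\<lambda>Q. (grad (kern E) (x - Q) \<bullet> v) * (f Q - ext E x))"
proof -
 have sk: "smooth (kern E)" by (rule smooth_kern[OF assms])
 have i1: "integrable (bdry L) (\<lambda>Q. (grad (kern E) (x - Q) \<bullet> v) * f Q)"
  by (rule conv(1)[OF Hhalf_integrable(1) smooth_grad(3)[OF sk]])
 have i2: "integrable (bdry L) (\<lambda>Q. (grad (kern E) (x - Q) \<bullet> v) * 1)"
  by (rule conv(1)[OF _ smooth_grad(3)[OF sk]]) simp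
 show "integrable (bdry L) (\<lambda>Q. (grad (kern E) (x - Q) \<bullet> v) * (f Q - ext E x))"
  using i1 integrable_mult_left[OF i2, of "ext E x"] by (simp add: right_diff_distrib)
 have eq: "(\<lambda>x. wt E x * ext E x) = num E" using wt_pos[OF assms] by (auto simp: ext_def fun_eq_iff less_imp_neq[symmetric])
 have "grad (num E) x = wt E x *\<^sub>R grad (ext E) x + ext E x *\<^sub>R grad (wt E) x"
  using grad_mult[OF smooth_wt[OF assms] smooth_ext[OF assms], of x] unfolding eq .
 then have "wt E x * (grad (ext E) x \<bullet> v) = grad (num E) x \<bullet> v - ext E x * (grad (wt E) x \<bullet> v)"
  by (simp add: inner_add_left)
 also have "grad (num E) x \<bullet> v = (LINT Q|bdry L. (grad (kern E) (x - Q) \<bullet> v) * f Q)"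
  unfolding num_def[abs_def] by (rule conv(3)[OF Hhalf_integrable(1) sk])
 also have "grad (wt E) x \<bullet> v = (LINT Q|bdry L. (grad (kern E) (x - Q) \<bullet> v) * 1)"
  unfolding wt_def[abs_def] by (rule conv(3)[OF _ sk]) simp
 finally show "wt E x * (grad (ext E) x \<bullet> v) = (LINT Q|bdry L. (grad (kern E) (x - Q) \<bullet> v) * (f Q - ext E x))"
  using Bochner_Integration.integral_diff[OF i1 integrable_mult_right[OF i2, of "ext E x"]] i2
  by (simp add: algebra_simps)
qed

lemma weighted_cauchy_schwarz:
 fixes K h :: "'c => real"
 assumes K: "integrable M K" "\<And>x. 0 <= K x" and h: "h \<in> borel_measurable M" "integrable M (\<lambda>x. K x * (h x)^2)"
 shows "(LINT x|M. K x * h x)^2 <= (LINT x|M. K x) * (LINT x|M. K x * (h x)^2)"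
proof -
 have m: "(\<lambda>x. sqrt (K x)) \<in> borel_measurable M" using borel_measurable_integrable[OF K(1)] by measurable
 have 1: "L2 M (\<lambda>x. sqrt (K x))" using K m by (simp add: L2_def)
 have 2: "L2 M (\<lambda>x. sqrt (K x) * h x)" using K m h by (simp add: L2_def power_mult_distrib)
 have "\<bar>\<integral>x. sqrt (K x) \<bullet> (sqrt (K x) * h x) \<partial>M\<bar> <= nrm M (\<lambda>x. sqrt (K x)) * nrm M (\<lambda>x. sqrt (K x) * h x)"
  by (rule L2_cauchy_schwarz[OF 1 2])
 moreover have "(\<lambda>x. sqrt (K x) \<bullet> (sqrt (K x) * h x)) = (\<lambda>x. K x * h x)" using K(2) by (simp add: fun_eq_iff mult.assoc[symmetric])
 ultimately have "(LINT x|M. K x * h x)^2 <= (nrm M (\<lambda>x. sqrt (K x)) * nrm M (\<lambda>x. sqrt (K x) * h x))^2"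
  by (simp add: abs_le_square_iff[symmetric])
 also have "\<dots> = (LINT x|M. K x) * (LINT x|M. K x * (h x)^2)"
  using K(2) by (simp add: power_mult_distrib nrm_sq sqn_def)
 finally show ?thesis .
qed

lemma ext_bound: assumes e: "E ~= 0"
 shows "wt E x * (ext E x - c)^2 <= (LINT Q|bdry L. kern E (x - Q) * (f Q - c)^2)"
  "integrable (bdry L) (\<lambda>Q. kern E (x - Q) * (f Q - c)^2)"
proof -
 show i: "integrable (bdry L) (\<lambda>Q. kern E (x - Q) * (f Q - c)^2)"
  by (rule conv(1)[OF Hhalf_integrable(2) smooth_kern[OF e]])
 have "(wt E x * (ext E x - c))^2 <= wt E x * (LINT Q|bdry L. kern E (x - Q) * (f Q - c)^2)"
  unfolding ext_average[OF e]
  using weighted_cauchy_schwarz[OF kern_integrable(1)[OF e, of x] less_imp_le[OF kern_pos[OF e]] _ i] borel_measurable_integrable[OF Hhalf_integrable(1)]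
  by (simp add: wt_def)
 then have "wt E x * (wt E x * (ext E x - c)^2) <= wt E x * (LINT Q|bdry L. kern E (x - Q) * (f Q - c)^2)"
  by (simp add: power_mult_distrib power2_eq_square mult_ac)
 then show "wt E x * (ext E x - c)^2 <= (LINT Q|bdry L. kern E (x - Q) * (f Q - c)^2)"
  using wt_pos[OF e, of x] by simp
qed

lemma norm_grad_kern: assumes "E ~= 0"
 shows "norm (grad (kern E) z) <= kern E z * (4 / sqrt (z \<bullet> z + E^2))"
proof -
 define A where "A = z \<bullet> z + E^2"
 have A: "0 < A" unfolding A_def by (rule kern_denom[OF assms])
 have "norm z <= sqrt A" unfolding norm_eq_sqrt_inner A_def by (rule real_sqrt_le_mono) simp
 moreover have "norm (grad (kern E) z) = 4 / A ^ 3 * norm z" using A by (simp add: grad_kern[OF assms] A_def[symmetric])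
 ultimately have "norm (grad (kern E) z) <= 4 / A ^ 3 * sqrt A" using A by (simp add: divide_right_mono)
 also have "4 / A ^ 3 * sqrt A = inverse (A^2) * (4 / sqrt A)"
 proof -
  have "sqrt A * sqrt A = A" using A by simp
  then show ?thesis using A by (simp add: divide_simps power2_eq_square power3_eq_cube mult_ac)
 qed
 finally show ?thesis by (simp add: kern_def A_def)
qed

lemma ext_grad_bound: assumes e: "E ~= 0"
 shows "wt E x * (norm (grad (ext E) x))^2
   <= 16 * (LINT Q|bdry L. (kern E (x - Q) * inverse ((x - Q) \<bullet> (x - Q) + E^2)) * (f Q - ext E x)^2)"
  "integrable (bdry L) (\<lambda>Q. (kern E (x - Q) * inverse ((x - Q) \<bullet> (x - Q) + E^2)) * (f Q - ext E x)^2)"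
proof -
 define A where "A Q = (x - Q) \<bullet> (x - Q) + E^2" for Q
 have A: "0 < A Q" for Q unfolding A_def by (rule kern_denom[OF e])
 define g where "g = grad (ext E) x"
 have sA: "smooth (\<lambda>z. kern E z * inverse (z \<bullet> z + E^2))"
  using kern_denom[OF e] unfolding inner_plane
  by (intro smooth_mult smooth_kern[OF e] smooth_inverse smooth_add smooth_const smooth_fst smooth_snd) (auto simp: less_imp_neq[symmetric])
 show iA: "integrable (bdry L) (\<lambda>Q. (kern E (x - Q) * inverse ((x - Q) \<bullet> (x - Q) + E^2)) * (f Q - ext E x)^2)"
  by (rule conv(1)[OF Hhalf_integrable(2) sA])
 have mf: "f \<in> borel_measurable (bdry L)" by (rule borel_measurable_integrable[OF Hhalf_integrable(1)])
 have mA: "(\<lambda>Q. 4 / sqrt (A Q)) \<in> borel_measurable (bdry L)"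
  using A unfolding A_def by (intro borel_measurable_bdry borel_measurable_continuous_onI continuous_intros) (auto simp: less_imp_neq[symmetric])
 define h where "h Q = 4 / sqrt (A Q) * \<bar>f Q - ext E x\<bar>" for Q
 have mh: "h \<in> borel_measurable (bdry L)" unfolding h_def using mf mA by measurable
 have h2: "kern E (x - Q) * (h Q)^2 = 16 * (kern E (x - Q) * inverse (A Q) * (f Q - ext E x)^2)" for Q
  using A[of Q] by (simp add: h_def power_mult_distrib power_divide divide_inverse power_inverse)
 have ih: "integrable (bdry L) (\<lambda>Q. kern E (x - Q) * (h Q)^2)"
  unfolding h2 using iA by (simp add: A_def)
 have ih1: "integrable (bdry L) (\<lambda>Q. kern E (x - Q) * h Q)"
 proof (rule Bochner_Integration.integrable_bound)
  show "integrable (bdry L) (\<lambda>Q. kern E (x - Q) + kern E (x - Q) * (h Q)^2)"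
   using ih kern_integrable(1)[OF e] by simp
  have "\<bar>h Q\<bar> <= 1 + (h Q)^2" for Q
  proof (cases "1 <= \<bar>h Q\<bar>")
   case True then show ?thesis using self_le_power[of "\<bar>h Q\<bar>" 2] by simp
  next
   case False then show ?thesis using zero_le_power2[of "h Q"] by linarith
  qed
  then have "norm (kern E (x - Q) * h Q) <= norm (kern E (x - Q) + kern E (x - Q) * (h Q)^2)" for Q
   using mult_left_mono[of "\<bar>h Q\<bar>" "1 + (h Q)^2" "kern E (x - Q)"] kern_pos[OF e, of "x - Q"]
   by (simp add: abs_mult distrib_left)
  then show "AE Q in bdry L. norm (kern E (x - Q) * h Q) <= norm (kern E (x - Q) + kern E (x - Q) * (h Q)^2)" by simp
 qed (use mh borel_measurable_integrable[OF kern_integrable(1)[OF e]] in measurable)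
 have "wt E x * (norm g)^2 = (LINT Q|bdry L. (grad (kern E) (x - Q) \<bullet> g) * (f Q - ext E x))"
  using ext_grad(1)[OF e, of x g] by (simp add: g_def power2_norm_eq_inner)
 also have "\<dots> <= (LINT Q|bdry L. norm g * (kern E (x - Q) * h Q))"
 proof (rule Bochner_Integration.integral_mono[OF ext_grad(2)[OF e] integrable_mult_right[OF ih1]])
  fix Q
  have "(grad (kern E) (x - Q) \<bullet> g) * (f Q - ext E x) <= \<bar>grad (kern E) (x - Q) \<bullet> g\<bar> * \<bar>f Q - ext E x\<bar>"
   by (metis abs_ge_self abs_mult)
  also have "\<dots> <= (kern E (x - Q) * (4 / sqrt (A Q)) * norm g) * \<bar>f Q - ext E x\<bar>"
   using order_trans[OF Cauchy_Schwarz_ineq2 mult_right_mono[OF norm_grad_kern[OF e, of "x - Q"] norm_ge_zero[of g]]]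
   by (intro mult_right_mono) (auto simp: A_def)
  finally show "(grad (kern E) (x - Q) \<bullet> g) * (f Q - ext E x) <= norm g * (kern E (x - Q) * h Q)"
   by (simp add: h_def mult_ac)
 qed
 finally have 1: "wt E x * (norm g)^2 <= norm g * (LINT Q|bdry L. kern E (x - Q) * h Q)" by simp
 have 2: "(LINT Q|bdry L. kern E (x - Q) * h Q)^2 <= wt E x * (LINT Q|bdry L. kern E (x - Q) * (h Q)^2)"
  using weighted_cauchy_schwarz[OF kern_integrable(1)[OF e, of x] less_imp_le[OF kern_pos[OF e]] mh ih] by (simp add: wt_def)
 have "wt E x * (norm g)^2 <= (LINT Q|bdry L. kern E (x - Q) * (h Q)^2)"
 proof (cases "norm g = 0")
  case False
  then have "wt E x * norm g <= (LINT Q|bdry L. kern E (x - Q) * h Q)"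
   using 1 by (simp add: power2_eq_square mult.left_commute)
  then have "(wt E x * norm g)^2 <= (LINT Q|bdry L. kern E (x - Q) * h Q)^2"
   using wt_pos[OF e, of x] by (intro power_mono) auto
  also note 2
  finally have "wt E x * (wt E x * (norm g)^2) <= wt E x * (LINT Q|bdry L. kern E (x - Q) * (h Q)^2)"
   by (simp add: power_mult_distrib power2_eq_square mult_ac)
  then show ?thesis using wt_pos[OF e, of x] by simp
 next
  case True
  have "0 <= (LINT Q|bdry L. kern E (x - Q) * (h Q)^2)"
   by (rule Bochner_Integration.integral_nonneg) (simp add: kern_pos[OF e] less_imp_le)
  then show ?thesis using True by simp
 qed
 then show "wt E x * (norm (grad (ext E) x))^2
   <= 16 * (LINT Q|bdry L. (kern E (x - Q) * inverse ((x - Q) \<bullet> (x - Q) + E^2)) * (f Q - ext E x)^2)"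
  unfolding h2 by (simp add: g_def A_def)
qed

definition W :: "plane => plane \<times> plane => real" where
 "W x p = (f (fst p) - f (snd p))^2 / ((x - fst p) \<bullet> (x - fst p) + (dist (fst p) (snd p) / 2)^2)^2"

text \<open>\<open>X + q\<close> is at most twice the larger of \<open>A\<close> and \<open>A'\<close>; the powers of \<open>D\<close> absorb the remaining factors.\<close>

lemma kernel_product_le:
 fixes D A A' X q :: real
 assumes D: "0 < D" "D <= A" "D <= A'" and X: "X <= A" "0 <= X" and m: "q <= max A A'" "0 <= q"
  and p: "0 < X + q"
 shows "D ^ 3 * (inverse (A^2) * inverse A * inverse (A'^2)) <= 4 / (X + q)^2"
proof -
 define m where "m = max A A'"
 have A: "0 < A" "0 < A'" by (rule less_le_trans[OF D(1) D(2)], rule less_le_trans[OF D(1) D(3)])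
 then have m0: "0 < m" by (simp add: m_def)
 have u: "D / A <= 1" "D / A' <= 1" "0 <= D / A" "0 <= D / A'" using D A by auto
 have "D ^ 3 * (inverse (A^2) * inverse A * inverse (A'^2)) <= 1 / m^2"
 proof (cases "A <= A'")
  case True
  have "D ^ 3 * (inverse (A^2) * inverse A * inverse (A'^2)) = (D / A) ^ 3 * (1 / A'^2)"
   using A by (simp add: divide_simps power2_eq_square power3_eq_cube)
  also have "\<dots> <= 1 * (1 / A'^2)" using u by (intro mult_right_mono power_le_one) auto
  finally show ?thesis using True by (simp add: m_def)
 next
  case False
  have "D ^ 3 * (inverse (A^2) * inverse A * inverse (A'^2)) = ((D / A) * (D / A')^2) * (1 / A^2)"
   using A by (simp add: divide_simps power2_eq_square power3_eq_cube)
  also have "\<dots> <= 1 * (1 / A^2)" using u by (intro mult_right_mono mult_le_one power_le_one) auto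
  finally show ?thesis using False by (simp add: m_def)
 qed
 also have "\<dots> <= 4 / (X + q)^2"
 proof -
  have "X + q <= 2 * m" using X m(1) by (auto simp: m_def)
  then have "(X + q)^2 <= (2 * m)^2" using p by (intro power_mono) auto
  then have "(X + q)^2 <= 4 * m^2" by (simp add: power_mult_distrib)
  then show ?thesis using p m0 by (simp add: divide_simps)
 qed
 finally show ?thesis .
qed

lemma W_measurable:
 "W x \<in> borel_measurable (bdry2 L)" "(\<lambda>q. W (fst q) (snd q)) \<in> borel_measurable (lborel \<Otimes>\<^sub>M (bdry2 L))"
proof -
 have mf [measurable]: "f \<in> borel_measurable (bdry L)" by (rule borel_measurable_integrable[OF Hhalf_integrable(1)])
 have [measurable]: "(\<lambda>p. fst p) \<in> borel_measurable (bdry2 L)" "(\<lambda>p. snd p) \<in> borel_measurable (bdry2 L)"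
  by (rule measurable_compose[OF measurable_fst id_bdry], rule measurable_compose[OF measurable_snd id_bdry])
 have [measurable]: "(\<lambda>q. fst q) \<in> borel_measurable ((lborel :: plane measure) \<Otimes>\<^sub>M (bdry2 L))"
  "(\<lambda>q. fst (snd q)) \<in> borel_measurable ((lborel :: plane measure) \<Otimes>\<^sub>M (bdry2 L))"
  "(\<lambda>q. snd (snd q)) \<in> borel_measurable ((lborel :: plane measure) \<Otimes>\<^sub>M (bdry2 L))"
  "(\<lambda>q. f (fst (snd q))) \<in> borel_measurable ((lborel :: plane measure) \<Otimes>\<^sub>M (bdry2 L))"
  "(\<lambda>q. f (snd (snd q))) \<in> borel_measurable ((lborel :: plane measure) \<Otimes>\<^sub>M (bdry2 L))"
  using measurable_compose[OF measurable_fst[of "lborel :: plane measure" "bdry2 L"], of "\<lambda>x. x" borel]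
   measurable_compose[OF measurable_compose[OF measurable_snd measurable_fst] id_bdry]
   measurable_compose[OF measurable_compose[OF measurable_snd measurable_snd] id_bdry]
   measurable_compose[OF measurable_compose[OF measurable_snd measurable_fst] mf]
   measurable_compose[OF measurable_compose[OF measurable_snd measurable_snd] mf]
  by auto
 show "W x \<in> borel_measurable (bdry2 L)"
  unfolding W_def[abs_def] dist_norm by measurable
 show "(\<lambda>q. W (fst q) (snd q)) \<in> borel_measurable (lborel \<Otimes>\<^sub>M (bdry2 L))"
  unfolding W_def[abs_def] dist_norm by measurable
qed

text \<open>The gradient of the average is an average of \<open>f Q - ext E x\<close>, which is itself an average of differences of
 \<open>f\<close>. Two applications of the Cauchy-Schwarz inequality leave a double integral of squared differences.\<close>

lemma ext_grad_dominated:
 assumes e: "0 < E" "E <= L" and x: "x \<in> square L"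
 shows "ennreal ((norm (grad (ext E) x))^2) <= ennreal 2560000 * (\<integral>\<^sup>+p. ennreal (W x p) \<partial>(bdry2 L))"
proof -
 have e0: "E ~= 0" using e by simp
 have xc: "x \<in> cbox (-L,-L) (L,L)" using x by (auto simp: mem_square mem_cbox_plane)
 obtain r where r: "E <= r" "\<And>Q. Q \<in> frontier (square L) ==> r^2 <= (x - Q) \<bullet> (x - Q) + E^2" "1 <= 200 * r ^ 3 * wt E x"
  using wt_lower[OF e xc] by blast
 have r0: "0 < r" using r e by linarith
 define A where "A Q = (x - Q) \<bullet> (x - Q) + E^2" for Q
 have A: "0 < A Q" for Q unfolding A_def by (rule kern_denom[OF e0])
 define g2 where "g2 = (norm (grad (ext E) x))^2"
 define k where "k Q = kern E (x - Q) * inverse (A Q)" for Q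
 have k0: "0 <= k Q" for Q using A[of Q] kern_pos[OF e0, of "x - Q"] by (simp add: k_def less_imp_le)
 have mk: "k \<in> borel_measurable (bdry L)"
 proof -
  have "continuous_on UNIV k" unfolding k_def A_def using kern_denom[OF e0]
   by (intro continuous_intros continuous_on_compose2[OF smooth_continuous[OF smooth_kern[OF e0], of UNIV]]) (auto simp: less_imp_neq[symmetric])
  then show ?thesis by (intro borel_measurable_bdry borel_measurable_continuous_onI)
 qed
 have mf: "f \<in> borel_measurable (bdry L)" by (rule borel_measurable_integrable[OF Hhalf_integrable(1)])
 have wt0: "0 < wt E x" by (rule wt_pos[OF e0])
 have g2: "0 <= g2" by (simp add: g2_def)
 have "g2 <= (200 * r ^ 3 * wt E x)^2 * g2" using one_le_power[OF r(3), of 2] g2 by (simp add: mult_le_cancel_right1)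
 also have "\<dots> = 40000 * r ^ 6 * wt E x * (wt E x * g2)" by (simp add: power_mult_distrib power2_eq_square power_mult[symmetric] mult_ac flip: power_mult)
 also have "\<dots> <= 40000 * r ^ 6 * wt E x * (16 * (LINT Q|bdry L. k Q * (f Q - ext E x)^2))"
  using ext_grad_bound(1)[OF e0, of x] wt0 r0 by (intro mult_left_mono) (auto simp: g2_def k_def A_def)
 finally have "ennreal g2 <= ennreal (640000 * r ^ 6 * wt E x) * ennreal (LINT Q|bdry L. k Q * (f Q - ext E x)^2)"
  using wt0 r0 k0 by (subst ennreal_mult[symmetric]) (auto intro!: ennreal_leI Bochner_Integration.integral_nonneg simp: mult_ac)
 also have "ennreal (LINT Q|bdry L. k Q * (f Q - ext E x)^2) = (\<integral>\<^sup>+Q. ennreal (k Q * (f Q - ext E x)^2) \<partial>bdry L)"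
  using ext_grad_bound(2)[OF e0, of x] k0 by (intro nn_integral_eq_integral[symmetric]) (auto simp: k_def A_def)
 also have "ennreal (640000 * r ^ 6 * wt E x) * \<dots> = (\<integral>\<^sup>+Q. ennreal (640000 * r ^ 6 * wt E x) * ennreal (k Q * (f Q - ext E x)^2) \<partial>bdry L)"
  by (rule nn_integral_cmult[symmetric]) (use mk mf in measurable)
 also have "\<dots> <= (\<integral>\<^sup>+Q. \<integral>\<^sup>+Q'. ennreal 2560000 * ennreal (W x (Q, Q')) \<partial>bdry L \<partial>bdry L)"
 proof (rule nn_integral_mono)
  fix Q assume "Q \<in> space (bdry L)"
  then have s: "Q \<in> frontier (square L)" by (simp add: space_bdry)
  have c0: "0 <= 640000 * r ^ 6 * k Q" using r0 k0 by simp
  have i: "integrable (bdry L) (\<lambda>Q'. kern E (x - Q') * (f Q' - f Q)^2)" by (rule ext_bound(2)[OF e0])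
  have "ennreal (640000 * r ^ 6 * wt E x) * ennreal (k Q * (f Q - ext E x)^2)
    = ennreal (640000 * r ^ 6 * k Q) * ennreal (wt E x * (ext E x - f Q)^2)"
   using r0 k0 wt0 by (simp add: ennreal_mult[symmetric] power2_commute[of "f Q"] mult_ac)
  also have "\<dots> <= ennreal (640000 * r ^ 6 * k Q) * ennreal (LINT Q'|bdry L. kern E (x - Q') * (f Q' - f Q)^2)"
   by (intro mult_left_mono ennreal_leI ext_bound(1)[OF e0]) simp
  also have "\<dots> = ennreal (640000 * r ^ 6 * k Q) * (\<integral>\<^sup>+Q'. ennreal (kern E (x - Q') * (f Q' - f Q)^2) \<partial>bdry L)"
   using i by (subst nn_integral_eq_integral) (auto simp: kern_pos[OF e0] less_imp_le)
  also have "\<dots> = (\<integral>\<^sup>+Q'. ennreal (640000 * r ^ 6 * k Q) * ennreal (kern E (x - Q') * (f Q' - f Q)^2) \<partial>bdry L)"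
   by (rule nn_integral_cmult[symmetric]) (use borel_measurable_integrable[OF i] in measurable)
  also have "\<dots> <= (\<integral>\<^sup>+Q'. ennreal 2560000 * ennreal (W x (Q, Q')) \<partial>bdry L)"
  proof (rule nn_integral_mono)
   fix Q' assume "Q' \<in> space (bdry L)"
   then have s': "Q' \<in> frontier (square L)" by (simp add: space_bdry)
   define X q where "X = (x - Q) \<bullet> (x - Q)" and "q = (dist Q Q' / 2)^2"
   have xs: "x ~= Q" using x s by (auto simp: frontier_square[OF L])
   have q: "q <= max (A Q) (A Q')"
   proof -
    have "dist Q Q' <= norm (x - Q) + norm (x - Q')"
     using dist_triangle2[of Q Q' x] by (simp add: dist_norm norm_minus_commute)
    then have "dist Q Q' / 2 <= max (norm (x - Q)) (norm (x - Q'))" by linarith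
    then have "q <= (max (norm (x - Q)) (norm (x - Q')))^2" unfolding q_def by (intro power_mono) auto
    also have "\<dots> <= max (A Q) (A Q')" by (auto simp: A_def power2_norm_eq_inner max_def norm_le)
    finally show ?thesis .
   qed
   have "(r^2) ^ 3 * (inverse ((A Q)^2) * inverse (A Q) * inverse ((A Q')^2)) <= 4 / (X + q)^2"
    by (rule kernel_product_le)
     (use r0 r(2)[OF s] r(2)[OF s'] q xs in \<open>auto simp: A_def X_def q_def add_pos_nonneg\<close>)
   then have "r ^ 6 * (k Q * kern E (x - Q')) <= 4 / (X + q)^2"
    by (simp add: k_def kern_def A_def flip: power_mult)
   then have "640000 * (r ^ 6 * (k Q * kern E (x - Q'))) * (f Q' - f Q)^2 <= 640000 * (4 / (X + q)^2) * (f Q' - f Q)^2"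
    by (intro mult_right_mono mult_left_mono) auto
   also have "\<dots> = 2560000 * W x (Q, Q')" by (simp add: W_def X_def q_def power2_commute[of "f Q"])
   finally have "640000 * (r ^ 6 * (k Q * kern E (x - Q'))) * (f Q' - f Q)^2 <= 2560000 * W x (Q, Q')" .
   moreover have "640000 * (r ^ 6 * (k Q * kern E (x - Q'))) * (f Q' - f Q)^2
     = (640000 * r ^ 6 * k Q) * (kern E (x - Q') * (f Q' - f Q)^2)" by simp
   ultimately have "ennreal ((640000 * r ^ 6 * k Q) * (kern E (x - Q') * (f Q' - f Q)^2)) <= ennreal (2560000 * W x (Q, Q'))"
    by (intro ennreal_leI) simp
   then show "ennreal (640000 * r ^ 6 * k Q) * ennreal (kern E (x - Q') * (f Q' - f Q)^2) <= ennreal 2560000 * ennreal (W x (Q, Q'))"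
    using c0 kern_pos[OF e0, of "x - Q'"] by (subst (asm) ennreal_mult) (auto simp: ennreal_mult' W_def)
  qed
  finally show "ennreal (640000 * r ^ 6 * wt E x) * ennreal (k Q * (f Q - ext E x)^2) <= (\<integral>\<^sup>+Q'. ennreal 2560000 * ennreal (W x (Q, Q')) \<partial>bdry L)" .
 qed
 also have "\<dots> = (\<integral>\<^sup>+p. ennreal 2560000 * ennreal (W x p) \<partial>(bdry2 L))"
  by (rule bd.nn_integral_fst) (use W_measurable(1) in measurable)
 also have "\<dots> = ennreal 2560000 * (\<integral>\<^sup>+p. ennreal (W x p) \<partial>(bdry2 L))"
  by (rule nn_integral_cmult) (use W_measurable(1) in measurable)
 finally show ?thesis by (simp add: g2_def)
qed

text \<open>Integration over the plane first turns the weight into the Gagliardo kernel.\<close>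

lemma W_total:
 "(\<integral>\<^sup>+x. (\<integral>\<^sup>+p. ennreal (W x p) \<partial>(bdry2 L)) \<partial>lborel) <= ennreal (4 * pi^2 * (LINT z|(bdry2 L). gagliardo f z))"
proof -
 interpret bb: pair_sigma_finite "bdry L" "bdry L" by unfold_locales
 interpret P: pair_sigma_finite "lborel :: plane measure" "bdry2 L" by unfold_locales
 have "(\<integral>\<^sup>+x. (\<integral>\<^sup>+p. ennreal (W x p) \<partial>(bdry2 L)) \<partial>lborel) = (\<integral>\<^sup>+p. (\<integral>\<^sup>+x. ennreal (W x p) \<partial>lborel) \<partial>(bdry2 L))"
  by (rule P.Fubini'[symmetric]) (use W_measurable(2) in \<open>simp add: case_prod_unfold\<close>)
 also have "\<dots> <= (\<integral>\<^sup>+p. ennreal (4 * pi^2 * gagliardo f p) \<partial>(bdry2 L))"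
 proof (rule nn_integral_mono)
  fix p :: "plane \<times> plane"
  obtain s t where p: "p = (s, t)" by (cases p)
  show "(\<integral>\<^sup>+x. ennreal (W x p) \<partial>lborel) <= ennreal (4 * pi^2 * gagliardo f p)"
  proof (cases "s = t")
   case True then show ?thesis by (simp add: p W_def gagliardo_def)
  next
   case False
   define a where "a = dist s t / 2"
   have a: "0 < a" using False by (simp add: a_def)
   have "(\<integral>\<^sup>+x. ennreal (W x p) \<partial>lborel) = (\<integral>\<^sup>+x. ennreal ((f s - f t)^2) * ennreal (1 / ((x - s) \<bullet> (x - s) + a^2)^2) \<partial>lborel)"
    by (intro nn_integral_cong) (simp add: p W_def a_def ennreal_mult[symmetric])
   also have "\<dots> = ennreal ((f s - f t)^2) * (\<integral>\<^sup>+x. ennreal (1 / ((x - s) \<bullet> (x - s) + a^2)^2) \<partial>lborel)"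
    by (rule nn_integral_cmult) measurable
   also have "\<dots> <= ennreal ((f s - f t)^2) * ennreal ((pi / a)^2)"
    by (intro mult_left_mono nn_integral_quartic a) simp
   also have "\<dots> = ennreal (4 * pi^2 * gagliardo f p)"
    using False by (simp add: ennreal_mult[symmetric] p gagliardo_def a_def power_divide power_mult_distrib)
   finally show ?thesis .
  qed
 qed
 also have "\<dots> = ennreal (4 * pi^2 * (LINT z|(bdry2 L). gagliardo f z))"
 proof -
  have "integrable (bdry2 L) (gagliardo f)" using f by (simp add: Hhalf_def)
  then show ?thesis
   by (subst nn_integral_eq_integral) (simp_all add: gagliardo_nonneg)
 qed
 finally show ?thesis .
qed

text \<open>At a boundary point the total weight is at least of order \<open>1 / E ^ 3\<close>, whereas the kernel is at most
 \<open>1 / (E * dist x Q)^2\<close>. One power of \<open>E\<close> is left.\<close>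

lemma ext_boundary:
 assumes e: "0 < E" "E <= L"
 shows "sqn (bdry L) (\<lambda>x. ext E x - f x) <= 200 * E * (LINT z|(bdry2 L). gagliardo f z)"
proof -
 have e0: "E ~= 0" using e by simp
 have gi: "integrable (bdry2 L) (gagliardo f)" using f by (simp add: Hhalf_def)
 have mg: "gagliardo f \<in> borel_measurable (bdry2 L)" by (rule borel_measurable_integrable[OF gi])
 have L2d: "L2 (bdry L) (\<lambda>x. ext E x - f x)" by (rule L2_diff[OF L2_smooth(3)[OF smooth_ext[OF e0] L] Hhalf_L2])
 have pt: "ennreal ((ext E x - f x)^2) <= (\<integral>\<^sup>+Q. ennreal (200 * E * gagliardo f (x, Q)) \<partial>bdry L)" if x: "x \<in> frontier (square L)" for x
 proof -
  have xc: "x \<in> cbox (-L,-L) (L,L)" using x by (simp add: frontier_square[OF L])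
  have w: "1 <= 200 * E ^ 3 * wt E x" using wt_lower[OF e xc] x by blast
  have i: "integrable (bdry L) (\<lambda>Q. kern E (x - Q) * (f Q - f x)^2)" by (rule ext_bound(2)[OF e0])
  have "(ext E x - f x)^2 <= 200 * E ^ 3 * wt E x * (ext E x - f x)^2"
   using mult_right_mono[OF w, of "(ext E x - f x)^2"] by simp
  also have "\<dots> <= 200 * E ^ 3 * (LINT Q|bdry L. kern E (x - Q) * (f Q - f x)^2)"
   unfolding mult.assoc using ext_bound(1)[OF e0, of x "f x"] e by (intro mult_left_mono) auto
  finally have "ennreal ((ext E x - f x)^2) <= ennreal (200 * E ^ 3) * (\<integral>\<^sup>+Q. ennreal (kern E (x - Q) * (f Q - f x)^2) \<partial>bdry L)"
   using e i by (subst nn_integral_eq_integral) (auto simp: kern_pos[OF e0] less_imp_le ennreal_mult[symmetric] intro!: ennreal_leI Bochner_Integration.integral_nonneg)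
  also have "\<dots> = (\<integral>\<^sup>+Q. ennreal (200 * E ^ 3) * ennreal (kern E (x - Q) * (f Q - f x)^2) \<partial>bdry L)"
   by (rule nn_integral_cmult[symmetric]) (use borel_measurable_integrable[OF i] in measurable)
  also have "\<dots> <= (\<integral>\<^sup>+Q. ennreal (200 * E * gagliardo f (x, Q)) \<partial>bdry L)"
  proof (rule nn_integral_mono)
   fix Q
   define X where "X = (x - Q) \<bullet> (x - Q)"
   have X: "0 <= X" "0 < X + E^2" "X = (dist x Q)^2"
    using e by (auto simp: X_def dist_norm power2_norm_eq_inner add_nonneg_pos)
   have "E ^ 3 * (kern E (x - Q) * (f Q - f x)^2) <= E * gagliardo f (x, Q)"
   proof (cases "x = Q")
    case False
    then have X0: "0 < X" by (simp add: X_def)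
    have "E^2 * X <= (X + E^2) * (X + E^2)" using X by (simp add: algebra_simps add_increasing add_increasing2)
    then have "E^2 * inverse ((X + E^2)^2) <= inverse X" using X X0 by (simp add: divide_simps power2_eq_square)
    then have "E * (E^2 * inverse ((X + E^2)^2)) * (f Q - f x)^2 <= E * inverse X * (f Q - f x)^2"
     using e by (intro mult_right_mono mult_left_mono) auto
    then show ?thesis
     by (simp add: kern_def X_def[symmetric] gagliardo_def X(3)[symmetric] power3_eq_cube power2_eq_square[of E] divide_inverse
       power2_commute[of "f x" "f Q"] mult_ac)
   qed (simp add: gagliardo_def)
   then have "200 * (E ^ 3 * (kern E (x - Q) * (f Q - f x)^2)) <= 200 * (E * gagliardo f (x, Q))" by simp
   then show "ennreal (200 * E ^ 3) * ennreal (kern E (x - Q) * (f Q - f x)^2) <= ennreal (200 * E * gagliardo f (x, Q))"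
    using e kern_pos[OF e0, of "x - Q"] by (simp add: ennreal_mult[symmetric] mult.assoc ennreal_leI)
  qed
  finally show ?thesis .
 qed
 have "ennreal (sqn (bdry L) (\<lambda>x. ext E x - f x)) = (\<integral>\<^sup>+x. ennreal ((ext E x - f x)^2) \<partial>bdry L)"
  using nn_integral_L2[OF L2d] by simp
 also have "\<dots> <= (\<integral>\<^sup>+x. (\<integral>\<^sup>+Q. ennreal (200 * E * gagliardo f (x, Q)) \<partial>bdry L) \<partial>bdry L)"
  by (rule nn_integral_mono) (simp add: pt space_bdry)
 also have "\<dots> = (\<integral>\<^sup>+p. ennreal (200 * E * gagliardo f p) \<partial>(bdry2 L))"
  by (rule bd.nn_integral_fst) (use mg in measurable)
 also have "\<dots> = ennreal (200 * E * (LINT z|(bdry2 L). gagliardo f z))"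
  using gi e by (subst nn_integral_eq_integral) (simp_all add: gagliardo_nonneg)
 finally show ?thesis
  using e by (subst (asm) ennreal_le_iff) (auto simp: gagliardo_nonneg intro!: mult_nonneg_nonneg Bochner_Integration.integral_nonneg)
qed

lemma extension_exists: "\<exists>G. trace_grad L f G \<and> nrm (SM L) G <= 3200 * pi * Hhalf_norm L f"
proof -
 define gag where "gag = (LINT z|(bdry2 L). gagliardo f z)"
 have gag: "0 <= gag" unfolding gag_def by (rule Bochner_Integration.integral_nonneg) (simp add: gagliardo_nonneg)
 define e where "e n = L * inverse (real (Suc n))" for n
 have e: "0 < e n" "e n <= L" "e n ~= 0" for n using L by (auto simp: e_def field_simps)
 have el: "e \<longlonglongrightarrow> 0" unfolding e_def using tendsto_mult_left[OF LIMSEQ_inverse_real_of_nat, of L] by simp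
 define M where "M x = ennreal 2560000 * (\<integral>\<^sup>+p. ennreal (W x p) \<partial>(bdry2 L))" for x
 interpret bb: pair_sigma_finite "bdry L" "bdry L" by unfold_locales
 have "(\<lambda>q. ennreal (W (fst q) (snd q))) \<in> borel_measurable ((lborel :: plane measure) \<Otimes>\<^sub>M (bdry2 L))"
  using W_measurable(2) by measurable
 note mW = bb.P.borel_measurable_nn_integral_fst[OF this]
 have "(\<integral>\<^sup>+x. M x \<partial>SM L) <= (\<integral>\<^sup>+x. M x \<partial>lborel)"
  by (subst nn_integral_restrict_space) (auto simp: nn_integral_completion indicator_def intro!: nn_integral_mono)
 also have "\<dots> = ennreal 2560000 * (\<integral>\<^sup>+x. (\<integral>\<^sup>+p. ennreal (W x p) \<partial>(bdry2 L)) \<partial>lborel)"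
  unfolding M_def using mW by (intro nn_integral_cmult) simp
 also have "\<dots> <= ennreal 2560000 * ennreal (4 * pi^2 * gag)" unfolding gag_def by (intro mult_left_mono W_total) simp
 also have "\<dots> = ennreal ((3200 * pi)^2 * gag)" using gag by (subst ennreal_mult[symmetric]) (auto simp: power_mult_distrib)
 finally have IM: "(\<integral>\<^sup>+x. M x \<partial>SM L) <= ennreal ((3200 * pi)^2 * gag)" .
 have bound: "nrm (SM L) (grad (ext (e n))) <= 3200 * pi * Hhalf_norm L f" for n
 proof -
  have "ennreal (sqn (SM L) (grad (ext (e n)))) = (\<integral>\<^sup>+x. ennreal ((norm (grad (ext (e n)) x))^2) \<partial>SM L)"
   by (rule nn_integral_L2[OF L2_smooth(2)[OF smooth_ext[OF e(3)]], symmetric])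
  also have "\<dots> <= ennreal ((3200 * pi)^2 * gag)"
   by (rule order_trans[OF nn_integral_mono IM]) (use ext_grad_dominated[OF e(1,2)] in \<open>simp only: M_def space_restrict_space Int_UNIV_right space_completion space_lborel space_borel\<close>)
  finally have "sqn (SM L) (grad (ext (e n))) <= (3200 * pi)^2 * gag" using gag by simp
  also have "\<dots> <= (3200 * pi)^2 * (Hhalf_norm L f)^2"
   using gag by (intro mult_left_mono) (simp_all add: Hhalf_norm_def gag_def[symmetric])
  finally have "nrm (SM L) (grad (ext (e n))) <= sqrt ((3200 * pi)^2 * (Hhalf_norm L f)^2)"
   unfolding nrm_def by (rule real_sqrt_le_mono)
  then show ?thesis by (simp add: real_sqrt_mult Hhalf_norm_def gag_def[symmetric] gag)
 qed
 have "(\<lambda>n. sqn (bdry L) (\<lambda>x. ext (e n) x - f x)) \<longlonglongrightarrow> 0"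
 proof (rule tendsto_sandwich[OF _ _ tendsto_const])
  show "\<forall>\<^sub>F n in sequentially. sqn (bdry L) (\<lambda>x. ext (e n) x - f x) <= 200 * e n * gag"
   using ext_boundary[OF e(1,2)] by (auto simp: gag_def intro!: always_eventually)
  show "(\<lambda>n. 200 * e n * gag) \<longlonglongrightarrow> 0" using el by (auto intro!: tendsto_eq_intros)
 qed auto
 then have "(\<lambda>n. nrm (bdry L) (\<lambda>x. ext (e n) x - f x)) \<longlonglongrightarrow> sqrt 0" unfolding nrm_def by (intro tendsto_intros)
 then show ?thesis using trace_grad_of_bounded[OF L Hhalf_L2 smooth_ext[OF e(3)] bound] by simp
qed

end

section \<open>Transport by smooth diffeomorphisms\<close>

subsection \<open>Change of variables in the plane\<close>

definition to_plane :: "real ^ 2 => plane" where "to_plane v = (v $ 1, v $ 2)"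
definition of_plane :: "plane => real ^ 2" where "of_plane p = vector [fst p, snd p]"

lemma plane_vec [simp]: "to_plane (of_plane p) = p" "of_plane (to_plane v) = v"
 by (auto simp: to_plane_def of_plane_def vec_eq_iff forall_2)

lemma bounded_linear_to_plane: "bounded_linear to_plane"
 unfolding to_plane_def[abs_def] by (intro bounded_linear_Pair bounded_linear_vec_nth)

lemma bounded_linear_of_plane: "bounded_linear of_plane"
proof (rule linear_conv_bounded_linear[THEN iffD1], rule linearI)
 show "of_plane (x + y) = of_plane x + of_plane y" for x y by (simp add: of_plane_def vec_eq_iff forall_2)
 show "of_plane (c *\<^sub>R x) = c *\<^sub>R of_plane x" for c x by (simp add: of_plane_def vec_eq_iff forall_2)
qed

lemma continuous_to_plane: "continuous_on A to_plane" by (rule linear_continuous_on[OF bounded_linear_to_plane])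

lemma to_plane_borel [measurable]: "to_plane \<in> borel_measurable borel"
 by (rule borel_measurable_continuous_onI[OF continuous_to_plane])

lemma emeasure_box_plane:
 assumes "fst l <= fst u" "snd l <= snd u"
 shows "emeasure lborel (box l (u :: plane)) = ennreal ((fst u - fst l) * (snd u - snd l))"
proof -
 have "emeasure lborel (box l u) = ennreal (\<Prod>b\<in>Basis. (u - l) \<bullet> b)"
  by (rule emeasure_lborel_box) (use assms in \<open>auto simp: Basis_prod_def inner_plane\<close>)
 then show ?thesis by (simp add: Basis_prod_def inner_plane mult.commute)
qed

lemma distr_to_plane: "distr lborel borel to_plane = (lborel :: plane measure)"
proof (rule lborel_eqI[symmetric])
 fix l u :: plane assume le: "\<And>b. b \<in> Basis ==> l \<bullet> b <= u \<bullet> b"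
 have le': "fst l <= fst u" "snd l <= snd u"
  using le[of "(1,0)"] le[of "(0,1)"] by (auto simp: Basis_prod_def inner_plane)
 have eq: "to_plane -` box l u = box (of_plane l) (of_plane u)"
  by (auto simp: to_plane_def of_plane_def mem_box_plane mem_box_cart forall_2)
 have "emeasure (distr lborel borel to_plane) (box l u) = emeasure lborel (box (of_plane l) (of_plane u))"
  by (subst emeasure_distr) (auto simp: eq)
 also have "\<dots> = ennreal (\<Prod>b\<in>Basis. (of_plane u - of_plane l) \<bullet> b)"
 proof (rule emeasure_lborel_box)
  have "of_plane l $ i <= of_plane u $ i" for i using exhaust_2[of i] le' by (auto simp: of_plane_def)
  then show "of_plane l \<bullet> b <= of_plane u \<bullet> b" if "b \<in> Basis" for b
   using that by (auto simp: Basis_vec_def inner_axis)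
 qed
 also have "(\<Prod>b\<in>Basis. (of_plane u - of_plane l) \<bullet> b) = (\<Prod>i\<in>UNIV. (of_plane u - of_plane l) $ i)"
 proof -
  have B: "Basis = (\<lambda>i. axis i (1::real)) ` (UNIV :: 2 set)" by (auto simp: Basis_vec_def)
  have "inj (\<lambda>i::2. axis i (1::real))" by (auto simp: inj_on_def axis_eq_axis)
  then show ?thesis unfolding B by (subst prod.reindex) (auto simp: inner_axis)
 qed
 also have "\<dots> = (fst u - fst l) * (snd u - snd l)" by (simp add: UNIV_2 of_plane_def)
 finally have "emeasure (distr lborel borel to_plane) (box l u) = emeasure lborel (box l u)"
  using emeasure_box_plane[OF le'] by simp
 then show "emeasure (distr lborel borel to_plane) (box l u) = (\<Prod>b\<in>Basis. (u - l) \<bullet> b)"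
  using emeasure_lborel_box[OF le] by simp
qed simp

definition jac :: "(plane => plane) => plane => real" where
 "jac T x = fst (grad (\<lambda>x. fst (T x)) x) * snd (grad (\<lambda>x. snd (T x)) x)
  - snd (grad (\<lambda>x. fst (T x)) x) * fst (grad (\<lambda>x. snd (T x)) x)"

definition pull :: "(plane => plane) => (plane => plane) => plane => plane" where
 "pull T G x = fst (G (T x)) *\<^sub>R grad (\<lambda>x. fst (T x)) x + snd (G (T x)) *\<^sub>R grad (\<lambda>x. snd (T x)) x"

locale smooth_diffeo =
 fixes L r :: real and T I :: "plane => plane"
 assumes L: "0 < L" and r: "r < L"
  and smooth: "smooth (\<lambda>x. fst (T x))" "smooth (\<lambda>x. snd (T x))" "smooth (\<lambda>x. fst (I x))" "smooth (\<lambda>x. snd (I x))"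
  and inv: "\<And>x. T (I x) = x" "\<And>x. I (T x) = x"
  and id: "\<And>x. x \<notin> cbox (-r,-r) (r,r) ==> T x = x" "\<And>x. x \<notin> cbox (-r,-r) (r,r) ==> I x = x"
begin

lemma inverse_diffeo: "smooth_diffeo L r I T"
 by unfold_locales (use L r smooth inv id in auto)

lemma deriv: "(T has_derivative (\<lambda>v. (grad (\<lambda>x. fst (T x)) x \<bullet> v, grad (\<lambda>x. snd (T x)) x \<bullet> v))) (at x)"
 using has_derivative_Pair[OF smooth_has_derivative[OF smooth(1)] smooth_has_derivative[OF smooth(2)]] by simp

lemma continuous: "continuous_on A T"
 by (meson continuous_on_subset deriv has_derivative_continuous_on has_derivative_at_withinI subset_UNIV)

lemma borel [measurable]: "T \<in> borel_measurable borel"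
 by (rule borel_measurable_continuous_onI[OF continuous])

lemma smooth_jac: "smooth (jac T)"
 unfolding jac_def[abs_def] by (intro smooth_diff smooth_mult smooth_grad smooth)

lemma jac_borel [measurable]: "jac T \<in> borel_measurable borel"
 by (rule borel_measurable_continuous_onI[OF smooth_continuous[OF smooth_jac]])

lemma image_square: "T x \<in> square L \<longleftrightarrow> x \<in> square L"
proof -
 have sub: "x \<in> cbox (-r,-r) (r,r) ==> x \<in> square L" for x using r by (auto simp: mem_square mem_cbox_plane)
 show ?thesis
 proof (cases "x \<in> cbox (-r,-r) (r,r)")
  case True
  have "T x \<in> cbox (-r,-r) (r,r)"
  proof (rule ccontr)
   assume "T x \<notin> cbox (-r,-r) (r,r)"
   then have "I (T x) = T x" by (rule id(2))
   then show False using True \<open>T x \<notin> _\<close> by (simp add: inv)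
  qed
  then show ?thesis using True sub by blast
 next
  case False then show ?thesis by (simp add: id)
 qed
qed

lemma preimage_box:
 assumes le: "fst l <= fst u" "snd l <= snd u"
 shows "(\<integral>\<^sup>+x. ennreal \<bar>jac T x\<bar> * indicator (T -` box l u) x \<partial>lborel) = emeasure lborel (box l u)"
proof -
 define f where "f v = of_plane (T (to_plane v))" for v
 define S where "S = (\<lambda>v. T (to_plane v)) -` box l u"
 define f' where "f' v = (\<lambda>w. of_plane (grad (\<lambda>x. fst (T x)) (to_plane v) \<bullet> to_plane w, grad (\<lambda>x. snd (T x)) (to_plane v) \<bullet> to_plane w))" for v
 have "continuous_on UNIV (\<lambda>v. T (to_plane v))"
  by (rule continuous_on_compose2[OF continuous[of UNIV] continuous_to_plane]) simp
 then have "open S" unfolding S_def by (rule open_vimage[OF open_box])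
 then have S: "S \<in> sets lebesgue" "S \<in> sets borel" by auto
 have d: "(f has_derivative f' v) (at v within S)" for v
  unfolding f_def f'_def
  by (rule has_derivative_at_withinI, rule has_derivative_compose[OF has_derivative_compose[OF bounded_linear_imp_has_derivative[OF bounded_linear_to_plane] deriv]
     bounded_linear_imp_has_derivative[OF bounded_linear_of_plane]])
 have inj: "inj_on f S"
  by (rule inj_on_inverseI[where g="\<lambda>w. of_plane (I (to_plane w))"]) (simp add: f_def inv)
 have img: "f ` S = to_plane -` box l u"
 proof (rule set_eqI, rule iffI)
  fix w assume "w \<in> to_plane -` box l u"
  then have "w = f (of_plane (I (to_plane w)))" "of_plane (I (to_plane w)) \<in> S" by (auto simp: f_def S_def inv)
  then show "w \<in> f ` S" by blast
 qed (auto simp: f_def S_def)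
 have det: "det (matrix (f' v)) = jac T (to_plane v)" for v
  by (simp add: det_2 matrix_def f'_def of_plane_def to_plane_def inner_plane jac_def axis_def mult.commute)
 have em: "emeasure lborel (to_plane -` box l u) = emeasure lborel (box l u)"
  using emeasure_distr[of to_plane lborel borel "box l u"] by (simp add: distr_to_plane)
 have fin: "emeasure lborel (box l u) < \<infinity>" using emeasure_box_plane[OF le] by simp
 have lm: "f ` S \<in> lmeasurable"
  unfolding img using fin em by (intro fmeasurableI) (auto simp: measurable_sets_borel[OF to_plane_borel])
 have int: "(\<lambda>v. \<bar>det (matrix (f' v))\<bar>) integrable_on S"
  using measurable_differentiable_image_eq[OF S(1) d inj] lm by simp
 have "measure lebesgue (f ` S) = integral S (\<lambda>v. \<bar>det (matrix (f' v))\<bar>)"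
  by (rule measure_differentiable_image_eq[OF S(1) d inj int])
 then have hi: "((\<lambda>v. \<bar>jac T (to_plane v)\<bar>) has_integral measure lebesgue (f ` S)) S"
  using integrable_integral[OF int] by (simp add: det)
 have "(\<integral>\<^sup>+x. ennreal \<bar>jac T x\<bar> * indicator (T -` box l u) x \<partial>lborel)
   = (\<integral>\<^sup>+v. ennreal \<bar>jac T (to_plane v)\<bar> * indicator (T -` box l u) (to_plane v) \<partial>lborel)"
  by (subst distr_to_plane[symmetric], subst nn_integral_distr) (auto intro!: borel_measurable_indicator measurable_sets_borel[OF borel])
 also have "\<dots> = (\<integral>\<^sup>+v. ennreal (indicator S v * \<bar>jac T (to_plane v)\<bar>) \<partial>lborel)"
  by (intro nn_integral_cong) (auto simp: S_def indicator_def)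
 also have "\<dots> = ennreal (measure lebesgue (f ` S))"
  by (rule nn_integral_has_integral_lebesgue[OF _ hi]) auto
 also have "\<dots> = emeasure lebesgue (f ` S)"
  using lm by (simp add: emeasure_eq_measure2 fmeasurableD2 emeasure_eq_ennreal_measure)
 also have "\<dots> = emeasure lborel (box l u)"
  unfolding img using em by (simp add: measurable_sets_borel[OF to_plane_borel])
 finally show ?thesis .
qed

lemma distr_lborel: "distr (density lborel (\<lambda>x. ennreal \<bar>jac T x\<bar>)) borel T = lborel"
proof (rule lborel_eqI[symmetric])
 fix l u :: plane assume le: "\<And>b. b \<in> Basis ==> l \<bullet> b <= u \<bullet> b"
 have le': "fst l <= fst u" "snd l <= snd u"
  using le[of "(1,0)"] le[of "(0,1)"] by (auto simp: Basis_prod_def inner_plane)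
 have "emeasure (distr (density lborel (\<lambda>x. ennreal \<bar>jac T x\<bar>)) borel T) (box l u)
   = (\<integral>\<^sup>+x. ennreal \<bar>jac T x\<bar> * indicator (T -` box l u) x \<partial>lborel)"
  by (subst emeasure_distr, simp, simp, subst emeasure_density) (auto intro: measurable_sets_borel[OF borel])
 also have "\<dots> = emeasure lborel (box l u)" by (rule preimage_box[OF le'])
 finally show "emeasure (distr (density lborel (\<lambda>x. ennreal \<bar>jac T x\<bar>)) borel T) (box l u) = (\<Prod>b\<in>Basis. (u - l) \<bullet> b)"
  using emeasure_lborel_box[OF le] by simp
qed simp

lemma nn_change: "h \<in> borel_measurable borel ==> (\<integral>\<^sup>+y. h y \<partial>lborel) = (\<integral>\<^sup>+x. ennreal \<bar>jac T x\<bar> * h (T x) \<partial>lborel)"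
 by (subst distr_lborel[symmetric], subst nn_integral_distr, simp, simp, subst nn_integral_density) auto

lemma jac_mult: "jac T (I x) * jac I x = 1"
proof -
 note P = smooth_diffeo.deriv[OF inverse_diffeo, of x]
 let ?a = "grad (\<lambda>x. fst (T x)) (I x)" and ?b = "grad (\<lambda>x. snd (T x)) (I x)"
  and ?c = "grad (\<lambda>x. fst (I x)) x" and ?d = "grad (\<lambda>x. snd (I x)) x"
 have "((\<lambda>x. T (I x)) has_derivative (\<lambda>v. (?a \<bullet> (?c \<bullet> v, ?d \<bullet> v), ?b \<bullet> (?c \<bullet> v, ?d \<bullet> v)))) (at x)"
  by (rule has_derivative_compose[OF P deriv])
 then have "((\<lambda>x. x) has_derivative (\<lambda>v. (?a \<bullet> (?c \<bullet> v, ?d \<bullet> v), ?b \<bullet> (?c \<bullet> v, ?d \<bullet> v)))) (at x)"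
  by (simp add: inv)
 then have "(\<lambda>v. (?a \<bullet> (?c \<bullet> v, ?d \<bullet> v), ?b \<bullet> (?c \<bullet> v, ?d \<bullet> v))) = (\<lambda>v. v)"
  by (rule has_derivative_unique) (rule has_derivative_ident)
 from fun_cong[OF this, of "(1,0)"] fun_cong[OF this, of "(0,1)"]
 have e: "fst ?a * fst ?c + snd ?a * fst ?d = 1" "fst ?b * fst ?c + snd ?b * fst ?d = 0"
  "fst ?a * snd ?c + snd ?a * snd ?d = 0" "fst ?b * snd ?c + snd ?b * snd ?d = 1"
  by (simp_all add: inner_plane)
 have "jac T (I x) * jac I x = (fst ?a * fst ?c + snd ?a * fst ?d) * (fst ?b * snd ?c + snd ?b * snd ?d)
   - (fst ?b * fst ?c + snd ?b * fst ?d) * (fst ?a * snd ?c + snd ?a * snd ?d)"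
  unfolding jac_def by algebra
 then show ?thesis unfolding e by simp
qed

lemma jac_nonzero: "jac T x ~= 0"
 using jac_mult[of "T x"] by (auto simp: inv)

lemma null_preimage: assumes "N \<in> null_sets lborel" shows "T -` N \<in> null_sets lborel"
proof -
 have N: "N \<in> sets borel" using assms by (simp add: null_sets_def)
 have P: "T -` N \<in> sets borel" by (rule measurable_sets_borel[OF borel N])
 have "(\<integral>\<^sup>+x. ennreal \<bar>jac T x\<bar> * indicator N (T x) \<partial>lborel) = emeasure lborel N"
  using nn_change[of "\<lambda>x. indicator N x"] N by simp
 also have "\<dots> = 0" using assms by auto
 finally have "AE x in lborel. ennreal \<bar>jac T x\<bar> * indicator N (T x) = 0"
  using N by (subst (asm) nn_integral_0_iff_AE) (auto intro!: borel_measurable_times_ennreal measurable_compose[OF borel] borel_measurable_indicator)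
 then have "AE x in lborel. x \<notin> T -` N" by (elim eventually_mono) (use jac_nonzero in \<open>auto simp: indicator_def\<close>)
 then show ?thesis using P by (simp add: AE_iff_null_sets)
qed

lemma lebesgue_measurable: "T \<in> lebesgue \<rightarrow>\<^sub>M lebesgue"
proof (rule completion.measurable_completion2)
 have "T \<in> lborel \<rightarrow>\<^sub>M lborel" using borel by simp
 from measurable_completion[OF this] show m: "T \<in> lebesgue \<rightarrow>\<^sub>M lborel" .
 show "null_sets lborel \<subseteq> null_sets (distr lebesgue lborel T)"
 proof
  fix N :: "plane set" assume N: "N \<in> null_sets lborel"
  then show "N \<in> null_sets (distr lebesgue lborel T)"
   using null_sets_completionI[OF null_preimage[OF N]] m by (auto simp: null_sets_def emeasure_distr)
 qed
qed

lemma SM_measurable: "T \<in> SM L \<rightarrow>\<^sub>M SM L"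
 by (rule measurable_restrict_space3[OF lebesgue_measurable]) (use image_square in auto)

lemma nn_change_SM:
 assumes h: "h \<in> borel_measurable (SM L)"
 shows "(\<integral>\<^sup>+y. h y \<partial>SM L) = (\<integral>\<^sup>+x. ennreal \<bar>jac T x\<bar> * h (T x) \<partial>SM L)"
proof -
 define k where "k y = h y * indicator (square L) y" for y
 have "k \<in> borel_measurable lebesgue"
  using h unfolding k_def by (simp add: borel_measurable_restrict_space_iff_ennreal)
 then obtain k' where k': "k' \<in> borel_measurable lborel" "AE x in lborel. k x = k' x"
  using completion_ex_borel_measurable by blast
 from k'(2) obtain N where N: "N \<in> null_sets lborel" "\<And>x. x \<notin> N ==> k x = k' x"
  by (auto simp: eventually_ae_filter)
 have ae: "AE x in lborel. k (T x) = k' (T x)"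
  using AE_not_in[OF null_preimage[OF N(1)]] by eventually_elim (use N(2) in auto)
 have "(\<integral>\<^sup>+y. h y \<partial>SM L) = (\<integral>\<^sup>+y. k y \<partial>lborel)"
  by (subst nn_integral_restrict_space) (simp_all add: nn_integral_completion k_def[abs_def])
 also have "\<dots> = (\<integral>\<^sup>+y. k' y \<partial>lborel)" by (rule nn_integral_cong_AE[OF k'(2)])
 also have "\<dots> = (\<integral>\<^sup>+x. ennreal \<bar>jac T x\<bar> * k' (T x) \<partial>lborel)" by (rule nn_change) (use k'(1) in simp)
 also have "\<dots> = (\<integral>\<^sup>+x. ennreal \<bar>jac T x\<bar> * k (T x) \<partial>lborel)"
  by (rule nn_integral_cong_AE) (use ae in \<open>auto elim: eventually_mono\<close>)
 also have "\<dots> = (\<integral>\<^sup>+x. ennreal \<bar>jac T x\<bar> * h (T x) \<partial>SM L)"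
  by (subst nn_integral_restrict_space) (auto simp: nn_integral_completion k_def image_square indicator_def intro!: nn_integral_cong)
 finally show ?thesis .
qed

lemma distr_SM: "distr (density (SM L) (\<lambda>x. ennreal \<bar>jac T x\<bar>)) (SM L) T = SM L"
proof (rule measure_eqI)
 have mj: "(\<lambda>x. ennreal \<bar>jac T x\<bar>) \<in> borel_measurable (SM L)" using borel_measurable_SM[OF jac_borel, of L] by measurable
 fix A assume "A \<in> sets (distr (density (SM L) (\<lambda>x. ennreal \<bar>jac T x\<bar>)) (SM L) T)"
 then have A: "A \<in> sets (SM L)" by simp
 have pre: "T -` A \<inter> space (SM L) \<in> sets (SM L)" by (rule measurable_sets[OF SM_measurable A])
 have "emeasure (distr (density (SM L) (\<lambda>x. ennreal \<bar>jac T x\<bar>)) (SM L) T) A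
   = (\<integral>\<^sup>+x. ennreal \<bar>jac T x\<bar> * indicator (T -` A \<inter> space (SM L)) x \<partial>SM L)"
  using SM_measurable A pre mj by (subst emeasure_distr) (auto simp: emeasure_density)
 also have "\<dots> = (\<integral>\<^sup>+x. ennreal \<bar>jac T x\<bar> * indicator A (T x) \<partial>SM L)"
  by (intro nn_integral_cong) (auto simp: indicator_def)
 also have "\<dots> = (\<integral>\<^sup>+y. indicator A y \<partial>SM L)" by (rule nn_change_SM[symmetric]) (use A in simp)
 also have "\<dots> = emeasure (SM L) A" using A by simp
 finally show "emeasure (distr (density (SM L) (\<lambda>x. ennreal \<bar>jac T x\<bar>)) (SM L) T) A = emeasure (SM L) A" .
qed simp

lemma integral_change:
 fixes h :: "plane => real"
 assumes h: "h \<in> borel_measurable (SM L)"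
 shows "integrable (SM L) h \<longleftrightarrow> integrable (SM L) (\<lambda>x. \<bar>jac T x\<bar> * h (T x))"
  "(LINT y|SM L. h y) = (LINT x|SM L. \<bar>jac T x\<bar> * h (T x))"
proof -
 have mj: "(\<lambda>x. \<bar>jac T x\<bar>) \<in> borel_measurable (SM L)" using borel_measurable_SM[OF jac_borel, of L] by measurable
 have m: "T \<in> density (SM L) (\<lambda>x. ennreal \<bar>jac T x\<bar>) \<rightarrow>\<^sub>M SM L" using SM_measurable by simp
 have hc: "(\<lambda>x. h (T x)) \<in> borel_measurable (SM L)" by (rule measurable_compose[OF SM_measurable h])
 have "integrable (SM L) h \<longleftrightarrow> integrable (distr (density (SM L) (\<lambda>x. ennreal \<bar>jac T x\<bar>)) (SM L) T) h"
  by (simp add: distr_SM)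
 also have "\<dots> \<longleftrightarrow> integrable (density (SM L) (\<lambda>x. ennreal \<bar>jac T x\<bar>)) (\<lambda>x. h (T x))"
  by (rule integrable_distr_eq[OF m h])
 also have "\<dots> \<longleftrightarrow> integrable (SM L) (\<lambda>x. \<bar>jac T x\<bar> *\<^sub>R h (T x))"
  by (rule integrable_density[OF hc mj]) simp
 finally show "integrable (SM L) h \<longleftrightarrow> integrable (SM L) (\<lambda>x. \<bar>jac T x\<bar> * h (T x))" by simp
 have "(LINT y|SM L. h y) = (LINT y|distr (density (SM L) (\<lambda>x. ennreal \<bar>jac T x\<bar>)) (SM L) T. h y)"
  by (simp add: distr_SM)
 also have "\<dots> = (LINT x|density (SM L) (\<lambda>x. ennreal \<bar>jac T x\<bar>). h (T x))"
  by (rule integral_distr[OF m h])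
 also have "\<dots> = (LINT x|SM L. \<bar>jac T x\<bar> *\<^sub>R h (T x))"
  by (rule integral_density[OF hc mj]) simp
 finally show "(LINT y|SM L. h y) = (LINT x|SM L. \<bar>jac T x\<bar> * h (T x))" by simp
qed

subsection \<open>Transport of gradients\<close>

lemma pull_measurable:
 assumes "G \<in> borel_measurable (SM L)" shows "pull T G \<in> borel_measurable (SM L)"
proof -
 have m: "(\<lambda>x. G (T x)) \<in> borel_measurable (SM L)" by (rule measurable_compose[OF SM_measurable assms])
 have mm: "(\<lambda>x. fst (G (T x))) \<in> borel_measurable (SM L)" "(\<lambda>x. snd (G (T x))) \<in> borel_measurable (SM L)"
  by (rule measurable_compose[OF m fst_snd_borel(1)], rule measurable_compose[OF m fst_snd_borel(2)])
 show ?thesis unfolding pull_def[abs_def]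
  by (intro borel_measurable_add borel_measurable_scaleR mm continuous_measurable_SM continuous_grad smooth)
qed

lemma pull_bound: "\<exists>C\<ge>0. \<forall>G. \<forall>x\<in>square L. norm (pull T G x) <= C * norm (G (T x))"
proof -
 obtain A where A: "\<And>x. x \<in> square L ==> norm (grad (\<lambda>x. fst (T x)) x) <= A"
  using continuous_bounded_square[OF continuous_grad[OF smooth(1)]] by blast
 obtain B where B: "\<And>x. x \<in> square L ==> norm (grad (\<lambda>x. snd (T x)) x) <= B"
  using continuous_bounded_square[OF continuous_grad[OF smooth(2)]] by blast
 have "norm (pull T G x) <= (\<bar>A\<bar> + \<bar>B\<bar>) * norm (G (T x))" if x: "x \<in> square L" for G x
 proof -
  have "norm (pull T G x) <= \<bar>fst (G (T x))\<bar> * norm (grad (\<lambda>x. fst (T x)) x) + \<bar>snd (G (T x))\<bar> * norm (grad (\<lambda>x. snd (T x)) x)"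
   unfolding pull_def by (rule order_trans[OF norm_triangle_ineq]) simp
  also have "\<dots> <= norm (G (T x)) * \<bar>A\<bar> + norm (G (T x)) * \<bar>B\<bar>"
   using A[OF x] B[OF x] norm_fst_le[of "fst (G (T x))" "snd (G (T x))"] norm_snd_le[of "snd (G (T x))" "fst (G (T x))"]
   by (intro add_mono mult_mono) auto
  finally show ?thesis by (simp add: algebra_simps)
 qed
 then show ?thesis by (intro exI[of _ "\<bar>A\<bar> + \<bar>B\<bar>"]) auto
qed

lemma pull_L2: "\<exists>C\<ge>0. \<forall>G. L2 (SM L) G --> L2 (SM L) (pull T G) \<and> nrm (SM L) (pull T G) <= C * nrm (SM L) G"
proof -
 interpret i: smooth_diffeo L r I T by (rule inverse_diffeo)
 obtain A where A: "0 <= A" "\<And>G x. x \<in> square L ==> norm (pull T G x) <= A * norm (G (T x))" using pull_bound by blast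
 obtain B where B: "\<And>x. x \<in> square L ==> norm (jac I x) <= B"
  using continuous_bounded_square[OF smooth_continuous[OF i.smooth_jac]] by blast
 have "L2 (SM L) (pull T G) \<and> nrm (SM L) (pull T G) <= (A * sqrt \<bar>B\<bar>) * nrm (SM L) G" if G: "L2 (SM L) G" for G
 proof -
  have mG: "(\<lambda>x. G (T x)) \<in> borel_measurable (SM L)" by (rule measurable_compose[OF SM_measurable L2_measurable[OF G]])
  have mn: "(\<lambda>x. (norm (G (T x)))^2) \<in> borel_measurable (SM L)" using mG by measurable
  have mj: "(\<lambda>x. \<bar>jac I x\<bar>) \<in> borel_measurable (SM L)" using borel_measurable_SM[OF i.jac_borel, of L] by measurable
  have int: "integrable (SM L) (\<lambda>x. \<bar>jac I x\<bar> * (norm (G x))^2)"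
   using integrable_mult_bounded[OF L2_integrable[OF G] mj, of B] B by (simp add: space_restrict_space)
  have L2c: "L2 (SM L) (\<lambda>x. G (T x))"
   using i.integral_change(1)[OF mn] int mG by (simp add: L2_def inv)
  have "sqn (SM L) (\<lambda>x. G (T x)) = (LINT x|SM L. \<bar>jac I x\<bar> * (norm (G x))^2)"
   unfolding sqn_def using i.integral_change(2)[OF mn] by (simp add: inv)
  also have "\<dots> <= (LINT x|SM L. \<bar>B\<bar> * (norm (G x))^2)"
  proof (rule Bochner_Integration.integral_mono[OF int])
   show "integrable (SM L) (\<lambda>x. \<bar>B\<bar> * (norm (G x))^2)" using L2_integrable[OF G] by simp
   show "\<bar>jac I x\<bar> * (norm (G x))^2 <= \<bar>B\<bar> * (norm (G x))^2" if "x \<in> space (SM L)" for x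
    using B[of x] that by (intro mult_right_mono) (auto simp: space_restrict_space)
  qed
  finally have "sqn (SM L) (\<lambda>x. G (T x)) <= \<bar>B\<bar> * sqn (SM L) G" by (simp add: sqn_def)
  then have n: "nrm (SM L) (\<lambda>x. G (T x)) <= sqrt \<bar>B\<bar> * nrm (SM L) G"
   unfolding nrm_def real_sqrt_mult[symmetric] by (rule real_sqrt_le_mono)
  have ae: "AE x in SM L. norm (pull T G x) <= A * norm (G (T x))"
   using A(2) by (intro AE_I2) (auto simp: space_restrict_space)
  note p = nrm_mono_AE[OF L2c pull_measurable[OF L2_measurable[OF G]] ae A(1)]
  have "nrm (SM L) (pull T G) <= A * (sqrt \<bar>B\<bar> * nrm (SM L) G)"
   using p(2) mult_left_mono[OF n A(1)] by linarith
  then show ?thesis using p(1) by (simp add: mult.assoc)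
 qed
 then show ?thesis using A(1) by (intro exI[of _ "A * sqrt \<bar>B\<bar>"]) auto
qed

text \<open>The chain rule for smooth functions, in the limit. The trace does not change since the map is the identity
 near the boundary.\<close>

lemma trace_grad_pull:
 assumes t: "trace_grad L f G" shows "trace_grad L f (pull T G)"
proof -
 obtain C where C: "0 <= C" "\<And>G. L2 (SM L) G ==> L2 (SM L) (pull T G) \<and> nrm (SM L) (pull T G) <= C * nrm (SM L) G"
  using pull_L2 by blast
 note G = trace_grad_L2[OF t]
 show ?thesis unfolding trace_grad_def
 proof (intro conjI allI impI)
  show "L2 (SM L) (pull T G)" using C(2)[OF G] by simp
  fix e :: real assume e: "0 < e"
  define d where "d = e / (1 + C)"
  have d: "0 < d" "d <= e" "C * d < e" using e C(1) by (auto simp: d_def field_simps)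
  obtain \<phi> where \<phi>: "smooth \<phi>" "nrm (SM L) (\<lambda>x. grad \<phi> x - G x) < d" "nrm (bdry L) (\<lambda>x. \<phi> x - f x) < d"
   using t d(1) unfolding trace_grad_def by blast
  have sm: "smooth (\<lambda>x. \<phi> (T x))" by (rule smooth_compose[OF smooth(1,2) \<phi>(1)])
  have gr: "grad (\<lambda>x. \<phi> (T x)) x - pull T G x = pull T (\<lambda>x. grad \<phi> x - G x) x" for x
   by (simp add: grad_compose[OF smooth(1,2) \<phi>(1)] pull_def algebra_simps)
  have "nrm (SM L) (\<lambda>x. grad (\<lambda>x. \<phi> (T x)) x - pull T G x) <= C * nrm (SM L) (\<lambda>x. grad \<phi> x - G x)"
   unfolding gr using C(2)[OF L2_diff[OF L2_smooth(2)[OF \<phi>(1)] G]] by simp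
  also have "\<dots> <= C * d" using \<phi>(2) C(1) by (intro mult_left_mono) auto
  finally have 1: "nrm (SM L) (\<lambda>x. grad (\<lambda>x. \<phi> (T x)) x - pull T G x) < e" using d(3) by simp
  have "nrm (bdry L) (\<lambda>x. \<phi> (T x) - f x) = nrm (bdry L) (\<lambda>x. \<phi> x - f x)"
   unfolding nrm_def sqn_def
  proof (intro arg_cong[where f=sqrt] Bochner_Integration.integral_cong refl)
   fix x assume "x \<in> space (bdry L)"
   then have "x \<notin> cbox (-r,-r) (r,r)" using r by (auto simp: space_bdry mem_frontier_square[OF L] mem_cbox_plane)
   then show "(norm (\<phi> (T x) - f x))^2 = (norm (\<phi> x - f x))^2" by (simp add: id)
  qed
  then have "nrm (bdry L) (\<lambda>x. \<phi> (T x) - f x) < e" using \<phi>(3) d(2) by simp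
  with 1 sm show "\<exists>\<phi>. smooth \<phi> \<and> nrm (SM L) (\<lambda>x. grad \<phi> x - pull T G x) < e \<and> nrm (bdry L) (\<lambda>x. \<phi> x - f x) < e"
   by (intro exI[of _ "\<lambda>x. \<phi> (T x)"]) simp
 qed
qed

lemma pull_pull: "pull T (pull I G) x = G x"
proof -
 note P = smooth_diffeo.deriv[OF inverse_diffeo, of "T x"]
 let ?a = "grad (\<lambda>x. fst (T x)) x" and ?b = "grad (\<lambda>x. snd (T x)) x"
  and ?c = "grad (\<lambda>x. fst (I x)) (T x)" and ?d = "grad (\<lambda>x. snd (I x)) (T x)"
 have "((\<lambda>x. I (T x)) has_derivative (\<lambda>v. (?c \<bullet> (?a \<bullet> v, ?b \<bullet> v), ?d \<bullet> (?a \<bullet> v, ?b \<bullet> v)))) (at x)"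
  by (rule has_derivative_compose[OF deriv P])
 then have "((\<lambda>x. x) has_derivative (\<lambda>v. (?c \<bullet> (?a \<bullet> v, ?b \<bullet> v), ?d \<bullet> (?a \<bullet> v, ?b \<bullet> v)))) (at x)"
  by (simp add: inv)
 then have "(\<lambda>v. (?c \<bullet> (?a \<bullet> v, ?b \<bullet> v), ?d \<bullet> (?a \<bullet> v, ?b \<bullet> v))) = (\<lambda>v. v)"
  by (rule has_derivative_unique) (rule has_derivative_ident)
 from fun_cong[OF this, of "(1,0)"] fun_cong[OF this, of "(0,1)"]
 have e: "fst ?c * fst ?a + snd ?c * fst ?b = 1" "fst ?d * fst ?a + snd ?d * fst ?b = 0"
  "fst ?c * snd ?a + snd ?c * snd ?b = 0" "fst ?d * snd ?a + snd ?d * snd ?b = 1"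
  by (simp_all add: inner_plane)
 have "pull T (pull I G) x = (fst (G x) * (fst ?c * fst ?a + snd ?c * fst ?b) + snd (G x) * (fst ?d * fst ?a + snd ?d * fst ?b),
   fst (G x) * (fst ?c * snd ?a + snd ?c * snd ?b) + snd (G x) * (fst ?d * snd ?a + snd ?d * snd ?b))"
  by (simp add: pull_def inv prod_eq_iff algebra_simps)
 then show ?thesis unfolding e by simp
qed

end

subsection \<open>Displacements\<close>

definition flow :: "(plane => plane) => real => plane => plane" where
 "flow V t x = x + t *\<^sub>R V x"

definition unflow :: "(plane => plane) => real => plane => plane" where
 "unflow V t = inv (flow V t)"

locale displacement =
 fixes V :: "plane => plane" and \<delta> t :: real
 assumes lip: "\<And>x y. norm (V x - V y) <= \<delta> * norm (x - y)" and \<delta>: "0 <= \<delta>" "\<delta> < 1" and t: "0 <= t" "t <= 1"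
begin

lemma flow_lower: "(1 - \<delta>) * norm (x - y) <= norm (flow V t x - flow V t y)"
proof -
 have "norm (x - y) <= norm (flow V t x - flow V t y) + norm (t *\<^sub>R (V x - V y))"
  using norm_triangle_ineq4[of "flow V t x - flow V t y" "t *\<^sub>R (V x - V y)"] by (simp add: flow_def algebra_simps)
 also have "norm (t *\<^sub>R (V x - V y)) <= 1 * norm (V x - V y)"
  unfolding norm_scaleR using t by (intro mult_right_mono) auto
 also have "\<dots> <= \<delta> * norm (x - y)" using lip[of x y] by simp
 finally show ?thesis by (simp add: left_diff_distrib)
qed

lemma inj_flow: "inj (flow V t)"
proof (rule injI)
 fix x y assume "flow V t x = flow V t y"
 then have "(1 - \<delta>) * norm (x - y) <= 0" using flow_lower[of x y] by simp
 then show "x = y" using \<delta> by (simp add: mult_le_0_iff)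
qed

lemma surj_flow: "surj (flow V t)"
proof (rule surjI)
 fix y
 have "\<exists>!x. y - t *\<^sub>R V x = x"
 proof (rule banach_fix_type[OF \<delta>], intro allI)
  fix x z
  have "dist (y - t *\<^sub>R V x) (y - t *\<^sub>R V z) = t * norm (V x - V z)"
   using t by (simp add: dist_norm norm_minus_commute flip: scaleR_diff_right)
  also have "\<dots> <= 1 * (\<delta> * norm (x - z))" using t lip[of x z] \<delta> by (intro mult_mono) auto
  finally show "dist (y - t *\<^sub>R V x) (y - t *\<^sub>R V z) <= \<delta> * dist x z" by (simp add: dist_norm)
 qed
 then show "flow V t (SOME x. y - t *\<^sub>R V x = x) = y"
  unfolding flow_def by (metis (mono_tags, lifting) diff_add_cancel someI_ex)
qed

lemma flow_unflow [simp]: "flow V t (unflow V t y) = y" and unflow_flow [simp]: "unflow V t (flow V t x) = x"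
 unfolding unflow_def using surj_f_inv_f[OF surj_flow] inv_f_f[OF inj_flow] by auto

lemma unflow_lipschitz: "norm (unflow V t x - unflow V t y) <= norm (x - y) / (1 - \<delta>)"
 using flow_lower[of "unflow V t x" "unflow V t y"] \<delta> by (simp add: pos_le_divide_eq mult.commute)

lemma continuous_unflow: "continuous_on A (unflow V t)"
proof -
 have "(1 / (1 - \<delta>))-lipschitz_on A (unflow V t)"
  using unflow_lipschitz \<delta> by (intro lipschitz_onI) (auto simp: dist_norm)
 then show ?thesis by (rule lipschitz_on_continuous_on)
qed

lemma continuous_V: "continuous_on A V"
proof -
 have "\<delta>-lipschitz_on A V" using lip \<delta> by (intro lipschitz_onI) (auto simp: dist_norm)
 then show ?thesis by (rule lipschitz_on_continuous_on)
qed

lemma continuous_flow: "continuous_on A (flow V t)"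
 unfolding flow_def[abs_def] by (intro continuous_intros continuous_V)

lemma flow_id: "V x = 0 ==> flow V t x = x" and unflow_id: "V x = 0 ==> unflow V t x = x"
proof -
 show "V x = 0 ==> flow V t x = x" by (simp add: flow_def)
 then show "V x = 0 ==> unflow V t x = x" by (metis unflow_flow)
qed

end

lemma grad_lipschitz:
 assumes p: "smooth p" and l: "\<And>x y. \<bar>p x - p y\<bar> <= \<delta> * norm (x - y)" shows "norm (grad p x) <= \<delta>"
proof -
 let ?g = "grad p x"
 have "((\<lambda>s. x + s *\<^sub>R ?g) has_derivative (\<lambda>s. s *\<^sub>R ?g)) (at 0)"
  by (auto intro!: derivative_eq_intros)
 from has_derivative_compose[OF this, of p "\<lambda>v. ?g \<bullet> v"] smooth_has_derivative[OF p, of x]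
 have "((\<lambda>s. p (x + s *\<^sub>R ?g)) has_derivative (\<lambda>s. ?g \<bullet> (s *\<^sub>R ?g))) (at 0)" by simp
 moreover have "(\<lambda>s. ?g \<bullet> (s *\<^sub>R ?g)) = (*) (?g \<bullet> ?g)" by (simp add: fun_eq_iff mult.commute)
 ultimately have "((\<lambda>s. p (x + s *\<^sub>R ?g)) has_real_derivative (?g \<bullet> ?g)) (at 0)" by (simp add: has_field_derivative_def)
 then have "((\<lambda>h. (p (x + h *\<^sub>R ?g) - p x) / h) \<longlongrightarrow> ?g \<bullet> ?g) (at 0)" by (simp add: DERIV_def)
 moreover have "\<forall>\<^sub>F h in at 0. (p (x + h *\<^sub>R ?g) - p x) / h <= \<delta> * norm ?g"
 proof -
  have "(p (x + h *\<^sub>R ?g) - p x) / h <= \<delta> * norm ?g" if "h ~= 0" for h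
  proof -
   have "(p (x + h *\<^sub>R ?g) - p x) / h <= \<bar>p (x + h *\<^sub>R ?g) - p x\<bar> / \<bar>h\<bar>"
    unfolding abs_divide[symmetric] by (rule abs_ge_self)
   also have "\<dots> <= (\<delta> * norm (h *\<^sub>R ?g)) / \<bar>h\<bar>" using l[of "x + h *\<^sub>R ?g" x] by (intro divide_right_mono) auto
   finally show ?thesis using that by simp
  qed
  then show ?thesis by (auto simp: eventually_at_filter)
 qed
 ultimately have "?g \<bullet> ?g <= \<delta> * norm ?g" by (rule tendsto_upperbound) simp
 then have "norm ?g * norm ?g <= \<delta> * norm ?g" by (simp add: power2_norm_eq_inner[symmetric] power2_eq_square)
 then show ?thesis
 proof (cases "?g = 0")
  case True
  then show ?thesis using l[of 0 "(1,0)"] by (simp add: norm_prod_def)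
 qed (simp add: mult_le_cancel_right)
qed

subsection \<open>The coefficient matrix as a function of time\<close>

text \<open>For a displacement with Jacobian matrix \<open>D\<close>, given by its rows, \<open>Jt D t\<close> is the determinant of \<open>I + t D\<close>, and
 its cofactor matrix maps \<open>X\<close> to \<open>X + t Ed D X\<close>. So \<open>Kt\<close> is the energy density of the pulled back problem,
 and \<open>Bt\<close> is its time derivative.\<close>

definition dV :: "(plane => plane) => plane => plane \<times> plane" where
 "dV V x = (grad (\<lambda>x. fst (V x)) x, grad (\<lambda>x. snd (V x)) x)"

definition Jt :: "plane \<times> plane => real => real" where
 "Jt D t = 1 + t * (fst (fst D) + snd (snd D)) + t^2 * (fst (fst D) * snd (snd D) - snd (fst D) * fst (snd D))"

definition Ed :: "plane \<times> plane => plane => plane" where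
 "Ed D X = (snd (snd D) * fst X - fst (snd D) * snd X, fst (fst D) * snd X - snd (fst D) * fst X)"

definition Nt :: "plane \<times> plane => real => plane => plane => real" where
 "Nt D t X Y = (X + t *\<^sub>R Ed D X) \<bullet> (Y + t *\<^sub>R Ed D Y)"

definition Kt :: "plane \<times> plane => real => plane => plane => real" where
 "Kt D t X Y = Nt D t X Y / Jt D t"

definition Bt :: "plane \<times> plane => real => plane => plane => real" where
 "Bt D s X Y = (((X \<bullet> Ed D Y + Ed D X \<bullet> Y) + 2 * s * (Ed D X \<bullet> Ed D Y)) * Jt D s
  - Nt D s X Y * ((fst (fst D) + snd (snd D)) + 2 * s * (fst (fst D) * snd (snd D) - snd (fst D) * fst (snd D)))) / (Jt D s)^2"

lemma abs_mult_le: "\<bar>x\<bar> <= X ==> \<bar>y\<bar> <= Y ==> \<bar>x * y\<bar> <= X * (Y::real)"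
 unfolding abs_mult by (rule mult_mono) auto

lemma abs_add_le: "\<bar>x\<bar> <= X ==> \<bar>y\<bar> <= Y ==> \<bar>x + y\<bar> <= X + (Y::real)"
 and abs_diff_le: "\<bar>x\<bar> <= X ==> \<bar>y\<bar> <= Y ==> \<bar>x - y\<bar> <= X + (Y::real)"
 by linarith+

text \<open>The remainder of the first-order expansion of \<open>N / J\<close> is \<open>(t - s)^2\<close> times an explicit rational function.
 The hypotheses on the coefficients are those met by the numerator and the denominator of \<open>Kt\<close>.\<close>

lemma quotient_expansion:
 fixes n0 n1 n2 j1 j2 s t n w :: real
 defines "N \<equiv> \<lambda>t. n0 + t * n1 + t^2 * n2" and "J \<equiv> \<lambda>t. 1 + t * j1 + t^2 * j2"
 defines "p \<equiv> (n1 + 2 * s * n2) * J s - N s * (j1 + 2 * s * j2)"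
 assumes w: "0 <= w" "w <= 1/2" and n: "0 <= n" "\<bar>n0\<bar> <= n" "\<bar>n1\<bar> <= 4 * w * n" "\<bar>n2\<bar> <= 4 * w^2 * n"
  and j: "\<bar>j1\<bar> <= 2 * w" "\<bar>j2\<bar> <= 2 * w^2" and st: "0 <= s" "s <= 1" "0 <= t" "t <= 1" and J: "1/7 <= J s" "1/7 <= J t"
 shows "\<bar>N t / J t - N s / J s\<bar> <= 2940 * w * \<bar>t - s\<bar> * n"
  "\<bar>N t / J t - N s / J s - (t - s) * (p / (J s)^2)\<bar> <= 89180 * w^2 * (t - s)^2 * n"
  "\<bar>p / (J s)^2\<bar> <= 1960 * w * n" "\<bar>N t / J t\<bar> <= 28 * n"
proof -
 have d2: "w^2 <= w / 2" "0 <= w^2" using w mult_left_mono[OF w(2) w(1)] by (auto simp: power2_eq_square)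
 have d2n: "w^2 * n <= w / 2 * n" "0 <= w^2 * n" "0 <= w * n" "w * n <= n / 2"
  using d2 n w mult_right_mono[OF d2(1) n(1)] mult_right_mono[OF w(2) n(1)] by auto
 have u: "\<bar>u\<bar> <= 1 \<and> \<bar>u^2\<bar> <= 1" if "0 <= u" "u <= 1" for u :: real using that by (auto intro: power_le_one)
 have Nb: "\<bar>N u\<bar> <= 4 * n" if "0 <= u" "u <= 1" for u
 proof -
  have "\<bar>N u\<bar> <= n + 1 * (4 * w * n) + 1 * (4 * w^2 * n)"
   unfolding N_def using u[OF that] n by (intro abs_add_le abs_mult_le) auto
  then show ?thesis using d2n by linarith
 qed
 have Jb: "\<bar>J u\<bar> <= 3" if "0 <= u" "u <= 1" for u
 proof -
  have "\<bar>J u\<bar> <= 1 + 1 * (2 * w) + 1 * (2 * w^2)"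
   unfolding J_def using u[OF that] j by (intro abs_add_le abs_mult_le) auto
  then show ?thesis using d2 w by linarith
 qed
 have N': "\<bar>n1 + 2 * s * n2\<bar> <= 8 * w * n"
 proof -
  have "\<bar>n1 + 2 * s * n2\<bar> <= 4 * w * n + 2 * (4 * w^2 * n)"
   using n st by (intro abs_add_le abs_mult_le) auto
  then show ?thesis using d2n by linarith
 qed
 have J': "\<bar>j1 + 2 * s * j2\<bar> <= 4 * w"
 proof -
  have "\<bar>j1 + 2 * s * j2\<bar> <= 2 * w + 2 * (2 * w^2)"
   using j st by (intro abs_add_le abs_mult_le) auto
  then show ?thesis using d2 by linarith
 qed
 have p: "\<bar>p\<bar> <= 40 * w * n"
 proof -
  have "\<bar>p\<bar> <= 8 * w * n * 3 + 4 * n * (4 * w)"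
   unfolding p_def by (intro abs_diff_le abs_mult_le N' Jb Nb J' st)
  then show ?thesis by (simp add: algebra_simps)
 qed
 define q where "q = n2 * J s - N s * j2"
 have q: "\<bar>q\<bar> <= 20 * w^2 * n"
 proof -
  have "\<bar>q\<bar> <= 4 * w^2 * n * 3 + 4 * n * (2 * w^2)"
   unfolding q_def by (intro abs_diff_le abs_mult_le n j Jb Nb st)
  then show ?thesis by (simp add: algebra_simps)
 qed
 have Jpos: "0 < J s" "0 < J t" using J by linarith+
 have inv1: "1 / (J t * J s) <= 49"
 proof -
  have "1/7 * (1/7) <= J t * J s" using J by (intro mult_mono) auto
  then show ?thesis using Jpos by (simp add: divide_simps)
 qed
 have inv2: "1 / (J t * (J s)^2) <= 343"
 proof -
  have "1/7 * (1/7)^2 <= J t * (J s)^2" using J by (intro mult_mono power_mono) auto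
  then show ?thesis using Jpos by (simp add: divide_simps power2_eq_square)
 qed
 have inv3: "1 / (J s)^2 <= 49"
 proof -
  have "(1/7)^2 <= (J s)^2" using J by (intro power_mono) auto
  then show ?thesis using Jpos by (simp add: divide_simps power2_eq_square)
 qed
 have cross: "N t * J s - N s * J t = (t - s) * p + (t - s)^2 * q"
  unfolding p_def q_def N_def J_def by algebra
 have diff: "N t / J t - N s / J s = ((t - s) * p + (t - s)^2 * q) * (1 / (J t * J s))"
  using Jpos unfolding cross[symmetric] by (simp add: field_simps)
 have ts: "\<bar>t - s\<bar> <= 1" using st by auto
 have ts2: "(t - s)^2 <= \<bar>t - s\<bar>"
  using mult_right_mono[OF ts, of "\<bar>t - s\<bar>"] by (simp add: power2_eq_square)
 have a1: "\<bar>(t - s) * p + (t - s)^2 * q\<bar> <= 60 * w * \<bar>t - s\<bar> * n"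
 proof -
  have "\<bar>(t - s) * p + (t - s)^2 * q\<bar> <= \<bar>t - s\<bar> * (40 * w * n) + \<bar>t - s\<bar> * (20 * w^2 * n)"
   using ts2 by (intro abs_add_le abs_mult_le p q) auto
  also have "\<dots> <= \<bar>t - s\<bar> * (40 * w * n) + \<bar>t - s\<bar> * (20 * w * n)"
   using d2n by (intro add_left_mono mult_left_mono) auto
  finally show ?thesis by (simp add: algebra_simps)
 qed
 show "\<bar>N t / J t - N s / J s\<bar> <= 2940 * w * \<bar>t - s\<bar> * n"
 proof -
  have "\<bar>N t / J t - N s / J s\<bar> <= (60 * w * \<bar>t - s\<bar> * n) * 49"
   unfolding diff using Jpos inv1 by (intro abs_mult_le a1) auto
  then show ?thesis by (simp add: algebra_simps)
 qed
 show "\<bar>p / (J s)^2\<bar> <= 1960 * w * n"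
 proof -
  have "\<bar>p * (1 / (J s)^2)\<bar> <= (40 * w * n) * 49" using inv3 by (intro abs_mult_le p) auto
  then show ?thesis by (simp add: algebra_simps)
 qed
 show "\<bar>N t / J t\<bar> <= 28 * n"
 proof -
  have "\<bar>N t * (1 / J t)\<bar> <= (4 * n) * 7" using J Jpos st by (intro abs_mult_le Nb) (auto simp: divide_simps)
  then show ?thesis by (simp add: algebra_simps)
 qed
 define k where "k = (j1 + 2 * s * j2) + (t - s) * j2"
 have Jd: "J t - J s = (t - s) * k" unfolding k_def J_def by algebra
 have k: "\<bar>k\<bar> <= 5 * w"
 proof -
  have "\<bar>k\<bar> <= 4 * w + 1 * (2 * w^2)" unfolding k_def by (intro abs_add_le abs_mult_le J' ts j)
  also have "\<dots> <= 5 * w" using d2 by simp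
  finally show ?thesis .
 qed
 have "N t / J t - N s / J s - (t - s) * (p / (J s)^2) = ((t - s)^2 * (q * J s - p * k)) * (1 / (J t * (J s)^2))"
 proof -
  have "((t - s) * p + (t - s)^2 * q) * J s - (t - s) * p * J t = (t - s)^2 * (q * J s) - (t - s) * p * (J t - J s)"
   by (simp add: algebra_simps)
  also have "\<dots> = (t - s)^2 * (q * J s - p * k)" unfolding Jd by (simp add: algebra_simps power2_eq_square)
  finally have e: "((t - s) * p + (t - s)^2 * q) * J s - (t - s) * p * J t = (t - s)^2 * (q * J s - p * k)" .
  have "N t / J t - N s / J s - (t - s) * (p / (J s)^2) = (((t - s) * p + (t - s)^2 * q) * J s - (t - s) * p * J t) / (J t * (J s)^2)"
   unfolding diff using Jpos by (simp add: divide_simps power2_eq_square)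
  then show ?thesis unfolding e by simp
 qed
 moreover have "\<bar>((t - s)^2 * (q * J s - p * k)) * (1 / (J t * (J s)^2))\<bar> <= ((t - s)^2 * (20 * w^2 * n * 3 + 40 * w * n * (5 * w))) * 343"
  using Jpos inv2 by (intro abs_mult_le abs_diff_le q p k Jb st) auto
 ultimately show "\<bar>N t / J t - N s / J s - (t - s) * (p / (J s)^2)\<bar> <= 89180 * w^2 * (t - s)^2 * n"
  by (simp add: algebra_simps power2_eq_square)
qed

context
 fixes D :: "plane \<times> plane" and w :: real
 assumes D: "norm (fst D) <= w" "norm (snd D) <= w" and w: "w <= 3/7"
begin

lemma entries: "\<bar>fst (fst D)\<bar> <= w" "\<bar>snd (fst D)\<bar> <= w" "\<bar>fst (snd D)\<bar> <= w" "\<bar>snd (snd D)\<bar> <= w"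
 using D norm_fst_le[of "fst (fst D)" "snd (fst D)"] norm_snd_le[of "snd (fst D)" "fst (fst D)"]
  norm_fst_le[of "fst (snd D)" "snd (snd D)"] norm_snd_le[of "snd (snd D)" "fst (snd D)"] by auto

lemma delta_nonneg: "0 <= w" using D(1) norm_ge_zero order_trans by blast

lemma Ed_bound: "norm (Ed D X) <= 2 * w * norm X"
proof -
 have X: "\<bar>fst X\<bar> <= norm X" "\<bar>snd X\<bar> <= norm X"
  using norm_fst_le[of "fst X" "snd X"] norm_snd_le[of "snd X" "fst X"] by auto
 have l: "\<bar>u * fst X - v * snd X\<bar> <= w * (\<bar>fst X\<bar> + \<bar>snd X\<bar>)" if "\<bar>u\<bar> <= w" "\<bar>v\<bar> <= w" for u v
  using abs_diff_le[OF abs_mult_le[OF that(1) order_refl] abs_mult_le[OF that(2) order_refl], of "fst X" "snd X"] by (simp add: distrib_left)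
 have s2: "(\<bar>fst X\<bar> + \<bar>snd X\<bar>)^2 <= 2 * (norm X)^2"
  using zero_le_power2[of "\<bar>fst X\<bar> - \<bar>snd X\<bar>"] by (simp add: norm_prod_def power2_sum power2_diff)
 have "(norm (Ed D X))^2 = (fst (Ed D X))^2 + (snd (Ed D X))^2" by (simp add: norm_prod_def)
 also have "\<dots> <= (w * (\<bar>fst X\<bar> + \<bar>snd X\<bar>))^2 + (w * (\<bar>fst X\<bar> + \<bar>snd X\<bar>))^2"
 proof (rule add_mono)
  show "(fst (Ed D X))^2 <= (w * (\<bar>fst X\<bar> + \<bar>snd X\<bar>))^2"
   using l[OF entries(4,3)] delta_nonneg by (simp add: Ed_def abs_le_square_iff[symmetric])
  have "\<bar>snd (Ed D X)\<bar> = \<bar>snd (fst D) * fst X - fst (fst D) * snd X\<bar>" by (simp add: Ed_def)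
  then show "(snd (Ed D X))^2 <= (w * (\<bar>fst X\<bar> + \<bar>snd X\<bar>))^2"
   using l[OF entries(2,1)] delta_nonneg by (simp add: abs_le_square_iff[symmetric])
 qed
 also have "\<dots> = 2 * (w^2 * (\<bar>fst X\<bar> + \<bar>snd X\<bar>)^2)" by (simp add: power_mult_distrib)
 also have "\<dots> <= 2 * (w^2 * (2 * (norm X)^2))" using s2 by (intro mult_left_mono) auto
 also have "\<dots> = (2 * w * norm X)^2" by (simp add: power_mult_distrib)
 finally show ?thesis by (rule power2_le_imp_le) (intro mult_nonneg_nonneg delta_nonneg norm_ge_zero zero_le_numeral)
qed

lemma Nt_poly: "Nt D t X Y = (X \<bullet> Y) + t * (X \<bullet> Ed D Y + Ed D X \<bullet> Y) + t^2 * (Ed D X \<bullet> Ed D Y)"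
 by (simp add: Nt_def inner_add_left inner_add_right power2_eq_square algebra_simps)

lemma Jt_lower: assumes t: "0 <= t" "t <= 1" shows "1/7 <= Jt D t"
proof -
 have e: "\<bar>t * u\<bar> <= w" if "\<bar>u\<bar> <= w" for u
  using abs_mult_le[of t 1 u w] t that by simp
 have f: "Jt D t = (1 + t * fst (fst D)) * (1 + t * snd (snd D)) - (t * snd (fst D)) * (t * fst (snd D))"
  by (simp add: Jt_def power2_eq_square algebra_simps)
 have "(1 - w) * (1 - w) <= (1 + t * fst (fst D)) * (1 + t * snd (snd D))"
  using e[OF entries(1)] e[OF entries(4)] w by (intro mult_mono) auto
 moreover have "(t * snd (fst D)) * (t * fst (snd D)) <= w * w"
  using abs_mult_le[OF e[OF entries(2)] e[OF entries(3)]] by linarith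
 moreover have "(1 - w) * (1 - w) - w * w = 1 - 2 * w" by (simp add: algebra_simps)
 ultimately show ?thesis using f w by linarith
qed

lemma Kt_estimates:
 assumes s: "0 <= s" "s <= 1" and t: "0 <= t" "t <= 1"
 shows "\<bar>Kt D t X Y - Kt D s X Y\<bar> <= 2940 * w * \<bar>t - s\<bar> * (norm X * norm Y)"
  "\<bar>Kt D t X Y - Kt D s X Y - (t - s) * Bt D s X Y\<bar> <= 89180 * w^2 * (t - s)^2 * (norm X * norm Y)"
  "\<bar>Bt D s X Y\<bar> <= 1960 * w * (norm X * norm Y)" "\<bar>Kt D t X Y\<bar> <= 28 * (norm X * norm Y)"
proof -
 let ?n = "norm X * norm Y"
 have n1: "\<bar>X \<bullet> Ed D Y + Ed D X \<bullet> Y\<bar> <= 4 * w * ?n"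
 proof -
  have "\<bar>X \<bullet> Ed D Y\<bar> <= norm X * (2 * w * norm Y)"
   using Cauchy_Schwarz_ineq2[of X "Ed D Y"] mult_left_mono[OF Ed_bound[of Y] norm_ge_zero[of X]] by linarith
  moreover have "\<bar>Ed D X \<bullet> Y\<bar> <= 2 * w * norm X * norm Y"
   using Cauchy_Schwarz_ineq2[of "Ed D X" Y] mult_right_mono[OF Ed_bound[of X] norm_ge_zero[of Y]] by linarith
  ultimately show ?thesis by (simp add: algebra_simps)
 qed
 have n2: "\<bar>Ed D X \<bullet> Ed D Y\<bar> <= 4 * w^2 * ?n"
 proof -
  have "\<bar>Ed D X \<bullet> Ed D Y\<bar> <= (2 * w * norm X) * (2 * w * norm Y)"
   using order_trans[OF Cauchy_Schwarz_ineq2 mult_mono[OF Ed_bound Ed_bound]] delta_nonneg by simp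
  then show ?thesis by (simp add: power2_eq_square algebra_simps)
 qed
 have j1: "\<bar>fst (fst D) + snd (snd D)\<bar> <= 2 * w" using abs_add_le[OF entries(1,4)] by simp
 have j2: "\<bar>fst (fst D) * snd (snd D) - snd (fst D) * fst (snd D)\<bar> <= 2 * w^2"
  using abs_diff_le[OF abs_mult_le[OF entries(1,4)] abs_mult_le[OF entries(2,3)]] by (simp add: power2_eq_square)
 have d: "w <= 1/2" using w by simp
 note q = quotient_expansion[OF delta_nonneg d _ Cauchy_Schwarz_ineq2 n1 n2 j1 j2 s t
   Jt_lower[OF s, unfolded Jt_def] Jt_lower[OF t, unfolded Jt_def]]
 show "\<bar>Kt D t X Y - Kt D s X Y\<bar> <= 2940 * w * \<bar>t - s\<bar> * ?n"
  "\<bar>Kt D t X Y - Kt D s X Y - (t - s) * Bt D s X Y\<bar> <= 89180 * w^2 * (t - s)^2 * ?n"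
  "\<bar>Bt D s X Y\<bar> <= 1960 * w * ?n" "\<bar>Kt D t X Y\<bar> <= 28 * ?n"
  unfolding Kt_def Bt_def Nt_poly Jt_def by (rule q, simp)+
qed

text \<open>The transpose of \<open>I + t D\<close> inverts the cofactor matrix up to the determinant, which bounds the latter matrix
 from below.\<close>

lemma Kt_coercive:
 assumes t: "0 <= t" "t <= 1" shows "(norm X)^2 / 28 <= Kt D t X X"
proof -
 define A where "A = X + t *\<^sub>R Ed D X"
 define D' where "D' = ((snd (snd D), - snd (fst D)), (- fst (snd D), fst (fst D)))"
 have e: "\<bar>u * fst A + v * snd A\<bar> <= w * (\<bar>fst A\<bar> + \<bar>snd A\<bar>)" if "\<bar>u\<bar> <= w" "\<bar>v\<bar> <= w" for u v
  using abs_add_le[OF abs_mult_le[OF that(1) order_refl] abs_mult_le[OF that(2) order_refl], of "fst A" "snd A"] by (simp add: distrib_left)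
 define R where "R = (fst (fst D) * fst A + fst (snd D) * snd A, snd (fst D) * fst A + snd (snd D) * snd A)"
 have id: "Jt D t *\<^sub>R X = A + t *\<^sub>R R"
  by (simp add: A_def R_def Jt_def Ed_def prod_eq_iff power2_eq_square algebra_simps)
 have s2: "(\<bar>fst A\<bar> + \<bar>snd A\<bar>)^2 <= 2 * (norm A)^2"
  using zero_le_power2[of "\<bar>fst A\<bar> - \<bar>snd A\<bar>"] by (simp add: norm_prod_def power2_sum power2_diff)
 have "(norm R)^2 = (fst R)^2 + (snd R)^2" by (simp add: norm_prod_def)
 also have "\<dots> <= (w * (\<bar>fst A\<bar> + \<bar>snd A\<bar>))^2 + (w * (\<bar>fst A\<bar> + \<bar>snd A\<bar>))^2"
  using e[OF entries(1,3)] e[OF entries(2,4)] delta_nonneg by (intro add_mono) (auto simp: R_def abs_le_square_iff[symmetric])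
 also have "\<dots> = 2 * (w^2 * (\<bar>fst A\<bar> + \<bar>snd A\<bar>)^2)" by (simp add: power_mult_distrib)
 also have "\<dots> <= 2 * (w^2 * (2 * (norm A)^2))" using s2 by (intro mult_left_mono) auto
 also have "\<dots> = (2 * w * norm A)^2" by (simp add: power_mult_distrib)
 finally have R: "norm R <= 2 * w * norm A"
  by (rule power2_le_imp_le) (intro mult_nonneg_nonneg delta_nonneg norm_ge_zero zero_le_numeral)
 have J: "1/7 <= Jt D t" by (rule Jt_lower[OF t])
 have "Jt D t * norm X = norm (A + t *\<^sub>R R)" using J by (simp flip: id)
 also have "\<dots> <= norm A + 1 * norm R"
  by (rule order_trans[OF norm_triangle_ineq]) (use t in \<open>auto intro: mult_left_le_one_le\<close>)
 also have "\<dots> <= 2 * norm A" using R mult_right_mono[OF w, of "norm A"] norm_ge_zero[of A] by linarith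
 finally have "(Jt D t * norm X)^2 <= (2 * norm A)^2" using J by (intro power_mono) auto
 then have "(Jt D t)^2 * (norm X)^2 <= 4 * (norm A)^2" by (simp add: power_mult_distrib)
 then have "Jt D t * (norm X)^2 / 4 <= (norm A)^2 / Jt D t"
  using J by (simp add: field_simps power2_eq_square)
 moreover have "1/7 * (norm X)^2 <= Jt D t * (norm X)^2" using J by (intro mult_right_mono) auto
 moreover have "Kt D t X X = (norm A)^2 / Jt D t" by (simp add: Kt_def Nt_def A_def power2_norm_eq_inner)
 ultimately show ?thesis by simp
qed

end

lemma Kt_commute: "Kt D t X Y = Kt D t Y X" by (simp add: Kt_def Nt_def inner_commute)

lemma abs_fst_le: "\<bar>fst x\<bar> <= norm (x :: plane)" and abs_snd_le: "\<bar>snd x\<bar> <= norm (x :: plane)"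
 using norm_fst_le[of "fst x" "snd x"] norm_snd_le[of "snd x" "fst x"] by auto

subsection \<open>Smooth displacements are diffeomorphisms\<close>

text \<open>The derivative of the inverse at \<open>y\<close> is a smooth function of the point \<open>Q y\<close>, so an induction over all
 smooth \<open>h\<close> closes.\<close>

lemma smooth_inverse_diffeo:
 assumes s: "smooth (\<lambda>x. fst (P x))" "smooth (\<lambda>x. snd (P x))"
  and inv: "\<And>x. P (Q x) = x" "\<And>x. Q (P x) = x" and c: "continuous_on UNIV Q" and J: "\<And>x. jac P x ~= 0" and h: "smooth h"
 shows "smooth (\<lambda>y. h (Q y))"
proof -
 define A B where "A = grad (\<lambda>x. fst (P x))" and "B = grad (\<lambda>x. snd (P x))"
 define E where "E x v = ((snd (B x) * fst v - snd (A x) * snd v) / jac P x, (fst (A x) * snd v - fst (B x) * fst v) / jac P x)" for x and v :: plane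
 have dP: "(P has_derivative (\<lambda>v. (A x \<bullet> v, B x \<bullet> v))) (at x)" for x
  using has_derivative_Pair[OF smooth_has_derivative[OF s(1)] smooth_has_derivative[OF s(2)]] by (simp add: A_def B_def)
 have dE: "(Q has_derivative E (Q y)) (at y)" for y
 proof (rule has_derivative_inverse_basic[OF dP, where T=UNIV])
  show "bounded_linear (E (Q y))"
   unfolding E_def
   by (intro bounded_linear_Pair bounded_linear_divide[THEN bounded_linear_compose] bounded_linear_sub
    bounded_linear_const_mult bounded_linear_fst bounded_linear_snd)
  show "E (Q y) \<circ> (\<lambda>v. (A (Q y) \<bullet> v, B (Q y) \<bullet> v)) = id"
  proof (rule ext)
   fix v :: plane
   have j: "jac P (Q y) = fst (A (Q y)) * snd (B (Q y)) - snd (A (Q y)) * fst (B (Q y))"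
    by (simp add: jac_def A_def B_def)
   have "snd (B (Q y)) * (A (Q y) \<bullet> v) - snd (A (Q y)) * (B (Q y) \<bullet> v) = jac P (Q y) * fst v"
    "fst (A (Q y)) * (B (Q y) \<bullet> v) - fst (B (Q y)) * (A (Q y) \<bullet> v) = jac P (Q y) * snd v"
    unfolding j inner_plane by algebra+
   then show "(E (Q y) \<circ> (\<lambda>v. (A (Q y) \<bullet> v, B (Q y) \<bullet> v))) v = id v" using J by (simp add: E_def)
  qed
  show "isCont Q y" using c by (simp add: continuous_on_eq_continuous_at)
 qed (use inv in auto)
 have "Ck n (\<lambda>y. h (Q y))" if "smooth h" for n h
  using that
 proof (induction n arbitrary: h)
  case 0
  then show ?case using continuous_on_compose2[OF smooth_continuous[OF 0, of UNIV] c] by simp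
 next
  case (Suc n)
  show ?case
  proof (rule Ck_SucI)
   show "((\<lambda>y. h (Q y)) has_derivative (\<lambda>v. grad h (Q y) \<bullet> E (Q y) v)) (at y)" for y
    by (rule has_derivative_compose[OF dE smooth_has_derivative[OF Suc.prems]])
   have "smooth (\<lambda>x. grad h x \<bullet> E x v)" for v
    unfolding inner_plane E_def fst_conv snd_conv A_def B_def
    by (intro smooth_add smooth_mult smooth_divide J smooth_diff smooth_const smooth_grad s Suc.prems smooth_diff[folded jac_def])
     (auto simp: jac_def[abs_def] intro!: smooth_diff smooth_mult smooth_grad s)
   from Suc.IH[OF this] show "Ck n (\<lambda>y. grad h (Q y) \<bullet> E (Q y) v)" for v .
  qed
 qed
 then show ?thesis using h by (simp add: smooth_def)
qed

locale smooth_displacement =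
 fixes L r :: real and V :: "plane => plane" and \<delta> :: real
 assumes L: "0 < L" and r: "r < L"
  and smooth_V: "smooth (\<lambda>x. fst (V x))" "smooth (\<lambda>x. snd (V x))"
  and lipV: "\<And>x y. norm (V x - V y) <= \<delta> * norm (x - y)" and \<delta>: "0 <= \<delta>" "\<delta> <= 3/7"
  and V0: "\<And>x. x \<notin> cbox (-r,-r) (r,r) ==> V x = 0"
begin

lemma dV_bound: "norm (fst (dV V x)) <= \<delta>" "norm (snd (dV V x)) <= \<delta>"
proof -
 have "\<bar>fst (V x) - fst (V y)\<bar> <= \<delta> * norm (x - y)" "\<bar>snd (V x) - snd (V y)\<bar> <= \<delta> * norm (x - y)" for x y
  using order_trans[OF abs_fst_le lipV[of x y]] order_trans[OF abs_snd_le lipV[of x y]] by auto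
 then show "norm (fst (dV V x)) <= \<delta>" "norm (snd (dV V x)) <= \<delta>"
  using grad_lipschitz[OF smooth_V(1)] grad_lipschitz[OF smooth_V(2)] by (auto simp: dV_def)
qed

lemma smooth_flow: "smooth (\<lambda>x. fst (flow V t x))" "smooth (\<lambda>x. snd (flow V t x))"
 unfolding flow_def by (auto intro!: smooth_add smooth_mult smooth_V)

lemma grad_flow: "grad (\<lambda>x. fst (flow V t x)) x = (1, 0) + t *\<^sub>R fst (dV V x)"
 "grad (\<lambda>x. snd (flow V t x)) x = (0, 1) + t *\<^sub>R snd (dV V x)"
proof -
 have l: "grad fst x = (1,0)" "grad snd x = (0,1)"
  by (rule grad_eqI, rule has_derivative_eq_rhs[OF bounded_linear_imp_has_derivative[OF bounded_linear_fst]], simp add: inner_plane fun_eq_iff,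
    rule grad_eqI, rule has_derivative_eq_rhs[OF bounded_linear_imp_has_derivative[OF bounded_linear_snd]], simp add: inner_plane fun_eq_iff)
 show "grad (\<lambda>x. fst (flow V t x)) x = (1, 0) + t *\<^sub>R fst (dV V x)"
  "grad (\<lambda>x. snd (flow V t x)) x = (0, 1) + t *\<^sub>R snd (dV V x)"
  using grad_add[OF smooth_fst smooth_mult[OF smooth_const[of t] smooth_V(1)], of x] grad_add[OF smooth_snd smooth_mult[OF smooth_const[of t] smooth_V(2)], of x]
  by (simp_all add: flow_def dV_def l grad_cmult[OF smooth_V(1)] grad_cmult[OF smooth_V(2)])
qed

lemma jac_flow: "jac (flow V t) x = Jt (dV V x) t"
 by (simp add: jac_def grad_flow Jt_def power2_eq_square algebra_simps)

lemma displacement: "0 <= t ==> t <= 1 ==> displacement V \<delta> t"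
 by unfold_locales (use lipV \<delta> in auto)

lemma diffeo: assumes t: "0 <= t" "t <= 1" shows "smooth_diffeo L r (flow V t) (unflow V t)"
proof -
 have J: "jac (flow V t) x ~= 0" for x
  using Jt_lower[OF dV_bound \<delta>(2) t, of x] by (simp add: jac_flow)
 interpret displacement V \<delta> t by (rule displacement[OF t])
 show ?thesis
  by unfold_locales
   (use L r smooth_flow V0 in \<open>auto intro!: flow_id unflow_id smooth_inverse_diffeo[OF smooth_flow flow_unflow unflow_flow continuous_unflow J]\<close>)
qed

text \<open>Pulling back multiplies by the transposed Jacobian matrix, which the cofactor matrix inverts up to the
 determinant.\<close>

lemma pull_energy:
 assumes t: "0 <= t" "t <= 1"
 shows "\<bar>jac (flow V t) x\<bar> * (G (flow V t x) \<bullet> H (flow V t x)) = Kt (dV V x) t (pull (flow V t) G x) (pull (flow V t) H x)"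
proof -
 let ?D = "dV V x" and ?g = "G (flow V t x)" and ?h = "H (flow V t x)"
 have J: "0 < Jt ?D t" using Jt_lower[OF dV_bound \<delta>(2) t, of x] by simp
 have e: "pull (flow V t) G x + t *\<^sub>R Ed ?D (pull (flow V t) G x) = Jt ?D t *\<^sub>R G (flow V t x)" for G
  by (simp add: pull_def grad_flow Ed_def Jt_def prod_eq_iff power2_eq_square algebra_simps)
 show ?thesis unfolding Kt_def Nt_def e jac_flow using J by simp
qed

lemma AE_flow:
 assumes t: "0 <= t" "t <= 1" and P: "AE x in SM L. P x"
 shows "AE x in SM L. P (flow V t x)" "AE x in SM L. P (unflow V t x)"
proof -
 interpret d: smooth_diffeo L r "flow V t" "unflow V t" by (rule diffeo[OF t])
 interpret i: smooth_diffeo L r "unflow V t" "flow V t" by (rule d.inverse_diffeo)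
 have "AE x in lborel. x \<in> square L --> P x"
  using P by (simp add: AE_restrict_space_iff AE_completion_iff)
 then obtain N where N: "N \<in> null_sets lborel" "\<And>x. x \<notin> N ==> x \<in> square L --> P x"
  by (auto simp: eventually_ae_filter)
 have "AE x in lborel. x \<in> square L --> P (flow V t x)"
  using AE_not_in[OF d.null_preimage[OF N(1)]] by eventually_elim (use N(2) d.image_square in auto)
 moreover have "AE x in lborel. x \<in> square L --> P (unflow V t x)"
  using AE_not_in[OF i.null_preimage[OF N(1)]] by eventually_elim (use N(2) i.image_square in auto)
 ultimately show "AE x in SM L. P (flow V t x)" "AE x in SM L. P (unflow V t x)"
  by (simp_all add: AE_restrict_space_iff AE_completion_iff)
qed

definition kform :: "(plane => real) => real => (plane => plane) => (plane => plane) => real" where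
 "kform \<gamma> t X Y = (LINT x|SM L. \<gamma> x * Kt (dV V x) t (X x) (Y x))"

lemma kernel_measurable:
 assumes [measurable]: "X \<in> borel_measurable (SM L)" "Y \<in> borel_measurable (SM L)"
 shows "(\<lambda>x. Kt (dV V x) t (X x) (Y x)) \<in> borel_measurable (SM L)"
  "(\<lambda>x. Bt (dV V x) t (X x) (Y x)) \<in> borel_measurable (SM L)"
proof -
 have [measurable]: "(\<lambda>x. grad (\<lambda>x. fst (V x)) x) \<in> borel_measurable (SM L)" "(\<lambda>x. grad (\<lambda>x. snd (V x)) x) \<in> borel_measurable (SM L)"
  by (intro continuous_measurable_SM continuous_grad smooth_V)+
 show "(\<lambda>x. Kt (dV V x) t (X x) (Y x)) \<in> borel_measurable (SM L)"
  "(\<lambda>x. Bt (dV V x) t (X x) (Y x)) \<in> borel_measurable (SM L)"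
  unfolding Kt_def Bt_def Nt_def Jt_def Ed_def dV_def fst_conv snd_conv by measurable
qed

end

locale displaced_coefficient = smooth_displacement L r V \<delta> + coefficient L \<gamma> \<kappa> \<Lambda>
 for L r V \<delta> \<gamma> \<kappa> \<Lambda> +
 assumes Lambda_nonneg: "0 <= \<Lambda>"
begin

lemma weighted_bound:
 assumes X: "L2 (SM L) X" and Y: "L2 (SM L) Y" and h: "h \<in> borel_measurable (SM L)"
  and b: "\<And>x. \<bar>h x\<bar> <= B * (norm (X x) * norm (Y x))" and B: "0 <= B"
 shows "integrable (SM L) (\<lambda>x. \<gamma> x * h x)" "\<bar>\<integral>x. \<gamma> x * h x \<partial>SM L\<bar> <= (\<bar>\<Lambda>\<bar> * B) * (nrm (SM L) X * nrm (SM L) Y)"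
proof -
 have m: "(\<lambda>x. \<gamma> x * h x) \<in> borel_measurable (SM L)" using a h by measurable
 have "AE x in SM L. \<bar>\<gamma> x * h x\<bar> <= (\<bar>\<Lambda>\<bar> * B) * (norm (X x) * norm (Y x))"
  using bounds
 proof eventually_elim
  case (elim x)
  show ?case using abs_mult_le[OF _ b[of x], of "\<gamma> x" "\<bar>\<Lambda>\<bar>"] elim \<kappa> by (simp add: mult.assoc)
 qed
 from integral_bilinear_bound[OF X Y m this] B
 show "integrable (SM L) (\<lambda>x. \<gamma> x * h x)" "\<bar>\<integral>x. \<gamma> x * h x \<partial>SM L\<bar> <= (\<bar>\<Lambda>\<bar> * B) * (nrm (SM L) X * nrm (SM L) Y)"
  by auto
qed

lemma kform_bound:
 assumes t: "0 <= t" "t <= 1" and X: "L2 (SM L) X" and Y: "L2 (SM L) Y"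
 shows "integrable (SM L) (\<lambda>x. \<gamma> x * Kt (dV V x) t (X x) (Y x))"
  "\<bar>kform \<gamma> t X Y\<bar> <= (\<bar>\<Lambda>\<bar> * 28) * (nrm (SM L) X * nrm (SM L) Y)"
 using weighted_bound[OF X Y kernel_measurable(1)[OF L2_measurable[OF X] L2_measurable[OF Y]]
   Kt_estimates(4)[OF dV_bound \<delta>(2) t t]] by (auto simp: kform_def)

lemma kform_commute: "kform \<gamma> t X Y = kform \<gamma> t Y X" by (simp add: kform_def Kt_commute)

lemma kform_diff:
 assumes t: "0 <= t" "t <= 1" and X: "L2 (SM L) X" "L2 (SM L) X'" and Y: "L2 (SM L) Y"
 shows "kform \<gamma> t (\<lambda>x. X x - X' x) Y = kform \<gamma> t X Y - kform \<gamma> t X' Y"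
proof -
 have "Kt D t (a - b) c = Kt D t a c - Kt D t b c" for D a b c
  by (simp add: Kt_def Nt_def Ed_def inner_plane diff_divide_distrib[symmetric] algebra_simps)
 then show ?thesis
  using kform_bound(1)[OF t X(1) Y] kform_bound(1)[OF t X(2) Y] by (simp add: kform_def right_diff_distrib)
qed

lemma kform_coercive:
 assumes t: "0 <= t" "t <= 1" and X: "L2 (SM L) X"
 shows "\<kappa> / 28 * (nrm (SM L) X)^2 <= kform \<gamma> t X X"
proof -
 have "(LINT x|SM L. \<kappa> / 28 * (norm (X x))^2) <= kform \<gamma> t X X" unfolding kform_def
 proof (rule integral_mono_AE[OF integrable_mult_right[OF L2_integrable[OF X]] kform_bound(1)[OF t X X]])
  show "AE x in SM L. \<kappa> / 28 * (norm (X x))^2 <= \<gamma> x * Kt (dV V x) t (X x) (X x)"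
   using bounds
  proof eventually_elim
   case (elim x)
   have "\<kappa> * ((norm (X x))^2 / 28) <= \<gamma> x * Kt (dV V x) t (X x) (X x)"
    using elim \<kappa> Kt_coercive[OF dV_bound \<delta>(2) t, of "X x" x] by (intro mult_mono) auto
   then show ?case by simp
  qed
 qed
 then show ?thesis by (simp add: nrm_sq sqn_def)
qed

lemma kform_difference:
 assumes s: "0 <= s" "s <= 1" and t: "0 <= t" "t <= 1" and X: "L2 (SM L) X" and Y: "L2 (SM L) Y"
 shows "\<bar>kform \<gamma> t X Y - kform \<gamma> s X Y\<bar> <= (\<bar>\<Lambda>\<bar> * (2940 * \<delta> * \<bar>t - s\<bar>)) * (nrm (SM L) X * nrm (SM L) Y)"
  "\<bar>kform \<gamma> t X Y - kform \<gamma> s X Y - (t - s) * (LINT x|SM L. \<gamma> x * Bt (dV V x) s (X x) (Y x))\<bar>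
   <= (\<bar>\<Lambda>\<bar> * (89180 * \<delta>^2 * (t - s)^2)) * (nrm (SM L) X * nrm (SM L) Y)"
proof -
 note m = L2_measurable[OF X] L2_measurable[OF Y]
 note E = Kt_estimates[OF dV_bound \<delta>(2) s t]
 have mb: "(\<lambda>x. Bt (dV V x) s (X x) (Y x)) \<in> borel_measurable (SM L)" by (rule kernel_measurable(2)[OF m])
 have mt: "(\<lambda>x. Kt (dV V x) t (X x) (Y x)) \<in> borel_measurable (SM L)" for t by (rule kernel_measurable(1)[OF m])
 have iB: "integrable (SM L) (\<lambda>x. \<gamma> x * Bt (dV V x) s (X x) (Y x))"
  by (rule weighted_bound(1)[OF X Y mb E(3)]) (use \<delta> in auto)
 note i = kform_bound(1)[OF t X Y] kform_bound(1)[OF s X Y]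
 have "\<bar>\<integral>x. \<gamma> x * (Kt (dV V x) t (X x) (Y x) - Kt (dV V x) s (X x) (Y x)) \<partial>SM L\<bar>
   <= (\<bar>\<Lambda>\<bar> * (2940 * \<delta> * \<bar>t - s\<bar>)) * (nrm (SM L) X * nrm (SM L) Y)"
  by (rule weighted_bound(2)[OF X Y borel_measurable_diff[OF mt mt] E(1)]) (use \<delta> in auto)
 then show "\<bar>kform \<gamma> t X Y - kform \<gamma> s X Y\<bar> <= (\<bar>\<Lambda>\<bar> * (2940 * \<delta> * \<bar>t - s\<bar>)) * (nrm (SM L) X * nrm (SM L) Y)"
  using i by (simp add: kform_def right_diff_distrib)
 have "\<bar>\<integral>x. \<gamma> x * (Kt (dV V x) t (X x) (Y x) - Kt (dV V x) s (X x) (Y x) - (t - s) * Bt (dV V x) s (X x) (Y x)) \<partial>SM L\<bar>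
   <= (\<bar>\<Lambda>\<bar> * (89180 * \<delta>^2 * (t - s)^2)) * (nrm (SM L) X * nrm (SM L) Y)"
  by (rule weighted_bound(2)[OF X Y borel_measurable_diff[OF borel_measurable_diff[OF mt mt] borel_measurable_times[OF borel_measurable_const mb]] E(2)])
   auto
 moreover have "(\<lambda>x. \<gamma> x * (Kt (dV V x) t (X x) (Y x) - Kt (dV V x) s (X x) (Y x) - (t - s) * Bt (dV V x) s (X x) (Y x)))
  = (\<lambda>x. \<gamma> x * Kt (dV V x) t (X x) (Y x) - \<gamma> x * Kt (dV V x) s (X x) (Y x) - (t - s) * (\<gamma> x * Bt (dV V x) s (X x) (Y x)))"
  by (simp add: fun_eq_iff algebra_simps)
 ultimately show "\<bar>kform \<gamma> t X Y - kform \<gamma> s X Y - (t - s) * (LINT x|SM L. \<gamma> x * Bt (dV V x) s (X x) (Y x))\<bar>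
   <= (\<bar>\<Lambda>\<bar> * (89180 * \<delta>^2 * (t - s)^2)) * (nrm (SM L) X * nrm (SM L) Y)"
  using i iB by (simp add: kform_def)
qed

lemma displaced: assumes t: "0 <= t" "t <= 1" shows "coefficient L (\<lambda>x. \<gamma> (unflow V t x)) \<kappa> \<Lambda>"
proof -
 interpret d: smooth_diffeo L r "flow V t" "unflow V t" by (rule diffeo[OF t])
 interpret i: smooth_diffeo L r "unflow V t" "flow V t" by (rule d.inverse_diffeo)
 show ?thesis
  by unfold_locales (use L \<kappa> AE_flow(2)[OF t bounds] measurable_compose[OF i.SM_measurable a] in auto)
qed

lemma form_pull:
 assumes t: "0 <= t" "t <= 1" and G: "L2 (SM L) G" and H: "L2 (SM L) H"
 shows "coefficient.form L (\<lambda>x. \<gamma> (unflow V t x)) G H = kform \<gamma> t (pull (flow V t) G) (pull (flow V t) H)"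
proof -
 interpret d: smooth_diffeo L r "flow V t" "unflow V t" by (rule diffeo[OF t])
 interpret c: coefficient L "\<lambda>x. \<gamma> (unflow V t x)" \<kappa> \<Lambda> by (rule displaced[OF t])
 have "(\<lambda>x. \<gamma> (unflow V t x) * (G x \<bullet> H x)) \<in> borel_measurable (SM L)"
  using c.a L2_measurable[OF G] L2_measurable[OF H] by measurable
 from d.integral_change(2)[OF this] show ?thesis
  unfolding c.form_def kform_def by (simp add: d.inv mult.left_commute pull_energy[OF t])
qed

text \<open>The Dirichlet to Neumann form of a displaced coefficient, pulled back to the reference
 configuration, where only the coefficient matrix of the energy depends on time.\<close>

lemma pulled_solution:
 assumes t: "0 <= t" "t <= 1" and f: "L2 (bdry L) f" and H: "trace_grad L f H"
 shows "\<exists>X. trace_grad L f X \<and> (\<forall>Z. trace_grad L (\<lambda>_. 0) Z --> kform \<gamma> t X Z = 0) \<and>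
  nrm (SM L) X <= 784 * \<Lambda> / \<kappa> * nrm (SM L) H \<and>
  (\<forall>g Y. L2 (bdry L) g --> trace_grad L g Y --> DN L (\<lambda>x. \<gamma> (unflow V t x)) f g = kform \<gamma> t X Y)"
proof -
 interpret d: smooth_diffeo L r "flow V t" "unflow V t" by (rule diffeo[OF t])
 interpret i: smooth_diffeo L r "unflow V t" "flow V t" by (rule d.inverse_diffeo)
 interpret c: coefficient L "\<lambda>x. \<gamma> (unflow V t x)" \<kappa> \<Lambda> by (rule displaced[OF t])
 obtain G where G: "c.solves f G" using c.solution_exists[OF f H] by blast
 then have tG: "trace_grad L f G" by (simp add: c.solves_def)
 define X where "X = pull (flow V t) G"
 have tX: "trace_grad L f X" unfolding X_def by (rule d.trace_grad_pull[OF tG])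
 have form: "c.form G (pull (unflow V t) Z) = kform \<gamma> t X Z" if "trace_grad L g Z" for g Z
 proof -
  have "pull (flow V t) (pull (unflow V t) Z) = Z" by (simp add: fun_eq_iff d.pull_pull)
  then show ?thesis
   using form_pull[OF t trace_grad_L2[OF tG] trace_grad_L2[OF i.trace_grad_pull[OF that]]] by (simp add: X_def)
 qed
 have z: "kform \<gamma> t X Z = 0" if "trace_grad L (\<lambda>_. 0) Z" for Z
  using form[OF that] G i.trace_grad_pull[OF that] by (simp add: c.solves_def)
 have DN: "DN L (\<lambda>x. \<gamma> (unflow V t x)) f g = kform \<gamma> t X Y" if "L2 (bdry L) g" "trace_grad L g Y" for g Y
  using c.DN_eq_form[OF f that(1) G i.trace_grad_pull[OF that(2)]] form[OF that(2)] by simp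
 have LX: "L2 (SM L) X" and LH: "L2 (SM L) H" using trace_grad_L2[OF tX] trace_grad_L2[OF H] by auto
 have "nrm (SM L) X <= 784 * \<Lambda> / \<kappa> * nrm (SM L) H"
 proof (cases "nrm (SM L) X = 0")
  case False
  have "kform \<gamma> t X X = kform \<gamma> t X H"
   using z[OF trace_grad_diff[OF L f tX H]] kform_diff[OF t LX LH LX]
    kform_commute[of t X "\<lambda>x. X x - H x"] kform_commute[of t H X] by linarith
  then have "\<kappa> / 28 * (nrm (SM L) X)^2 <= (\<bar>\<Lambda>\<bar> * 28) * (nrm (SM L) X * nrm (SM L) H)"
   using kform_coercive[OF t LX] kform_bound(2)[OF t LX LH] by linarith
  then have "\<kappa> / 28 * nrm (SM L) X <= (\<bar>\<Lambda>\<bar> * 28) * nrm (SM L) H"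
   using False by (simp add: power2_eq_square mult.left_commute[of _ "nrm (SM L) X"] mult_le_cancel_left_pos less_le)
  then show ?thesis using \<kappa> Lambda_nonneg by (simp add: field_simps)
 qed (use \<kappa> Lambda_nonneg in auto)
 then show ?thesis using tX z DN by blast
qed

text \<open>The solutions \<open>X t\<close> and \<open>X s\<close> have the same trace, and so have \<open>Y t\<close> and \<open>Y s\<close>; hence \<open>N t - N s\<close> is the difference
 of the two forms at \<open>X t\<close>, \<open>Y s\<close>. Replacing \<open>X t\<close> by \<open>X s\<close> there costs a term of second order, because \<open>X t - X s\<close> is
 of first order in \<open>t - s\<close>.\<close>

lemma DN_second_order:
 assumes f: "L2 (bdry L) f" "trace_grad L f Hf" and g: "L2 (bdry L) g" "trace_grad L g Hg"
 defines "N \<equiv> \<lambda>t. DN L (\<lambda>x. \<gamma> (unflow V t x)) f g"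
 shows "\<exists>D. \<forall>s\<in>{0..1}. \<forall>t\<in>{0..1}. \<bar>N t - N s - (t - s) * D s\<bar>
  <= \<Lambda> * (784 * \<Lambda> / \<kappa>)^2 * (89180 + 2940^2 * 28 * \<Lambda> / \<kappa>) * \<delta>^2 * (t - s)^2 * (nrm (SM L) Hf * nrm (SM L) Hg)"
proof -
 let ?n = "nrm (SM L)"
 define A where "A = 784 * \<Lambda> / \<kappa>"
 have A: "0 <= A" using Lambda_nonneg \<kappa> by (simp add: A_def)
 have "\<forall>t\<in>{0..1}. \<exists>X. trace_grad L f X \<and> (\<forall>Z. trace_grad L (\<lambda>_. 0) Z --> kform \<gamma> t X Z = 0) \<and>
  ?n X <= A * ?n Hf \<and> (\<forall>g Y. L2 (bdry L) g --> trace_grad L g Y --> DN L (\<lambda>x. \<gamma> (unflow V t x)) f g = kform \<gamma> t X Y)"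
  using pulled_solution[OF _ _ f] unfolding A_def by auto
 from bchoice[OF this] obtain X where X: "\<And>t. t \<in> {0..1} ==> trace_grad L f (X t)"
  "\<And>t Z. t \<in> {0..1} ==> trace_grad L (\<lambda>_. 0) Z ==> kform \<gamma> t (X t) Z = 0"
  "\<And>t. t \<in> {0..1} ==> ?n (X t) <= A * ?n Hf"
  "\<And>t Y. t \<in> {0..1} ==> trace_grad L g Y ==> N t = kform \<gamma> t (X t) Y"
  using g(1) unfolding N_def by blast
 have "\<forall>t\<in>{0..1}. \<exists>Y. trace_grad L g Y \<and> (\<forall>Z. trace_grad L (\<lambda>_. 0) Z --> kform \<gamma> t Y Z = 0) \<and> ?n Y <= A * ?n Hg"
 proof
  fix t :: real assume "t \<in> {0..1}"
  then have t: "0 <= t" "t <= 1" by auto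
  from pulled_solution[OF t g] obtain Y where "trace_grad L g Y" "\<forall>Z. trace_grad L (\<lambda>_. 0) Z --> kform \<gamma> t Y Z = 0" "?n Y <= A * ?n Hg"
   unfolding A_def by (elim exE conjE)
  then show "\<exists>Y. trace_grad L g Y \<and> (\<forall>Z. trace_grad L (\<lambda>_. 0) Z --> kform \<gamma> t Y Z = 0) \<and> ?n Y <= A * ?n Hg" by (intro exI conjI)
 qed
 from bchoice[OF this] obtain Y where Y: "\<And>t. t \<in> {0..1} ==> trace_grad L g (Y t)"
  "\<And>t Z. t \<in> {0..1} ==> trace_grad L (\<lambda>_. 0) Z ==> kform \<gamma> t (Y t) Z = 0"
  "\<And>t. t \<in> {0..1} ==> ?n (Y t) <= A * ?n Hg" by blast
 have LX: "L2 (SM L) (X t)" and LY: "L2 (SM L) (Y t)" if "t \<in> {0..1}" for t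
  using X(1)[OF that] Y(1)[OF that] trace_grad_L2 by auto
 define D where "D s = (LINT x|SM L. \<gamma> x * Bt (dV V x) s (X s x) (Y s x))" for s
 show ?thesis
 proof (intro exI[of _ D] ballI)
  fix s t :: real assume s: "s \<in> {0..1}" and t: "t \<in> {0..1}"
  then have s': "0 <= s" "s <= 1" and t': "0 <= t" "t <= 1" by auto
  define e where "e = \<delta> * \<bar>t - s\<bar>"
  define Z where "Z = (\<lambda>x. X t x - X s x)"
  have tZ: "trace_grad L (\<lambda>_. 0) Z" unfolding Z_def by (rule trace_grad_diff[OF L f(1) X(1)[OF t] X(1)[OF s]])
  note LZ = trace_grad_L2[OF tZ]
  have e: "0 <= e" using \<delta> by (simp add: e_def)
  have e2: "\<delta>^2 * (t - s)^2 = e^2" by (simp add: e_def power_mult_distrib)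
  have Zb: "?n Z <= 2940 * 28 * \<Lambda> / \<kappa> * e * ?n (X s)"
  proof (cases "?n Z = 0")
   case False
   have "kform \<gamma> t Z Z = kform \<gamma> t (X t) Z - kform \<gamma> t (X s) Z"
    unfolding Z_def by (rule kform_diff[OF t' LX[OF t] LX[OF s]]) (use LZ in \<open>simp add: Z_def\<close>)
   also have "\<dots> = - (kform \<gamma> t (X s) Z - kform \<gamma> s (X s) Z)" using X(2)[OF t tZ] X(2)[OF s tZ] by simp
   finally have "\<kappa> / 28 * (?n Z)^2 <= (\<bar>\<Lambda>\<bar> * (2940 * \<delta> * \<bar>t - s\<bar>)) * (?n (X s) * ?n Z)"
    using kform_coercive[OF t' LZ] kform_difference(1)[OF s' t' LX[OF s] LZ] by linarith
   then have "\<kappa> / 28 * ?n Z * ?n Z <= 2940 * \<Lambda> * e * ?n (X s) * ?n Z"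
    using Lambda_nonneg by (simp add: power2_eq_square e_def mult_ac)
   then have "\<kappa> / 28 * ?n Z <= 2940 * \<Lambda> * e * ?n (X s)" using False by (simp add: mult_le_cancel_right less_le)
   then show ?thesis using \<kappa> by (simp add: field_simps)
  qed (use \<kappa> Lambda_nonneg e in auto)
  have "N t = kform \<gamma> t (X t) (Y s)" "N s = kform \<gamma> s (X s) (Y s)"
   by (rule X(4)[OF t Y(1)[OF s]], rule X(4)[OF s Y(1)[OF s]])
  moreover have "kform \<gamma> u Z (Y s) = kform \<gamma> u (X t) (Y s) - kform \<gamma> u (X s) (Y s)" if "u \<in> {0..1}" for u
   unfolding Z_def by (rule kform_diff) (use that LX[OF t] LX[OF s] LY[OF s] in auto)
  moreover have "kform \<gamma> s Z (Y s) = 0" using Y(2)[OF s tZ] by (simp add: kform_commute)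
  ultimately have eq: "N t - N s - (t - s) * D s = (kform \<gamma> t (X s) (Y s) - kform \<gamma> s (X s) (Y s) - (t - s) * D s)
    + (kform \<gamma> t Z (Y s) - kform \<gamma> s Z (Y s))" using s t by simp
  have 1: "\<bar>kform \<gamma> t (X s) (Y s) - kform \<gamma> s (X s) (Y s) - (t - s) * D s\<bar> <= \<Lambda> * 89180 * e^2 * (?n (X s) * ?n (Y s))"
   using kform_difference(2)[OF s' t' LX[OF s] LY[OF s]] Lambda_nonneg e2 unfolding D_def by (simp add: mult.assoc)
  have 2: "\<bar>kform \<gamma> t Z (Y s) - kform \<gamma> s Z (Y s)\<bar> <= \<Lambda> * (2940^2 * 28 * \<Lambda> / \<kappa>) * e^2 * (?n (X s) * ?n (Y s))"
  proof -
   have "\<bar>kform \<gamma> t Z (Y s) - kform \<gamma> s Z (Y s)\<bar> <= (\<Lambda> * 2940 * e * ?n (Y s)) * ?n Z"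
    using kform_difference(1)[OF s' t' LZ LY[OF s]] Lambda_nonneg by (simp add: e_def mult_ac)
   also have "\<dots> <= (\<Lambda> * 2940 * e * ?n (Y s)) * (2940 * 28 * \<Lambda> / \<kappa> * e * ?n (X s))"
    by (rule mult_left_mono[OF Zb]) (use Lambda_nonneg e in auto)
   finally show ?thesis by (simp add: power2_eq_square mult_ac)
  qed
  have "\<bar>N t - N s - (t - s) * D s\<bar> <= \<Lambda> * (89180 + 2940^2 * 28 * \<Lambda> / \<kappa>) * e^2 * (?n (X s) * ?n (Y s))"
   unfolding eq by (rule order_trans[OF abs_triangle_ineq], rule order_trans[OF add_mono[OF 1 2]])
    (simp only: distrib_left distrib_right order_refl)
  also have "\<dots> <= \<Lambda> * (89180 + 2940^2 * 28 * \<Lambda> / \<kappa>) * e^2 * ((A * ?n Hf) * (A * ?n Hg))"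
   using A Lambda_nonneg \<kappa> by (intro mult_left_mono mult_mono X(3)[OF s] Y(3)[OF s]) auto
  finally have "\<bar>N t - N s - (t - s) * D s\<bar> <= \<Lambda> * (89180 + 2940^2 * 28 * \<Lambda> / \<kappa>) * (\<delta>^2 * (t - s)^2) * ((A * ?n Hf) * (A * ?n Hg))"
   by (simp only: e2)
  then show "\<bar>N t - N s - (t - s) * D s\<bar>
   <= \<Lambda> * (784 * \<Lambda> / \<kappa>)^2 * (89180 + 2940^2 * 28 * \<Lambda> / \<kappa>) * \<delta>^2 * (t - s)^2 * (?n Hf * ?n Hg)"
   unfolding A_def[symmetric] power2_eq_square[of A] by (simp only: mult_ac)
 qed
qed

end

section \<open>Mollification\<close>

lemma integrable_compact_support:
 fixes w :: "plane => 'b::euclidean_space"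
 assumes "continuous_on UNIV w" "\<And>x. x \<notin> cbox (-R,-R) (R,R) ==> w x = 0"
 shows "integrable lborel w"
proof -
 have "integrable lborel (\<lambda>x. indicator (cbox (-R,-R) (R,R)) x *\<^sub>R w x)"
  by (rule borel_integrable_compact[OF compact_cbox continuous_on_subset[OF assms(1) subset_UNIV]])
 moreover have "(\<lambda>x. indicator (cbox (-R,-R) (R,R)) x *\<^sub>R w x) = w"
  using assms(2) by (auto simp: indicator_def fun_eq_iff)
 ultimately show ?thesis by simp
qed

definition bump :: "real => plane => real" where
 "bump E x = flat 0 (E^2 - (norm x)^2)"

definition moll :: "real => plane => real" where
 "moll E x = bump E x / (LINT y|lborel. bump E y)"

definition smoothing :: "real => (plane => plane) => plane => plane" where
 "smoothing E V x = (LINT b|lborel. moll E b *\<^sub>R V (x - b))"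

context
 fixes E :: real assumes E: "0 < E"
begin

lemma smooth_bump: "smooth (bump E)"
proof -
 have "bump E = (\<lambda>x. flat 0 (E^2 - ((fst x)^2 + (snd x)^2)))"
  by (simp add: bump_def fun_eq_iff norm_prod_def)
 then show ?thesis
  by (simp only:) (intro smooth_flat smooth_diff smooth_const smooth_add smooth_power smooth_fst smooth_snd)
qed

lemma bump_zero: "E <= norm x ==> bump E x = 0"
 unfolding bump_def using E by (intro flat_zero) (simp add: power_mono)

lemma zero_off_box: "x \<notin> cbox (-E,-E) (E,E) ==> E <= norm x"
 using abs_fst_le[of x] abs_snd_le[of x] by (auto simp: mem_cbox_plane)

lemma integrable_bump: "integrable lborel (bump E)"
 by (rule integrable_compact_support[OF smooth_continuous[OF smooth_bump] bump_zero[OF zero_off_box]])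

lemma integral_bump_pos: "0 < (LINT y|lborel. bump E y)"
proof -
 have nn: "0 <= bump E y" for y by (simp add: bump_def flat_nonneg)
 have "(LINT y|lborel. bump E y) ~= 0"
 proof
  assume "(LINT y|lborel. bump E y) = 0"
  then have ae: "AE y in lborel. bump E y = 0"
   using integral_nonneg_eq_0_iff_AE[OF integrable_bump] nn by auto
  have nz: "bump E y ~= 0" if "y \<in> ball 0 E" for y
   using that flat_pos[of "E^2 - (norm y)^2" 0] E by (auto simp: bump_def power_strict_mono)
  have "AE y in lborel. y \<notin> ball (0::plane) E" by (rule eventually_mono[OF ae]) (use nz in blast)
  then have "ball 0 E \<in> null_sets (lborel :: plane measure)" by (subst (asm) AE_iff_null_sets[symmetric]) auto
  then have "negligible (ball (0::plane) E)"
   by (simp add: negligible_iff_null_sets null_sets_completionI)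
  then show False using open_not_negligible[of "ball (0::plane) E"] E by auto
 qed
 then show ?thesis using integral_nonneg_AE[of "bump E" lborel] nn by (auto simp: less_le)
qed

lemma smooth_moll: "smooth (moll E)"
 unfolding moll_def[abs_def] by (intro smooth_divide smooth_bump smooth_const) (use integral_bump_pos in simp)

lemma moll_nonneg: "0 <= moll E x"
 using integral_bump_pos by (simp add: moll_def bump_def flat_nonneg)

lemma moll_zero: "E <= norm x ==> moll E x = 0"
 by (simp add: moll_def bump_zero)

lemma moll_borel [measurable]: "moll E \<in> borel_measurable borel"
 by (rule borel_measurable_continuous_onI[OF smooth_continuous[OF smooth_moll]])

lemma integrable_moll: "integrable lborel (moll E)" and integral_moll: "(LINT b|lborel. moll E b) = 1"
 using integrable_bump integral_bump_pos by (auto simp: moll_def[abs_def])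

lemma moll_average_bound:
 fixes h :: "plane => plane"
 assumes "h \<in> borel_measurable borel" "\<And>b. norm b <= E ==> norm (h b) <= c"
 shows "integrable lborel (\<lambda>b. moll E b *\<^sub>R h b)" "norm (LINT b|lborel. moll E b *\<^sub>R h b) <= c"
proof -
 have le: "norm (moll E b *\<^sub>R h b) <= c * moll E b" for b
 proof (cases "norm b <= E")
  case True
  then show ?thesis using mult_left_mono[OF assms(2)[OF True] moll_nonneg[of b]] moll_nonneg[of b] by (simp add: mult.commute)
 qed (simp add: moll_zero)
 have m: "(\<lambda>b. moll E b *\<^sub>R h b) \<in> borel_measurable lborel" using assms(1) by measurable
 show i: "integrable lborel (\<lambda>b. moll E b *\<^sub>R h b)"
  by (rule Bochner_Integration.integrable_bound[OF integrable_mult_right[OF integrable_moll, of c] m])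
   (use le abs_ge_self order_trans in \<open>fastforce intro!: AE_I2\<close>)
 have "norm (LINT b|lborel. moll E b *\<^sub>R h b) <= (LINT b|lborel. c * moll E b)"
  by (rule Bochner_Integration.integral_norm_bound_integral[OF i]) (use integrable_moll le in auto)
 then show "norm (LINT b|lborel. moll E b *\<^sub>R h b) <= c" by (simp add: integral_moll)
qed

context
 fixes V :: "plane => plane" and R :: real
 assumes cV: "continuous_on UNIV V" and V0: "\<And>x. x \<notin> cbox (-R,-R) (R,R) ==> V x = 0"
begin

lemma V_borel [measurable]: "V \<in> borel_measurable borel"
 by (rule borel_measurable_continuous_onI[OF cV])

lemma V_bounded: obtains B where "\<And>x. norm (V x) <= B"
proof -
 have "compact (V ` cbox (-R,-R) (R,R))" by (intro compact_continuous_image continuous_on_subset[OF cV]) auto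
 then obtain B where "\<And>x. x \<in> cbox (-R,-R) (R,R) ==> norm (V x) <= B"
  using compact_imp_bounded[of "V ` cbox (-R,-R) (R,R)"] unfolding bounded_iff by auto
 then have "norm (V x) <= max B 0" for x using V0[of x] by (cases "x \<in> cbox (-R,-R) (R,R)") (auto simp: le_max_iff_disj)
 then show thesis by (rule that)
qed

lemma smoothing_integrable: "integrable lborel (\<lambda>b. moll E b *\<^sub>R V (x - b))"
proof -
 obtain B where "\<And>x. norm (V x) <= B" by (rule V_bounded) blast
 then show ?thesis by (intro moll_average_bound(1)[where c=B]) auto
qed

lemma smoothing_diff_bound:
 assumes "\<And>b. norm b <= E ==> norm (V (x - b) - z) <= c" shows "norm (smoothing E V x - z) <= c"
proof -
 have "z = (LINT b|lborel. moll E b *\<^sub>R z)" using integrable_moll by (simp add: integral_moll)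
 then have "smoothing E V x - z = (LINT b|lborel. moll E b *\<^sub>R (V (x - b) - z))"
  using smoothing_integrable[of x] integrable_moll by (simp add: smoothing_def scaleR_diff_right)
 then show ?thesis using moll_average_bound(2)[of "\<lambda>b. V (x - b) - z" c] assms by simp
qed

lemma smoothing_lipschitz:
 assumes "\<And>x y. norm (V x - V y) <= \<delta> * norm (x - y)"
 shows "norm (smoothing E V x - smoothing E V y) <= \<delta> * norm (x - y)"
proof -
 have "smoothing E V x - smoothing E V y = (LINT b|lborel. moll E b *\<^sub>R (V (x - b) - V (y - b)))"
  using smoothing_integrable[of x] smoothing_integrable[of y] by (simp add: smoothing_def scaleR_diff_right)
 moreover have "norm (V (x - b) - V (y - b)) <= \<delta> * norm (x - y)" for b using assms[of "x - b" "y - b"] by simp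
 ultimately show ?thesis using moll_average_bound(2)[of "\<lambda>b. V (x - b) - V (y - b)" "\<delta> * norm (x - y)"] by simp
qed

lemma smoothing_zero: assumes "x \<notin> cbox (-R - E,-R - E) (R + E,R + E)" shows "smoothing E V x = 0"
proof -
 have "V (x - b) = 0" if "norm b <= E" for b
  using assms that abs_fst_le[of b] abs_snd_le[of b] by (intro V0) (auto simp: mem_cbox_plane)
 then show ?thesis using smoothing_diff_bound[of x 0 0] by simp
qed

lemma smoothing_component:
 fixes l :: "plane => real"
 assumes l: "bounded_linear l"
 shows "l (smoothing E V x) = (LINT a|lborel. moll E (x - a) * l (V a))"
  and "smooth (\<lambda>x. l (smoothing E V x))"
  and "grad (\<lambda>x. l (smoothing E V x)) x \<bullet> v = (LINT a|lborel. (grad (moll E) (x - a) \<bullet> v) * l (V a))"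
proof -
 have [measurable]: "l \<in> borel_measurable borel" by (rule borel_measurable_continuous_onI[OF linear_continuous_on[OF l]])
 have e: "l (smoothing E V x) = (LINT a|lborel. moll E (x - a) * l (V a))" for x
 proof -
  have "l (smoothing E V x) = (LINT b|lborel. l (moll E b *\<^sub>R V (x - b)))"
   unfolding smoothing_def by (rule integral_bounded_linear[symmetric, OF l smoothing_integrable])
  also have "\<dots> = (LINT b|lborel. (\<lambda>a. moll E (x - a) * l (V a)) (x - b))"
   by (simp add: linear_simps(5)[OF l])
  also have "\<dots> = (LINT a|lborel. moll E (x - a) * l (V a))"
   by (rule lborel_integral_reflect(1)[symmetric]) measurable
  finally show ?thesis .
 qed
 then show "l (smoothing E V x) = (LINT a|lborel. moll E (x - a) * l (V a))" .
 define s where "s a = (if a \<in> cbox (-R,-R) (R,R) then a else 0)" for a :: plane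
 have ks: "K (x - s a) * l (V a) = K (x - a) * l (V a)" for K :: "plane => real" and x a
  using V0[of a] linear_simps(3)[OF l] by (auto simp: s_def)
 have ms: "s \<in> borel_measurable lborel" unfolding s_def[abs_def] by measurable
 have iw: "integrable lborel (\<lambda>a. l (V a))"
  by (rule integrable_compact_support[where R=R])
   (use V0 linear_simps(3)[OF l] in \<open>auto intro!: continuous_on_compose2[OF linear_continuous_on[OF l] cV]\<close>)
 obtain B where B: "\<And>a. a \<in> cbox (-R,-R) (R,R) ==> norm (a :: plane) <= B"
  using bounded_cbox unfolding bounded_iff by blast
 have sb: "norm (s a) <= \<bar>B\<bar>" for a using B[of a] by (auto simp: s_def)
 have eq: "(\<lambda>x. l (smoothing E V x)) = (\<lambda>x. \<integral>a. moll E (x - s a) * l (V a) \<partial>lborel)" by (simp add: e ks)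
 show "smooth (\<lambda>x. l (smoothing E V x))" unfolding eq by (rule smooth_convolution[OF ms iw sb smooth_moll])
 show "grad (\<lambda>x. l (smoothing E V x)) x \<bullet> v = (LINT a|lborel. (grad (moll E) (x - a) \<bullet> v) * l (V a))"
  unfolding eq by (subst grad_convolution[OF ms iw sb smooth_moll]) (simp_all add: ks[of "\<lambda>z. grad (moll E) z \<bullet> v"])
qed

end

end

lemma moll_bounded: assumes "0 < E" shows "norm (moll E x) <= 1 / (LINT y|lborel. bump E y)"
proof -
 have "flat 0 z <= 1" for z by (simp add: flat_def)
 then show ?thesis
  using integral_bump_pos[OF assms] flat_nonneg[of 0] by (simp add: moll_def bump_def divide_right_mono)
qed

text \<open>Mollification turns an almost everywhere bound on the weak derivative into a pointwise bound on
 a classical derivative, and this passes to the limit as a Lipschitz bound.\<close>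

lemma weak_gradient_smoothing:
 assumes E: "0 < E" and c: "continuous_on UNIV u" and G: "weak_gradient UNIV u G"
 shows "integrable lebesgue (\<lambda>a. moll E (x - a) *\<^sub>R G a)"
  and "(LINT a|lborel. (grad (moll E) (x - a) \<bullet> v) * u a) = (LINT a|lebesgue. moll E (x - a) * (G a \<bullet> v))"
proof -
 define p where "p a = moll E (x - a)" for a
 have lin: "((\<lambda>a. x - a) has_derivative (\<lambda>v. - v)) (at a)" for a
  by (auto intro!: derivative_eq_intros)
 have g: "grad p a = - grad (moll E) (x - a)" for a
  unfolding p_def
  by (rule grad_eqI, rule has_derivative_eq_rhs[OF has_derivative_compose[OF lin smooth_has_derivative[OF smooth_moll[OF E]]]]) simp
 have sm: "smooth p" unfolding p_def
  by (rule smooth_compose) (auto intro!: smooth_diff smooth_moll[OF E])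
 have zero: "p a = 0" if "a \<notin> cball x E" for a
  using that moll_zero[OF E, of "x - a"] by (simp add: p_def dist_norm)
 have sub: "supp p \<subseteq> cball x E" unfolding supp_def
  by (rule closure_minimal) (use zero in blast, simp)
 have comp: "compact (supp p)"
  using bounded_subset[OF bounded_cball sub] by (simp add: compact_eq_bounded_closed supp_def)
 have t: "test_function UNIV p" using sm comp by (simp add: test_function_def)
 have G1: "set_integrable lebesgue (cball x E) G"
  using G unfolding weak_gradient_def locally_integrable_def by auto
 have m: "p \<in> borel_measurable lebesgue"
  by (rule measurable_completion) (simp add: borel_measurable_continuous_onI[OF smooth_continuous[OF sm]])
 have "integrable lebesgue (\<lambda>a. p a *\<^sub>R (indicator (cball x E) a *\<^sub>R G a))"
  by (rule integrable_mult_bounded[OF G1[unfolded set_integrable_def] m, where B="1 / (LINT y|lborel. bump E y)"])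
   (simp only: p_def moll_bounded[OF E])
 moreover have "(\<lambda>a. p a *\<^sub>R (indicator (cball x E) a *\<^sub>R G a)) = (\<lambda>a. p a *\<^sub>R G a)"
  using zero by (auto simp: fun_eq_iff indicator_def)
 ultimately have i: "integrable lebesgue (\<lambda>a. p a *\<^sub>R G a)" by simp
 then show "integrable lebesgue (\<lambda>a. moll E (x - a) *\<^sub>R G a)" by (simp add: p_def)
 obtain R where R: "\<And>a. a \<in> cball x E ==> norm a <= R" using bounded_cball[of x E] unfolding bounded_iff by blast
 have cug: "continuous_on UNIV (\<lambda>a. u a *\<^sub>R grad p a)" by (intro continuous_intros c continuous_grad sm)
 have z: "u a *\<^sub>R grad p a = 0" if "a \<notin> cbox (-R,-R) (R,R)" for a
 proof -
  have "a \<notin> cball x E" using that R[of a] abs_fst_le[of a] abs_snd_le[of a] by (auto simp: mem_cbox_plane)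
  then have "a \<notin> supp p" using sub by blast
  then show ?thesis by (simp add: grad_zero_off_supp)
 qed
 have iu: "integrable lborel (\<lambda>a. u a *\<^sub>R grad p a)" by (rule integrable_compact_support[OF cug z])
 have "(LINT a|lebesgue. u a *\<^sub>R grad p a) = - (LINT a|lebesgue. p a *\<^sub>R G a)"
  using G t unfolding weak_gradient_def lebesgue_on_UNIV_eq by blast
 also have "(LINT a|lebesgue. u a *\<^sub>R grad p a) = (LINT a|lborel. u a *\<^sub>R grad p a)"
  by (rule integral_completion) (simp add: borel_measurable_continuous_onI[OF cug])
 finally have "(LINT a|lborel. u a *\<^sub>R grad p a) \<bullet> v = - ((LINT a|lebesgue. p a *\<^sub>R G a) \<bullet> v)" by simp
 then have "(LINT a|lborel. (u a *\<^sub>R grad p a) \<bullet> v) = - (LINT a|lebesgue. (p a *\<^sub>R G a) \<bullet> v)"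
  by (simp only: integral_inner_left[OF iu] integral_inner_left[OF i])
 then show "(LINT a|lborel. (grad (moll E) (x - a) \<bullet> v) * u a) = (LINT a|lebesgue. moll E (x - a) * (G a \<bullet> v))"
  by (simp add: g p_def mult.commute)
qed

lemma weak_lipschitz:
 fixes U :: "plane => plane"
 assumes c: "continuous_on UNIV U" and U0: "\<And>x. x \<notin> cbox (-R,-R) (R,R) ==> U x = 0"
  and G: "weak_gradient UNIV (\<lambda>x. fst (U x)) G1" "weak_gradient UNIV (\<lambda>x. snd (U x)) G2"
  and b: "AE a in lebesgue. \<forall>v. norm (G1 a \<bullet> v, G2 a \<bullet> v) <= M * norm v"
 shows "norm (U x - U y) <= M * norm (x - y)"
proof -
 have cc: "continuous_on UNIV (\<lambda>x. fst (U x))" "continuous_on UNIV (\<lambda>x. snd (U x))"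
  by (intro continuous_intros c)+
 have S: "norm (smoothing E U x - smoothing E U y) <= M * norm (x - y)" if E: "0 < E" for E
 proof -
  note comp = smoothing_component[OF E c U0, where R=R]
  let ?S = "smoothing E U"
  define D where "D x v = (grad (\<lambda>x. fst (?S x)) x \<bullet> v, grad (\<lambda>x. snd (?S x)) x \<bullet> v)" for x v
  have d: "(?S has_derivative D x) (at x)" for x
   using has_derivative_Pair[OF smooth_has_derivative[OF comp(2)[OF _ bounded_linear_fst]] smooth_has_derivative[OF comp(2)[OF _ bounded_linear_snd]]]
   unfolding D_def[abs_def] by simp
  have "norm (D x v) <= M * norm v" for x v
  proof -
   let ?K = "\<lambda>a. moll E (x - a)" and ?P = "\<lambda>a. (G1 a \<bullet> v, G2 a \<bullet> v)"
   note w1 = weak_gradient_smoothing[OF E cc(1) G(1), of x] and w2 = weak_gradient_smoothing[OF E cc(2) G(2), of x]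
   have i: "integrable lebesgue (\<lambda>a. ?K a * (G1 a \<bullet> v))" "integrable lebesgue (\<lambda>a. ?K a * (G2 a \<bullet> v))"
    using integrable_inner_left[OF w1(1), of v] integrable_inner_left[OF w2(1), of v] by simp_all
   have mK: "?K \<in> borel_measurable lborel" by (rule measurable_compose[OF _ moll_borel[OF E]]) simp
   have e: "(\<lambda>a. ?K a *\<^sub>R ?P a) = (\<lambda>a. (?K a * (G1 a \<bullet> v)) *\<^sub>R (1,0) + (?K a * (G2 a \<bullet> v)) *\<^sub>R (0,1))"
    by (simp add: fun_eq_iff)
   have "D x v = ((LINT a|lebesgue. ?K a * (G1 a \<bullet> v)), (LINT a|lebesgue. ?K a * (G2 a \<bullet> v)))"
    unfolding D_def using comp(3)[OF _ bounded_linear_fst, of x v] comp(3)[OF _ bounded_linear_snd, of x v] w1(2)[of v] w2(2)[of v] by simp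
   also have "\<dots> = (LINT a|lebesgue. ?K a *\<^sub>R ?P a)"
    unfolding e Bochner_Integration.integral_add[OF integrable_scaleR_left[OF i(1)] integrable_scaleR_left[OF i(2)]]
     integral_scaleR_left[OF i(1)] integral_scaleR_left[OF i(2)] by simp
   also have "norm \<dots> <= (LINT a|lebesgue. norm (?K a *\<^sub>R ?P a))" by (rule integral_norm_bound)
   also have "\<dots> <= (LINT a|lebesgue. (M * norm v) * ?K a)"
   proof (rule integral_mono_AE)
    show "integrable lebesgue (\<lambda>a. norm (?K a *\<^sub>R ?P a))"
     by (rule integrable_norm, unfold e) (intro Bochner_Integration.integrable_add integrable_scaleR_left i)
    show "integrable lebesgue (\<lambda>a. (M * norm v) * ?K a)"
     using lborel_integral_reflect(2)[OF moll_borel[OF E] integrable_moll[OF E], of x] mK by (simp add: integrable_completion)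
    show "AE a in lebesgue. norm (?K a *\<^sub>R ?P a) <= (M * norm v) * ?K a"
     using b
    proof eventually_elim
     case (elim a)
     then show ?case unfolding norm_scaleR using mult_right_mono[OF elim[rule_format, of v] moll_nonneg[OF E, of "x - a"]] moll_nonneg[OF E, of "x - a"]
      by (simp add: mult.commute)
    qed
   qed
   also have "\<dots> = M * norm v"
    using lborel_integral_reflect(1)[OF moll_borel[OF E], of x] mK by (simp add: integral_completion integral_moll[OF E])
   finally show ?thesis .
  qed
  then have "onorm (D x) <= M" for x by (rule onorm_le)
  then show ?thesis
   by (intro differentiable_bound[OF convex_UNIV, where f'=D]) (use d has_derivative_at_withinI in auto)
 qed
 have lim: "\<exists>E>0. norm (smoothing E U x - U x) <= e \<and> norm (smoothing E U y - U y) <= e" if e: "0 < e" for e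
 proof -
  obtain d1 where d1: "0 < d1" "\<And>z. dist z x < d1 ==> dist (U z) (U x) < e"
   using c e unfolding continuous_on_iff by (metis UNIV_I)
  obtain d2 where d2: "0 < d2" "\<And>z. dist z y < d2 ==> dist (U z) (U y) < e"
   using c e unfolding continuous_on_iff by (metis UNIV_I)
  define E where "E = min d1 d2 / 2"
  have E: "0 < E" "E < d1" "E < d2" using d1 d2 by (auto simp: E_def)
  have "norm (smoothing E U x - U x) <= e"
   by (rule smoothing_diff_bound[OF E(1) c U0, where R=R]) (use d1(2)[of "x - _"] E in \<open>auto simp: dist_norm intro!: less_imp_le\<close>)
  moreover have "norm (smoothing E U y - U y) <= e"
   by (rule smoothing_diff_bound[OF E(1) c U0, where R=R]) (use d2(2)[of "y - _"] E in \<open>auto simp: dist_norm intro!: less_imp_le\<close>)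
  ultimately show ?thesis using E(1) by blast
 qed
 show ?thesis
 proof (rule field_le_epsilon)
  fix e :: real assume e: "0 < e"
  obtain E where E: "0 < E" "norm (smoothing E U x - U x) <= e/2" "norm (smoothing E U y - U y) <= e/2"
   using lim[of "e/2"] e by auto
  have "norm (U x - U y) = norm ((smoothing E U x - smoothing E U y) - (smoothing E U x - U x) + (smoothing E U y - U y))" by simp
  then have "norm (U x - U y) <= norm (smoothing E U x - smoothing E U y) + norm (smoothing E U x - U x) + norm (smoothing E U y - U y)"
   using norm_triangle_ineq[of "smoothing E U x - smoothing E U y - (smoothing E U x - U x)" "smoothing E U y - U y"]
    norm_triangle_ineq4[of "smoothing E U x - smoothing E U y" "smoothing E U x - U x"] by linarith
  then show "norm (U x - U y) <= M * norm (x - y) + e" using S[OF E(1)] E(2,3) by linarith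
 qed
qed

section \<open>Stability of the Dirichlet to Neumann map under convergence of the coefficient\<close>

text \<open>The difference of the two values is the integral of \<open>a n - b\<close> against the product of a bounded sequence of
 gradients and a fixed gradient \<open>K\<close>, and \<open>(a n - b) K\<close> tends to zero by dominated convergence.\<close>

lemma DN_tendsto:
 assumes an: "\<And>n::nat. coefficient L (a n) \<kappa> \<Lambda>" and ac: "coefficient L b \<kappa> \<Lambda>"
  and conv: "AE x in SM L. (\<lambda>n. a n x) \<longlonglongrightarrow> b x"
  and f: "L2 (bdry L) f" "trace_grad L f Hf" and g: "L2 (bdry L) g" "trace_grad L g Hg"
 shows "(\<lambda>n. DN L (a n) f g) \<longlonglongrightarrow> DN L b f g"
proof -
 interpret b: coefficient L b \<kappa> \<Lambda> by (rule ac)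
 let ?n = "nrm (SM L)"
 obtain G where G: "b.solves f G" using b.solution_exists[OF f] by blast
 obtain K where K: "b.solves g K" using b.solution_exists[OF g] by blast
 have tG: "trace_grad L f G" and tK: "trace_grad L g K" using G K by (auto simp: b.solves_def)
 note LG = trace_grad_L2[OF tG] and LK = trace_grad_L2[OF tK]
 define w where "w n x = (a n x - b x) *\<^sub>R K x" for n x
 have ma: "a n \<in> borel_measurable (SM L)" for n by (rule coefficient.a[OF an])
 have mw: "w n \<in> borel_measurable (SM L)" for n
  using ma b.a L2_measurable[OF LK] unfolding w_def by measurable
 have bd: "AE x in SM L. \<forall>n. \<bar>a n x - b x\<bar> <= 2 * \<bar>\<Lambda>\<bar>"
  unfolding AE_all_countable
 proof
  fix n show "AE x in SM L. \<bar>a n x - b x\<bar> <= 2 * \<bar>\<Lambda>\<bar>"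
   using coefficient.bounds[OF an[of n]] b.bounds by eventually_elim (use b.\<kappa> in auto)
 qed
 have Lw: "L2 (SM L) (w n)" for n
  unfolding w_def by (rule L2_bounded_mult[OF LK borel_measurable_diff[OF ma b.a], where B="2 * \<bar>\<Lambda>\<bar>"])
   (use bd in \<open>auto elim: eventually_mono\<close>)
 have "(\<lambda>n. sqn (SM L) (w n)) \<longlonglongrightarrow> (LINT x|SM L. 0)"
  unfolding sqn_def
 proof (rule integral_dominated_convergence[where w="\<lambda>x. (2 * \<bar>\<Lambda>\<bar>)^2 * (norm (K x))^2"])
  show "(\<lambda>x. (norm (w n x))^2) \<in> borel_measurable (SM L)" for n using mw by measurable
  show "integrable (SM L) (\<lambda>x. (2 * \<bar>\<Lambda>\<bar>)^2 * (norm (K x))^2)" using L2_integrable[OF LK] by auto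
  show "AE x in SM L. (\<lambda>n. (norm (w n x))^2) \<longlonglongrightarrow> 0" using conv
  proof eventually_elim
   case (elim x)
   have "(\<lambda>n. (norm ((a n x - b x) *\<^sub>R K x))^2) \<longlonglongrightarrow> (norm ((b x - b x) *\<^sub>R K x))^2"
    by (intro tendsto_intros elim)
   then show ?case by (simp add: w_def)
  qed
  show "AE x in SM L. norm ((norm (w n x))^2) <= (2 * \<bar>\<Lambda>\<bar>)^2 * (norm (K x))^2" for n using bd
  proof eventually_elim
   case (elim x)
   have "\<bar>a n x - b x\<bar>^2 <= (2 * \<bar>\<Lambda>\<bar>)^2" using elim by (intro power_mono) auto
   then show ?case by (auto simp: w_def power_mult_distrib intro: mult_right_mono)
  qed
 qed simp
 then have "(\<lambda>n. ?n (w n)) \<longlonglongrightarrow> sqrt 0" unfolding nrm_def by (intro tendsto_intros) simp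
 then have w0: "(\<lambda>n. \<bar>\<Lambda>\<bar> / \<kappa> * ?n Hf * ?n (w n)) \<longlonglongrightarrow> 0"
  using tendsto_mult_left[of "\<lambda>n. ?n (w n)" 0 sequentially "\<bar>\<Lambda>\<bar> / \<kappa> * ?n Hf"] by simp
 have "\<bar>DN L (a n) f g - DN L b f g\<bar> <= \<bar>\<Lambda>\<bar> / \<kappa> * ?n Hf * ?n (w n)" for n
 proof -
  interpret c: coefficient L "a n" \<kappa> \<Lambda> by (rule an)
  obtain E where E: "c.solves f E" using c.solution_exists[OF f] by blast
  have tE: "trace_grad L f E" using E by (auto simp: c.solves_def)
  note LE = trace_grad_L2[OF tE]
  have "b.form K (\<lambda>x. E x - G x) = 0"
   using K trace_grad_diff[OF b.L f(1) tE tG] by (simp add: b.solves_def)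
  then have "b.form E K = b.form G K" using b.form_diff_right[OF LE LG LK] by (simp add: b.form_commute[of K])
  then have "DN L (a n) f g - DN L b f g = c.form E K - b.form E K"
   using c.DN_eq_form[OF f(1) g(1) E tK] b.DN_eq_form[OF f(1) g(1) G tK] by simp
  also have "\<dots> = (LINT x|SM L. E x \<bullet> w n x)"
   unfolding c.form_def b.form_def w_def
   using c.form_bound(1)[OF LE LK] b.form_bound(1)[OF LE LK] by (simp flip: Bochner_Integration.integral_diff add: left_diff_distrib)
  finally have "\<bar>DN L (a n) f g - DN L b f g\<bar> <= ?n E * ?n (w n)" using L2_cauchy_schwarz[OF LE Lw] by simp
  also have "?n E <= \<bar>\<Lambda>\<bar> / \<kappa> * ?n Hf" using c.solution_bound[OF f(1) E f(2)] b.\<kappa> by (simp add: field_simps)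
  finally show ?thesis by (simp add: mult_right_mono)
 qed
 then have "(\<lambda>n. DN L (a n) f g - DN L b f g) \<longlonglongrightarrow> 0"
  by (intro Lim_null_comparison[OF _ w0]) auto
 then show ?thesis by (simp add: LIM_zero_iff)
qed

section \<open>Quadratic first-order expansions\<close>

text \<open>At a fixed \<open>s\<close> the numbers \<open>D n s\<close> are bounded, and every limit point of them serves as \<open>D s\<close>.\<close>

lemma second_order_limit:
 fixes N :: "real => real" and Nn D :: "nat => real => real"
 assumes conv: "\<And>t. t \<in> {0..1} ==> (\<lambda>n. Nn n t) \<longlonglongrightarrow> N t"
  and b: "\<And>n s t. s \<in> {0..1} ==> t \<in> {0..1} ==> \<bar>Nn n t - Nn n s - (t - s) * D n s\<bar> <= M * (t - s)^2"
 shows "\<exists>D. \<forall>s\<in>{0..1}. \<forall>t\<in>{0..1}. \<bar>N t - N s - (t - s) * D s\<bar> <= M * (t - s)^2"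
proof -
 have "\<exists>d. \<forall>t\<in>{0..1}. \<bar>N t - N s - (t - s) * d\<bar> <= M * (t - s)^2" if s: "s \<in> {0..1}" for s
 proof -
  (* a time at distance 1/2 from s, to bound D n s by difference quotients *)
  define u where "u = (if s <= 1/2 then s + 1/2 else s - 1/2)"
  have u: "u \<in> {0..1}" "\<bar>u - s\<bar> = 1/2" "(u - s)^2 = 1/4" using s by (auto simp: u_def power2_eq_square)
  have "convergent (\<lambda>n. Nn n u - Nn n s)" using tendsto_diff[OF conv[OF u(1)] conv[OF s]] by (auto simp: convergent_def)
  then have "Bseq (\<lambda>n. Nn n u - Nn n s)" by (rule convergent_imp_Bseq)
  then obtain K where K: "\<And>n. \<bar>Nn n u - Nn n s\<bar> <= K" unfolding Bseq_def by auto
  have "\<bar>D n s\<bar> <= 2 * (K + M / 4)" for n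
  proof -
   have "\<bar>(u - s) * D n s\<bar> <= K + M / 4" using b[OF s u(1), of n] K[of n] unfolding u(3) by linarith
   then show ?thesis unfolding abs_mult u(2) by simp
  qed
  then have "bounded (range (\<lambda>n. D n s))" unfolding bounded_iff by auto
  then obtain d r where r: "strict_mono r" "((\<lambda>n. D n s) \<circ> r) \<longlonglongrightarrow> d"
   using bounded_imp_convergent_subsequence by blast
  have "\<bar>N t - N s - (t - s) * d\<bar> <= M * (t - s)^2" if t: "t \<in> {0..1}" for t
  proof (rule LIMSEQ_le_const2)
   show "(\<lambda>n. \<bar>Nn (r n) t - Nn (r n) s - (t - s) * D (r n) s\<bar>) \<longlonglongrightarrow> \<bar>N t - N s - (t - s) * d\<bar>"
    using r(2) LIMSEQ_subseq_LIMSEQ[OF conv[OF t] r(1)] LIMSEQ_subseq_LIMSEQ[OF conv[OF s] r(1)]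
    by (intro tendsto_intros) (simp_all add: o_def)
  qed (use b[OF s t] in auto)
  then show ?thesis by blast
 qed
 then show ?thesis by (intro bchoice ballI) blast
qed

text \<open>Adding the expansions at \<open>s\<close> and at \<open>t\<close> compares the two derivatives.\<close>

lemma second_order_derivative:
 fixes N D :: "real => real"
 assumes b: "\<And>s t. s \<in> {0..1} ==> t \<in> {0..1} ==> \<bar>N t - N s - (t - s) * D s\<bar> <= M * (t - s)^2"
 shows "\<And>s. s \<in> {0..1} ==> (N has_vector_derivative D s) (at s within {0..1})"
  and "\<And>s t. s \<in> {0..1} ==> t \<in> {0..1} ==> \<bar>D t - D s\<bar> <= 2 * M * \<bar>t - s\<bar>"
proof -
 fix s :: real assume s: "s \<in> {0..1}"
 show "(N has_vector_derivative D s) (at s within {0..1})"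
  unfolding has_vector_derivative_def
 proof (rule has_derivativeI_sandwich[where e=1])
  show "norm (N t - N s - (t - s) *\<^sub>R D s) / norm (t - s) <= M * norm (t - s)" if "t \<in> {0..1}" "t ~= s" for t
   using b[OF s that(1)] that(2) by (simp add: divide_simps power2_eq_square abs_mult_self_eq mult.assoc)
  show "((\<lambda>t. M * norm (t - s)) \<longlongrightarrow> 0) (at s within {0..1})" by (auto intro!: tendsto_eq_intros)
 qed (auto intro: bounded_linear_scaleR_left bounded_linear_mult_left)
 fix t :: real assume t: "t \<in> {0..1}"
 have "(t - s) * (D t - D s) = (N t - N s - (t - s) * D s) + (N s - N t - (s - t) * D t)" by (simp add: algebra_simps)
 then have "\<bar>(t - s) * (D t - D s)\<bar> <= 2 * M * (t - s)^2"
  using b[OF s t] b[OF t s] by (simp add: power2_commute[of s t])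
 then have "\<bar>t - s\<bar> * \<bar>D t - D s\<bar> <= \<bar>t - s\<bar> * (2 * M * \<bar>t - s\<bar>)"
  by (simp add: abs_mult power2_eq_square abs_mult_self_eq mult_ac)
 then show "\<bar>D t - D s\<bar> <= 2 * M * \<bar>t - s\<bar>" by (cases "t = s") (auto simp: mult_le_cancel_left_pos)
qed

section \<open>Lipschitz displacements\<close>

context displacement
begin

context
 fixes L r :: real assumes V0: "\<And>x. x \<notin> cbox (-r,-r) (r,r) ==> V x = 0" and r: "r < L"
begin

lemma flow_square: "flow V t x \<in> square L \<longleftrightarrow> x \<in> square L"
proof -
 have sub: "x \<in> cbox (-r,-r) (r,r) ==> x \<in> square L" for x using r by (auto simp: mem_square mem_cbox_plane)
 show ?thesis
 proof (cases "x \<in> cbox (-r,-r) (r,r)")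
  case True
  have "flow V t x \<in> cbox (-r,-r) (r,r)"
  proof (rule ccontr)
   assume n: "flow V t x \<notin> cbox (-r,-r) (r,r)"
   then have "unflow V t (flow V t x) = flow V t x" by (intro unflow_id V0)
   then show False using True n by simp
  qed
  then show ?thesis using True sub by blast
 qed (simp add: flow_id V0)
qed

end

lemma negligible_flow: "negligible N ==> negligible (flow V t ` N)"
proof (rule negligible_locally_Lipschitz_image)
 fix x assume "x \<in> N"
 have "norm (flow V t y - flow V t x) <= 2 * norm (y - x)" for y
 proof -
  have "norm (flow V t y - flow V t x) <= norm (y - x) + norm (t *\<^sub>R (V y - V x))"
   using norm_triangle_ineq[of "y - x" "t *\<^sub>R (V y - V x)"] by (simp add: flow_def algebra_simps)
  also have "norm (t *\<^sub>R (V y - V x)) <= 1 * (1 * norm (y - x))"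
   unfolding norm_scaleR using t \<delta> lip[of y x] mult_right_mono[of \<delta> 1 "norm (y - x)"] by (intro mult_mono) auto
  finally show ?thesis by simp
 qed
 then show "\<exists>T B. open T \<and> x \<in> T \<and> (\<forall>y\<in>N \<inter> T. norm (flow V t y - flow V t x) <= B * norm (y - x))"
  by (intro exI[of _ UNIV] exI[of _ 2]) auto
qed simp

end

text \<open>The field is mollified; this keeps its Lipschitz constant, the only quantity that enters the bound. The
 displaced coefficients converge at every point that the limit flow brings from a point of continuity of \<open>\<gamma>\<close>.\<close>

theorem DN_second_order_lipschitz:
 fixes V :: "plane => plane"
 assumes L: "0 < L" "r < L" and lip: "\<And>x y. norm (V x - V y) <= \<delta> * norm (x - y)" and \<delta>: "0 <= \<delta>" "\<delta> <= 3/7"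
  and V0: "\<And>x. x \<notin> cbox (-r,-r) (r,r) ==> V x = 0"
  and \<gamma>: "coefficient L \<gamma> \<kappa> \<Lambda>" and \<Lambda>: "0 <= \<Lambda>"
  and N: "negligible N" "\<And>x. x \<in> square L ==> x \<notin> N ==> isCont \<gamma> x"
  and \<gamma>t: "\<And>t. t \<in> {0..1} ==> coefficient L (\<lambda>x. \<gamma> (unflow V t x)) \<kappa> \<Lambda>"
  and f: "L2 (bdry L) f" "trace_grad L f Hf" and g: "L2 (bdry L) g" "trace_grad L g Hg"
 defines "K \<equiv> \<Lambda> * (784 * \<Lambda> / \<kappa>)^2 * (89180 + 2940^2 * 28 * \<Lambda> / \<kappa>)"
 shows "\<exists>D. \<forall>s\<in>{0..1}. \<forall>t\<in>{0..1}. \<bar>DN L (\<lambda>x. \<gamma> (unflow V t x)) f g - DN L (\<lambda>x. \<gamma> (unflow V s x)) f g - (t - s) * D s\<bar>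
  <= K * \<delta>^2 * (nrm (SM L) Hf * nrm (SM L) Hg) * (t - s)^2"
proof -
 (* small enough to keep all supports in a fixed compact part of the square *)
 define E where "E n = (L - r) / 2 / (real n + 1)" for n
 have E: "0 < E n" "E n <= (L - r) / 2" for n
 proof -
  have "(L - r) / 2 / (real n + 1) <= (L - r) / 2 / 1" using L by (intro divide_left_mono) auto
  then show "E n <= (L - r) / 2" by (simp add: E_def)
 qed (use L in \<open>simp add: E_def\<close>)
 have E0: "E \<longlonglongrightarrow> 0" unfolding E_def[abs_def] by real_asymp
 define W where "W n = smoothing (E n) V" for n
 define r' where "r' = (L + r) / 2"
 have dV: "displacement V \<delta> t" if "t \<in> {0..1}" for t by unfold_locales (use lip \<delta> that in auto)
 have cV: "continuous_on UNIV V" using displacement.continuous_V[OF dV[of 0]] by simp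
 have W: "smooth_displacement L r' (W n) \<delta>" for n
 proof
  show "r' < L" using L by (simp add: r'_def)
  show "smooth (\<lambda>x. fst (W n x))" "smooth (\<lambda>x. snd (W n x))"
   unfolding W_def by (intro smoothing_component(2)[OF E(1) cV V0] bounded_linear_fst bounded_linear_snd; assumption)+
  show "norm (W n x - W n y) <= \<delta> * norm (x - y)" for x y
   unfolding W_def by (rule smoothing_lipschitz[OF E(1) cV V0 lip])
  show "W n x = 0" if "x \<notin> cbox (- r', - r') (r', r')" for x
   unfolding W_def by (rule smoothing_zero[OF E(1) cV V0]) (use that E(2)[of n] in \<open>auto simp: mem_cbox_plane r'_def field_simps\<close>)
 qed (use L \<delta> in auto)
 have WV: "norm (W n x - V x) <= E n" for n x
  unfolding W_def
 proof (rule smoothing_diff_bound[OF E(1) cV V0])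
  fix b :: plane assume b: "norm b <= E n"
  have "norm (V (x - b) - V x) <= \<delta> * norm b" using lip[of "x - b" x] by simp
  also have "\<dots> <= 1 * norm b" using \<delta> by (intro mult_right_mono) auto
  finally show "norm (V (x - b) - V x) <= E n" using b by simp
 qed
 have dc: "displaced_coefficient L r' (W n) \<delta> \<gamma> \<kappa> \<Lambda>" for n
  by (intro displaced_coefficient.intro displaced_coefficient_axioms.intro W \<gamma> \<Lambda>)
 define Nn where "Nn n t = DN L (\<lambda>x. \<gamma> (unflow (W n) t x)) f g" for n t
 let ?M = "K * \<delta>^2 * (nrm (SM L) Hf * nrm (SM L) Hg)"
 have "\<forall>n. \<exists>D. \<forall>s\<in>{0..1}. \<forall>t\<in>{0..1}. \<bar>Nn n t - Nn n s - (t - s) * D s\<bar> <= ?M * (t - s)^2"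
  using displaced_coefficient.DN_second_order[OF dc f g] unfolding Nn_def K_def by (simp add: mult_ac)
 then obtain D where D: "\<And>n s t. s \<in> {0..1} ==> t \<in> {0..1} ==> \<bar>Nn n t - Nn n s - (t - s) * D n s\<bar> <= ?M * (t - s)^2"
  by metis
 have conv: "(\<lambda>n. Nn n t) \<longlonglongrightarrow> DN L (\<lambda>x. \<gamma> (unflow V t x)) f g" if t: "t \<in> {0..1}" for t
  unfolding Nn_def
 proof (rule DN_tendsto[OF _ \<gamma>t[OF t] _ f g])
  have t': "0 <= t" "t <= 1" using t by auto
  show "coefficient L (\<lambda>x. \<gamma> (unflow (W n) t x)) \<kappa> \<Lambda>" for n
   by (rule displaced_coefficient.displaced[OF dc t'])
  interpret v: displacement V \<delta> t by (rule dV[OF t])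
  have un: "(\<lambda>n. unflow (W n) t x) \<longlonglongrightarrow> unflow V t x" for x
  proof -
   have le: "norm (unflow (W n) t x - unflow V t x) <= E n / (1 - \<delta>)" for n
   proof -
    interpret w: displacement "W n" \<delta> t by (rule smooth_displacement.displacement[OF W t'])
    let ?y = "unflow (W n) t x"
    have "flow V t ?y - flow V t (unflow V t x) = flow V t ?y - flow (W n) t ?y" by simp
    also have "\<dots> = t *\<^sub>R (V ?y - W n ?y)" by (simp add: flow_def scaleR_diff_right)
    finally have "norm (flow V t ?y - flow V t (unflow V t x)) <= 1 * E n"
     using t' WV[of n ?y] by (simp only: norm_scaleR norm_minus_commute[of "V ?y"], intro mult_mono) auto
    then show ?thesis using v.flow_lower[of ?y "unflow V t x"] \<delta> by (simp add: field_simps)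
   qed
   have lim: "(\<lambda>n. E n / (1 - \<delta>)) \<longlonglongrightarrow> 0" using tendsto_divide[OF E0 tendsto_const, of "1 - \<delta>"] \<delta> by simp
   have "(\<lambda>n. unflow (W n) t x - unflow V t x) \<longlonglongrightarrow> 0"
    by (rule Lim_null_comparison[OF always_eventually lim]) (rule allI, rule le)
   then show ?thesis by (simp add: LIM_zero_iff)
  qed
  have "negligible (flow V t ` N)" by (rule v.negligible_flow[OF N(1)])
  then have "AE x in lebesgue. x \<notin> flow V t ` N" by (intro AE_not_in) (simp add: negligible_iff_null_sets)
  then have "AE x in SM L. x \<notin> flow V t ` N" by (subst AE_restrict_space_iff) (auto elim: eventually_mono)
  moreover have "AE x in SM L. x \<in> square L" by (rule AE_I2) (simp add: space_restrict_space)
  ultimately show "AE x in SM L. (\<lambda>n. \<gamma> (unflow (W n) t x)) \<longlonglongrightarrow> \<gamma> (unflow V t x)"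
  proof eventually_elim
   case (elim x)
   have "unflow V t x \<notin> N" using elim(1) by (metis imageI v.flow_unflow)
   moreover have "unflow V t x \<in> square L" using elim(2) v.flow_square[OF V0 L(2), of "unflow V t x"] by simp
   ultimately show ?case using N(2) un isCont_tendsto_compose by blast
  qed
 qed
 show ?thesis by (rule second_order_limit[OF conv D])
qed

section \<open>Polygons\<close>

lemma homeomorphism_inside:
 fixes P Q :: "plane => plane"
 assumes c: "continuous_on UNIV P" "continuous_on UNIV Q" and inv: "\<And>x. P (Q x) = x" "\<And>x. Q (P x) = x"
 shows "P ` inside B = inside (P ` B)"
proof -
 have sub: "f x \<in> inside (f ` A)" if x: "x \<in> inside A" and cf: "continuous_on UNIV f" "continuous_on UNIV g"
  and i: "\<And>x. f (g x) = x" "\<And>x. g (f x) = x" for f g :: "plane => plane" and A x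
 proof -
  let ?C = "connected_component_set (- (f ` A)) (f x)"
  have fx: "f x \<notin> f ` A" using x i(2) inside_no_overlap[of A] by (metis disjoint_iff image_iff)
  have "g ` ?C \<subseteq> connected_component_set (- A) x"
  proof (rule connected_component_maximal)
   have "f x \<in> ?C" using fx by (simp add: connected_component_refl)
   then show "x \<in> g ` ?C" using i(2) by (metis imageI)
   show "connected (g ` ?C)" by (rule connected_continuous_image[OF continuous_on_subset[OF cf(2)]]) auto
   have "?C \<subseteq> - (f ` A)" by (rule connected_component_subset)
   show "g ` ?C \<subseteq> - A"
   proof (rule image_subsetI, rule ComplI)
    fix y assume y: "y \<in> ?C" "g y \<in> A"
    then have "y \<in> f ` A" using i(1)[of y] by (metis imageI)
    then show False using y(1) \<open>?C \<subseteq> - (f ` A)\<close> by blast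
   qed
  qed
  then have "?C \<subseteq> f ` closure (connected_component_set (- A) x)"
   using i(1) closure_subset by (metis (no_types, lifting) image_subset_iff order_trans subsetI imageI subsetD)
  moreover have "bounded (connected_component_set (- A) x)" using x by (simp add: inside_def)
  then have "compact (f ` closure (connected_component_set (- A) x))"
   by (intro compact_continuous_image continuous_on_subset[OF cf(1)]) auto
  ultimately have "bounded ?C" using bounded_subset compact_imp_bounded by blast
  then show ?thesis using fx by (simp add: inside_def)
 qed
 show ?thesis
 proof
  show "P ` inside B \<subseteq> inside (P ` B)" using sub[OF _ c inv] by blast
  show "inside (P ` B) \<subseteq> P ` inside B"
  proof
   fix y assume "y \<in> inside (P ` B)"
   from sub[OF this c(2,1) inv(2,1)] have "Q y \<in> inside B" by (simp add: image_image inv)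
   then show "y \<in> P ` inside B" using inv(1) by (metis imageI)
  qed
 qed
qed

lemma cnext_in: "j < length xs ==> cnext xs j \<in> set xs"
 unfolding cnext_def by (intro nth_mem mod_less_divisor) auto

definition sides :: "plane list => plane set" where
 "sides vs = (\<Union>i<length vs. closed_segment (vs ! i) (cnext vs i))"

text \<open>The directions in which one can leave \<open>x\<close> along \<open>S\<close>.\<close>

definition germ :: "plane set => plane => plane => bool" where
 "germ S x u \<longleftrightarrow> (\<exists>E>0. \<forall>s. 0 <= s \<and> s <= E --> x + s *\<^sub>R u \<in> S)"

definition codirected :: "plane => plane => bool" where
 "codirected u v \<longleftrightarrow> (\<exists>c>0. v = c *\<^sub>R u)"

lemma codirected_sym: "codirected u v ==> codirected v u"
 unfolding codirected_def by (metis divideR_right divide_pos_pos inverse_eq_divide less_numeral_extra(3) zero_less_one)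

lemma germ_codirected: assumes g: "germ S x u" and c: "codirected u v" shows "germ S x v"
proof -
 obtain E where E: "E > 0" "\<And>s. 0 <= s ==> s <= E ==> x + s *\<^sub>R u \<in> S" using g by (auto simp: germ_def)
 obtain c where c: "c > 0" "v = c *\<^sub>R u" using c by (auto simp: codirected_def)
 have "x + s *\<^sub>R v \<in> S" if "0 <= s" "s <= E / c" for s
  using E(2)[of "s * c"] that c by (simp add: field_simps)
 then show ?thesis using E(1) c(1) by (auto simp: germ_def intro!: exI[of _ "E / c"])
qed

lemma germ_mono: "germ S x u ==> S \<subseteq> T ==> germ T x u"
 unfolding germ_def by blast

lemma germ_toward: "convex S ==> x \<in> S ==> y \<in> S ==> germ S x (y - x)"
 unfolding germ_def
 by (intro exI[of _ 1] conjI allI impI) (auto simp: convex_alt algebra_simps)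

lemma germ_finite_Union:
 assumes g: "germ (\<Union>i<n. S i) x u" and S: "\<And>i. i < n ==> closed (S i)" "\<And>i. i < n ==> convex (S i)"
 shows "\<exists>i<(n::nat). germ (S i) x u"
proof -
 obtain E where E: "E > 0" "\<And>s. 0 <= s ==> s <= E ==> x + s *\<^sub>R u \<in> (\<Union>i<n. S i)" using g by (auto simp: germ_def)
 have "\<exists>i<n. \<not> (\<forall>\<^sub>F s in at_right 0. x + s *\<^sub>R u \<notin> S i)"
 proof (rule ccontr)
  assume "\<not> ?thesis"
  then have "\<forall>\<^sub>F s in at_right 0. \<forall>i\<in>{..<n}. x + s *\<^sub>R u \<notin> S i" by (intro eventually_ball_finite) auto
  moreover have "\<forall>\<^sub>F s in at_right 0. x + s *\<^sub>R u \<in> (\<Union>i<n. S i)"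
   unfolding eventually_at_right_field by (intro exI[of _ E]) (use E in auto)
  ultimately have "\<forall>\<^sub>F s in at_right (0::real). False" by eventually_elim auto
  then show False by simp
 qed
 then obtain i where i: "i < n" "\<not> (\<forall>\<^sub>F s in at_right 0. x + s *\<^sub>R u \<notin> S i)" by blast
 have x: "x \<in> S i"
 proof (rule ccontr)
  assume "x \<notin> S i"
  moreover have "((\<lambda>s. x + s *\<^sub>R u) \<longlongrightarrow> x + 0 *\<^sub>R u) (at_right 0)" by (intro tendsto_intros)
  ultimately have "\<forall>\<^sub>F s in at_right 0. x + s *\<^sub>R u \<in> - S i"
   using S(1)[OF i(1)] by (intro topological_tendstoD[of "\<lambda>s. x + s *\<^sub>R u" x]) auto
  then show False using i(2) by simp
 qed
 obtain s where s: "0 < s" "x + s *\<^sub>R u \<in> S i"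
  using i(2) unfolding eventually_at_right_field by (metis zero_less_one)
 from germ_toward[OF S(2)[OF i(1)] x s(2)] have "germ (S i) x (s *\<^sub>R u)" by simp
 then have "germ (S i) x u"
  by (rule germ_codirected) (use s(1) in \<open>auto simp: codirected_def intro!: exI[of _ "1/s"]\<close>)
 then show ?thesis using i(1) by blast
qed

lemma germ_segment:
 assumes g: "germ (closed_segment a b) x u" and u: "u ~= 0"
 obtains c where "c ~= 0" "u = c *\<^sub>R (b - a)" "x \<in> closed_segment a b" "0 < c ==> x ~= b" "c < 0 ==> x ~= a"
proof -
 obtain E where E: "E > 0" "\<And>s. 0 <= s ==> s <= E ==> x + s *\<^sub>R u \<in> closed_segment a b" using g by (auto simp: germ_def)
 have x: "x \<in> closed_segment a b" using E(2)[of 0] E(1) by simp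
 obtain p where p: "x = (1 - p) *\<^sub>R a + p *\<^sub>R b" "0 <= p" "p <= 1" using x by (auto simp: in_segment)
 obtain q where q: "x + E *\<^sub>R u = (1 - q) *\<^sub>R a + q *\<^sub>R b" "0 <= q" "q <= 1" using E(2)[of E] E(1) by (auto simp: in_segment)
 have eu: "E *\<^sub>R u = (q - p) *\<^sub>R (b - a)" using q(1) p(1) by (simp add: algebra_simps)
 have uc: "u = ((q - p) / E) *\<^sub>R (b - a)"
 proof -
  have "u = (1 / E) *\<^sub>R (E *\<^sub>R u)" using E(1) by simp
  also have "\<dots> = ((q - p) / E) *\<^sub>R (b - a)" unfolding eu by simp
  finally show ?thesis .
 qed
 have ab: "a ~= b" using uc u by auto
 have e: "x - a = p *\<^sub>R (b - a)" "b - x = (1 - p) *\<^sub>R (b - a)" using p(1) by (simp_all add: algebra_simps)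
 show thesis
 proof
  show "(q - p) / E ~= 0" using uc u by auto
  show "x ~= b" if "0 < (q - p) / E"
  proof -
   have "p < 1" using that E(1) q(3) by (simp add: zero_less_divide_iff)
   then show ?thesis using e(2) ab by auto
  qed
  show "x ~= a" if "(q - p) / E < 0"
  proof -
   have "0 < p" using that E(1) q(2) by (simp add: divide_less_0_iff)
   then show ?thesis using e(1) ab by auto
  qed
 qed (use uc x in auto)
qed

lemma codirected_multiples: "0 < c * d ==> codirected (c *\<^sub>R w) (d *\<^sub>R w)"
 unfolding codirected_def by (intro exI[of _ "d / c"]) (auto simp: zero_less_mult_iff zero_less_divide_iff)

context
 fixes vs :: "plane list" and P :: "plane set"
 assumes poly: "is_polygon vs P"
begin

lemma polygon: "3 <= length vs" "distinct vs" "P = sides vs \<union> inside (sides vs)"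
 "\<And>i j. i < length vs ==> j < length vs ==> i ~= j ==>
  closed_segment (vs ! i) (cnext vs i) \<inter> closed_segment (vs ! j) (cnext vs j) = {vs ! i, cnext vs i} \<inter> {vs ! j, cnext vs j}"
 using poly unfolding is_polygon_def sides_def Let_def by auto

lemma compact_sides: "compact (sides vs)"
 unfolding sides_def by (intro compact_UN) auto

lemma closed_polygon: "closed P"
proof -
 have "closed (sides vs)" using compact_sides by (rule compact_imp_closed)
 then have "open (outside (sides vs))" by (rule open_outside)
 then show ?thesis unfolding polygon(3) union_with_inside by (rule closed_Compl)
qed

lemma frontier_polygon: "frontier P \<subseteq> sides vs"
proof -
 have "inside (sides vs) \<subseteq> interior P"
  using open_inside[OF compact_imp_closed[OF compact_sides]] polygon(3) by (intro interior_maximal) auto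
 moreover have "frontier P = P - interior P" unfolding frontier_def closure_closed[OF closed_polygon] ..
 ultimately show ?thesis using polygon(3) by blast
qed

lemma two_sides_at_vertex:
 assumes i: "i < length vs" "j < length vs" "l < length vs" "i ~= j" "i ~= l" "j ~= l"
  and x: "x \<in> {vs ! i, cnext vs i}" "x \<in> {vs ! j, cnext vs j}" "x \<in> {vs ! l, cnext vs l}"
 shows False
proof -
 let ?n = "length vs"
 have "x \<in> set vs" using x(1) i(1) cnext_in by auto
 then obtain a where a: "a < ?n" "x = vs ! a" by (auto simp: in_set_conv_nth)
 have c: "i = a \<or> Suc i mod ?n = a" if "i < ?n" "x \<in> {vs ! i, cnext vs i}" for i
 proof -
  have "Suc i mod ?n < ?n" by (rule mod_less_divisor) (use polygon(1) in linarith)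
  then show ?thesis using that a polygon(2) by (auto simp: cnext_def nth_eq_iff_index_eq)
 qed
 have inj: "i = j" if "i < ?n" "j < ?n" "Suc i mod ?n = Suc j mod ?n" for i j
  using that by (auto simp: mod_Suc split: if_splits)
 have ne: "Suc a mod ?n ~= a" using a(1) polygon(1) by (auto simp: mod_Suc)
 show False using c[OF i(1) x(1)] c[OF i(2) x(2)] c[OF i(3) x(3)] inj[OF i(1,2)] inj[OF i(1,3)] inj[OF i(2,3)] i(4-6) by auto
qed

lemma germs_on_one_side:
 assumes i: "i < length vs" "germ (closed_segment (vs ! i) (cnext vs i)) x u1" "germ (closed_segment (vs ! i) (cnext vs i)) x u2"
  and j: "j < length vs" "germ (closed_segment (vs ! j) (cnext vs j)) x u3"
  and n: "u1 ~= 0" "u2 ~= 0" "u3 ~= 0" "\<not> codirected u1 u2"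
 shows "codirected u1 u3 \<or> codirected u2 u3"
proof -
 obtain c1 where c1: "c1 ~= 0" "u1 = c1 *\<^sub>R (cnext vs i - vs ! i)" "x \<in> closed_segment (vs ! i) (cnext vs i)" "0 < c1 ==> x ~= cnext vs i" "c1 < 0 ==> x ~= vs ! i"
  using germ_segment[OF i(2) n(1)] by blast
 obtain c2 where c2: "c2 ~= 0" "u2 = c2 *\<^sub>R (cnext vs i - vs ! i)" "0 < c2 ==> x ~= cnext vs i" "c2 < 0 ==> x ~= vs ! i"
  using germ_segment[OF i(3) n(2)] by blast
 have neg: "\<not> 0 < c1 * c2" using n(4) codirected_multiples c1(2) c2(2) by blast
 then have x: "x ~= vs ! i" "x ~= cnext vs i" using c1 c2 by (auto simp: zero_less_mult_iff)
 obtain c3 where c3: "c3 ~= 0" "u3 = c3 *\<^sub>R (cnext vs j - vs ! j)" "x \<in> closed_segment (vs ! j) (cnext vs j)"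
  using germ_segment[OF j(2) n(3)] by blast
 have "i = j"
 proof (rule ccontr)
  assume "i ~= j"
  from polygon(4)[OF i(1) j(1) this] c1(3) c3(3) x show False by auto
 qed
 then have "0 < c1 * c3 \<or> 0 < c2 * c3" using neg c1(1) c2(1) c3(1) by (auto simp: zero_less_mult_iff)
 then show ?thesis using c1(2) c2(2) c3(2) \<open>i = j\<close> codirected_multiples by blast
qed

text \<open>Each direction of departure from \<open>x\<close> follows a side. If two of them follow the same side, then they are
 opposite and \<open>x\<close> is an inner point of that side; otherwise \<open>x\<close> is a vertex, and only two sides meet there.\<close>

lemma at_most_two_germs:
 assumes g: "germ (sides vs) x u1" "germ (sides vs) x u2" "germ (sides vs) x u3"
  and n: "u1 ~= 0" "u2 ~= 0" "u3 ~= 0" "\<not> codirected u1 u2"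
 shows "codirected u1 u3 \<or> codirected u2 u3"
proof -
 let ?s = "\<lambda>i. closed_segment (vs ! i) (cnext vs i)"
 have "\<exists>i<length vs. germ (?s i) x u" if "germ (sides vs) x u" for u
  using that unfolding sides_def by (rule germ_finite_Union) auto
 then obtain i j l where i: "i < length vs" "germ (?s i) x u1" and j: "j < length vs" "germ (?s j) x u2" and l: "l < length vs" "germ (?s l) x u3"
  using g by meson
 have mem: "x \<in> ?s i" "x \<in> ?s j" "x \<in> ?s l"
  using germ_segment[OF i(2) n(1)] germ_segment[OF j(2) n(2)] germ_segment[OF l(2) n(3)] by blast+
 consider "i = j" | "i = l" | "j = l" | "i ~= j" "i ~= l" "j ~= l" by blast
 then show ?thesis
 proof cases
  case 1
  then show ?thesis using germs_on_one_side[OF i(1,2) _ l n] j(2) by blast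
 next
  case 2
  then show ?thesis using germs_on_one_side[OF i(1,2) _ j n(1,3,2)] l(2) n(4) codirected_sym by blast
 next
  case 3
  then show ?thesis using germs_on_one_side[OF j(1,2) _ i n(2,3,1)] l(2) n(4) codirected_sym by blast
 next
  case 4
  have "x \<in> {vs ! i, cnext vs i} \<inter> {vs ! j, cnext vs j}" "x \<in> {vs ! i, cnext vs i} \<inter> {vs ! l, cnext vs l}"
   using polygon(4)[OF i(1) j(1) 4(1)] polygon(4)[OF i(1) l(1) 4(2)] mem by blast+
  then show ?thesis using two_sides_at_vertex[OF i(1) j(1) l(1) 4, of x] by blast
 qed
qed

context
 fixes \<Sigma> :: "plane set" and ps :: "plane list"
 assumes marked: "marked_points \<Sigma> P ps"
begin

lemma marked: "distinct ps" "set vs \<subseteq> set ps" "set ps \<subseteq> vertices P \<union> (frontier P \<inter> \<Sigma>)" "frontier P \<inter> \<Sigma> \<subseteq> set ps" "3 <= length ps"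
 "sides ps \<subseteq> frontier P" "\<And>j. j < length ps ==> open_segment (ps ! j) (cnext ps j) \<inter> set ps = {}"
proof -
 show 1: "distinct ps" "set vs \<subseteq> set ps" "set ps \<subseteq> vertices P \<union> (frontier P \<inter> \<Sigma>)" "frontier P \<inter> \<Sigma> \<subseteq> set ps" "sides ps \<subseteq> frontier P"
  "\<And>j. j < length ps ==> open_segment (ps ! j) (cnext ps j) \<inter> set ps = {}"
  using marked poly unfolding marked_points_def vertices_def sides_def by auto
 have "card (set vs) <= card (set ps)" by (rule card_mono) (use 1(2) in auto)
 then show "3 <= length ps" using polygon(1) by (simp add: distinct_card polygon(2) 1(1))
qed

lemma two_germs_on_marked_sides:
 assumes x: "x \<in> sides ps"
 shows "\<exists>u1 u2. germ (sides ps) x u1 \<and> germ (sides ps) x u2 \<and> u1 ~= 0 \<and> u2 ~= 0 \<and> \<not> codirected u1 u2"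
proof -
 let ?n = "length ps"
 obtain j where j: "j < ?n" "x \<in> closed_segment (ps ! j) (cnext ps j)" using x by (auto simp: sides_def)
 have g: "germ (sides ps) y (z - y)" if "i < ?n" "y \<in> closed_segment (ps ! i) (cnext ps i)" "z \<in> closed_segment (ps ! i) (cnext ps i)" for i y z
  by (rule germ_mono[OF germ_toward[OF convex_closed_segment that(2,3)]]) (use that(1) in \<open>auto simp: sides_def\<close>)
 show ?thesis
 proof (cases "x \<in> open_segment (ps ! j) (cnext ps j)")
  case True
  then obtain p where p: "x = (1 - p) *\<^sub>R ps ! j + p *\<^sub>R cnext ps j" "0 < p" "p < 1" "ps ! j ~= cnext ps j" by (auto simp: in_segment)
  define w where "w = cnext ps j - ps ! j"
  have w: "w ~= 0" using p(4) by (simp add: w_def)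
  have e: "cnext ps j - x = (1 - p) *\<^sub>R w" "ps ! j - x = (- p) *\<^sub>R w" using p(1) by (simp_all add: w_def algebra_simps)
  have "\<not> codirected ((1 - p) *\<^sub>R w) ((- p) *\<^sub>R w)"
  proof
   assume "codirected ((1 - p) *\<^sub>R w) ((- p) *\<^sub>R w)"
   then obtain c where c: "c > 0" "(- p) *\<^sub>R w = (c * (1 - p)) *\<^sub>R w" by (auto simp: codirected_def)
   then have "- p = c * (1 - p)" using w by (simp only: scaleR_cancel_right) simp
   moreover have "0 < c * (1 - p)" using c(1) p(3) by simp
   ultimately show False using p(2) by linarith
  qed
  moreover have "germ (sides ps) x ((1 - p) *\<^sub>R w)" "germ (sides ps) x ((- p) *\<^sub>R w)"
   using g[OF j(1,2), of "cnext ps j"] g[OF j(1,2), of "ps ! j"] unfolding e by auto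
  ultimately show ?thesis using w p(2,3) by (intro exI[of _ "(1 - p) *\<^sub>R w"] exI[of _ "(- p) *\<^sub>R w"]) auto
 next
  case False
  then have "x = ps ! j \<or> x = cnext ps j" using j(2) by (auto simp: open_segment_def)
  then have "x \<in> set ps" using j(1) cnext_in by auto
  then obtain k where k: "k < ?n" "x = ps ! k" by (auto simp: in_set_conv_nth)
  define a where "a = (if k = 0 then ?n - 1 else k - 1)"
  have a: "a < ?n" "Suc a mod ?n = k" using k(1) marked(5) by (auto simp: a_def mod_Suc)
  have ca: "cnext ps a = x" using a(2) k(2) by (simp add: cnext_def)
  define b where "b = Suc k mod ?n"
  have b: "b < ?n" "b ~= k" "a ~= k" "a ~= b" using k(1) marked(5) by (auto simp: b_def a_def mod_Suc)
  have ck: "cnext ps k = ps ! b" by (simp add: cnext_def b_def)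
  have ne: "ps ! a ~= x" "ps ! b ~= x" "ps ! a ~= ps ! b" using marked(1) a(1) b k by (auto simp: nth_eq_iff_index_eq)
  have seg: "False" if c: "0 < c" "c < 1" "z - x = c *\<^sub>R (y - x)" and z: "z \<in> set ps" and o: "open_segment x y \<inter> set ps = {}" and "y ~= x" for c y z
  proof -
   have "z = (1 - c) *\<^sub>R x + c *\<^sub>R y" using c(3) by (simp add: algebra_simps)
   then have "z \<in> open_segment x y" using c(1,2) \<open>y ~= x\<close> by (auto simp: in_segment)
   then show False using z o by blast
  qed
  have o1: "open_segment x (ps ! b) \<inter> set ps = {}" using marked(7)[OF k(1)] k(2) ck by simp
  have o2: "open_segment x (ps ! a) \<inter> set ps = {}" using marked(7)[OF a(1)] ca by (simp add: open_segment_commute)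
  have "\<not> codirected (ps ! b - x) (ps ! a - x)"
  proof
   assume "codirected (ps ! b - x) (ps ! a - x)"
   then obtain c where c: "0 < c" "ps ! a - x = c *\<^sub>R (ps ! b - x)" by (auto simp: codirected_def)
   consider "c = 1" | "c < 1" | "c > 1" by linarith
   then show False
   proof cases
    case 1
    then show False using c(2) ne(3) by simp
   next
    case 2
    then show False using seg[OF c(1) 2 c(2) _ o1 ne(2)] a(1) by simp
   next
    case 3
    have "ps ! b - x = (1 / c) *\<^sub>R (ps ! a - x)" using c by simp
    then show False using seg[OF _ _ _ _ o2 ne(1), of "1/c" "ps ! b"] c(1) 3 b(1) by simp
   qed
  qed
  moreover have "germ (sides ps) x (ps ! b - x)" using g[OF k(1), of x "ps ! b"] k(2) ck by simp
  moreover have "germ (sides ps) x (ps ! a - x)" using g[OF a(1), of x "ps ! a"] ca by simp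
  ultimately show ?thesis using ne by (intro exI[of _ "ps ! b - x"] exI[of _ "ps ! a - x"]) auto
 qed
qed

text \<open>Starting at a vertex, which is marked, a point moving along a side of the polygon can never leave
 the segments between marked points: they already use up the two available directions.\<close>

lemma sides_marked: "sides vs = sides ps"
proof
 show "sides ps \<subseteq> sides vs" using marked(6) frontier_polygon by blast
 show "sides vs \<subseteq> sides ps"
 proof
  fix y assume "y \<in> sides vs"
  then obtain i where i: "i < length vs" "y \<in> closed_segment (vs ! i) (cnext vs i)" by (auto simp: sides_def)
  define a w where "a = vs ! i" and "w = cnext vs i - vs ! i"
  obtain r where r: "y = (1 - r) *\<^sub>R vs ! i + r *\<^sub>R cnext vs i" "0 <= r" "r <= 1" using i(2) by (auto simp: in_segment)
  then have yr: "y = a + r *\<^sub>R w" by (simp add: a_def w_def algebra_simps)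
  have aS: "a \<in> sides ps"
  proof -
   have "a \<in> set ps" using marked(2) i(1) by (auto simp: a_def)
   then obtain k where "k < length ps" "a = ps ! k" by (auto simp: in_set_conv_nth)
   then show ?thesis unfolding sides_def by auto
  qed
  have clS: "closed (sides ps)" unfolding sides_def by (intro compact_imp_closed compact_UN) auto
  define T where "T = {s \<in> {0..r}. a + s *\<^sub>R w \<in> sides ps}"
  have "T = {0..r} \<inter> (\<lambda>s. a + s *\<^sub>R w) -` sides ps" by (auto simp: T_def)
  moreover have "closed ((\<lambda>s. a + s *\<^sub>R w) -` sides ps)" by (intro closed_vimage[OF clS] continuous_intros)
  ultimately have "compact T" using compact_Int_closed[OF compact_Icc] by metis
  moreover have "0 \<in> T" using aS r(2) by (simp add: T_def)
  ultimately obtain s where s: "s \<in> T" "\<And>s'. s' \<in> T ==> s' <= s" using compact_attains_sup[of T] by blast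
  show "y \<in> sides ps"
  proof (cases "s = r \<or> w = 0")
   case True
   then show ?thesis using s(1) yr aS by (auto simp: T_def)
  next
   case False
   have sr: "0 <= s" "s < r" "a + s *\<^sub>R w \<in> sides ps" using s(1) False by (auto simp: T_def)
   define x where "x = a + s *\<^sub>R w"
   obtain u1 u2 where u: "germ (sides ps) x u1" "germ (sides ps) x u2" "u1 ~= 0" "u2 ~= 0" "\<not> codirected u1 u2"
    using two_germs_on_marked_sides[OF sr(3)] unfolding x_def by blast
   have sub: "sides ps \<subseteq> sides vs" using marked(6) frontier_polygon by blast
   have xseg: "x \<in> closed_segment (vs ! i) (cnext vs i)"
    unfolding in_segment by (intro exI[of _ s]) (use sr r(3) in \<open>auto simp: x_def a_def w_def algebra_simps\<close>)
   have "germ (closed_segment (vs ! i) (cnext vs i)) x (cnext vs i - x)" by (rule germ_toward) (use xseg in auto)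
   moreover have "cnext vs i - x = (1 - s) *\<^sub>R w" by (simp add: x_def a_def w_def algebra_simps)
   ultimately have "germ (closed_segment (vs ! i) (cnext vs i)) x w"
    using germ_codirected[of _ x "(1 - s) *\<^sub>R w" w] sr r(3) codirected_multiples[of "1 - s" 1 w] by simp
   then have "germ (sides vs) x w" by (rule germ_mono) (use i(1) in \<open>auto simp: sides_def\<close>)
   from at_most_two_germs[OF germ_mono[OF u(1) sub] germ_mono[OF u(2) sub] this u(3,4) _ u(5)] False
   have "germ (sides ps) x w" using germ_codirected u(1,2) by blast
   then obtain E where E: "E > 0" "\<And>h. 0 <= h ==> h <= E ==> x + h *\<^sub>R w \<in> sides ps" by (auto simp: germ_def)
   define h where "h = min E (r - s)"
   have h: "0 < h" "h <= E" "s + h <= r" using E(1) sr(2) by (auto simp: h_def)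
   have "a + (s + h) *\<^sub>R w \<in> sides ps" using E(2)[of h] h by (simp add: x_def scaleR_add_left add.assoc)
   then have "s + h \<in> T" using h sr by (simp add: T_def)
   from s(2)[OF this] h(1) show ?thesis by simp
  qed
 qed
qed

end

end

section \<open>The layered medium\<close>

context
 fixes L d0 :: real and m :: nat and w :: "nat => real"
 assumes L: "0 < L" and layering: "layering L d0 m w"
begin

lemma levels_ends: "w 0 = - L" "w m = L"
 using layering by (auto simp: layering_def)

lemma levels_mono: "i < j ==> j <= m ==> w i < w j"
proof (induction j)
 case (Suc j)
 have "w j < w (Suc j)" using layering Suc.prems(2) by (auto simp: layering_def)
 then show ?case using Suc by (cases "i = j") auto
qed simp

lemma levels_le: "i <= j ==> j <= m ==> w i <= w j"
 using levels_mono[of i j] by (cases "i = j") auto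

lemma background_value:
 assumes x: "x \<in> square L" "snd x \<notin> w ` {0..m}"
 shows "\<exists>i\<in>{1..m}. background L m w \<gamma> x = \<gamma> i"
proof -
 have sx: "- L < snd x" "snd x < L" using x(1) by (auto simp: mem_square)
 define j where "j = (LEAST j. snd x < w j)"
 have ex: "snd x < w m" using sx levels_ends by simp
 have j: "snd x < w j" "j <= m" unfolding j_def by (rule LeastI[of "\<lambda>j. snd x < w j", OF ex], rule Least_le[of "\<lambda>j. snd x < w j", OF ex])
 have j0: "1 <= j" using j(1) sx levels_ends by (cases "j = 0") auto
 have "\<not> snd x < w (j - 1)" using not_less_Least[of "j - 1" "\<lambda>j. snd x < w j"] j0 by (simp add: j_def)
 moreover have "snd x ~= w (j - 1)" using x(2) j(2) by auto
 ultimately have j1: "w (j - 1) < snd x" by simp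
 have ind: "indicator (layer L w i) x = (if i = j then 1 else 0 :: real)" if i: "i \<in> {1..m}" for i
 proof -
  have "x \<in> layer L w i \<longleftrightarrow> w (i - 1) < snd x \<and> snd x < w i" using x(1) by (auto simp: layer_def)
  moreover have "\<not> snd x < w i" if "i < j"
  proof -
   have "w i <= w (j - 1)" using that j(2) by (intro levels_le) linarith+
   then show ?thesis using j1 by simp
  qed
  moreover have "\<not> w (i - 1) < snd x" if "j < i"
  proof -
   have "w j <= w (i - 1)" by (rule levels_le) (use that i in auto)
   then show ?thesis using j(1) by simp
  qed
  ultimately show ?thesis using j(1) j1 by (cases i j rule: linorder_cases) (auto simp: indicator_def)
 qed
 have "background L m w \<gamma> x = (\<Sum>i=1..m. if i = j then \<gamma> i else 0)"
  unfolding background_def by (intro sum.cong) (auto simp: ind)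
 also have "\<dots> = \<gamma> j" using j0 j(2) by simp
 finally show ?thesis using j0 j(2) by auto
qed

lemma negligible_levels: "negligible {x :: plane. snd x \<in> w ` {0..m}}"
proof -
 have e: "{x :: plane. snd x \<in> w ` {0..m}} = (\<Union>i\<in>{0..m}. {x. (0,1) \<bullet> x = w i})"
  by (auto simp: inner_plane)
 show ?thesis unfolding e by (rule negligible_Union) (auto intro!: negligible_hyperplane simp: zero_prod_def)
qed

lemma open_layer: "open (layer L w i)"
proof -
 have "layer L w i = square L \<inter> {x. w (i - 1) < snd x} \<inter> {x. snd x < w i}" by (auto simp: layer_def)
 then show ?thesis by (simp only:) (intro open_Int square_open open_Collect_less continuous_intros)
qed

lemma not_in_frontier_layer:
 assumes x: "x \<in> square L" "snd x \<notin> w ` {0..m}" and i: "i \<in> {1..m}"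
 shows "x \<notin> frontier (layer L w i)"
proof
 assume f: "x \<in> frontier (layer L w i)"
 have "closure (layer L w i) \<subseteq> {x. w (i - 1) <= snd x} \<inter> {x. snd x <= w i}"
  by (rule closure_minimal) (auto simp: layer_def intro!: closed_Int closed_Collect_le continuous_intros)
 then have "w (i - 1) <= snd x" "snd x <= w i" using f by (auto simp: frontier_def)
 moreover have "snd x ~= w (i - 1)" "snd x ~= w i" using x(2) i by auto
 ultimately have "x \<in> layer L w i" using x(1) by (auto simp: layer_def)
 then show False using f open_layer[of i] by (simp add: frontier_def interior_open)
qed

lemma conductivity_continuous:
 assumes x: "x \<in> square L" "snd x \<notin> w ` {0..m}" "x \<notin> frontier P"
 shows "isCont (conductivity L m w k \<gamma> P) x"
proof -
 have P: "isCont (indicator P :: plane => real) x" using x(3) by (simp add: isCont_indicator)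
 have B: "isCont (background L m w \<gamma>) x" unfolding background_def[abs_def]
  by (intro continuous_intros) (use not_in_frontier_layer[OF x(1,2)] in \<open>simp add: isCont_indicator\<close>)
 show ?thesis unfolding conductivity_def[abs_def] by (intro continuous_intros P B)
qed

lemma conductivity_coefficient:
 assumes P: "closed P" and \<kappa>: "0 < \<kappa>" and v: "\<And>v. v \<in> insert k (\<gamma> ` {1..m}) ==> \<kappa> <= v \<and> v <= \<Lambda>"
 shows "coefficient L (conductivity L m w k \<gamma> P) \<kappa> \<Lambda>"
proof
 have [measurable]: "layer L w i \<in> sets borel" "P \<in> sets borel" for i using open_layer P by auto
 have "conductivity L m w k \<gamma> P \<in> borel_measurable borel"
  unfolding conductivity_def[abs_def] background_def by measurable
 then show "conductivity L m w k \<gamma> P \<in> borel_measurable (SM L)" by (rule borel_measurable_SM)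
 have "AE x in lebesgue. x \<notin> {x :: plane. snd x \<in> w ` {0..m}}"
  by (intro AE_not_in) (use negligible_levels in \<open>simp add: negligible_iff_null_sets\<close>)
 then have "AE x in SM L. snd x \<notin> w ` {0..m}" by (subst AE_restrict_space_iff) (auto elim: eventually_mono)
 moreover have "AE x in SM L. x \<in> square L" by (rule AE_I2) (simp add: space_restrict_space)
 ultimately show "AE x in SM L. \<kappa> <= conductivity L m w k \<gamma> P x \<and> conductivity L m w k \<gamma> P x <= \<Lambda>"
 proof eventually_elim
  case (elim x)
  obtain i where "i \<in> {1..m}" "background L m w \<gamma> x = \<gamma> i" using background_value[OF elim(2,1)] by blast
  then have "conductivity L m w k \<gamma> P x \<in> insert k (\<gamma> ` {1..m})"
   by (auto simp: conductivity_def indicator_def)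
  then show ?case by (rule v)
 qed
qed (use L \<kappa> in auto)

text \<open>A displacement that moves no point across a level keeps every layer, so it transports the
 conductivity of a polygon to that of the displaced polygon.\<close>

lemma conductivity_flow:
 assumes d: "displacement V \<delta> t" and V0: "\<And>x. x \<notin> cbox (-r,-r) (r,r) ==> V x = 0" and r: "r < L"
  and b: "\<And>x i. i <= m ==> \<bar>snd (V x)\<bar> <= q * \<bar>snd x - w i\<bar>" and q: "0 <= q" "q < 1"
 shows "conductivity L m w k \<gamma> (flow V t ` P) x = conductivity L m w k \<gamma> P (unflow V t x)"
proof -
 interpret displacement V \<delta> t by (rule d)
 define y where "y = unflow V t x"
 have x: "x = flow V t y" by (simp add: y_def)
 have lay: "x \<in> layer L w i \<longleftrightarrow> y \<in> layer L w i" if i: "i \<in> {1..m}" for i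
 proof -
  have side: "(snd x < w j \<longleftrightarrow> snd y < w j) \<and> (w j < snd x \<longleftrightarrow> w j < snd y)" if j: "j <= m" for j
  proof (cases "snd y = w j")
   case True
   then have "snd (V y) = 0" using b[OF j, of y] by simp
   then show ?thesis using True by (simp add: x flow_def)
  next
   case False
   have "\<bar>t * snd (V y)\<bar> <= 1 * (q * \<bar>snd y - w j\<bar>)" using t b[OF j, of y] by (intro abs_mult_le) auto
   also have "\<dots> < \<bar>snd y - w j\<bar>" using q False by simp
   finally have "\<bar>snd x - snd y\<bar> < \<bar>snd y - w j\<bar>" by (simp add: x flow_def)
   then show ?thesis by linarith
  qed
  have "x \<in> square L \<longleftrightarrow> y \<in> square L" unfolding x by (rule flow_square[OF V0 r])
  then show ?thesis using side[of i] side[of "i - 1"] i by (auto simp: layer_def case_prod_unfold)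
 qed
 have bg: "background L m w \<gamma> x = background L m w \<gamma> y"
  unfolding background_def by (intro sum.cong refl) (simp add: indicator_def lay)
 have "x \<in> flow V t ` P \<longleftrightarrow> y \<in> P" unfolding x using inj_flow by (simp add: inj_image_mem_iff)
 then show ?thesis unfolding conductivity_def y_def[symmetric] bg by (simp add: indicator_def)
qed

end

lemma negligible_sides: "negligible (sides vs)"
 unfolding sides_def by (rule negligible_Union) (auto simp: negligible_convex_interior interior_closed_segment_ge2)

section \<open>Clipping\<close>

definition clip :: "real => real => real" where
 "clip b u = max (- b) (min b u)"

lemma clip_lipschitz: "\<bar>clip b u - clip b' u'\<bar> <= max \<bar>u - u'\<bar> \<bar>b - b'\<bar>"
 unfolding clip_def by linarith

lemma clip_bound: "0 <= b ==> \<bar>clip b u\<bar> <= b" and clip_id: "\<bar>u\<bar> <= b ==> clip b u = u"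
 unfolding clip_def by linarith+

text \<open>The vertical component is cut down where it could carry a point across a level.\<close>

definition clipped :: "(real => real) => (plane => plane) => plane => plane" where
 "clipped b U x = (fst (U x), clip (b (snd x)) (snd (U x)))"

lemma clipped_lipschitz:
 assumes U: "\<And>x y. norm (U x - U y) <= A * norm (x - y)" and b: "\<And>s t. \<bar>b s - b t\<bar> <= B * \<bar>s - t\<bar>" and B: "0 <= B"
 shows "norm (clipped b U x - clipped b U y) <= sqrt (A^2 + B^2) * norm (x - y)"
proof (rule power2_le_imp_le)
 let ?u = "fst (U x) - fst (U y)" and ?v = "snd (U x) - snd (U y)" and ?n = "norm (x - y)"
 have "\<bar>b (snd x) - b (snd y)\<bar> <= B * ?n"
  using b[of "snd x" "snd y"] mult_left_mono[OF abs_snd_le[of "x - y"] B] by simp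
 then have c: "\<bar>clip (b (snd x)) (snd (U x)) - clip (b (snd y)) (snd (U y))\<bar> <= max \<bar>?v\<bar> (B * ?n)"
  using clip_lipschitz[of "b (snd x)" "snd (U x)" "b (snd y)" "snd (U y)"] by linarith
 have "(norm (clipped b U x - clipped b U y))^2 = ?u^2 + \<bar>clip (b (snd x)) (snd (U x)) - clip (b (snd y)) (snd (U y))\<bar>^2"
  by (simp add: norm_prod_def clipped_def)
 also have "\<dots> <= ?u^2 + (max \<bar>?v\<bar> (B * ?n))^2" using c by (intro add_left_mono power_mono) auto
 also have "\<dots> <= ?u^2 + (?v^2 + (B * ?n)^2)" by (auto simp: max_def)
 also have "\<dots> = (norm (U x - U y))^2 + B^2 * ?n^2" by (simp add: norm_prod_def power_mult_distrib)
 also have "\<dots> <= (A * ?n)^2 + B^2 * ?n^2" using U[of x y] by (intro add_right_mono power_mono) auto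
 also have "\<dots> = (sqrt (A^2 + B^2) * ?n)^2" by (simp add: power_mult_distrib distrib_right)
 finally show "(norm (clipped b U x - clipped b U y))^2 <= (sqrt (A^2 + B^2) * ?n)^2" .
qed simp

text \<open>The moved polygon depends on the field on the sides only: the flow of a small Lipschitz field is a
 homeomorphism of the plane, so it maps the inside of the boundary to the inside of its image.\<close>

lemma flow_polygon_cong:
 assumes poly: "is_polygon vs P" and U: "displacement U \<delta> t" and V: "displacement V \<delta>' t"
  and eq: "\<And>x. x \<in> sides vs ==> V x = U x"
 shows "flow U t ` P = flow V t ` P"
proof -
 interpret u: displacement U \<delta> t by (rule U)
 interpret v: displacement V \<delta>' t by (rule V)
 have s: "flow U t ` sides vs = flow V t ` sides vs" using eq by (intro image_cong) (auto simp: flow_def)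
 have "flow U t ` inside (sides vs) = inside (flow U t ` sides vs)"
  by (rule homeomorphism_inside[OF u.continuous_flow u.continuous_unflow]) auto
 moreover have "flow V t ` inside (sides vs) = inside (flow V t ` sides vs)"
  by (rule homeomorphism_inside[OF v.continuous_flow v.continuous_unflow]) auto
 ultimately show ?thesis using s polygon(3)[OF poly] by (simp add: image_Un)
qed

section \<open>The movement field\<close>

locale movement =
 fixes N0 m :: nat and d0 r0 K0 L \<beta>0 :: real and w :: "nat => real" and P0 P1 :: "plane set" and U :: "plane => plane"
  and vs p0 p1 :: "plane list"
 assumes d0: "0 < d0" and L: "0 < L" and \<beta>0: "0 < \<beta>0" "\<beta>0 <= pi / 2"
  and layering: "layering L d0 m w"
  and P0: "P0 \<in> admissible N0 d0 r0 K0 \<beta>0 L m w"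
  and h: "hausdorff_dist (frontier P0) (frontier P1) <= delta0 d0 r0 K0 \<beta>0 / 5"
  and U: "movement_field d0 \<beta>0 L m w P0 P1 U"
  and vs: "is_polygon vs P0"
  and match: "matched_points \<beta>0 L m w P0 P1 p0 p1"
  and affine: "\<And>j. j < length p0 ==> affine_map_on (closed_segment (p0 ! j) (cnext p0 j)) U \<and> U (p0 ! j) = p1 ! j - p0 ! j"
begin

text \<open>The field is bounded by \<open>c\<close>, and its derivative by \<open>8 * q\<close>.\<close>

definition c where "c = C0 \<beta>0 * hausdorff_dist (frontier P0) (frontier P1)"

definition q where "q = c / d0"

lemma continuous_U: "continuous_on UNIV U"
 using U by (simp add: movement_field_def)

lemma jac_norm_bound: "norm (wgrad UNIV (fst \<circ> U) x \<bullet> v, wgrad UNIV (snd \<circ> U) x \<bullet> v) <= jac_norm U x * norm v"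
 and jac_norm_nonneg: "0 <= jac_norm U x"
proof -
 have b: "bounded_linear (\<lambda>v. (wgrad UNIV (fst \<circ> U) x \<bullet> v, wgrad UNIV (snd \<circ> U) x \<bullet> v))"
  by (intro bounded_linear_Pair bounded_linear_inner_right)
 show "norm (wgrad UNIV (fst \<circ> U) x \<bullet> v, wgrad UNIV (snd \<circ> U) x \<bullet> v) <= jac_norm U x * norm v"
  unfolding jac_norm_def using onorm[OF b, of v] by simp
 show "0 <= jac_norm U x" unfolding jac_norm_def by (rule onorm_pos_le[OF b])
qed

lemma U_bound_AE: "AE x in lebesgue. norm (U x) + d0 / 8 * jac_norm U x <= c"
 using U by (simp add: movement_field_def c_def)

lemma U_bound: "norm (U x) <= c"
proof (rule ccontr)
 let ?A = "{x. c < norm (U x)}"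
 have o: "open ?A" by (intro open_Collect_less continuous_intros continuous_U)
 have "AE x in lebesgue. x \<notin> ?A" using U_bound_AE
 proof eventually_elim
  case (elim x)
  have "0 <= d0 / 8 * jac_norm U x" using d0 jac_norm_nonneg[of x] by simp
  then have "norm (U x) <= c" using elim by linarith
  then show ?case by simp
 qed
 then have "negligible ?A" using o by (simp add: negligible_iff_null_sets AE_iff_null_sets)
 moreover assume "\<not> norm (U x) <= c"
 then have "x \<in> ?A" by simp
 then have "?A ~= {}" by blast
 ultimately show False using open_not_negligible[OF o] by blast
qed

lemma c_nonneg: "0 <= c" using U_bound[of 0] norm_ge_zero order_trans by blast

lemma q_nonneg: "0 <= q" using c_nonneg d0 by (simp add: q_def)

lemma c_eq: "c = q * d0" using d0 by (simp add: q_def)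

text \<open>The definition of \<open>delta0\<close> gives \<open>q <= C0 \<beta>0 * sin \<beta>0 / 80\<close>, and the numerator is at most the square root of
 \<open>17\<close>. The number \<open>68\<close> is \<open>8^2 + 2^2\<close>: the clipped field has a Lipschitz bound \<open>8 * q\<close> from \<open>U\<close> and \<open>2 * q\<close> from the
 clipping.\<close>

lemma q_small: "68 * q^2 <= (3/7)^2" "8 * q < 1"
proof -
 have s: "0 < sin \<beta>0" using \<beta>0 by (intro sin_gt_zero) auto
 have C: "0 <= C0 \<beta>0" by (simp add: C0_def)
 have C2: "(C0 \<beta>0 * sin \<beta>0)^2 <= 17"
 proof -
  have "(C0 \<beta>0)^2 = 1 + 16 / (sin \<beta>0)^2" by (simp add: C0_def)
  then have "(C0 \<beta>0 * sin \<beta>0)^2 = (sin \<beta>0)^2 + 16" using s by (simp add: power_mult_distrib field_simps)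
  moreover have "(sin \<beta>0)^2 <= 1" using sin_cos_squared_add[of \<beta>0] zero_le_power2[of "cos \<beta>0"] by linarith
  ultimately show ?thesis by simp
 qed
 have "delta0 d0 r0 K0 \<beta>0 <= d0 * sin \<beta>0 / 16" by (simp add: delta0_def)
 then have "c <= C0 \<beta>0 * (d0 * sin \<beta>0 / 80)" unfolding c_def using h C by (intro mult_left_mono) auto
 then have q: "q <= C0 \<beta>0 * sin \<beta>0 / 80" using d0 by (simp add: q_def field_simps)
 have "q^2 <= (C0 \<beta>0 * sin \<beta>0 / 80)^2" using q q_nonneg by (intro power_mono) auto
 also have "\<dots> <= 17 / 6400" using C2 by (simp add: power_divide)
 finally have q2: "q^2 <= 17 / 6400" .
 then show "68 * q^2 <= (3/7)^2" by (simp add: power2_eq_square)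
 have "(8 * q)^2 < 1^2" using q2 by (simp add: power_mult_distrib)
 then show "8 * q < 1" by (rule power_less_imp_less_base) simp
qed

lemma compact_P0: "compact P0"
proof -
 have "bounded (square L)" unfolding square_box by (rule bounded_box)
 moreover have "P0 \<subseteq> square L" using P0 by (simp add: admissible_def)
 ultimately show ?thesis using closed_polygon[OF vs] bounded_subset compact_eq_bounded_closed by blast
qed

lemma marked0: "marked_points (interfaces L m w) P0 p0"
 using match by (simp add: matched_points_def)

lemma frontier_sub: "frontier P0 \<subseteq> P0"
 using closed_polygon[OF vs] by (simp add: frontier_subset_closed)

lemma margin: assumes x: "x \<in> P0" shows "\<bar>fst x\<bar> <= L - d0" "\<bar>snd x\<bar> <= L - d0"
proof -
 have sq: "x \<in> square L" using P0 x by (auto simp: admissible_def)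
 then have b: "\<bar>fst x\<bar> < L" "\<bar>snd x\<bar> < L" by (auto simp: mem_square)
 have d: "d0 <= dist x y" if "y \<in> frontier (square L)" for y
  using setdist_le_dist[OF x that] P0 by (auto simp: admissible_def)
 have "(L, snd x) \<in> frontier (square L)" "(-L, snd x) \<in> frontier (square L)" "(fst x, L) \<in> frontier (square L)" "(fst x, -L) \<in> frontier (square L)"
  using b L by (auto simp: mem_frontier_square)
 from this[THEN d] show "\<bar>fst x\<bar> <= L - d0" "\<bar>snd x\<bar> <= L - d0" using b by (auto simp: dist_prod_def dist_real_def)
qed

lemma U_support: assumes x: "x \<notin> cbox (-(L - 3/4*d0),-(L - 3/4*d0)) (L - 3/4*d0,L - 3/4*d0)" shows "U x = 0"
proof (rule ccontr)
 assume "U x ~= 0"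
 then have "x \<in> supp U" unfolding supp_def using closure_subset[of "{x. U x ~= 0}"] by auto
 then have "x \<in> closure (tube d0 P0)" using U by (auto simp: movement_field_def)
 moreover have "closure (tube d0 P0) \<subseteq> {x. infdist x (frontier P0) <= d0 / 4}"
  by (rule closure_minimal) (auto simp: tube_def intro!: closed_Collect_le continuous_intros)
 ultimately have i: "infdist x (frontier P0) <= d0 / 4" by blast
 have "p0 ! 0 \<in> sides p0" unfolding sides_def by (rule UN_I[of 0]) (use marked(5)[OF vs marked0] in auto)
 then have "p0 ! 0 \<in> frontier P0" using marked(6)[OF vs marked0] by blast
 then have "frontier P0 ~= {}" by blast
 then obtain p where p: "p \<in> frontier P0" "infdist x (frontier P0) = dist x p"
  using infdist_attains_inf[OF frontier_closed] by blast
 have m: "\<bar>fst p\<bar> <= L - d0" "\<bar>snd p\<bar> <= L - d0" using margin p(1) frontier_sub by blast+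
 have "norm (x - p) <= d0 / 4" using i p(2) by (simp add: dist_norm)
 then have "\<bar>fst x - fst p\<bar> <= d0 / 4" "\<bar>snd x - snd p\<bar> <= d0 / 4"
  using abs_fst_le[of "x - p"] abs_snd_le[of "x - p"] by auto
 then have "\<bar>fst x\<bar> <= L - 3/4*d0" "\<bar>snd x\<bar> <= L - 3/4*d0" using m by linarith+
 then show False using x unfolding mem_cbox_plane by (simp add: abs_le_iff)
qed

lemma U_lipschitz: "norm (U x - U y) <= 8 * q * norm (x - y)"
proof (rule weak_lipschitz[OF continuous_U U_support])
 have W: "U \<in> W1inf" using U by (simp add: movement_field_def)
 show "weak_gradient UNIV (\<lambda>x. fst (U x)) (wgrad UNIV (fst \<circ> U))"
  using W someI_ex[of "\<lambda>G. weak_gradient UNIV (fst \<circ> U) G"] by (simp add: W1inf_def wgrad_def o_def)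
 show "weak_gradient UNIV (\<lambda>x. snd (U x)) (wgrad UNIV (snd \<circ> U))"
  using W someI_ex[of "\<lambda>G. weak_gradient UNIV (snd \<circ> U) G"] by (simp add: W1inf_def wgrad_def o_def)
 show "AE a in lebesgue. \<forall>v. norm (wgrad UNIV (fst \<circ> U) a \<bullet> v, wgrad UNIV (snd \<circ> U) a \<bullet> v) <= 8 * q * norm v"
  using U_bound_AE
 proof eventually_elim
  case (elim a)
  then have "d0 / 8 * jac_norm U a <= c" using norm_ge_zero[of "U a"] by linarith
  then have j: "jac_norm U a <= 8 * q" using d0 by (simp add: q_def field_simps)
  show ?case
  proof
   fix v
   show "norm (wgrad UNIV (fst \<circ> U) a \<bullet> v, wgrad UNIV (snd \<circ> U) a \<bullet> v) <= 8 * q * norm v"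
    using jac_norm_bound[of a v] mult_right_mono[OF j norm_ge_zero[of v]] by linarith
  qed
 qed
qed

text \<open>A vertex is at distance at least \<open>d0 / 2\<close> from every level, whereas the field is at most \<open>q * d0\<close>. A marked point
 on an interface is matched with a point of the same height.\<close>

lemma U_vertical_marked:
 assumes p: "p \<in> set p0" and i: "i <= m" shows "\<bar>snd (U p)\<bar> <= 2 * q * \<bar>snd p - w i\<bar>"
proof -
 obtain j where j: "j < length p0" "p = p0 ! j" using p by (auto simp: in_set_conv_nth)
 consider "p \<in> vertices P0" "p \<in> P0" | "p \<in> interfaces L m w"
 proof -
  have "p \<in> sides p0" using j by (auto simp: sides_def)
  then have "p \<in> P0" using marked(6)[OF vs marked0] frontier_sub by blast
  moreover have "p \<in> vertices P0 \<or> p \<in> interfaces L m w" using marked(3)[OF vs marked0] p by blast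
  ultimately show thesis using that by blast
 qed
 then show ?thesis
 proof cases
  case 1
  have "d0 / 2 <= \<bar>snd p - w i\<bar>"
  proof (cases "i \<in> {1..<m}")
   case True
   have "p \<in> square L" using 1(2) P0 by (auto simp: admissible_def)
   then have "(fst p, w i) \<in> interface L w i" by (auto simp: interface_def mem_square)
   then have "infdist p (interface L w i) <= dist p (fst p, w i)" by (rule infdist_le)
   moreover have "d0 / 2 <= infdist p (interface L w i)" using P0 1(1) True by (auto simp: admissible_def)
   ultimately show ?thesis by (simp add: dist_prod_def dist_real_def)
  next
   case False
   then have "w i = - L \<or> w i = L" using i levels_ends[OF L layering] by (cases "i = 0") auto
   then show ?thesis using margin(2)[OF 1(2)] d0 by auto
  qed
  then have "2 * q * (d0 / 2) <= 2 * q * \<bar>snd p - w i\<bar>" using q_nonneg by (intro mult_left_mono) auto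
  moreover have "\<bar>snd (U p)\<bar> <= q * d0" using order_trans[OF abs_snd_le U_bound] c_eq by simp
  ultimately show ?thesis by simp
 next
  case 2
  then obtain i' where i': "i' \<in> {1..<m}" "p \<in> interface L w i'" by (auto simp: interfaces_def)
  then have "p1 ! j \<in> interface L w i'" using match j by (auto simp: matched_points_def)
  then have "snd (U p) = 0" using affine[OF j(1)] i'(2) j(2) by (auto simp: interface_def)
  then show ?thesis using q_nonneg by simp
 qed
qed

text \<open>Between consecutive marked points the field is affine and the boundary does not cross a level, so
 the bound at the marked points propagates.\<close>

lemma U_vertical:
 assumes x: "x \<in> sides vs" and i: "i <= m" shows "\<bar>snd (U x)\<bar> <= 2 * q * \<bar>snd x - w i\<bar>"
proof -
 have "x \<in> sides p0" using x sides_marked[OF vs marked0] by simp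
 then obtain j where j: "j < length p0" "x \<in> closed_segment (p0 ! j) (cnext p0 j)" by (auto simp: sides_def)
 define a b where "a = p0 ! j" and "b = cnext p0 j"
 have ab: "a \<in> set p0" "b \<in> set p0" using j(1) cnext_in by (auto simp: a_def b_def)
 obtain s where s: "x = (1 - s) *\<^sub>R a + s *\<^sub>R b" "0 <= s" "s <= 1" using j(2) by (auto simp: in_segment a_def b_def)
 obtain A e where A: "linear A" "\<And>y. y \<in> closed_segment a b ==> U y = A y + e"
  using affine[OF j(1)] unfolding affine_map_on_def a_def b_def by blast
 have "U x = A x + e" "U a = A a + e" "U b = A b + e" using A(2) j(2) by (auto simp: a_def b_def)
 moreover have "A x = (1 - s) *\<^sub>R A a + s *\<^sub>R A b" by (simp only: s(1) linear_add[OF A(1)] linear_scale[OF A(1)])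
 ultimately have "U x = (1 - s) *\<^sub>R U a + s *\<^sub>R U b" by (simp add: algebra_simps)
 then have Ux: "snd (U x) = (1 - s) * snd (U a) + s * snd (U b)" by simp
 let ?a = "snd a - w i" and ?b = "snd b - w i"
 have sign: "0 <= ?a * ?b"
 proof (rule ccontr)
  assume "\<not> ?thesis"
  then have lt: "?a * ?b < 0" by simp
  (* the affine height vanishes at this parameter *)
  define r where "r = ?a / (?a - ?b)"
  have r: "0 < r" "r < 1" "a ~= b" using lt by (auto simp: r_def mult_less_0_iff divide_simps)
  define z where "z = (1 - r) *\<^sub>R a + r *\<^sub>R b"
  have zo: "z \<in> open_segment a b" using r by (auto simp: in_segment z_def)
  have "?a - ?b ~= 0" using lt by (auto simp: mult_less_0_iff)
  then have "r * (?a - ?b) = ?a" by (simp add: r_def)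
  then have sz: "snd z = w i" by (simp add: z_def algebra_simps)
  have zf: "z \<in> frontier P0"
   using zo j(1) marked(6)[OF vs marked0] open_closed_segment[OF zo] by (auto simp: sides_def a_def b_def)
  then have "z \<in> P0" using frontier_sub by blast
  then have zL: "z \<in> square L" using P0 by (auto simp: admissible_def)
  then have "i \<in> {1..<m}" using sz i levels_ends[OF L layering] by (cases "i = 0"; cases "i = m") (auto simp: mem_square)
  then have "z \<in> interfaces L m w" using zL sz by (cases z) (auto simp: interfaces_def interface_def mem_square)
  then have "z \<in> set p0" using zf marked(4)[OF vs marked0] by blast
  then show False using zo marked(7)[OF vs marked0 j(1)] by (auto simp: a_def b_def)
 qed
 have "\<bar>snd (U x)\<bar> <= (1 - s) * \<bar>snd (U a)\<bar> + s * \<bar>snd (U b)\<bar>"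
  unfolding Ux using abs_triangle_ineq[of "(1 - s) * snd (U a)" "s * snd (U b)"] s(2,3) by (simp add: abs_mult)
 also have "\<dots> <= (1 - s) * (2 * q * \<bar>?a\<bar>) + s * (2 * q * \<bar>?b\<bar>)"
  using U_vertical_marked[OF ab(1) i] U_vertical_marked[OF ab(2) i] s(2,3) by (intro add_mono mult_left_mono) auto
 also have "\<dots> = 2 * q * (\<bar>(1 - s) * ?a\<bar> + \<bar>s * ?b\<bar>)"
 proof -
  have e: "\<bar>1 - s\<bar> = 1 - s" "\<bar>s\<bar> = s" using s(2,3) by auto
  show ?thesis by (simp only: abs_mult e distrib_left mult_ac)
 qed
 also have "\<bar>(1 - s) * ?a\<bar> + \<bar>s * ?b\<bar> = \<bar>(1 - s) * ?a + s * ?b\<bar>"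
 proof -
  have "0 <= ((1 - s) * ?a) * (s * ?b)"
   using mult_nonneg_nonneg[OF mult_nonneg_nonneg[of "1 - s" s] sign] s(2,3) by (simp add: mult_ac)
  then show ?thesis by (auto simp: zero_le_mult_iff)
 qed
 also have "(1 - s) * ?a + s * ?b = snd x - w i" by (simp add: s(1) algebra_simps)
 finally show ?thesis .
qed

definition lev where "lev s = 2 * q * infdist s (w ` {0..m})"

definition V where "V = clipped lev U"

lemma lev: "0 <= lev s" "i <= m ==> lev s <= 2 * q * \<bar>s - w i\<bar>" "\<bar>lev s - lev t\<bar> <= 2 * q * \<bar>s - t\<bar>"
proof -
 show "0 <= lev s" using q_nonneg by (simp add: lev_def infdist_nonneg)
 show "lev s <= 2 * q * \<bar>s - w i\<bar>" if "i <= m"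
  unfolding lev_def using infdist_le[of "w i" "w ` {0..m}" s] that q_nonneg by (intro mult_left_mono) (auto simp: dist_real_def)
 have "\<bar>lev s - lev t\<bar> = 2 * q * \<bar>infdist s (w ` {0..m}) - infdist t (w ` {0..m})\<bar>"
  unfolding lev_def right_diff_distrib[symmetric] abs_mult using q_nonneg by simp
 also have "\<dots> <= 2 * q * \<bar>s - t\<bar>"
  using infdist_triangle_abs[of s "w ` {0..m}" t] q_nonneg by (intro mult_left_mono) (auto simp: dist_real_def)
 finally show "\<bar>lev s - lev t\<bar> <= 2 * q * \<bar>s - t\<bar>" .
qed

lemma V_lipschitz: "norm (V x - V y) <= sqrt (68 * q^2) * norm (x - y)"
 using clipped_lipschitz[OF U_lipschitz lev(3), of x y] q_nonneg by (simp add: V_def power_mult_distrib)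

lemma V_support: "x \<notin> cbox (-(L - 3/4*d0),-(L - 3/4*d0)) (L - 3/4*d0,L - 3/4*d0) ==> V x = 0"
 using U_support[of x] lev(1) by (simp add: V_def clipped_def clip_id zero_prod_def)

lemma V_sides: assumes x: "x \<in> sides vs" shows "V x = U x"
proof -
 have "closed (w ` {0..m})" by (intro finite_imp_closed) auto
 then obtain s where "s \<in> w ` {0..m}" "infdist (snd x) (w ` {0..m}) = dist (snd x) s"
  using infdist_attains_inf[of "w ` {0..m}" "snd x"] by auto
 then have "\<bar>snd (U x)\<bar> <= lev (snd x)" using U_vertical[OF x] by (auto simp: lev_def dist_real_def)
 then show ?thesis by (simp add: V_def clipped_def clip_id prod_eq_iff)
qed

lemma V_levels: "i <= m ==> \<bar>snd (V x)\<bar> <= 2 * q * \<bar>snd x - w i\<bar>"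
 using clip_bound[OF lev(1), of "snd x" "snd (U x)"] lev(2)[of i "snd x"] by (simp add: V_def clipped_def)

lemma root_small: "0 <= sqrt (68 * q^2)" "sqrt (68 * q^2) <= 3/7"
proof -
 show "sqrt (68 * q^2) <= 3/7" using q_small(1) by (intro real_le_lsqrt) auto
qed simp

lemma V_displacement: "t \<in> {0..1} ==> displacement V (sqrt (68 * q^2)) t"
 and U_displacement: "t \<in> {0..1} ==> displacement U (8 * q) t"
proof -
 have "sqrt (68 * q^2) < 1" using root_small(2) by linarith
 then show "t \<in> {0..1} ==> displacement V (sqrt (68 * q^2)) t" by unfold_locales (use V_lipschitz root_small in auto)
 show "t \<in> {0..1} ==> displacement U (8 * q) t" by unfold_locales (use U_lipschitz q_nonneg q_small in auto)
qed

lemma moved_eq: assumes t: "t \<in> {0..1}" shows "moved U P0 t = flow V t ` P0"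
 using flow_polygon_cong[OF vs U_displacement[OF t] V_displacement[OF t] V_sides] by (simp add: moved_def flow_def)

lemma moved_conductivity: assumes t: "t \<in> {0..1}"
 shows "conductivity L m w k \<gamma> (moved U P0 t) = (\<lambda>x. conductivity L m w k \<gamma> P0 (unflow V t x))"
 unfolding moved_eq[OF t]
proof
 fix x
 have r: "L - 3/4*d0 < L" and q: "0 <= 2 * q" "2 * q < 1" using d0 q_nonneg q_small(2) by auto
 show "conductivity L m w k \<gamma> (flow V t ` P0) x = conductivity L m w k \<gamma> P0 (unflow V t x)"
  by (rule conductivity_flow[OF L layering V_displacement[OF t] V_support r V_levels q])
qed

lemma closed_moved: assumes t: "t \<in> {0..1}" shows "closed (moved U P0 t)"
 unfolding moved_eq[OF t]
 by (intro compact_imp_closed compact_continuous_image displacement.continuous_flow[OF V_displacement[OF t]] compact_P0)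

lemma F_second_order:
 assumes \<kappa>: "0 < \<kappa>" "\<And>v. v \<in> insert k (\<gamma> ` {1..m}) ==> \<kappa> <= v \<and> v <= \<Lambda>"
  and f: "L2 (bdry L) f" "trace_grad L f Hf" and g: "L2 (bdry L) g" "trace_grad L g Hg"
 shows "\<exists>D. \<forall>s\<in>{0..1}. \<forall>t\<in>{0..1}. \<bar>F L m w k \<gamma> P0 U t f g - F L m w k \<gamma> P0 U s f g - (t - s) * D s\<bar>
  <= (\<Lambda> * (784 * \<Lambda> / \<kappa>)^2 * (89180 + 2940^2 * 28 * \<Lambda> / \<kappa>)) * (68 * q^2) * (nrm (SM L) Hf * nrm (SM L) Hg) * (t - s)^2"
proof -
 let ?\<gamma> = "conductivity L m w k \<gamma> P0" and ?N = "sides vs \<union> {x :: plane. snd x \<in> w ` {0..m}}"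
 have \<Lambda>: "0 <= \<Lambda>" using \<kappa>(1) \<kappa>(2)[of k] by auto
 have N: "negligible ?N" using negligible_sides negligible_levels[OF L layering] by simp
 have cont: "isCont ?\<gamma> x" if "x \<in> square L" "x \<notin> ?N" for x
  using conductivity_continuous[OF L layering that(1)] that(2) frontier_polygon[OF vs] by blast
 have c0: "coefficient L ?\<gamma> \<kappa> \<Lambda>" by (rule conductivity_coefficient[OF L layering closed_polygon[OF vs] \<kappa>])
 have ct: "coefficient L (\<lambda>x. ?\<gamma> (unflow V t x)) \<kappa> \<Lambda>" if t: "t \<in> {0..1}" for t
  using conductivity_coefficient[OF L layering closed_moved[OF t] \<kappa>] unfolding moved_conductivity[OF t] by simp
 have rL: "L - 3/4*d0 < L" using d0 by simp
 from DN_second_order_lipschitz[OF L rL V_lipschitz root_small V_support c0 \<Lambda> N cont ct f g]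
 obtain D where D: "\<And>s t. s \<in> {0..1} ==> t \<in> {0..1} ==>
  \<bar>DN L (\<lambda>x. ?\<gamma> (unflow V t x)) f g - DN L (\<lambda>x. ?\<gamma> (unflow V s x)) f g - (t - s) * D s\<bar>
  <= (\<Lambda> * (784 * \<Lambda> / \<kappa>)^2 * (89180 + 2940^2 * 28 * \<Lambda> / \<kappa>)) * (sqrt (68 * q^2))^2 * (nrm (SM L) Hf * nrm (SM L) Hg) * (t - s)^2"
  by blast
 have sq: "(sqrt (68 * q^2))^2 = 68 * q^2" by simp
 show ?thesis
  by (intro exI[of _ D] ballI) (use D in \<open>simp only: F_def moved_conductivity sq\<close>)
qed

end

section \<open>The estimate\<close>

theorem proposition5p3:
  fixes N0 m :: nat and d0 r0 K0 L \<beta>0 c0 k :: real and \<gamma> :: "nat \<Rightarrow> real"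
  assumes "N0 > 0" "d0 > 0" "r0 > 0" "K0 > 0" "L > 0" "c0 > 0"
    and "0 < \<beta>0" "\<beta>0 \<le> pi / 2"
    and "k > 0" "\<And>i. i \<in> {1..m} \<Longrightarrow> \<gamma> i > 0"
    and "\<And>i. i \<in> {1..m} \<Longrightarrow> \<bar>k - \<gamma> i\<bar> \<ge> c0"
  shows "\<exists>C>0. \<exists>\<beta>>0. \<forall>\<omega> P0 P1 U.
    layering L d0 m \<omega> \<longrightarrow>
    P0 \<in> admissible N0 d0 r0 K0 \<beta>0 L m \<omega> \<longrightarrow>
    P1 \<in> admissible N0 d0 r0 K0 \<beta>0 L m \<omega> \<longrightarrow>
    hausdorff_dist (frontier P0) (frontier P1) \<le> delta0 d0 r0 K0 \<beta>0 / 5 \<longrightarrow>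
    movement_field d0 \<beta>0 L m \<omega> P0 P1 U \<longrightarrow>
    (\<forall>f \<in> Hhalf L. \<forall>g \<in> Hhalf L.
      (\<lambda>t. F L m \<omega> k \<gamma> P0 U t f g) differentiable_on {0..1} \<and>
      (\<forall>t\<in>{0..1}.
        \<bar>F' L m \<omega> k \<gamma> P0 U t f g - F' L m \<omega> k \<gamma> P0 U 0 f g\<bar>
          \<le> C * Hhalf_norm L f * Hhalf_norm L g * t powr \<beta>
              * hausdorff_dist (frontier P0) (frontier P1) powr (1 + \<beta>)))"
proof -
 define \<kappa> where "\<kappa> = Min (insert k (\<gamma> ` {1..m}))"
 define \<Lambda> where "\<Lambda> = Max (insert k (\<gamma> ` {1..m}))"
 have \<kappa>: "0 < \<kappa>" unfolding \<kappa>_def using assms(9,10) by (subst Min_gr_iff) auto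
 have b: "\<kappa> <= v \<and> v <= \<Lambda>" if "v \<in> insert k (\<gamma> ` {1..m})" for v
  unfolding \<kappa>_def \<Lambda>_def using that by (intro conjI Min_le Max_ge) auto
 have \<Lambda>: "0 <= \<Lambda>" using \<kappa> b[of k] by auto
 define K where "K = \<Lambda> * (784 * \<Lambda> / \<kappa>)^2 * (89180 + 2940^2 * 28 * \<Lambda> / \<kappa>)"
 have K: "0 <= K" unfolding K_def using \<Lambda> \<kappa> by auto
 (* twice the second-order bound, by the exchange of s and t; one is added for positivity *)
 define C where "C = 2 * K * (68 * (C0 \<beta>0)^2 / d0^2) * (3200 * pi)^2 + 1"
 have C: "0 < C" unfolding C_def using K by (intro add_nonneg_pos) auto
 show ?thesis
 proof (rule exI[of _ C], rule conjI[OF C], rule exI[of _ 1], rule conjI, simp, intro allI impI ballI)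
  fix w P0 P1 U f g
  assume H: "layering L d0 m w" "P0 \<in> admissible N0 d0 r0 K0 \<beta>0 L m w"
   "hausdorff_dist (frontier P0) (frontier P1) <= delta0 d0 r0 K0 \<beta>0 / 5" "movement_field d0 \<beta>0 L m w P0 P1 U"
   and f: "f \<in> Hhalf L" and g: "g \<in> Hhalf L"
  let ?h = "hausdorff_dist (frontier P0) (frontier P1)" and ?F = "\<lambda>t. F L m w k \<gamma> P0 U t f g"
  obtain vs where vs: "is_polygon vs P0" using H(2) by (auto simp: admissible_def)
  obtain p0 p1 where p: "matched_points \<beta>0 L m w P0 P1 p0 p1"
   "\<And>j. j < length p0 ==> affine_map_on (closed_segment (p0 ! j) (cnext p0 j)) U \<and> U (p0 ! j) = p1 ! j - p0 ! j"
   using H(4) unfolding movement_field_def by blast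
  interpret movement N0 m d0 r0 K0 L \<beta>0 w P0 P1 U vs p0 p1
   by unfold_locales (use assms H vs p in auto)
  obtain Hf where Hf: "trace_grad L f Hf" "nrm (SM L) Hf <= 3200 * pi * Hhalf_norm L f"
   using extension_exists[OF assms(5) f] by blast
  obtain Hg where Hg: "trace_grad L g Hg" "nrm (SM L) Hg <= 3200 * pi * Hhalf_norm L g"
   using extension_exists[OF assms(5) g] by blast
  let ?nf = "Hhalf_norm L f" and ?ng = "Hhalf_norm L g"
  let ?M = "K * (68 * q^2) * (nrm (SM L) Hf * nrm (SM L) Hg)"
  have "\<exists>D. \<forall>s\<in>{0..1}. \<forall>t\<in>{0..1}. \<bar>?F t - ?F s - (t - s) * D s\<bar> <= ?M * (t - s)^2"
   unfolding K_def by (rule F_second_order[OF \<kappa> _ Hhalf_L2[OF assms(5) f] Hf(1) Hhalf_L2[OF assms(5) g] Hg(1)]) (rule b)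
  then obtain D where D': "\<forall>s\<in>{0..1}. \<forall>t\<in>{0..1}. \<bar>?F t - ?F s - (t - s) * D s\<bar> <= ?M * (t - s)^2"
   by (elim exE)
  note D = D'[rule_format]
  have der: "(?F has_vector_derivative D s) (at s within {0..1})" if "s \<in> {0..1}" for s
   by (rule second_order_derivative(1)[of ?F D ?M]) (erule (1) D, rule that)
  have lip: "\<bar>D t - D s\<bar> <= 2 * ?M * \<bar>t - s\<bar>" if "s \<in> {0..1}" "t \<in> {0..1}" for s t
   by (rule second_order_derivative(2)[of ?F D ?M]) (erule (1) D, (rule that)+)
  have vd: "F' L m w k \<gamma> P0 U t f g = D t" if "t \<in> {0..1}" for t
   unfolding F'_def by (rule vector_derivative_within_closed_interval[OF _ that der[OF that]]) simp
  have nn: "0 <= ?nf" "0 <= ?ng"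
   using order_trans[OF nrm_nonneg Hf(2)] order_trans[OF nrm_nonneg Hg(2)] pi_gt_zero by (auto simp: zero_le_mult_iff)
  have "0 < C0 \<beta>0" unfolding C0_def by (simp add: add_pos_nonneg)
  then have h0: "0 <= ?h" using c_nonneg by (simp add: c_def zero_le_mult_iff)
  have q2: "q^2 = (C0 \<beta>0)^2 / d0^2 * ?h^2" by (simp add: q_def c_def power_divide power_mult_distrib)
  have "nrm (SM L) Hf * nrm (SM L) Hg <= (3200 * pi * ?nf) * (3200 * pi * ?ng)"
   using Hf(2) Hg(2) nn by (intro mult_mono) auto
  then have "?M <= K * (68 * q^2) * ((3200 * pi * ?nf) * (3200 * pi * ?ng))" using K by (intro mult_left_mono) auto
  also have "\<dots> = K * (68 * (C0 \<beta>0)^2 / d0^2) * (3200 * pi)^2 * (?nf * ?ng * ?h^2)"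
   unfolding q2 by (simp add: power2_eq_square)
  finally have "2 * ?M <= (2 * K * (68 * (C0 \<beta>0)^2 / d0^2) * (3200 * pi)^2) * (?nf * ?ng * ?h^2)" by simp
  also have "\<dots> <= C * (?nf * ?ng * ?h^2)" unfolding C_def using nn by (intro mult_right_mono) auto
  finally have M: "2 * ?M <= C * (?nf * ?ng * ?h^2)" .
  have "\<bar>F' L m w k \<gamma> P0 U t f g - F' L m w k \<gamma> P0 U 0 f g\<bar> <= C * ?nf * ?ng * t powr 1 * ?h powr (1 + 1)" if t: "t \<in> {0..1}" for t
  proof -
   have "\<bar>D t - D 0\<bar> <= 2 * ?M * t" using lip[of 0 t] t by simp
   also have "\<dots> <= C * (?nf * ?ng * ?h^2) * t" using M t by (intro mult_right_mono) auto
   finally show ?thesis using t h0 vd[OF t] vd[of 0] by (simp add: mult_ac)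
  qed
  moreover have "?F differentiable_on {0..1}"
   unfolding differentiable_on_def using der differentiableI_vector by blast
  ultimately show "?F differentiable_on {0..1} \<and> (\<forall>t\<in>{0..1}. \<bar>F' L m w k \<gamma> P0 U t f g - F' L m w k \<gamma> P0 U 0 f g\<bar>
    <= C * Hhalf_norm L f * Hhalf_norm L g * t powr 1 * ?h powr (1 + 1))" by blast
 qed
qed

end
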